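(* Let $R$ be a ring, let $\mathbf K(\mathrm{Proj})$ be the homotopy category of complexes of projective right $R$-modules, let $\mathcal K$ be its full subcategory whose objects are the totally acyclic complexes, and let $\mathrm{Mor}_{\mathcal K}$ be the class of morphisms of $\mathbf K(\mathrm{Proj})$ whose cones belong to $\mathcal K$. Suppose that $\mathrm{Mor}_{\mathcal K}$ satisfies the generalized Baer Lemma in $\mathbf K(\mathrm{Proj})$. Then $\mathbf K(\mathrm{Proj})$ has enough $\mathrm{Mor}_{\mathcal K}$-injective objects. In particular: \begin{enumerate} \item The Verdier quotient $\mathbf K(\mathrm{Proj})/\mathcal K$ has small Hom-sets. \item The class of all Gorenstein-projective modules is precovering in $\mathrm{Mod}\text{-}R$. \item The class of all totally acyclic complexes is precovering in $\mathbf C(\mathrm{Mod}\text{-}R)$. \end{enumerate}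
   Context: $R$ is an associative, not necessarily commutative, ring with unit; modules are right $R$-modules; $\mathrm{Mod}\text{-}R$ is the category of all modules and $\mathrm{Proj}$ the full subcategory of projective modules. $\mathbf C(\mathrm{Mod}\text{-}R)$ is the category of (unbounded) cochain complexes of modules and cochain maps, and $\mathbf K(\mathrm{Mod}\text{-}R)$ is the homotopy category: same objects, morphisms the homotopy classes of cochain maps. Shifts are given by $X[n]^k=X^{k-n}$, $d_{X[n]}^k=(-1)^n d_X^{k-n}$. The cone of a cochain map $f:X\to Y$ has $\mathrm{cone}(f)^n=X^{n+1}\oplus Y^n$ and $d^n(x,y)=(-d_X^{n+1}(x),\,d_Y^n(y)-f^{n+1}(x))$. $\mathbf K(\mathrm{Mod}\text{-}R)$ is triangulated with exact triangles those isomorphic to $X\xrightarrow{f}Y\to \mathrm{cone}(f)\to X[-1]$ (canonical injection and projection). $\mathbf K(\mathrm{Proj})$ is the full subcategory of $\mathbf K(\mathrm{Mod}\text{-}R)$ on the complexes of projective modules. A complex $X$ is totally acyclic if every $X^n$ is projective, $X$ is acyclic (exact), and $\mathrm{Hom}_R(X,P)$ is acyclic for every projective module $P$. A module $M$ is Gorenstein-projective if $M\cong \mathrm{Ker}\, d_X^0$ for some totally acyclic complex $X$. $\mathrm{Mor}_{\mathcal K}$ is the class of morphisms $f:X\to Y$ in $\mathbf K(\mathrm{Proj})$ for which there is an exact triangle $X\xrightarrow{f}Y\to Z\to X[-1]$ with $Z\in\mathcal K$. For a class $\mathcal M$ of morphisms in an additive category $\mathcal A$: an object $E$ is $\mathcal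 M$-injective if $\mathrm{Hom}_{\mathcal A}(i,E)$ is surjective for every $i\in\mathcal M$; $\mathcal A$ has enough $\mathcal M$-injective objects if for every object $A$ there is a morphism $i:A\to E$ in $\mathcal M$ with $E$ $\mathcal M$-injective; $\mathcal M$ satisfies the generalized Baer Lemma in $\mathcal A$ if there is a subset (a small set, not a proper class) $\mathcal N\subseteq\mathcal M$ such that every $\mathcal N$-injective object of $\mathcal A$ is $\mathcal M$-injective. The Verdier quotient $\mathbf K(\mathrm{Proj})/\mathcal K$ has the same objects as $\mathbf K(\mathrm{Proj})$; a morphism $X\to Y$ is an equivalence class of triples $(Z,f,g)$ with $f:Z\to X$ in $\mathrm{Mor}_{\mathcal K}$ and $g:Z\to Y$ a morphism in $\mathbf K(\mathrm{Proj})$, where $(Z,f,g)\sim(Z',f',g')$ iff there are a triple $(Z'',f'',g'')$ of the same kind and morphisms $u:Z''\to Z$, $v:Z''\to Z'$ with $fu=f''=f'v$ and $gu=g''=g'v$. It has small Hom-sets if, for all objects $X,Y$, the class of morphisms from $X$ to $Y$ is a (small) set rather than a proper class. A full subcategory (or class of objects) $\mathcal B$ of a category $\mathcal A$ is precovering if every $A\in\mathcal A$ has a $\mathcal B$-precover, i.e. a morphism $f:B\to A$ with $B\in\mathcal B$ such that $\mathrm{Hom}_{\mathcal A}(B',f)$ is surjective for every $B'\in\mathcal B$. *)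

theory Defs
  imports "HOL-Algebra.Module"
begin

unbundle cardinal_syntax

section \<open>Sets and classes\<close>

text \<open>
  HOL has no proper classes. As in a Grothendieck universe, a type \<open>'u\<close> of strongly inaccessible
  cardinality \<open>\<kappa>\<close> takes the place of the universe of sets: what has fewer than \<open>\<kappa>\<close> elements is
  a set, anything larger is a proper class. Each set is in bijection with a small subset
  of \<open>'u\<close>, so that every module is isomorphic to one whose carrier is a small subset of \<open>'u\<close>.
\<close>

definition universe :: "'u itself \<Rightarrow> bool" where
  "universe _ \<longleftrightarrow>
     |UNIV :: nat set| <o |UNIV :: 'u set| \<and>
     regularCard |UNIV :: 'u set| \<and>
     (\<forall>A :: 'u set. |A| <o |UNIV :: 'u set| \<longrightarrow> |Pow A| <o |UNIV :: 'u set| )"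

definition small :: "'u itself \<Rightarrow> 'a set \<Rightarrow> bool" where
  "small _ A \<longleftrightarrow> |A| <o |UNIV :: 'u set|"


section \<open>Categories\<close>

text \<open>
  The term \<open>Comp C X Y Z g f\<close> is the composite of \<open>f : X \<rightarrow> Y\<close> and \<open>g : Y \<rightarrow> Z\<close>. The \<open>Hom\<close>-sets
  need not be disjoint; a morphism on its own is therefore a triple \<open>(X, f, Y)\<close>.
\<close>

record ('o, 'm) category =
  Obj :: "'o set"
  Hom :: "'o \<Rightarrow> 'o \<Rightarrow> 'm set"
  Id :: "'o \<Rightarrow> 'm"
  Comp :: "'o \<Rightarrow> 'o \<Rightarrow> 'o \<Rightarrow> 'm \<Rightarrow> 'm \<Rightarrow> 'm"

definition full_subcategory :: "('o, 'm) category \<Rightarrow> 'o set \<Rightarrow> ('o, 'm) category" where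
  "full_subcategory C B = C\<lparr>Obj := Obj C \<inter> B\<rparr>"

definition is_iso :: "('o, 'm) category \<Rightarrow> 'o \<Rightarrow> 'o \<Rightarrow> 'm \<Rightarrow> bool" where
  "is_iso C X Y f \<longleftrightarrow> f \<in> Hom C X Y \<and>
     (\<exists>g\<in>Hom C Y X. Comp C X Y X g f = Id C X \<and> Comp C Y X Y f g = Id C Y)"

definition injective_wrt :: "('o, 'm) category \<Rightarrow> ('o \<times> 'm \<times> 'o) set \<Rightarrow> 'o \<Rightarrow> bool" where
  "injective_wrt C \<M> E \<longleftrightarrow> E \<in> Obj C \<and>
     (\<forall>(X, i, Y)\<in>\<M>. (\<lambda>h. Comp C X Y E h i) ` Hom C Y E = Hom C X E)"

definition enough_injectives :: "('o, 'm) category \<Rightarrow> ('o \<times> 'm \<times> 'o) set \<Rightarrow> bool" where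
  "enough_injectives C \<M> \<longleftrightarrow>
     (\<forall>A\<in>Obj C. \<exists>E i. (A, i, E) \<in> \<M> \<and> injective_wrt C \<M> E)"

definition generalized_Baer ::
  "'u itself \<Rightarrow> ('o, 'm) category \<Rightarrow> ('o \<times> 'm \<times> 'o) set \<Rightarrow> bool" where
  "generalized_Baer U C \<M> \<longleftrightarrow>
     (\<exists>\<N>\<subseteq>\<M>. small U \<N> \<and> (\<forall>E. injective_wrt C \<N> E \<longrightarrow> injective_wrt C \<M> E))"

definition is_precover :: "('o, 'm) category \<Rightarrow> 'o set \<Rightarrow> 'o \<Rightarrow> 'o \<Rightarrow> 'm \<Rightarrow> bool" where
  "is_precover C \<B> A B f \<longleftrightarrow> B \<in> \<B> \<and> f \<in> Hom C B A \<and>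
     (\<forall>B'\<in>\<B>. (\<lambda>h. Comp C B' B A f h) ` Hom C B' B = Hom C B' A)"

definition precovering :: "('o, 'm) category \<Rightarrow> 'o set \<Rightarrow> bool" where
  "precovering C \<B> \<longleftrightarrow> \<B> \<subseteq> Obj C \<and> (\<forall>A\<in>Obj C. \<exists>B f. is_precover C \<B> A B f)"

text \<open>
  Right fractions with denominators in \<open>S\<close>: a triple \<open>(Z, f, g)\<close> stands for the diagram
  \<open>X \<leftarrow> Z \<rightarrow> Y\<close> formed by \<open>f\<close> and \<open>g\<close>.
\<close>

definition fractions ::
  "('o, 'm) category \<Rightarrow> ('o \<times> 'm \<times> 'o) set \<Rightarrow> 'o \<Rightarrow> 'o \<Rightarrow> ('o \<times> 'm \<times> 'm) set" where
  "fractions C S X Y = {(Z, f, g). Z \<in> Obj C \<and> (Z, f, X) \<in> S \<and> g \<in> Hom C Z Y}"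

definition fraction_rel ::
  "('o, 'm) category \<Rightarrow> ('o \<times> 'm \<times> 'o) set \<Rightarrow> 'o \<Rightarrow> 'o \<Rightarrow> ('o \<times> 'm \<times> 'm) rel" where
  "fraction_rel C S X Y = {((Z, f, g), (Z', f', g')).
     (Z, f, g) \<in> fractions C S X Y \<and> (Z', f', g') \<in> fractions C S X Y \<and>
     (\<exists>Z'' f'' g''. (Z'', f'', g'') \<in> fractions C S X Y \<and>
       (\<exists>u\<in>Hom C Z'' Z. \<exists>v\<in>Hom C Z'' Z'.
          Comp C Z'' Z X f u = f'' \<and> Comp C Z'' Z' X f' v = f'' \<and>
          Comp C Z'' Z Y g u = g'' \<and> Comp C Z'' Z' Y g' v = g''))}"

definition fraction_Hom ::
  "('o, 'm) category \<Rightarrow> ('o \<times> 'm \<times> 'o) set \<Rightarrow> 'o \<Rightarrow> 'o \<Rightarrow> ('o \<times> 'm \<times> 'm) set set" where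
  "fraction_Hom C S X Y = fractions C S X Y // fraction_rel C S X Y"


section \<open>Right modules\<close>

text \<open>
  The library's locale \<open>module\<close> is restricted to commutative rings. In its record of operations
  the scalar is on the left; here \<open>a \<odot>\<^bsub>M\<^esub> x\<close> is to be read as \<open>x a\<close>. The fields \<open>mult\<close> and
  \<open>one\<close> that the record inherits from rings are irrelevant.
\<close>

locale right_module = R?: ring R + M?: abelian_group M
  for R (structure) and M (structure) +
  assumes smult_closed [simp, intro]:
      "\<lbrakk>a \<in> carrier R; x \<in> carrier M\<rbrakk> \<Longrightarrow> a \<odot>\<^bsub>M\<^esub> x \<in> carrier M"
    and smult_l_distr:
      "\<lbrakk>a \<in> carrier R; b \<in> carrier R; x \<in> carrier M\<rbrakk> \<Longrightarrow>
       (a \<oplus> b) \<odot>\<^bsub>M\<^esub> x = a \<odot>\<^bsub>M\<^esub> x \<oplus>\<^bsub>M\<^esub> b \<odot>\<^bsub>M\<^esub> x"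
    and smult_r_distr:
      "\<lbrakk>a \<in> carrier R; x \<in> carrier M; y \<in> carrier M\<rbrakk> \<Longrightarrow>
       a \<odot>\<^bsub>M\<^esub> (x \<oplus>\<^bsub>M\<^esub> y) = a \<odot>\<^bsub>M\<^esub> x \<oplus>\<^bsub>M\<^esub> a \<odot>\<^bsub>M\<^esub> y"
    and smult_assoc:
      "\<lbrakk>a \<in> carrier R; b \<in> carrier R; x \<in> carrier M\<rbrakk> \<Longrightarrow>
       (a \<otimes> b) \<odot>\<^bsub>M\<^esub> x = b \<odot>\<^bsub>M\<^esub> (a \<odot>\<^bsub>M\<^esub> x)"
    and smult_one [simp]:
      "x \<in> carrier M \<Longrightarrow> \<one> \<odot>\<^bsub>M\<^esub> x = x"

definition rmodules :: "('r, 'k) ring_scheme \<Rightarrow> ('r, 'u) module set" where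
  "rmodules R = {M. right_module R M \<and> small TYPE('u) (carrier M)}"

definition rhom ::
  "('r, 'k) ring_scheme \<Rightarrow> ('r, 'u) module \<Rightarrow> ('r, 'v) module \<Rightarrow> ('u \<Rightarrow> 'v) set" where
  "rhom R M N = {f \<in> carrier M \<rightarrow>\<^sub>E carrier N.
     (\<forall>x\<in>carrier M. \<forall>y\<in>carrier M. f (x \<oplus>\<^bsub>M\<^esub> y) = f x \<oplus>\<^bsub>N\<^esub> f y) \<and>
     (\<forall>a\<in>carrier R. \<forall>x\<in>carrier M. f (a \<odot>\<^bsub>M\<^esub> x) = a \<odot>\<^bsub>N\<^esub> f x)}"

definition Mod :: "('r, 'k) ring_scheme \<Rightarrow> (('r, 'u) module, 'u \<Rightarrow> 'u) category" where
  "Mod R = \<lparr>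
     Obj = rmodules R,
     Hom = rhom R,
     Id = (\<lambda>M. \<lambda>x\<in>carrier M. x),
     Comp = (\<lambda>L M N g f. compose (carrier L) g f)\<rparr>"

definition module_isomorphic ::
  "('r, 'k) ring_scheme \<Rightarrow> ('r, 'u) module \<Rightarrow> ('r, 'v) module \<Rightarrow> bool" where
  "module_isomorphic R M N \<longleftrightarrow> (\<exists>f\<in>rhom R M N. bij_betw f (carrier M) (carrier N))"

definition projective :: "('r, 'k) ring_scheme \<Rightarrow> ('r, 'u) module \<Rightarrow> bool" where
  "projective R P \<longleftrightarrow> P \<in> rmodules R \<and>
     (\<forall>M\<in>rmodules R :: ('r, 'u) module set. \<forall>N\<in>rmodules R :: ('r, 'u) module set.
      \<forall>p\<in>rhom R M N. p ` carrier M = carrier N \<longrightarrow>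
        (\<forall>f\<in>rhom R P N. \<exists>g\<in>rhom R P M. compose (carrier P) p g = f))"

definition hom_group ::
  "('r, 'k) ring_scheme \<Rightarrow> ('r, 'u) module \<Rightarrow> ('r, 'v) module \<Rightarrow> ('u \<Rightarrow> 'v) ring" where
  "hom_group R M N = \<lparr>
     carrier = rhom R M N, mult = undefined, one = undefined,
     zero = (\<lambda>x\<in>carrier M. \<zero>\<^bsub>N\<^esub>),
     add = (\<lambda>f g. \<lambda>x\<in>carrier M. f x \<oplus>\<^bsub>N\<^esub> g x)\<rparr>"

text \<open>
  For the direct sum, pairs of elements of \<open>'u\<close> are encoded in \<open>'u\<close>; an injection
  \<open>'u \<times> 'u \<Rightarrow> 'u\<close> exists because \<open>'u\<close> is infinite.
\<close>

definition pair :: "'u \<times> 'u \<Rightarrow> 'u" where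
  "pair = (SOME p. inj p)"

definition unpair :: "'u \<Rightarrow> 'u \<times> 'u" where
  "unpair = inv_into UNIV pair"

definition direct_sum :: "('r, 'u) module \<Rightarrow> ('r, 'u) module \<Rightarrow> ('r, 'u) module" where
  "direct_sum M N = \<lparr>
     carrier = pair ` (carrier M \<times> carrier N), mult = undefined, one = undefined,
     zero = pair (\<zero>\<^bsub>M\<^esub>, \<zero>\<^bsub>N\<^esub>),
     add = (\<lambda>z w. pair (fst (unpair z) \<oplus>\<^bsub>M\<^esub> fst (unpair w), snd (unpair z) \<oplus>\<^bsub>N\<^esub> snd (unpair w))),
     smult = (\<lambda>a z. pair (a \<odot>\<^bsub>M\<^esub> fst (unpair z), a \<odot>\<^bsub>N\<^esub> snd (unpair z)))\<rparr>"


section \<open>Cochain complexes\<close>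

record ('r, 'u) cochain_complex =
  Ob :: "int \<Rightarrow> ('r, 'u) module"
  Diff :: "int \<Rightarrow> 'u \<Rightarrow> 'u"

definition complexes :: "('r, 'k) ring_scheme \<Rightarrow> ('r, 'u) cochain_complex set" where
  "complexes R = {X. \<forall>n. Ob X n \<in> rmodules R \<and> Diff X n \<in> rhom R (Ob X n) (Ob X (n + 1)) \<and>
     (\<forall>x\<in>carrier (Ob X n). Diff X (n + 1) (Diff X n x) = \<zero>\<^bsub>Ob X (n + 1 + 1)\<^esub>)}"

definition cochain_maps :: "('r, 'k) ring_scheme \<Rightarrow>
    ('r, 'u) cochain_complex \<Rightarrow> ('r, 'u) cochain_complex \<Rightarrow> (int \<Rightarrow> 'u \<Rightarrow> 'u) set" where
  "cochain_maps R X Y = {f. \<forall>n. f n \<in> rhom R (Ob X n) (Ob Y n) \<and>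
     (\<forall>x\<in>carrier (Ob X n). f (n + 1) (Diff X n x) = Diff Y n (f n x))}"

definition cochain_id :: "('r, 'u) cochain_complex \<Rightarrow> int \<Rightarrow> 'u \<Rightarrow> 'u" where
  "cochain_id X = (\<lambda>n. \<lambda>x\<in>carrier (Ob X n). x)"

definition cochain_comp :: "('r, 'u) cochain_complex \<Rightarrow>
    (int \<Rightarrow> 'u \<Rightarrow> 'u) \<Rightarrow> (int \<Rightarrow> 'u \<Rightarrow> 'u) \<Rightarrow> int \<Rightarrow> 'u \<Rightarrow> 'u" where
  "cochain_comp X g f = (\<lambda>n. compose (carrier (Ob X n)) (g n) (f n))"

definition C_Mod ::
  "('r, 'k) ring_scheme \<Rightarrow> (('r, 'u) cochain_complex, int \<Rightarrow> 'u \<Rightarrow> 'u) category" where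
  "C_Mod R = \<lparr>
     Obj = complexes R,
     Hom = cochain_maps R,
     Id = cochain_id,
     Comp = (\<lambda>X Y Z g f. cochain_comp X g f)\<rparr>"

definition shift :: "int \<Rightarrow> ('r, 'u) cochain_complex \<Rightarrow> ('r, 'u) cochain_complex" where
  "shift n X = \<lparr>
     Ob = (\<lambda>k. Ob X (k - n)),
     Diff = (\<lambda>k. \<lambda>x\<in>carrier (Ob X (k - n)).
       if even n then Diff X (k - n) x else \<ominus>\<^bsub>Ob X (k - n + 1)\<^esub> Diff X (k - n) x)\<rparr>"

definition shift_map :: "int \<Rightarrow> (int \<Rightarrow> 'u \<Rightarrow> 'u) \<Rightarrow> int \<Rightarrow> 'u \<Rightarrow> 'u" where
  "shift_map n f = (\<lambda>k. f (k - n))"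

definition cone :: "('r, 'u) cochain_complex \<Rightarrow> ('r, 'u) cochain_complex \<Rightarrow>
    (int \<Rightarrow> 'u \<Rightarrow> 'u) \<Rightarrow> ('r, 'u) cochain_complex" where
  "cone X Y f = \<lparr>
     Ob = (\<lambda>n. direct_sum (Ob X (n + 1)) (Ob Y n)),
     Diff = (\<lambda>n. \<lambda>z\<in>carrier (direct_sum (Ob X (n + 1)) (Ob Y n)).
       let (x, y) = unpair z in
       pair (\<ominus>\<^bsub>Ob X (n + 1 + 1)\<^esub> Diff X (n + 1) x, Diff Y n y \<ominus>\<^bsub>Ob Y (n + 1)\<^esub> f (n + 1) x))\<rparr>"

definition cone_inj :: "('r, 'u) cochain_complex \<Rightarrow> ('r, 'u) cochain_complex \<Rightarrow> int \<Rightarrow> 'u \<Rightarrow> 'u"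
  where "cone_inj X Y = (\<lambda>n. \<lambda>y\<in>carrier (Ob Y n). pair (\<zero>\<^bsub>Ob X (n + 1)\<^esub>, y))"

definition cone_proj :: "('r, 'u) cochain_complex \<Rightarrow> ('r, 'u) cochain_complex \<Rightarrow> int \<Rightarrow> 'u \<Rightarrow> 'u"
  where "cone_proj X Y =
    (\<lambda>n. \<lambda>z\<in>carrier (direct_sum (Ob X (n + 1)) (Ob Y n)). fst (unpair z))"

definition exact_complex :: "(int \<Rightarrow> ('a, 'b) ring_scheme) \<Rightarrow> (int \<Rightarrow> 'a \<Rightarrow> 'a) \<Rightarrow> bool" where
  "exact_complex A d \<longleftrightarrow> (\<forall>n. d n ` carrier (A n) =
     {x \<in> carrier (A (n + 1)). d (n + 1) x = \<zero>\<^bsub>A (n + 1 + 1)\<^esub>})"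

text \<open>
  The complex \<open>Hom\<^sub>R(X, P)\<close> has \<open>Hom\<^sub>R(X\<^sup>-\<^sup>k, P)\<close> in degree \<open>k\<close>. The customary signs of its
  differentials are omitted, since they affect neither kernels nor images.
\<close>

definition Hom_complex_Ob :: "('r, 'k) ring_scheme \<Rightarrow>
    ('r, 'u) cochain_complex \<Rightarrow> ('r, 'u) module \<Rightarrow> int \<Rightarrow> ('u \<Rightarrow> 'u) ring" where
  "Hom_complex_Ob R X P = (\<lambda>k. hom_group R (Ob X (- k)) P)"

definition Hom_complex_Diff ::
  "('r, 'u) cochain_complex \<Rightarrow> int \<Rightarrow> ('u \<Rightarrow> 'u) \<Rightarrow> 'u \<Rightarrow> 'u" where
  "Hom_complex_Diff X = (\<lambda>k \<phi>. compose (carrier (Ob X (- (k + 1)))) \<phi> (Diff X (- (k + 1))))"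

definition totally_acyclic :: "('r, 'k) ring_scheme \<Rightarrow> ('r, 'u) cochain_complex set" where
  "totally_acyclic R = {X \<in> complexes R.
     (\<forall>n. projective R (Ob X n)) \<and>
     exact_complex (Ob X) (Diff X) \<and>
     (\<forall>P. projective R P \<longrightarrow> exact_complex (Hom_complex_Ob R X P) (Hom_complex_Diff X))}"

definition ker_Diff :: "('r, 'u) cochain_complex \<Rightarrow> int \<Rightarrow> ('r, 'u) module" where
  "ker_Diff X n =
     (Ob X n)\<lparr>carrier := {x \<in> carrier (Ob X n). Diff X n x = \<zero>\<^bsub>Ob X (n + 1)\<^esub>}\<rparr>"

definition Gorenstein_projective :: "('r, 'k) ring_scheme \<Rightarrow> ('r, 'u) module set" where
  "Gorenstein_projective R =
     {M \<in> rmodules R. \<exists>X\<in>totally_acyclic R :: ('r, 'u) cochain_complex set.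
        module_isomorphic R M (ker_Diff X 0)}"


section \<open>The homotopy category\<close>

definition homotopic :: "('r, 'k) ring_scheme \<Rightarrow>
    ('r, 'u) cochain_complex \<Rightarrow> ('r, 'u) cochain_complex \<Rightarrow> (int \<Rightarrow> 'u \<Rightarrow> 'u) rel" where
  "homotopic R X Y = {(f, g). f \<in> cochain_maps R X Y \<and> g \<in> cochain_maps R X Y \<and>
     (\<exists>s. (\<forall>n. s n \<in> rhom R (Ob X n) (Ob Y (n - 1))) \<and>
       (\<forall>n. \<forall>x\<in>carrier (Ob X n).
          f n x \<ominus>\<^bsub>Ob Y n\<^esub> g n x = Diff Y (n - 1) (s n x) \<oplus>\<^bsub>Ob Y n\<^esub> s (n + 1) (Diff X n x)))}"

definition homotopy_class :: "('r, 'k) ring_scheme \<Rightarrow>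
    ('r, 'u) cochain_complex \<Rightarrow> ('r, 'u) cochain_complex \<Rightarrow>
    (int \<Rightarrow> 'u \<Rightarrow> 'u) \<Rightarrow> (int \<Rightarrow> 'u \<Rightarrow> 'u) set" where
  "homotopy_class R X Y f = homotopic R X Y `` {f}"

definition K_Mod ::
  "('r, 'k) ring_scheme \<Rightarrow> (('r, 'u) cochain_complex, (int \<Rightarrow> 'u \<Rightarrow> 'u) set) category" where
  "K_Mod R = \<lparr>
     Obj = complexes R,
     Hom = (\<lambda>X Y. cochain_maps R X Y // homotopic R X Y),
     Id = (\<lambda>X. homotopy_class R X X (cochain_id X)),
     Comp = (\<lambda>X Y Z G F. \<Union>g\<in>G. \<Union>f\<in>F. homotopy_class R X Z (cochain_comp X g f))\<rparr>"

definition K_Proj ::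
  "('r, 'k) ring_scheme \<Rightarrow> (('r, 'u) cochain_complex, (int \<Rightarrow> 'u \<Rightarrow> 'u) set) category" where
  "K_Proj R = full_subcategory (K_Mod R) {X. \<forall>n. projective R (Ob X n)}"

text \<open>
  \<open>exact_triangle R X F Y G Z H\<close> says that \<open>X \<rightarrow> Y \<rightarrow> Z \<rightarrow> X[-1]\<close>, with morphisms \<open>F\<close>, \<open>G\<close>, \<open>H\<close>
  of the homotopy category, is isomorphic to the standard triangle of a cochain map \<open>f\<close>.
  Shifting all the representatives of a homotopy class \<open>\<alpha>\<close> gives the homotopy class \<open>\<alpha>[-1]\<close>.
\<close>

definition exact_triangle :: "('r, 'k) ring_scheme \<Rightarrow>
    ('r, 'u) cochain_complex \<Rightarrow> (int \<Rightarrow> 'u \<Rightarrow> 'u) set \<Rightarrow>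
    ('r, 'u) cochain_complex \<Rightarrow> (int \<Rightarrow> 'u \<Rightarrow> 'u) set \<Rightarrow>
    ('r, 'u) cochain_complex \<Rightarrow> (int \<Rightarrow> 'u \<Rightarrow> 'u) set \<Rightarrow> bool" where
  "exact_triangle R X F Y G Z H \<longleftrightarrow>
     X \<in> complexes R \<and> Y \<in> complexes R \<and> Z \<in> complexes R \<and>
     F \<in> Hom (K_Mod R) X Y \<and> G \<in> Hom (K_Mod R) Y Z \<and> H \<in> Hom (K_Mod R) Z (shift (-1) X) \<and>
     (\<exists>X'\<in>complexes R. \<exists>Y'\<in>complexes R. \<exists>f\<in>cochain_maps R X' Y'. \<exists>\<alpha> \<beta> \<gamma>.
        is_iso (K_Mod R) X X' \<alpha> \<and> is_iso (K_Mod R) Y Y' \<beta> \<and>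
        is_iso (K_Mod R) Z (cone X' Y' f) \<gamma> \<and>
        Comp (K_Mod R) X Y Y' \<beta> F =
          Comp (K_Mod R) X X' Y' (homotopy_class R X' Y' f) \<alpha> \<and>
        Comp (K_Mod R) Y Z (cone X' Y' f) \<gamma> G =
          Comp (K_Mod R) Y Y' (cone X' Y' f)
            (homotopy_class R Y' (cone X' Y' f) (cone_inj X' Y')) \<beta> \<and>
        Comp (K_Mod R) Z (shift (-1) X) (shift (-1) X') (shift_map (-1) ` \<alpha>) H =
          Comp (K_Mod R) Z (cone X' Y' f) (shift (-1) X')
            (homotopy_class R (cone X' Y' f) (shift (-1) X') (cone_proj X' Y')) \<gamma>)"

definition Mor :: "('r, 'k) ring_scheme \<Rightarrow> ('r, 'u) cochain_complex set \<Rightarrow>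
    (('r, 'u) cochain_complex \<times> (int \<Rightarrow> 'u \<Rightarrow> 'u) set \<times> ('r, 'u) cochain_complex) set" where
  "Mor R \<K> = {(X, F, Y).
     X \<in> Obj (K_Proj R) \<and> Y \<in> Obj (K_Proj R) \<and> F \<in> Hom (K_Proj R) X Y \<and>
     (\<exists>Z\<in>\<K>. \<exists>G H. exact_triangle R X F Y G Z H)}"

end

(*
  Let K be the class of totally acyclic complexes and perp K the class of all complexes Q such that
  every chain map from a complex of K to Q is null homotopic.  A complex of projectives is
  Mor_K-injective if and only if it lies in perp K.  Hence the generalized Baer Lemma yields a small
  set of complexes of K, the shifted cones of the morphisms of the test set, that detects whether a
  complex of projectives belongs to perp K.  Adding to this set a contractible complex that generates
  all complexes does not change its right orthogonal.

  Let S be a small set of complexes of K.  Every complex M admits a chain map g : T -> M with cone(g)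
  right orthogonal to S, where T in K is built from members of S.  Instead of a transfinite iteration
  of pushouts, T is taken in one step.  The cells are the pairs of a complex X in S and a label; the
  graded module P is the direct sum of the X over all cells; and the label encodes an attaching map
  X -> P of degree 1 together with a map X -> M, which prescribe a differential on P and a map to M.
  The labels can encode all such data: if the modules occurring in S and M have at most |B| elements,
  B infinite, then there are at most |Pow B| cells, P^n has at most |Pow B| elements, and there are at
  most |Pow B| maps from X to P.  Finally T consists of those cells that are well founded with respect
  to attachment, which gives the inductions needed for T in K and for the orthogonality of T.

  For a complex M of projectives, E = cone(g) lies in perp K and M -> E is in Mor_K: there are enough
  injectives.  A fraction X <- Z -> Y is determined by the extension X -> E of the composite
  Z -> Y -> E, so the fractions embed into Hom(X, E).  Since a generating complex was added, g is
  surjective in each degree, and homotopies into M lift along g; so a factorization through g up to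
  homotopy can be corrected to a strict one and g is a precover.  For M concentrated in a single degree
  this yields Gorenstein-projective precovers of modules.
*)
theory Submission
  imports "HOL-Library.Multiset" "HOL-Library.Poly_Mapping" "HOL-Library.Countable" Defs
begin

section \<open>Small sets\<close>

text \<open>The one-step construction has to break a circle: attaching maps go into P, whose size
  depends on the number of cells, yet every attaching map must occur among the cells. The bound |Pow
  B| is stable under direct sums and under exponents of size |B|, so Pow B can serve as the set of
  labels before P exists; once P is formed, a surjection from the labels onto the attaching data is
  chosen. Since a valid cell attached to accessible cells is itself accessible, nothing has to be
  iterated.

  The Baer Lemma tests complexes of projectives only, while precovers need orthogonality for
  arbitrary complexes Q. For this, T in K is itself approximated by some T0 built from S: the cone
  of T0 -> T consists of projectives, hence lies in perp K, and T -> cone is null homotopic; every T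
  -> Q extends over the cone because it is null homotopic on T0.

  Total acyclicity of a cellular complex is shown in two ways: exactness by eliminating a top cell
  of a cocycle, and acyclicity of Hom into a projective P as orthogonality to P placed in one
  degree.\<close>

lemma small_mono: "small U A \<Longrightarrow> |B| \<le>o |A| \<Longrightarrow> small U B"
  unfolding small_def using ordLeq_ordLess_trans by blast

lemma small_subset: "small U A \<Longrightarrow> B \<subseteq> A \<Longrightarrow> small U B"
  by (rule small_mono[OF _ card_of_mono1])

lemma small_image: "small U A \<Longrightarrow> small U (f ` A)"
  by (rule small_mono[OF _ card_of_image])

lemma small_inj_on: "small U B \<Longrightarrow> inj_on f A \<Longrightarrow> f ` A \<subseteq> B \<Longrightarrow> small U A"
  by (rule small_mono) (auto simp: card_of_ordLeq[symmetric])

lemma small_embeds: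
  assumes "small TYPE('u) A"
  obtains e :: "'a \<Rightarrow> 'u" where "inj_on e A"
proof -
  have "|A| \<le>o |UNIV :: 'u set|"
    using assms ordLess_imp_ordLeq unfolding small_def by blast
  then show ?thesis using that unfolding card_of_ordLeq[symmetric] by blast
qed

lemma universe_infinite:
  assumes "universe TYPE('u)"
  shows "infinite (UNIV :: 'u set)"
proof -
  have "|UNIV :: nat set| \<le>o |UNIV :: 'u set|"
    using assms ordLess_imp_ordLeq unfolding universe_def by blast
  then show ?thesis using card_of_ordLeq_infinite infinite_UNIV_nat by blast
qed

lemma small_countable:
  assumes "universe TYPE('u)"
  shows "small TYPE('u) (A :: 'a :: countable set)"
proof -
  have "small TYPE('u) (UNIV :: nat set)"
    using assms by (simp only: universe_def small_def)
  then show ?thesis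
    by (rule small_inj_on[where f = to_nat]) (auto simp: inj_on_def)
qed

text \<open>This is regularity of the cardinal of \<open>'u\<close>, in the form
  \<open>stable\<close>; smallness of unions and products is derived from it.\<close>

lemma small_Sigma:
  assumes u: "universe TYPE('u)" and "small TYPE('u) A"
    and "\<And>a. a \<in> A \<Longrightarrow> small TYPE('u) (F a)"
  shows "small TYPE('u) (Sigma A F)"
proof -
  have "stable |UNIV :: 'u set|"
    using u universe_infinite[OF u] unfolding universe_def
    by (intro regularCard_stable card_of_Card_order) (simp_all only: Field_card_of, blast)
  then show ?thesis
    using assms(2,3) unfolding small_def by (rule stable_elim)
qed

lemma small_UN:
  assumes "universe TYPE('u)" "small TYPE('u) A"
    and "\<And>a. a \<in> A \<Longrightarrow> small TYPE('u) (F a)"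
  shows "small TYPE('u) (\<Union>a\<in>A. F a)"
  by (rule small_mono[OF small_Sigma[OF assms] card_of_UNION_Sigma])

lemma small_Un:
  assumes "universe TYPE('u)" "small TYPE('u) A" "small TYPE('u) B"
  shows "small TYPE('u) (A \<union> B)"
proof -
  have "A \<union> B = (\<Union>b\<in>UNIV. if b then A else B)" by (auto split: if_splits)
  moreover have "small TYPE('u) (\<Union>b\<in>UNIV. if b then A else B)"
    by (rule small_UN[OF assms(1) small_countable[OF assms(1)]]) (simp add: assms)
  ultimately show ?thesis by simp
qed

lemma small_insert:
  assumes "universe TYPE('u)" "small TYPE('u) A"
  shows "small TYPE('u) (insert x A)"
proof -
  have "small TYPE('u) {x}"
    by (rule small_inj_on[OF small_countable[OF assms(1), of "UNIV :: unit set"], of "\<lambda>_. ()"]) auto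
  then show ?thesis using small_Un[OF assms(1) _ assms(2)] by (metis insert_is_Un)
qed

lemma small_Times:
  assumes "universe TYPE('u)" "small TYPE('u) A" "small TYPE('u) B"
  shows "small TYPE('u) (A \<times> B)"
  using assms by (intro small_Sigma)

lemma small_Pow:
  assumes u: "universe TYPE('u)" and "small TYPE('u) A"
  shows "small TYPE('u) (Pow A)"
proof -
  obtain e :: "_ \<Rightarrow> 'u" where e: "inj_on e A" using small_embeds[OF assms(2)] .
  have "small TYPE('u) (e ` A)" using assms(2) by (rule small_image)
  then have "small TYPE('u) (Pow (e ` A))" using u unfolding universe_def small_def by blast
  then show ?thesis
    by (rule small_inj_on[where f = "image e"]) (use e inj_on_image_Pow in auto)
qed

text \<open>Passing to graphs lets function sets inherit smallness from power sets.\<close>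

lemma PiE_graph_inj: "inj_on (\<lambda>f. {(x, f x) |x. x \<in> A}) (A \<rightarrow>\<^sub>E B)"
proof (rule inj_onI)
  fix f g assume f: "f \<in> A \<rightarrow>\<^sub>E B" and g: "g \<in> A \<rightarrow>\<^sub>E B"
    and eq: "{(x, f x) |x. x \<in> A} = {(x, g x) |x. x \<in> A}"
  show "f = g" by (rule PiE_ext[OF f g]) (use eq in blast)
qed

lemma small_PiE:
  assumes "universe TYPE('u)" "small TYPE('u) A" "small TYPE('u) B"
  shows "small TYPE('u) (A \<rightarrow>\<^sub>E B)"
  by (rule small_inj_on[OF small_Pow[OF assms(1) small_Times[OF assms]] PiE_graph_inj]) auto

lemma inj_pair:
  assumes "universe TYPE('u)"
  shows "inj (pair :: 'u \<times> 'u \<Rightarrow> 'u)"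
proof -
  have "|(UNIV :: 'u set) \<times> (UNIV :: 'u set)| =o |UNIV :: 'u set|"
    using card_of_Times_same_infinite[OF universe_infinite[OF assms]] .
  then obtain f :: "'u \<times> 'u \<Rightarrow> 'u" where "bij_betw f (UNIV \<times> UNIV) UNIV"
    using card_of_ordIso by blast
  then have "inj f" by (simp add: bij_betw_def)
  then show ?thesis unfolding pair_def by (rule someI[of inj])
qed

lemma unpair_pair: "universe TYPE('u) \<Longrightarrow> unpair (pair (p :: 'u \<times> 'u)) = p"
  unfolding unpair_def by (simp add: inj_pair)


section \<open>Identities in abelian groups\<close>

text \<open>
  An identity between sums of elements of an abelian group is reduced to one in the free abelian
  group on its elements, where the simplifier decides it.
\<close>

definition formal_value :: "('a, 'b) ring_scheme \<Rightarrow> ('a \<Rightarrow>\<^sub>0 int) \<Rightarrow> 'a" where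
  "formal_value G X = (\<Otimes>\<^bsub>add_monoid G\<^esub>x\<in>Poly_Mapping.keys X.
     x [^]\<^bsub>add_monoid G\<^esub> Poly_Mapping.lookup X x)"

definition formal_atom :: "'a \<Rightarrow> 'a \<Rightarrow>\<^sub>0 int" where
  "formal_atom x = Poly_Mapping.single x 1"

definition represents :: "('a, 'b) ring_scheme \<Rightarrow> 'a \<Rightarrow> ('a \<Rightarrow>\<^sub>0 int) \<Rightarrow> bool" where
  "represents G x X \<longleftrightarrow> abelian_group G \<and> Poly_Mapping.keys X \<subseteq> carrier G \<and> formal_value G X = x"

text \<open>Cancellation may make the support of X + Y smaller than the union of the supports, so
  the values are compared as products over a common finite superset.\<close>

lemma formal_value_superset:
  assumes "abelian_group G" "Poly_Mapping.keys X \<subseteq> A" "finite A" "A \<subseteq> carrier G"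
  shows "formal_value G X =
    (\<Otimes>\<^bsub>add_monoid G\<^esub>x\<in>A. x [^]\<^bsub>add_monoid G\<^esub> Poly_Mapping.lookup X x)"
proof -
  interpret A: comm_group "add_monoid G" using assms(1) by (rule abelian_group.a_comm_group)
  have "x [^]\<^bsub>add_monoid G\<^esub> (k :: int) \<in> carrier G" if "x \<in> A" for x k
    using A.int_pow_closed[of x k] that assms(4) by auto
  then show ?thesis unfolding formal_value_def
    using assms(2-) by (intro A.finprod_mono_neutral_cong_left) (auto simp: in_keys_iff)
qed

lemma represents_add:
  assumes "represents G x X" "represents G y Y"
  shows "represents G (x \<oplus>\<^bsub>G\<^esub> y) (X + Y)"
proof -
  have G: "abelian_group G" using assms(1) by (simp add: represents_def)
  interpret A: comm_group "add_monoid G" using G by (rule abelian_group.a_comm_group)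
  let ?A = "Poly_Mapping.keys X \<union> Poly_Mapping.keys Y"
  let ?f = "\<lambda>(X :: 'a \<Rightarrow>\<^sub>0 int) x. x [^]\<^bsub>add_monoid G\<^esub> Poly_Mapping.lookup X x"
  have A: "finite ?A" "?A \<subseteq> carrier G" using assms by (auto simp: represents_def)
  have cl: "?f Z \<in> ?A \<rightarrow> carrier (add_monoid G)" for Z :: "'a \<Rightarrow>\<^sub>0 int"
  proof (rule funcsetI)
    fix x assume "x \<in> ?A"
    then have "x \<in> carrier (add_monoid G)" using A(2) by auto
    then show "?f Z x \<in> carrier (add_monoid G)" by (rule A.int_pow_closed)
  qed
  have k: "Poly_Mapping.keys (X + Y) \<subseteq> ?A" by (rule Poly_Mapping.keys_add)
  have "formal_value G (X + Y) = finprod (add_monoid G) (?f (X + Y)) ?A"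
    by (rule formal_value_superset[OF G k A])
  also have "\<dots> = finprod (add_monoid G) (\<lambda>x. ?f X x \<otimes>\<^bsub>add_monoid G\<^esub> ?f Y x) ?A"
    using A(2) cl by (intro A.finprod_cong' funcsetI A.m_closed)
      (auto simp: lookup_add A.int_pow_mult[simplified] subsetD)
  also have "\<dots> = finprod (add_monoid G) (?f X) ?A \<otimes>\<^bsub>add_monoid G\<^esub> finprod (add_monoid G) (?f Y) ?A"
    by (rule A.finprod_multf[OF cl cl])
  also have "\<dots> = formal_value G X \<oplus>\<^bsub>G\<^esub> formal_value G Y"
    by (simp add: formal_value_superset[OF G _ A])
  finally show ?thesis using assms k A by (auto simp: represents_def)
qed

text \<open>Additivity applied to - X + X = 0 shows that the value of - X is inverse to x.\<close>

lemma represents_minus: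
  assumes "represents G x X"
  shows "represents G (\<ominus>\<^bsub>G\<^esub> x) (- X)"
proof -
  have G: "abelian_group G" using assms(1) by (simp add: represents_def)
  interpret A: comm_group "add_monoid G" using G by (rule abelian_group.a_comm_group)
  have k: "Poly_Mapping.keys (- X) = Poly_Mapping.keys X" by simp
  have cl: "formal_value G Z \<in> carrier G" if "Poly_Mapping.keys Z \<subseteq> carrier G" for Z
  proof -
    have "formal_value G Z \<in> carrier (add_monoid G)" unfolding formal_value_def
      using that by (intro A.finprod_closed funcsetI A.int_pow_closed) auto
    then show ?thesis by simp
  qed
  have "represents G (formal_value G (- X)) (- X)" using assms k by (auto simp: represents_def)
  from represents_add[OF this assms] have "formal_value G (- X) \<oplus>\<^bsub>G\<^esub> x = \<zero>\<^bsub>G\<^esub>"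
    by (simp add: represents_def formal_value_def)
  moreover have "x \<in> carrier G" "formal_value G (- X) \<in> carrier G"
    using assms cl by (auto simp: represents_def)
  ultimately have "formal_value G (- X) = \<ominus>\<^bsub>G\<^esub> x"
    using abelian_group.minus_equality[OF G] by simp
  then show ?thesis using assms k by (auto simp: represents_def)
qed

lemma represents_diff:
  assumes "represents G x X" "represents G y Y"
  shows "represents G (x \<ominus>\<^bsub>G\<^esub> y) (X - Y)"
  using represents_add[OF assms(1) represents_minus[OF assms(2)]]
  by (simp add: a_minus_def)

lemma represents_zero: "abelian_group G \<Longrightarrow> represents G \<zero>\<^bsub>G\<^esub> 0"
  using comm_group.axioms(1)[OF abelian_group.a_comm_group, of G]
  by (simp add: represents_def formal_value_def comm_monoid.finprod_empty)

lemma represents_atom: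
  assumes "abelian_group G" "x \<in> carrier G"
  shows "represents G x (formal_atom x)"
proof -
  interpret A: comm_group "add_monoid G" using assms(1) by (rule abelian_group.a_comm_group)
  have "x \<in> carrier (add_monoid G)" using assms(2) by simp
  then have "formal_value G (formal_atom x) = x"
    using A.r_one by (simp add: formal_value_def formal_atom_def A.finprod_insert)
  then show ?thesis using assms
    by (simp add: represents_def formal_atom_def)
qed

text \<open>Resolving with \<open>represents\<close> and \<open>represents_atom\<close> follows the
  syntax of both sides and instantiates X and Y; the last goal X = Y is an identity in a commutative
  group given by type classes, where \<open>algebra_simps\<close> applies.\<close>

lemma represents_eq: "represents G x X \<Longrightarrow> represents G y Y \<Longrightarrow> X = Y \<Longrightarrow> x = y"
  by (simp add: represents_def)

lemmas represents = represents_add represents_diff represents_minus represents_zero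

lemma abelian_group_diff_diff:
  assumes "abelian_group G" "a \<in> carrier G" "b \<in> carrier G"
  shows "a \<ominus>\<^bsub>G\<^esub> (a \<ominus>\<^bsub>G\<^esub> b) = b"
proof -
  interpret abelian_group G by fact
  show ?thesis using assms(2,3) by (simp add: a_minus_def minus_add r_neg2)
qed


section \<open>Modules and linear maps\<close>

text \<open>This is \<open>rhom\<close> without extensionality. Linear maps can then be added and
  composed as plain lambda terms, and are restricted to the carrier only where \<open>rhom\<close>
  itself is required.\<close>

definition rlinear :: "('r, 'k) ring_scheme \<Rightarrow> ('r, 'u) module \<Rightarrow> ('r, 'v) module \<Rightarrow> ('u \<Rightarrow> 'v) \<Rightarrow> bool"
  where "rlinear R M N f \<longleftrightarrow> (\<forall>x\<in>carrier M. f x \<in> carrier N) \<and>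
    (\<forall>x\<in>carrier M. \<forall>y\<in>carrier M. f (x \<oplus>\<^bsub>M\<^esub> y) = f x \<oplus>\<^bsub>N\<^esub> f y) \<and>
    (\<forall>a\<in>carrier R. \<forall>x\<in>carrier M. f (a \<odot>\<^bsub>M\<^esub> x) = a \<odot>\<^bsub>N\<^esub> f x)"

lemma rlinearI:
  assumes "\<And>x. x \<in> carrier M \<Longrightarrow> f x \<in> carrier N"
    and "\<And>x y. x \<in> carrier M \<Longrightarrow> y \<in> carrier M \<Longrightarrow> f (x \<oplus>\<^bsub>M\<^esub> y) = f x \<oplus>\<^bsub>N\<^esub> f y"
    and "\<And>a x. a \<in> carrier R \<Longrightarrow> x \<in> carrier M \<Longrightarrow> f (a \<odot>\<^bsub>M\<^esub> x) = a \<odot>\<^bsub>N\<^esub> f x"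
  shows "rlinear R M N f"
  using assms by (simp add: rlinear_def)

text \<open>The module is a parameter here because later arguments handle modules in many degrees at
  once, where interpreting a locale for each of them would be unwieldy.\<close>

lemma right_module_simps:
  assumes "right_module R M"
  shows "abelian_group M" "\<zero>\<^bsub>M\<^esub> \<in> carrier M"
    "\<And>x y. x \<in> carrier M \<Longrightarrow> y \<in> carrier M \<Longrightarrow> x \<oplus>\<^bsub>M\<^esub> y \<in> carrier M"
    "\<And>x y. x \<in> carrier M \<Longrightarrow> y \<in> carrier M \<Longrightarrow> x \<ominus>\<^bsub>M\<^esub> y \<in> carrier M"
    "\<And>x. x \<in> carrier M \<Longrightarrow> \<ominus>\<^bsub>M\<^esub> x \<in> carrier M"
    "\<And>a x. a \<in> carrier R \<Longrightarrow> x \<in> carrier M \<Longrightarrow> a \<odot>\<^bsub>M\<^esub> x \<in> carrier M"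
    "\<And>x. x \<in> carrier M \<Longrightarrow> \<zero>\<^bsub>M\<^esub> \<oplus>\<^bsub>M\<^esub> x = x"
    "\<And>x. x \<in> carrier M \<Longrightarrow> x \<oplus>\<^bsub>M\<^esub> \<zero>\<^bsub>M\<^esub> = x"
    "\<And>x. x \<in> carrier M \<Longrightarrow> x \<ominus>\<^bsub>M\<^esub> \<zero>\<^bsub>M\<^esub> = x"
    "\<And>x. x \<in> carrier M \<Longrightarrow> x \<ominus>\<^bsub>M\<^esub> x = \<zero>\<^bsub>M\<^esub>"
    "\<And>x. x \<in> carrier M \<Longrightarrow> \<ominus>\<^bsub>M\<^esub> (\<ominus>\<^bsub>M\<^esub> x) = x"
    "\<ominus>\<^bsub>M\<^esub> \<zero>\<^bsub>M\<^esub> = \<zero>\<^bsub>M\<^esub>"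
    "\<And>a x y. a \<in> carrier R \<Longrightarrow> x \<in> carrier M \<Longrightarrow> y \<in> carrier M \<Longrightarrow>
      a \<odot>\<^bsub>M\<^esub> (x \<oplus>\<^bsub>M\<^esub> y) = a \<odot>\<^bsub>M\<^esub> x \<oplus>\<^bsub>M\<^esub> a \<odot>\<^bsub>M\<^esub> y"
    "\<And>a. a \<in> carrier R \<Longrightarrow> a \<odot>\<^bsub>M\<^esub> \<zero>\<^bsub>M\<^esub> = \<zero>\<^bsub>M\<^esub>"
    "\<And>a x. a \<in> carrier R \<Longrightarrow> x \<in> carrier M \<Longrightarrow> a \<odot>\<^bsub>M\<^esub> (\<ominus>\<^bsub>M\<^esub> x) = \<ominus>\<^bsub>M\<^esub> (a \<odot>\<^bsub>M\<^esub> x)"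
    "\<And>a x y. a \<in> carrier R \<Longrightarrow> x \<in> carrier M \<Longrightarrow> y \<in> carrier M \<Longrightarrow>
      a \<odot>\<^bsub>M\<^esub> (x \<ominus>\<^bsub>M\<^esub> y) = a \<odot>\<^bsub>M\<^esub> x \<ominus>\<^bsub>M\<^esub> a \<odot>\<^bsub>M\<^esub> y"
proof -
  interpret right_module R M by fact
  show G: "abelian_group M" ..
  \<comment> \<open>An idempotent of a group is zero; this is applied to the product of a scalar
    with zero.\<close>
  have inj: "x \<oplus>\<^bsub>M\<^esub> x = x \<Longrightarrow> x = \<zero>\<^bsub>M\<^esub>" if "x \<in> carrier M" for x
    using that by (metis M.a_assoc M.l_neg M.a_inv_closed M.l_zero)
  show z: "a \<odot>\<^bsub>M\<^esub> \<zero>\<^bsub>M\<^esub> = \<zero>\<^bsub>M\<^esub>" if "a \<in> carrier R" for a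
  proof -
    have "a \<odot>\<^bsub>M\<^esub> \<zero>\<^bsub>M\<^esub> \<oplus>\<^bsub>M\<^esub> a \<odot>\<^bsub>M\<^esub> \<zero>\<^bsub>M\<^esub> = a \<odot>\<^bsub>M\<^esub> \<zero>\<^bsub>M\<^esub>"
      using smult_r_distr[OF that M.zero_closed M.zero_closed] by simp
    then show ?thesis using that by (intro inj) auto
  qed
  show n: "a \<odot>\<^bsub>M\<^esub> (\<ominus>\<^bsub>M\<^esub> x) = \<ominus>\<^bsub>M\<^esub> (a \<odot>\<^bsub>M\<^esub> x)" if "a \<in> carrier R" "x \<in> carrier M" for a x
    by (rule M.minus_equality[symmetric])
      (use that smult_r_distr[of a "\<ominus>\<^bsub>M\<^esub> x" x] z in \<open>simp_all add: M.l_neg\<close>)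
  show "a \<odot>\<^bsub>M\<^esub> (x \<ominus>\<^bsub>M\<^esub> y) = a \<odot>\<^bsub>M\<^esub> x \<ominus>\<^bsub>M\<^esub> a \<odot>\<^bsub>M\<^esub> y"
    if "a \<in> carrier R" "x \<in> carrier M" "y \<in> carrier M" for a x y
    using that n by (simp add: a_minus_def smult_r_distr)
  show "\<ominus>\<^bsub>M\<^esub> \<zero>\<^bsub>M\<^esub> = \<zero>\<^bsub>M\<^esub>" by (rule M.minus_equality) simp_all
  show "x \<ominus>\<^bsub>M\<^esub> x = \<zero>\<^bsub>M\<^esub>" "x \<ominus>\<^bsub>M\<^esub> \<zero>\<^bsub>M\<^esub> = x" if "x \<in> carrier M" for x
    using that M.r_neg by (simp_all add: a_minus_def)
  show "a \<odot>\<^bsub>M\<^esub> (x \<oplus>\<^bsub>M\<^esub> y) = a \<odot>\<^bsub>M\<^esub> x \<oplus>\<^bsub>M\<^esub> a \<odot>\<^bsub>M\<^esub> y"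
    if "a \<in> carrier R" "x \<in> carrier M" "y \<in> carrier M" for a x y
    using that by (rule smult_r_distr)
  show "\<zero>\<^bsub>M\<^esub> \<in> carrier M" by simp
  show "x \<oplus>\<^bsub>M\<^esub> y \<in> carrier M" "x \<ominus>\<^bsub>M\<^esub> y \<in> carrier M" if "x \<in> carrier M" "y \<in> carrier M" for x y
    using that by auto
  show "\<ominus>\<^bsub>M\<^esub> x \<in> carrier M" "\<zero>\<^bsub>M\<^esub> \<oplus>\<^bsub>M\<^esub> x = x" "x \<oplus>\<^bsub>M\<^esub> \<zero>\<^bsub>M\<^esub> = x" "\<ominus>\<^bsub>M\<^esub> (\<ominus>\<^bsub>M\<^esub> x) = x"
    if "x \<in> carrier M" for x
    using that by auto
  show "a \<odot>\<^bsub>M\<^esub> x \<in> carrier M" if "a \<in> carrier R" "x \<in> carrier M" for a x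
    using that by auto
qed


lemma rmodulesD: "M \<in> rmodules R \<Longrightarrow> right_module R M"
  by (simp add: rmodules_def)

lemma rlinear_zero:
  assumes "rlinear R M N f" "right_module R M" "right_module R N"
  shows "f \<zero>\<^bsub>M\<^esub> = \<zero>\<^bsub>N\<^esub>"
proof -
  interpret M: right_module R M by fact
  interpret N: right_module R N by fact
  have "f \<zero>\<^bsub>M\<^esub> \<oplus>\<^bsub>N\<^esub> f \<zero>\<^bsub>M\<^esub> = f \<zero>\<^bsub>M\<^esub>" "f \<zero>\<^bsub>M\<^esub> \<in> carrier N"
    using assms(1) M.M.zero_closed M.M.l_zero unfolding rlinear_def by (metis, metis)
  then show ?thesis
    by (metis N.M.a_assoc N.M.l_neg N.M.a_inv_closed N.M.l_zero)
qed

lemma rlinear_neg: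
  assumes "rlinear R M N f" "right_module R M" "right_module R N" "x \<in> carrier M"
  shows "f (\<ominus>\<^bsub>M\<^esub> x) = \<ominus>\<^bsub>N\<^esub> f x"
proof -
  interpret M: right_module R M by fact
  interpret N: right_module R N by fact
  have "f (\<ominus>\<^bsub>M\<^esub> x) \<oplus>\<^bsub>N\<^esub> f x = f (\<ominus>\<^bsub>M\<^esub> x \<oplus>\<^bsub>M\<^esub> x)"
    using assms by (simp add: rlinear_def)
  also have "\<dots> = \<zero>\<^bsub>N\<^esub>"
    using rlinear_zero[OF assms(1-3)] assms(4) by (simp add: M.M.l_neg)
  finally show ?thesis
    using assms by (intro N.M.minus_equality[symmetric]) (auto simp: rlinear_def)
qed

lemma rlinear_simps:
  assumes f: "rlinear R M N f" and M: "right_module R M" and N: "right_module R N"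
  shows "\<And>x. x \<in> carrier M \<Longrightarrow> f x \<in> carrier N"
    "\<And>x y. x \<in> carrier M \<Longrightarrow> y \<in> carrier M \<Longrightarrow> f (x \<oplus>\<^bsub>M\<^esub> y) = f x \<oplus>\<^bsub>N\<^esub> f y"
    "\<And>x y. x \<in> carrier M \<Longrightarrow> y \<in> carrier M \<Longrightarrow> f (x \<ominus>\<^bsub>M\<^esub> y) = f x \<ominus>\<^bsub>N\<^esub> f y"
    "\<And>x. x \<in> carrier M \<Longrightarrow> f (\<ominus>\<^bsub>M\<^esub> x) = \<ominus>\<^bsub>N\<^esub> f x"
    "f \<zero>\<^bsub>M\<^esub> = \<zero>\<^bsub>N\<^esub>"
    "\<And>a x. a \<in> carrier R \<Longrightarrow> x \<in> carrier M \<Longrightarrow> f (a \<odot>\<^bsub>M\<^esub> x) = a \<odot>\<^bsub>N\<^esub> f x"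
  using f rlinear_zero[OF assms] rlinear_neg[OF assms] right_module_simps[OF M]
  by (simp_all add: rlinear_def a_minus_def)

lemma rlinear_closed: "rlinear R M N f \<Longrightarrow> x \<in> carrier M \<Longrightarrow> f x \<in> carrier N"
  by (simp add: rlinear_def)

lemma rhom_iff: "f \<in> rhom R M N \<longleftrightarrow> rlinear R M N f \<and> f \<in> extensional (carrier M)"
  by (auto simp: rhom_def rlinear_def PiE_def)

lemma rlinear_cong:
  assumes "right_module R M" "rlinear R M N f" "\<And>x. x \<in> carrier M \<Longrightarrow> f x = g x"
  shows "rlinear R M N g"
  using assms right_module_simps[OF assms(1)] by (auto simp: rlinear_def)

lemma restrict_rhom:
  assumes "right_module R M" "rlinear R M N f"
  shows "restrict f (carrier M) \<in> rhom R M N"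
  using rlinear_cong[OF assms, of "restrict f (carrier M)"] by (simp add: rhom_iff)

lemma rlinear_id: "rlinear R M M (\<lambda>x. x)"
  by (simp add: rlinear_def)

lemma rlinear_comp: "rlinear R M N g \<Longrightarrow> rlinear R L M f \<Longrightarrow> rlinear R L N (\<lambda>x. g (f x))"
  by (simp add: rlinear_def)

lemma rlinear_const_zero: "right_module R N \<Longrightarrow> rlinear R M N (\<lambda>x. \<zero>\<^bsub>N\<^esub>)"
  using right_module_simps[of R N] by (simp add: rlinear_def)

lemma rlinear_add:
  assumes N: "right_module R N" and "rlinear R M N f" "rlinear R M N g"
  shows "rlinear R M N (\<lambda>x. f x \<oplus>\<^bsub>N\<^esub> g x)"
proof -
  interpret N: right_module R N by fact
  show ?thesis using assms(2,3)
    by (auto simp: rlinear_def N.smult_r_distr N.M.a_ac)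
qed

lemma rlinear_uminus:
  assumes N: "right_module R N" and "rlinear R M N f"
  shows "rlinear R M N (\<lambda>x. \<ominus>\<^bsub>N\<^esub> f x)"
proof -
  interpret N: right_module R N by fact
  show ?thesis using assms(2) right_module_simps[OF N]
    by (auto simp: rlinear_def N.M.minus_add)
qed

lemma rlinear_diff:
  assumes "right_module R N" and "rlinear R M N f" "rlinear R M N g"
  shows "rlinear R M N (\<lambda>x. f x \<ominus>\<^bsub>N\<^esub> g x)"
  using rlinear_add[OF assms(1,2) rlinear_uminus[OF assms(1,3)]] by (simp add: a_minus_def)

lemma abelian_group_cancel:
  assumes "abelian_group G" "x \<in> carrier G" "y \<in> carrier G"
  shows "x \<ominus>\<^bsub>G\<^esub> y = \<zero>\<^bsub>G\<^esub> \<longleftrightarrow> x = y"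
proof -
  interpret abelian_group G by fact
  have "(x \<ominus>\<^bsub>G\<^esub> y) \<oplus>\<^bsub>G\<^esub> y = x"
    by (rule represents_eq, (rule represents | (rule represents_atom, simp_all add: assms) | simp)+)
  then show ?thesis using assms r_neg by (auto simp: a_minus_def)
qed


subsection \<open>Binary direct sums\<close>

locale module_universe =
  fixes R :: "('r, 'k) ring_scheme" and U :: "'u itself"
  assumes univ: "universe U" and ring: "ring R"
begin

lemma univ': "universe TYPE('u)"
  using univ by (simp add: universe_def)

lemma unpair_pair' [simp]: "unpair (pair (p :: 'u \<times> 'u)) = p"
  by (rule unpair_pair[OF univ'])

lemma pair_eq [simp]: "pair (p :: 'u \<times> 'u) = pair q \<longleftrightarrow> p = q"
  by (rule inj_eq[OF inj_pair[OF univ']])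

lemma direct_sum_carrier [simp]:
  "pair (x, y) \<in> carrier (direct_sum M N) \<longleftrightarrow> x \<in> carrier M \<and> y \<in> carrier (N :: ('r, 'u) module)"
  by (auto simp: direct_sum_def)

lemma direct_sumE:
  assumes "z \<in> carrier (direct_sum M N)"
  obtains x y where "x \<in> carrier M" "y \<in> carrier (N :: ('r, 'u) module)" "z = pair (x, y)"
  using assms by (auto simp: direct_sum_def)

lemma direct_sum_ops [simp]:
  fixes M N :: "('r, 'u) module"
  shows "\<zero>\<^bsub>direct_sum M N\<^esub> = pair (\<zero>\<^bsub>M\<^esub>, \<zero>\<^bsub>N\<^esub>)"
    "pair (x, y) \<oplus>\<^bsub>direct_sum M N\<^esub> pair (x', y') = pair (x \<oplus>\<^bsub>M\<^esub> x', y \<oplus>\<^bsub>N\<^esub> y')"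
    "a \<odot>\<^bsub>direct_sum M N\<^esub> pair (x, y) = pair (a \<odot>\<^bsub>M\<^esub> x, a \<odot>\<^bsub>N\<^esub> y)"
  by (simp_all add: direct_sum_def)

lemma direct_sum_right_module:
  fixes M N :: "('r, 'u) module"
  assumes "right_module R M" "right_module R N"
  shows "right_module R (direct_sum M N)"
proof -
  interpret M: right_module R M by fact
  interpret N: right_module R N by fact
  have "abelian_group (direct_sum M N)"
  proof (rule abelian_groupI)
    fix z assume "z \<in> carrier (direct_sum M N)"
    then obtain x y where z: "x \<in> carrier M" "y \<in> carrier N" "z = pair (x, y)" by (rule direct_sumE)
    then show "\<exists>w\<in>carrier (direct_sum M N). w \<oplus>\<^bsub>direct_sum M N\<^esub> z = \<zero>\<^bsub>direct_sum M N\<^esub>"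
      by (intro bexI[of _ "pair (\<ominus>\<^bsub>M\<^esub> x, \<ominus>\<^bsub>N\<^esub> y)"]) (simp_all add: M.M.l_neg N.M.l_neg)
  qed (auto elim!: direct_sumE simp: M.M.a_ac N.M.a_ac)
  then interpret S: abelian_group "direct_sum M N" .
  show ?thesis
    by unfold_locales
      (auto elim!: direct_sumE simp: M.smult_l_distr N.smult_l_distr M.smult_r_distr N.smult_r_distr
         M.smult_assoc N.smult_assoc)
qed

lemma direct_sum_neg:
  fixes M N :: "('r, 'u) module"
  assumes "right_module R M" "right_module R N" "x \<in> carrier M" "y \<in> carrier N"
  shows "\<ominus>\<^bsub>direct_sum M N\<^esub> pair (x, y) = pair (\<ominus>\<^bsub>M\<^esub> x, \<ominus>\<^bsub>N\<^esub> y)"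
proof -
  interpret M: right_module R M by fact
  interpret N: right_module R N by fact
  interpret S: right_module R "direct_sum M N" by (rule direct_sum_right_module[OF assms(1,2)])
  show ?thesis using assms by (intro S.M.minus_equality) (simp_all add: M.M.l_neg N.M.l_neg)
qed

lemma direct_sum_minus:
  fixes M N :: "('r, 'u) module"
  assumes "right_module R M" "right_module R N"
    "x \<in> carrier M" "y \<in> carrier N" "x' \<in> carrier M" "y' \<in> carrier N"
  shows "pair (x, y) \<ominus>\<^bsub>direct_sum M N\<^esub> pair (x', y') = pair (x \<ominus>\<^bsub>M\<^esub> x', y \<ominus>\<^bsub>N\<^esub> y')"
  using assms by (simp add: a_minus_def direct_sum_neg)

lemma direct_sum_rmodules:
  fixes M N :: "('r, 'u) module"
  assumes "M \<in> rmodules R" "N \<in> rmodules R"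
  shows "direct_sum M N \<in> rmodules R"
proof -
  have "carrier (direct_sum M N) = pair ` (carrier M \<times> carrier N)" by (simp add: direct_sum_def)
  then show ?thesis using assms direct_sum_right_module univ'
    by (auto simp: rmodules_def intro!: small_image small_Times)
qed

lemma rlinear_pair:
  fixes M N :: "('r, 'u) module"
  assumes "rlinear R L M f" "rlinear R L N g"
  shows "rlinear R L (direct_sum M N) (\<lambda>x. pair (f x, g x))"
  using assms by (simp add: rlinear_def)

lemma rlinear_fst: "rlinear R (direct_sum M N) M (\<lambda>z. fst (unpair z))"
  for M N :: "('r, 'u) module"
  by (rule rlinearI) (auto elim!: direct_sumE)

lemma rlinear_snd: "rlinear R (direct_sum M N) N (\<lambda>z. snd (unpair z))"
  for M N :: "('r, 'u) module"
  by (rule rlinearI) (auto elim!: direct_sumE)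

lemma projective_lift:
  fixes P M N :: "('r, 'u) module"
  assumes "projective R P" "M \<in> rmodules R" "N \<in> rmodules R"
    and p: "rlinear R M N p" "p ` carrier M = carrier N" and f: "rlinear R P N f"
  obtains g where "rlinear R P M g" "\<forall>x\<in>carrier P. p (g x) = f x"
proof -
  note mods = assms(2,3)[THEN rmodulesD]
  have P: "right_module R P" using assms(1) by (simp add: projective_def rmodulesD)
  have "restrict p (carrier M) \<in> rhom R M N" "restrict f (carrier P) \<in> rhom R P N"
    using mods P p f by (auto intro: restrict_rhom)
  moreover have "restrict p (carrier M) ` carrier M = carrier N" using p(2) by simp
  ultimately obtain g where g: "g \<in> rhom R P M"
    "compose (carrier P) (restrict p (carrier M)) g = restrict f (carrier P)"
    using assms(1-3) unfolding projective_def by blast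
  have "rlinear R P M g" using g(1) by (simp add: rhom_iff)
  moreover have "p (g x) = f x" if "x \<in> carrier P" for x
    using fun_cong[OF g(2), of x] that calculation by (simp add: compose_def rlinear_def)
  ultimately show thesis using that by blast
qed

lemma projectiveI:
  fixes P :: "('r, 'u) module"
  assumes "P \<in> rmodules R"
    and "\<And>(M :: ('r, 'u) module) (N :: ('r, 'u) module) p f. M \<in> rmodules R \<Longrightarrow> N \<in> rmodules R \<Longrightarrow> rlinear R M N p \<Longrightarrow>
      p ` carrier M = carrier N \<Longrightarrow> rlinear R P N f \<Longrightarrow>
      \<exists>g. rlinear R P M g \<and> (\<forall>x\<in>carrier P. p (g x) = f x)"
  shows "projective R P"
  unfolding projective_def
proof (intro conjI ballI impI)
  fix M N :: "('r, 'u) module" and p f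
  assume h: "M \<in> rmodules R" "N \<in> rmodules R" "p \<in> rhom R M N" "p ` carrier M = carrier N"
    "f \<in> rhom R P N"
  then obtain g where g: "rlinear R P M g" "\<forall>x\<in>carrier P. p (g x) = f x"
    using assms(2)[of M N p f] unfolding rhom_iff by blast
  have P: "right_module R P" using assms(1) by (rule rmodulesD)
  have "restrict g (carrier P) \<in> rhom R P M" by (rule restrict_rhom[OF P g(1)])
  moreover have "compose (carrier P) p (restrict g (carrier P)) = f"
    using g(2) h(5) by (intro ext) (simp add: compose_def rhom_iff extensional_def)
  ultimately show "\<exists>g\<in>rhom R P M. compose (carrier P) p g = f" by blast
qed (fact assms(1))

lemma projective_rmodules: "projective R P \<Longrightarrow> P \<in> rmodules R"
  by (simp add: projective_def)

lemma projective_direct_sum: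
  fixes P Q :: "('r, 'u) module"
  assumes "projective R P" "projective R Q"
  shows "projective R (direct_sum P Q)"
proof (rule projectiveI)
  note PQ = assms[THEN projective_rmodules]
  show "direct_sum P Q \<in> rmodules R" by (rule direct_sum_rmodules[OF PQ])
  note mods = PQ[THEN rmodulesD]
  fix M N :: "('r, 'u) module" and p f
  assume h: "M \<in> rmodules R" "N \<in> rmodules R" "rlinear R M N p" "p ` carrier M = carrier N"
    "rlinear R (direct_sum P Q) N f"
  note MN = h(1,2)[THEN rmodulesD]
  note f = rlinear_simps[OF h(5) direct_sum_right_module[OF mods] MN(2)]
  have l: "rlinear R P N (\<lambda>x. f (pair (x, \<zero>\<^bsub>Q\<^esub>)))"
    by (rule rlinear_comp[OF h(5)], rule rlinear_pair[OF rlinear_id rlinear_const_zero[OF mods(2)]])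
  have r: "rlinear R Q N (\<lambda>x. f (pair (\<zero>\<^bsub>P\<^esub>, x)))"
    by (rule rlinear_comp[OF h(5)], rule rlinear_pair[OF rlinear_const_zero[OF mods(1)] rlinear_id])
  obtain g where g: "rlinear R P M g" "\<forall>x\<in>carrier P. p (g x) = f (pair (x, \<zero>\<^bsub>Q\<^esub>))"
    by (rule projective_lift[OF assms(1) h(1-4) l])
  obtain k where k: "rlinear R Q M k" "\<forall>x\<in>carrier Q. p (k x) = f (pair (\<zero>\<^bsub>P\<^esub>, x))"
    by (rule projective_lift[OF assms(2) h(1-4) r])
  \<comment> \<open>A map out of a sum is lifted on each summand separately.\<close>
  let ?g = "\<lambda>z. g (fst (unpair z)) \<oplus>\<^bsub>M\<^esub> k (snd (unpair z))"
  have "rlinear R (direct_sum P Q) M ?g"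
    by (rule rlinear_add[OF MN(1) rlinear_comp[OF g(1) rlinear_fst] rlinear_comp[OF k(1) rlinear_snd]])
  moreover have "p (?g z) = f z" if z: "z \<in> carrier (direct_sum P Q)" for z
  proof -
    from z obtain x y where xy: "x \<in> carrier P" "y \<in> carrier Q" "z = pair (x, y)" by (rule direct_sumE)
    note s = right_module_simps[OF mods(1)] right_module_simps[OF mods(2)]
    have "f z = f (pair (x, \<zero>\<^bsub>Q\<^esub>)) \<oplus>\<^bsub>N\<^esub> f (pair (\<zero>\<^bsub>P\<^esub>, y))"
      using xy s f(2)[of "pair (x, \<zero>\<^bsub>Q\<^esub>)" "pair (\<zero>\<^bsub>P\<^esub>, y)"] by simp
    then show ?thesis using xy rlinear_simps[OF g(1) mods(1) MN(1)] rlinear_simps[OF k(1) mods(2) MN(1)]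
        rlinear_simps[OF h(3) MN] g(2) k(2) by simp
  qed
  ultimately show "\<exists>g. rlinear R (direct_sum P Q) M g \<and> (\<forall>x\<in>carrier (direct_sum P Q). p (g x) = f x)"
    by blast
qed

end


section \<open>Complexes, homotopies and cones\<close>

definition chain_map :: "('r, 'k) ring_scheme \<Rightarrow> ('r, 'u) cochain_complex \<Rightarrow>
    ('r, 'u) cochain_complex \<Rightarrow> (int \<Rightarrow> 'u \<Rightarrow> 'u) \<Rightarrow> bool" where
  "chain_map R X Y f \<longleftrightarrow> (\<forall>n. rlinear R (Ob X n) (Ob Y n) (f n)) \<and>
     (\<forall>n. \<forall>x\<in>carrier (Ob X n). f (n + 1) (Diff X n x) = Diff Y n (f n x))"

definition null_homotopic :: "('r, 'k) ring_scheme \<Rightarrow> ('r, 'u) cochain_complex \<Rightarrow>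
    ('r, 'u) cochain_complex \<Rightarrow> (int \<Rightarrow> 'u \<Rightarrow> 'u) \<Rightarrow> bool" where
  "null_homotopic R X Y f \<longleftrightarrow> (\<exists>s. (\<forall>n. rlinear R (Ob X n) (Ob Y (n - 1)) (s n)) \<and>
     (\<forall>n. \<forall>x\<in>carrier (Ob X n).
        f n x = Diff Y (n - 1) (s n x) \<oplus>\<^bsub>Ob Y n\<^esub> s (n + 1) (Diff X n x)))"

definition heq :: "('r, 'k) ring_scheme \<Rightarrow> ('r, 'u) cochain_complex \<Rightarrow>
    ('r, 'u) cochain_complex \<Rightarrow> (int \<Rightarrow> 'u \<Rightarrow> 'u) \<Rightarrow> (int \<Rightarrow> 'u \<Rightarrow> 'u) \<Rightarrow> bool" where
  "heq R X Y f g \<longleftrightarrow> null_homotopic R X Y (\<lambda>n x. f n x \<ominus>\<^bsub>Ob Y n\<^esub> g n x)"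

lemma complex_module:
  "X \<in> complexes R \<Longrightarrow> Ob X n \<in> rmodules R" "X \<in> complexes R \<Longrightarrow> right_module R (Ob X n)"
  by (auto simp: complexes_def rmodules_def)

lemma complex_Diff: "X \<in> complexes R \<Longrightarrow> m = n + 1 \<Longrightarrow> rlinear R (Ob X n) (Ob X m) (Diff X n)"
  by (auto simp: complexes_def rhom_iff)

text \<open>In the rules about membership and the square of the differential, the target degree is a
  variable m with m = n + 1. They therefore still apply after degrees such as n - 1 + 1 have been
  normalized.\<close>

lemma complex_simps:
  assumes X: "X \<in> complexes R"
  shows "\<And>n. abelian_group (Ob X n)" "\<And>n. \<zero>\<^bsub>Ob X n\<^esub> \<in> carrier (Ob X n)"
    "\<And>n x y. x \<in> carrier (Ob X n) \<Longrightarrow> y \<in> carrier (Ob X n) \<Longrightarrow> x \<oplus>\<^bsub>Ob X n\<^esub> y \<in> carrier (Ob X n)"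
    "\<And>n x y. x \<in> carrier (Ob X n) \<Longrightarrow> y \<in> carrier (Ob X n) \<Longrightarrow> x \<ominus>\<^bsub>Ob X n\<^esub> y \<in> carrier (Ob X n)"
    "\<And>n x. x \<in> carrier (Ob X n) \<Longrightarrow> \<ominus>\<^bsub>Ob X n\<^esub> x \<in> carrier (Ob X n)"
    "\<And>n x. x \<in> carrier (Ob X n) \<Longrightarrow> \<zero>\<^bsub>Ob X n\<^esub> \<oplus>\<^bsub>Ob X n\<^esub> x = x"
    "\<And>n x. x \<in> carrier (Ob X n) \<Longrightarrow> x \<oplus>\<^bsub>Ob X n\<^esub> \<zero>\<^bsub>Ob X n\<^esub> = x"
    "\<And>n x. x \<in> carrier (Ob X n) \<Longrightarrow> x \<ominus>\<^bsub>Ob X n\<^esub> \<zero>\<^bsub>Ob X n\<^esub> = x"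
    "\<And>n x. x \<in> carrier (Ob X n) \<Longrightarrow> x \<ominus>\<^bsub>Ob X n\<^esub> x = \<zero>\<^bsub>Ob X n\<^esub>"
    "\<And>n x. x \<in> carrier (Ob X n) \<Longrightarrow> \<ominus>\<^bsub>Ob X n\<^esub> (\<ominus>\<^bsub>Ob X n\<^esub> x) = x"
    "\<And>n. \<ominus>\<^bsub>Ob X n\<^esub> \<zero>\<^bsub>Ob X n\<^esub> = \<zero>\<^bsub>Ob X n\<^esub>"
    "\<And>n m x. m = n + 1 \<Longrightarrow> x \<in> carrier (Ob X n) \<Longrightarrow> Diff X n x \<in> carrier (Ob X m)"
    "\<And>n x y. x \<in> carrier (Ob X n) \<Longrightarrow> y \<in> carrier (Ob X n) \<Longrightarrow>
      Diff X n (x \<oplus>\<^bsub>Ob X n\<^esub> y) = Diff X n x \<oplus>\<^bsub>Ob X (n + 1)\<^esub> Diff X n y"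
    "\<And>n x y. x \<in> carrier (Ob X n) \<Longrightarrow> y \<in> carrier (Ob X n) \<Longrightarrow>
      Diff X n (x \<ominus>\<^bsub>Ob X n\<^esub> y) = Diff X n x \<ominus>\<^bsub>Ob X (n + 1)\<^esub> Diff X n y"
    "\<And>n x. x \<in> carrier (Ob X n) \<Longrightarrow> Diff X n (\<ominus>\<^bsub>Ob X n\<^esub> x) = \<ominus>\<^bsub>Ob X (n + 1)\<^esub> Diff X n x"
    "\<And>n. Diff X n \<zero>\<^bsub>Ob X n\<^esub> = \<zero>\<^bsub>Ob X (n + 1)\<^esub>"
    "\<And>n m x. m = n + 1 \<Longrightarrow> x \<in> carrier (Ob X n) \<Longrightarrow> Diff X m (Diff X n x) = \<zero>\<^bsub>Ob X (m + 1)\<^esub>"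
proof -
  note M = complex_module(2)[OF X]
  note s = right_module_simps[OF M] rlinear_simps[OF complex_Diff[OF X refl] M M]
  fix n m x assume "m = n + 1" "x \<in> carrier (Ob X n)"
  then show "Diff X m (Diff X n x) = \<zero>\<^bsub>Ob X (m + 1)\<^esub>" "Diff X n x \<in> carrier (Ob X m)"
    using X s by (auto simp: complexes_def)
next
  note M = complex_module(2)[OF X]
  note s = right_module_simps[OF M] rlinear_simps[OF complex_Diff[OF X refl] M M]
  fix n
  show "abelian_group (Ob X n)" "\<zero>\<^bsub>Ob X n\<^esub> \<in> carrier (Ob X n)"
    "\<ominus>\<^bsub>Ob X n\<^esub> \<zero>\<^bsub>Ob X n\<^esub> = \<zero>\<^bsub>Ob X n\<^esub>" "Diff X n \<zero>\<^bsub>Ob X n\<^esub> = \<zero>\<^bsub>Ob X (n + 1)\<^esub>"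
    by (rule s)+
  fix x assume x: "x \<in> carrier (Ob X n)"
  show "\<ominus>\<^bsub>Ob X n\<^esub> x \<in> carrier (Ob X n)" "\<zero>\<^bsub>Ob X n\<^esub> \<oplus>\<^bsub>Ob X n\<^esub> x = x"
    "x \<oplus>\<^bsub>Ob X n\<^esub> \<zero>\<^bsub>Ob X n\<^esub> = x" "x \<ominus>\<^bsub>Ob X n\<^esub> \<zero>\<^bsub>Ob X n\<^esub> = x" "x \<ominus>\<^bsub>Ob X n\<^esub> x = \<zero>\<^bsub>Ob X n\<^esub>"
    "\<ominus>\<^bsub>Ob X n\<^esub> (\<ominus>\<^bsub>Ob X n\<^esub> x) = x" "Diff X n (\<ominus>\<^bsub>Ob X n\<^esub> x) = \<ominus>\<^bsub>Ob X (n + 1)\<^esub> Diff X n x"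
    using x by (simp_all add: s)
  fix y assume y: "y \<in> carrier (Ob X n)"
  show "x \<oplus>\<^bsub>Ob X n\<^esub> y \<in> carrier (Ob X n)" "x \<ominus>\<^bsub>Ob X n\<^esub> y \<in> carrier (Ob X n)"
    "Diff X n (x \<oplus>\<^bsub>Ob X n\<^esub> y) = Diff X n x \<oplus>\<^bsub>Ob X (n + 1)\<^esub> Diff X n y"
    "Diff X n (x \<ominus>\<^bsub>Ob X n\<^esub> y) = Diff X n x \<ominus>\<^bsub>Ob X (n + 1)\<^esub> Diff X n y"
    using x y by (simp_all add: s)
qed

lemma graded_simps:
  assumes X: "X \<in> complexes R" and Y: "Y \<in> complexes R"
    and f: "\<And>n. rlinear R (Ob X (n + i)) (Ob Y (n + j)) (f n)"
  shows "\<And>n m l x. l = n + i \<Longrightarrow> m = n + j \<Longrightarrow> x \<in> carrier (Ob X l) \<Longrightarrow> f n x \<in> carrier (Ob Y m)"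
    "\<And>n l x y. l = n + i \<Longrightarrow> x \<in> carrier (Ob X l) \<Longrightarrow> y \<in> carrier (Ob X l) \<Longrightarrow>
      f n (x \<oplus>\<^bsub>Ob X l\<^esub> y) = f n x \<oplus>\<^bsub>Ob Y (n + j)\<^esub> f n y"
    "\<And>n l x y. l = n + i \<Longrightarrow> x \<in> carrier (Ob X l) \<Longrightarrow> y \<in> carrier (Ob X l) \<Longrightarrow>
      f n (x \<ominus>\<^bsub>Ob X l\<^esub> y) = f n x \<ominus>\<^bsub>Ob Y (n + j)\<^esub> f n y"
    "\<And>n l x. l = n + i \<Longrightarrow> x \<in> carrier (Ob X l) \<Longrightarrow> f n (\<ominus>\<^bsub>Ob X l\<^esub> x) = \<ominus>\<^bsub>Ob Y (n + j)\<^esub> f n x"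
    "\<And>n l. l = n + i \<Longrightarrow> f n \<zero>\<^bsub>Ob X l\<^esub> = \<zero>\<^bsub>Ob Y (n + j)\<^esub>"
  using rlinear_simps[OF f complex_module(2)[OF X] complex_module(2)[OF Y]] by auto

lemma chain_map_rlinear: "chain_map R X Y f \<Longrightarrow> rlinear R (Ob X n) (Ob Y n) (f n)"
  by (simp add: chain_map_def)

lemma chain_map_comm: "chain_map R X Y f \<Longrightarrow> m = n + 1 \<Longrightarrow> x \<in> carrier (Ob X n) \<Longrightarrow>
    f m (Diff X n x) = Diff Y n (f n x)"
  by (simp add: chain_map_def)

lemma chain_map_simps:
  assumes "chain_map R X Y f" "X \<in> complexes R" "Y \<in> complexes R"
  shows "\<And>n x. x \<in> carrier (Ob X n) \<Longrightarrow> f n x \<in> carrier (Ob Y n)"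
    "\<And>n x y. x \<in> carrier (Ob X n) \<Longrightarrow> y \<in> carrier (Ob X n) \<Longrightarrow>
      f n (x \<oplus>\<^bsub>Ob X n\<^esub> y) = f n x \<oplus>\<^bsub>Ob Y n\<^esub> f n y"
    "\<And>n x y. x \<in> carrier (Ob X n) \<Longrightarrow> y \<in> carrier (Ob X n) \<Longrightarrow>
      f n (x \<ominus>\<^bsub>Ob X n\<^esub> y) = f n x \<ominus>\<^bsub>Ob Y n\<^esub> f n y"
    "\<And>n x. x \<in> carrier (Ob X n) \<Longrightarrow> f n (\<ominus>\<^bsub>Ob X n\<^esub> x) = \<ominus>\<^bsub>Ob Y n\<^esub> f n x"
    "\<And>n. f n \<zero>\<^bsub>Ob X n\<^esub> = \<zero>\<^bsub>Ob Y n\<^esub>"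
    "\<And>n m x. m = n + 1 \<Longrightarrow> x \<in> carrier (Ob X n) \<Longrightarrow> f m (Diff X n x) = Diff Y n (f n x)"
  using rlinear_simps[OF chain_map_rlinear[OF assms(1)] complex_module(2)[OF assms(2)]
      complex_module(2)[OF assms(3)]] chain_map_comm[OF assms(1)] by auto

lemma null_homotopicI:
  assumes "\<And>n. rlinear R (Ob X n) (Ob Y (n - 1)) (s n)"
    and "\<And>n x. x \<in> carrier (Ob X n) \<Longrightarrow>
      f n x = Diff Y (n - 1) (s n x) \<oplus>\<^bsub>Ob Y n\<^esub> s (n + 1) (Diff X n x)"
  shows "null_homotopic R X Y f"
  using assms unfolding null_homotopic_def by blast

lemma null_homotopicE:
  assumes "null_homotopic R X Y f"
  obtains s where "\<And>n. rlinear R (Ob X n) (Ob Y (n - 1)) (s n)"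
    "\<And>n x. x \<in> carrier (Ob X n) \<Longrightarrow>
      f n x = Diff Y (n - 1) (s n x) \<oplus>\<^bsub>Ob Y n\<^esub> s (n + 1) (Diff X n x)"
  using assms unfolding null_homotopic_def by blast

lemma homotopy_simps:
  assumes "X \<in> complexes R" "Y \<in> complexes R" "\<And>n. rlinear R (Ob X n) (Ob Y (n - 1)) (s n)"
  shows "\<And>n m x. m = n - 1 \<Longrightarrow> x \<in> carrier (Ob X n) \<Longrightarrow> s n x \<in> carrier (Ob Y m)"
    "\<And>n x y. x \<in> carrier (Ob X n) \<Longrightarrow> y \<in> carrier (Ob X n) \<Longrightarrow>
      s n (x \<oplus>\<^bsub>Ob X n\<^esub> y) = s n x \<oplus>\<^bsub>Ob Y (n - 1)\<^esub> s n y"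
    "\<And>n x y. x \<in> carrier (Ob X n) \<Longrightarrow> y \<in> carrier (Ob X n) \<Longrightarrow>
      s n (x \<ominus>\<^bsub>Ob X n\<^esub> y) = s n x \<ominus>\<^bsub>Ob Y (n - 1)\<^esub> s n y"
    "\<And>n x. x \<in> carrier (Ob X n) \<Longrightarrow> s n (\<ominus>\<^bsub>Ob X n\<^esub> x) = \<ominus>\<^bsub>Ob Y (n - 1)\<^esub> s n x"
    "\<And>n. s n \<zero>\<^bsub>Ob X n\<^esub> = \<zero>\<^bsub>Ob Y (n - 1)\<^esub>"
  using graded_simps[OF assms(1,2), of 0 "-1" s] assms(3) by simp_all

lemma null_homotopic_cong:
  assumes "null_homotopic R X Y f" "\<And>n x. x \<in> carrier (Ob X n) \<Longrightarrow> f n x = g n x"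
  shows "null_homotopic R X Y g"
  using assms unfolding null_homotopic_def by simp

lemma heq_cong:
  assumes "heq R X Y f g" "\<And>n x. x \<in> carrier (Ob X n) \<Longrightarrow> f n x = f' n x"
    "\<And>n x. x \<in> carrier (Ob X n) \<Longrightarrow> g n x = g' n x"
  shows "heq R X Y f' g'"
  using assms unfolding heq_def null_homotopic_def by simp

lemma chain_map_cong:
  assumes "X \<in> complexes R" "chain_map R X Y f" "\<And>n x. x \<in> carrier (Ob X n) \<Longrightarrow> f n x = g n x"
  shows "chain_map R X Y g"
  unfolding chain_map_def
proof (intro conjI allI ballI)
  fix n
  show "rlinear R (Ob X n) (Ob Y n) (g n)"
    by (rule rlinear_cong[OF complex_module(2)[OF assms(1)] chain_map_rlinear[OF assms(2)]])
      (rule assms(3))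
  fix x assume "x \<in> carrier (Ob X n)"
  then show "g (n + 1) (Diff X n x) = Diff Y n (g n x)"
    using assms(3) complex_simps[OF assms(1)] chain_map_comm[OF assms(2)] by (metis (no_types))
qed

lemma chain_map_id: "chain_map R X X (\<lambda>n x. x)"
  by (simp add: chain_map_def rlinear_id)

lemma chain_map_comp:
  assumes "chain_map R Y Z g" "chain_map R X Y f"
  shows "chain_map R X Z (\<lambda>n x. g n (f n x))"
  using assms unfolding chain_map_def by (auto intro: rlinear_comp simp: rlinear_def)

lemma chain_map_zero:
  assumes "Y \<in> complexes R"
  shows "chain_map R X Y (\<lambda>n x. \<zero>\<^bsub>Ob Y n\<^esub>)"
  using assms complex_simps[OF assms] complex_module(2)[OF assms]
  by (auto simp: chain_map_def intro: rlinear_const_zero)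

lemma chain_map_diff:
  assumes "X \<in> complexes R" "Y \<in> complexes R" "chain_map R X Y f" "chain_map R X Y g"
  shows "chain_map R X Y (\<lambda>n x. f n x \<ominus>\<^bsub>Ob Y n\<^esub> g n x)"
  using assms complex_simps[OF assms(2)] chain_map_simps[OF assms(3,1,2)] chain_map_simps[OF assms(4,1,2)]
  by (auto simp: chain_map_def intro!: rlinear_diff complex_module(2))

lemma chain_map_add:
  assumes "X \<in> complexes R" "Y \<in> complexes R" "chain_map R X Y f" "chain_map R X Y g"
  shows "chain_map R X Y (\<lambda>n x. f n x \<oplus>\<^bsub>Ob Y n\<^esub> g n x)"
  using assms complex_simps[OF assms(2)] chain_map_simps[OF assms(3,1,2)] chain_map_simps[OF assms(4,1,2)]
  by (auto simp: chain_map_def intro!: rlinear_add complex_module(2))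

lemma chain_map_uminus:
  assumes "X \<in> complexes R" "Y \<in> complexes R" "chain_map R X Y f"
  shows "chain_map R X Y (\<lambda>n x. \<ominus>\<^bsub>Ob Y n\<^esub> f n x)"
  using assms complex_simps[OF assms(2)] chain_map_simps[OF assms(3,1,2)]
  by (auto simp: chain_map_def intro!: rlinear_uminus complex_module(2))

lemma null_homotopic_zero:
  assumes "X \<in> complexes R" "Y \<in> complexes R" "\<And>n x. x \<in> carrier (Ob X n) \<Longrightarrow> f n x = \<zero>\<^bsub>Ob Y n\<^esub>"
  shows "null_homotopic R X Y f"
  by (rule null_homotopicI[where s = "\<lambda>n x. \<zero>\<^bsub>Ob Y (n - 1)\<^esub>"])
    (use assms complex_simps[OF assms(2)] in
      \<open>auto intro!: rlinear_const_zero complex_module(2)\<close>)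

lemma null_homotopic_add:
  assumes XY: "X \<in> complexes R" "Y \<in> complexes R"
    and "null_homotopic R X Y f" "null_homotopic R X Y g"
  shows "null_homotopic R X Y (\<lambda>n x. f n x \<oplus>\<^bsub>Ob Y n\<^esub> g n x)"
proof -
  obtain s where s: "\<And>n. rlinear R (Ob X n) (Ob Y (n - 1)) (s n)"
    "\<And>n x. x \<in> carrier (Ob X n) \<Longrightarrow> f n x = Diff Y (n - 1) (s n x) \<oplus>\<^bsub>Ob Y n\<^esub> s (n + 1) (Diff X n x)"
    using null_homotopicE[OF assms(3)] by blast
  obtain t where t: "\<And>n. rlinear R (Ob X n) (Ob Y (n - 1)) (t n)"
    "\<And>n x. x \<in> carrier (Ob X n) \<Longrightarrow> g n x = Diff Y (n - 1) (t n x) \<oplus>\<^bsub>Ob Y n\<^esub> t (n + 1) (Diff X n x)"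
    using null_homotopicE[OF assms(4)] by blast
  note simps = complex_simps[OF XY(1)] complex_simps[OF XY(2)]
    homotopy_simps[OF XY s(1)] homotopy_simps[OF XY t(1)]
  show ?thesis
  proof (rule null_homotopicI[where s = "\<lambda>n x. s n x \<oplus>\<^bsub>Ob Y (n - 1)\<^esub> t n x"])
    show "rlinear R (Ob X n) (Ob Y (n - 1)) (\<lambda>x. s n x \<oplus>\<^bsub>Ob Y (n - 1)\<^esub> t n x)" for n
      by (intro rlinear_add s t complex_module(2) XY)
    fix n x assume x: "x \<in> carrier (Ob X n)"
    then show "f n x \<oplus>\<^bsub>Ob Y n\<^esub> g n x = Diff Y (n - 1) (s n x \<oplus>\<^bsub>Ob Y (n - 1)\<^esub> t n x) \<oplus>\<^bsub>Ob Y n\<^esub>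
      (s (n + 1) (Diff X n x) \<oplus>\<^bsub>Ob Y (n + 1 - 1)\<^esub> t (n + 1) (Diff X n x))"
      by (simp add: simps s(2) t(2))
        (rule represents_eq, (rule represents | (rule represents_atom, simp add: simps, simp add: simps)
            | simp add: algebra_simps)+)
  qed
qed

lemma null_homotopic_uminus:
  assumes XY: "X \<in> complexes R" "Y \<in> complexes R" and "null_homotopic R X Y f"
  shows "null_homotopic R X Y (\<lambda>n x. \<ominus>\<^bsub>Ob Y n\<^esub> f n x)"
proof -
  obtain s where s: "\<And>n. rlinear R (Ob X n) (Ob Y (n - 1)) (s n)"
    "\<And>n x. x \<in> carrier (Ob X n) \<Longrightarrow> f n x = Diff Y (n - 1) (s n x) \<oplus>\<^bsub>Ob Y n\<^esub> s (n + 1) (Diff X n x)"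
    using null_homotopicE[OF assms(3)] by blast
  note simps = complex_simps[OF XY(1)] complex_simps[OF XY(2)] homotopy_simps[OF XY s(1)]
  show ?thesis
  proof (rule null_homotopicI[where s = "\<lambda>n x. \<ominus>\<^bsub>Ob Y (n - 1)\<^esub> s n x"])
    show "rlinear R (Ob X n) (Ob Y (n - 1)) (\<lambda>x. \<ominus>\<^bsub>Ob Y (n - 1)\<^esub> s n x)" for n
      by (intro rlinear_uminus s complex_module(2) XY)
    fix n x assume x: "x \<in> carrier (Ob X n)"
    then show "\<ominus>\<^bsub>Ob Y n\<^esub> f n x = Diff Y (n - 1) (\<ominus>\<^bsub>Ob Y (n - 1)\<^esub> s n x) \<oplus>\<^bsub>Ob Y n\<^esub>
      (\<ominus>\<^bsub>Ob Y (n + 1 - 1)\<^esub> s (n + 1) (Diff X n x))"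
      by (simp add: simps s(2))
        (rule represents_eq, (rule represents | (rule represents_atom, simp add: simps, simp add: simps)
            | simp add: algebra_simps)+)
  qed
qed

lemma null_homotopic_comp_left:
  assumes XYZ: "X \<in> complexes R" "Y \<in> complexes R" "Z \<in> complexes R"
    and "null_homotopic R X Y f" and g: "chain_map R Y Z g"
  shows "null_homotopic R X Z (\<lambda>n x. g n (f n x))"
proof -
  obtain s where s: "\<And>n. rlinear R (Ob X n) (Ob Y (n - 1)) (s n)"
    "\<And>n x. x \<in> carrier (Ob X n) \<Longrightarrow> f n x = Diff Y (n - 1) (s n x) \<oplus>\<^bsub>Ob Y n\<^esub> s (n + 1) (Diff X n x)"
    using null_homotopicE[OF assms(4)] by blast
  note simps = complex_simps[OF XYZ(1)] complex_simps[OF XYZ(2)] homotopy_simps[OF XYZ(1,2) s(1)]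
    chain_map_simps[OF g XYZ(2,3)]
  show ?thesis
  proof (rule null_homotopicI[where s = "\<lambda>n x. g (n - 1) (s n x)"])
    show "rlinear R (Ob X n) (Ob Z (n - 1)) (\<lambda>x. g (n - 1) (s n x))" for n
      by (rule rlinear_comp[OF chain_map_rlinear[OF g] s(1)])
    fix n x assume x: "x \<in> carrier (Ob X n)"
    then show "g n (f n x) = Diff Z (n - 1) (g (n - 1) (s n x)) \<oplus>\<^bsub>Ob Z n\<^esub>
      g (n + 1 - 1) (s (n + 1) (Diff X n x))"
      by (simp add: simps s(2))
  qed
qed

lemma null_homotopic_comp_right:
  assumes XYZ: "X \<in> complexes R" "Y \<in> complexes R" "Z \<in> complexes R"
    and f: "chain_map R X Y f" and "null_homotopic R Y Z g"
  shows "null_homotopic R X Z (\<lambda>n x. g n (f n x))"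
proof -
  obtain s where s: "\<And>n. rlinear R (Ob Y n) (Ob Z (n - 1)) (s n)"
    "\<And>n x. x \<in> carrier (Ob Y n) \<Longrightarrow> g n x = Diff Z (n - 1) (s n x) \<oplus>\<^bsub>Ob Z n\<^esub> s (n + 1) (Diff Y n x)"
    using null_homotopicE[OF assms(5)] by blast
  note simps = complex_simps[OF XYZ(1)] complex_simps[OF XYZ(2)] homotopy_simps[OF XYZ(2,3) s(1)]
    chain_map_simps[OF f XYZ(1,2)]
  show ?thesis
  proof (rule null_homotopicI[where s = "\<lambda>n x. s n (f n x)"])
    show "rlinear R (Ob X n) (Ob Z (n - 1)) (\<lambda>x. s n (f n x))" for n
      by (rule rlinear_comp[OF s(1) chain_map_rlinear[OF f]])
    fix n x assume x: "x \<in> carrier (Ob X n)"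
    then show "g n (f n x) = Diff Z (n - 1) (s n (f n x)) \<oplus>\<^bsub>Ob Z n\<^esub> s (n + 1) (f (n + 1) (Diff X n x))"
      by (simp add: simps s(2))
  qed
qed


text \<open>Degrees get one normal form, so that \<open>Ob X (1 + n)\<close> and
  \<open>Ob X (n + 1)\<close> are recognized as the same module.\<close>

lemma index_simps: "1 + n = n + 1" "2 + n = n + 2" "3 + n = n + 3" for n :: int
  by simp_all

lemma heq_refl:
  assumes "X \<in> complexes R" "Y \<in> complexes R" "chain_map R X Y f"
  shows "heq R X Y f f"
  unfolding heq_def using assms complex_simps[OF assms(2)] chain_map_simps[OF assms(3,1,2)]
  by (intro null_homotopic_zero) auto

lemma heq_sym:
  assumes "X \<in> complexes R" "Y \<in> complexes R" "chain_map R X Y f" "chain_map R X Y g" "heq R X Y f g"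
  shows "heq R X Y g f"
  unfolding heq_def
proof (rule null_homotopic_cong[OF null_homotopic_uminus[OF assms(1,2) assms(5)[unfolded heq_def]]])
  note simps = complex_simps[OF assms(2)] chain_map_simps[OF assms(3,1,2)] chain_map_simps[OF assms(4,1,2)]
  fix n x assume "x \<in> carrier (Ob X n)"
  then show "\<ominus>\<^bsub>Ob Y n\<^esub> (f n x \<ominus>\<^bsub>Ob Y n\<^esub> g n x) = g n x \<ominus>\<^bsub>Ob Y n\<^esub> f n x"
    by - (rule represents_eq, (rule represents | (rule represents_atom, simp add: simps, simp add: simps)
            | simp add: algebra_simps)+)
qed

lemma heq_trans:
  assumes "X \<in> complexes R" "Y \<in> complexes R" "chain_map R X Y f" "chain_map R X Y g" "chain_map R X Y h"
    and "heq R X Y f g" "heq R X Y g h"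
  shows "heq R X Y f h"
  unfolding heq_def
proof (rule null_homotopic_cong[OF null_homotopic_add[OF assms(1,2) assms(6,7)[unfolded heq_def]]])
  note simps = complex_simps[OF assms(2)] chain_map_simps[OF assms(3,1,2)]
    chain_map_simps[OF assms(4,1,2)] chain_map_simps[OF assms(5,1,2)]
  fix n x assume "x \<in> carrier (Ob X n)"
  then show "(f n x \<ominus>\<^bsub>Ob Y n\<^esub> g n x) \<oplus>\<^bsub>Ob Y n\<^esub> (g n x \<ominus>\<^bsub>Ob Y n\<^esub> h n x) = f n x \<ominus>\<^bsub>Ob Y n\<^esub> h n x"
    by - (rule represents_eq, (rule represents | (rule represents_atom, simp add: simps, simp add: simps)
            | simp add: algebra_simps)+)
qed

lemma heq_comp_left:
  assumes XYZ: "X \<in> complexes R" "Y \<in> complexes R" "Z \<in> complexes R"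
    and f: "chain_map R X Y f" "chain_map R X Y f'" and "heq R X Y f f'" and g: "chain_map R Y Z g"
  shows "heq R X Z (\<lambda>n x. g n (f n x)) (\<lambda>n x. g n (f' n x))"
  unfolding heq_def
  by (rule null_homotopic_cong[OF null_homotopic_comp_left[OF XYZ assms(6)[unfolded heq_def] g]])
    (simp add: chain_map_simps[OF f(1) XYZ(1,2)] chain_map_simps[OF f(2) XYZ(1,2)]
       chain_map_simps[OF g XYZ(2,3)])

lemma heq_comp_right:
  assumes XYZ: "X \<in> complexes R" "Y \<in> complexes R" "Z \<in> complexes R"
    and f: "chain_map R X Y f" and "heq R Y Z g g'"
  shows "heq R X Z (\<lambda>n x. g n (f n x)) (\<lambda>n x. g' n (f n x))"
  unfolding heq_def
  by (rule null_homotopic_cong[OF null_homotopic_comp_right[OF XYZ f assms(5)[unfolded heq_def]]]) simp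

lemma heq_zero_iff:
  assumes "X \<in> complexes R" "Y \<in> complexes R" "chain_map R X Y f"
  shows "heq R X Y f (\<lambda>n x. \<zero>\<^bsub>Ob Y n\<^esub>) \<longleftrightarrow> null_homotopic R X Y f"
  unfolding heq_def using complex_simps[OF assms(2)] chain_map_simps[OF assms(3,1,2)]
  by (auto elim!: null_homotopic_cong)

lemma null_homotopic_heq:
  assumes XY: "X \<in> complexes R" "Y \<in> complexes R" and fg: "chain_map R X Y f" "chain_map R X Y g"
    and "heq R X Y f g" "null_homotopic R X Y g"
  shows "null_homotopic R X Y f"
  using heq_trans[OF XY fg chain_map_zero[OF XY(2)] assms(5)] assms(6)
  by (simp add: heq_zero_iff XY fg)

section \<open>Orthogonality up to homotopy\<close>

definition orth :: "('r, 'k) ring_scheme \<Rightarrow> ('r, 'u) cochain_complex \<Rightarrow> ('r, 'u) cochain_complex \<Rightarrow> bool"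
  where "orth R X Y \<longleftrightarrow> (\<forall>f. chain_map R X Y f \<longrightarrow> null_homotopic R X Y f)"

lemma orthD: "orth R X Y \<Longrightarrow> chain_map R X Y f \<Longrightarrow> null_homotopic R X Y f"
  by (simp add: orth_def)

text \<open>A map f on X is homotopic to f b a, and f b starts at Y, hence is null
  homotopic.\<close>

lemma orth_retract:
  assumes "X \<in> complexes R" "Y \<in> complexes R" "Q \<in> complexes R"
    and a: "chain_map R X Y a" "chain_map R Y X b" "heq R X X (\<lambda>n x. b n (a n x)) (\<lambda>n x. x)"
    and Y: "orth R Y Q"
  shows "orth R X Q"
  unfolding orth_def
proof (intro allI impI)
  fix f assume f: "chain_map R X Q f"
  have "null_homotopic R X Q (\<lambda>n x. f n (b n (a n x)))"
    by (rule null_homotopic_comp_right[OF assms(1-3) a(1)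
          orthD[OF Y chain_map_comp[OF f a(2)]]])
  moreover have "heq R X Q (\<lambda>n x. f n x) (\<lambda>n x. f n (b n (a n x)))"
    by (rule heq_sym[OF assms(1,3) _ _ heq_comp_left[OF assms(1,1,3) _ _ a(3) f]])
      (intro chain_map_comp[OF f] chain_map_comp[OF a(2,1)] chain_map_id f)+
  ultimately show "null_homotopic R X Q f"
    by (intro null_homotopic_heq[OF assms(1,3) f chain_map_comp[OF f chain_map_comp[OF a(2,1)]]])
qed


subsection \<open>Shifts\<close>

lemma shift_Ob [simp]: "Ob (shift k X) n = Ob X (n - k)"
  by (simp add: shift_def)

lemma shift_Diff:
  "odd k \<Longrightarrow> x \<in> carrier (Ob X (n - k)) \<Longrightarrow>
     Diff (shift k X) n x = \<ominus>\<^bsub>Ob X (n - k + 1)\<^esub> Diff X (n - k) x"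
  by (simp add: shift_def)

text \<open>For odd k the differential is negated in every degree. The shifts that occur later are
  those by 1 and -1.\<close>

lemma shift_complex:
  assumes X: "X \<in> complexes R" and k: "odd k"
  shows "shift k X \<in> complexes R"
  unfolding complexes_def
proof (intro CollectI allI conjI ballI)
  fix n
  note simps = complex_simps[OF X]
  have idx: "n - k + 1 = n + 1 - k" "n + 1 - k + 1 = n + 2 - k" by simp_all
  show "Ob (shift k X) n \<in> rmodules R" by (simp add: complex_module X)
  have "rlinear R (Ob X (n - k)) (Ob X (n - k + 1)) (\<lambda>x. \<ominus>\<^bsub>Ob X (n - k + 1)\<^esub> Diff X (n - k) x)"
    by (intro rlinear_uminus complex_Diff complex_module X refl)
  from restrict_rhom[OF complex_module(2)[OF X] this]
  show "Diff (shift k X) n \<in> rhom R (Ob (shift k X) n) (Ob (shift k X) (n + 1))"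
    using k by (simp add: shift_def idx)
  fix x assume "x \<in> carrier (Ob (shift k X) n)"
  then show "Diff (shift k X) (n + 1) (Diff (shift k X) n x) = \<zero>\<^bsub>Ob (shift k X) (n + 1 + 1)\<^esub>"
    using k by (simp add: shift_Diff simps idx index_simps)
qed

text \<open>This is an equality of records and not merely an isomorphism: the two signs cancel on
  the carriers, and off the carriers both differentials are \<open>undefined\<close>, since those of
  a complex are extensional. Statements can therefore be unshifted by shifting back.\<close>

lemma shift_shift:
  assumes X: "X \<in> complexes R" and k: "odd k" and l: "l = - k"
  shows "shift l (shift k X) = X"
proof (rule cochain_complex.equality)
  show "Ob (shift l (shift k X)) = Ob X" by (simp add: l fun_eq_iff)
  show "Diff (shift l (shift k X)) = Diff X"
  proof (rule ext, rule ext)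
    fix n x
    have "Diff X n x = undefined" if "x \<notin> carrier (Ob X n)"
    proof -
      have "Diff X n \<in> rhom R (Ob X n) (Ob X (n + 1))" using X by (simp add: complexes_def)
      then show ?thesis using that by (simp add: rhom_iff extensional_def)
    qed
    then show "Diff (shift l (shift k X)) n x = Diff X n x"
      using k l complex_simps[OF X] by (simp add: shift_def)
  qed
qed simp

lemma chain_map_shift:
  assumes XY: "X \<in> complexes R" "Y \<in> complexes R" and k: "odd k" and f: "chain_map R X Y f"
  shows "chain_map R (shift k X) (shift k Y) (\<lambda>n. f (n - k))"
  unfolding chain_map_def
proof (intro conjI allI ballI)
  fix n
  note simps = complex_simps[OF XY(1)] complex_simps[OF XY(2)] chain_map_simps[OF f XY]
  have idx: "n - k + 1 = n + 1 - k" by simp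
  show "rlinear R (Ob (shift k X) n) (Ob (shift k Y) n) (f (n - k))"
    by (simp add: chain_map_rlinear[OF f])
  fix x assume "x \<in> carrier (Ob (shift k X) n)"
  then show "f (n + 1 - k) (Diff (shift k X) n x) = Diff (shift k Y) n (f (n - k) x)"
    using k by (simp add: shift_Diff simps idx index_simps)
qed

lemma chain_map_unshift:
  assumes "X \<in> complexes R" "Y \<in> complexes R" "odd k" "chain_map R (shift k X) (shift k Y) f"
  shows "chain_map R X Y (\<lambda>n. f (n + k))"
  using chain_map_shift[OF shift_complex[OF assms(1,3)] shift_complex[OF assms(2,3)] _ assms(4), of "- k"]
    assms(3) shift_shift[OF assms(1,3) refl] shift_shift[OF assms(2,3) refl] by simp

lemma null_homotopic_shift:
  assumes XY: "X \<in> complexes R" "Y \<in> complexes R" and k: "odd k" and f: "null_homotopic R X Y f"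
  shows "null_homotopic R (shift k X) (shift k Y) (\<lambda>n. f (n - k))"
proof -
  obtain s where s: "\<And>n. rlinear R (Ob X n) (Ob Y (n - 1)) (s n)"
    "\<And>n x. x \<in> carrier (Ob X n) \<Longrightarrow> f n x = Diff Y (n - 1) (s n x) \<oplus>\<^bsub>Ob Y n\<^esub> s (n + 1) (Diff X n x)"
    using null_homotopicE[OF f] by blast
  note simps = complex_simps[OF XY(1)] complex_simps[OF XY(2)] homotopy_simps[OF XY s(1)]
  show ?thesis
  \<comment> \<open>Both differentials change sign under an odd shift, so the homotopy has to change
    sign too.\<close>
  proof (rule null_homotopicI[where s = "\<lambda>n x. \<ominus>\<^bsub>Ob Y (n - k - 1)\<^esub> s (n - k) x"])
    fix n
    have idx: "n - 1 - k = n - k - 1" "n + 1 - k = n - k + 1" by simp_all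
    show "rlinear R (Ob (shift k X) n) (Ob (shift k Y) (n - 1)) (\<lambda>x. \<ominus>\<^bsub>Ob Y (n - k - 1)\<^esub> s (n - k) x)"
      by (simp add: idx rlinear_uminus s complex_module XY)
    fix x assume "x \<in> carrier (Ob (shift k X) n)"
    then show "f (n - k) x = Diff (shift k Y) (n - 1) (\<ominus>\<^bsub>Ob Y (n - k - 1)\<^esub> s (n - k) x) \<oplus>\<^bsub>Ob (shift k Y) n\<^esub>
       (\<ominus>\<^bsub>Ob Y (n + 1 - k - 1)\<^esub> s (n + 1 - k) (Diff (shift k X) n x))"
      using k by (simp add: shift_Diff simps s(2) idx)
  qed
qed

lemma null_homotopic_unshift:
  assumes "X \<in> complexes R" "Y \<in> complexes R" "odd k" "null_homotopic R (shift k X) (shift k Y) f"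
  shows "null_homotopic R X Y (\<lambda>n. f (n + k))"
  using null_homotopic_shift[OF shift_complex[OF assms(1,3)] shift_complex[OF assms(2,3)] _ assms(4), of "- k"]
    assms(3) shift_shift[OF assms(1,3) refl] shift_shift[OF assms(2,3) refl] by simp

lemma orth_shift_iff:
  assumes "X \<in> complexes R" "Y \<in> complexes R" "odd k"
  shows "orth R (shift k X) (shift k Y) \<longleftrightarrow> orth R X Y"
proof
  assume o: "orth R (shift k X) (shift k Y)"
  show "orth R X Y" unfolding orth_def
  proof (intro allI impI)
    fix f assume f: "chain_map R X Y f"
    from null_homotopic_unshift[OF assms orthD[OF o chain_map_shift[OF assms f]]]
    show "null_homotopic R X Y f" by simp
  qed
next
  assume o: "orth R X Y"
  show "orth R (shift k X) (shift k Y)" unfolding orth_def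
  proof (intro allI impI)
    fix f assume f: "chain_map R (shift k X) (shift k Y) f"
    from null_homotopic_shift[OF assms orthD[OF o chain_map_unshift[OF assms f]]]
    show "null_homotopic R (shift k X) (shift k Y) f" by simp
  qed
qed


subsection \<open>Cones\<close>

context module_universe
begin

lemma cone_Ob [simp]: "Ob (cone X Y f) n = direct_sum (Ob X (n + 1)) (Ob Y n)"
  by (simp add: cone_def)

lemma cone_Diff:
  "x \<in> carrier (Ob X (n + 1)) \<Longrightarrow> y \<in> carrier (Ob (Y :: ('r, 'u) cochain_complex) n) \<Longrightarrow>
   Diff (cone X Y f) n (pair (x, y)) =
     pair (\<ominus>\<^bsub>Ob X (n + 1 + 1)\<^esub> Diff X (n + 1) x, Diff Y n y \<ominus>\<^bsub>Ob Y (n + 1)\<^esub> f (n + 1) x)"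
  by (simp add: cone_def)

lemma cone_complex:
  fixes X Y :: "('r, 'u) cochain_complex"
  assumes XY: "X \<in> complexes R" "Y \<in> complexes R" and f: "chain_map R X Y f"
  shows "cone X Y f \<in> complexes R"
  unfolding complexes_def
proof (intro CollectI allI conjI ballI)
  fix n
  note simps = complex_simps[OF XY(1)] complex_simps[OF XY(2)] chain_map_simps[OF f XY]
  note M = complex_module(2)[OF XY(1)] complex_module(2)[OF XY(2)]
  show "Ob (cone X Y f) n \<in> rmodules R" by (simp add: direct_sum_rmodules complex_module XY)
  let ?S = "direct_sum (Ob X (n + 1)) (Ob Y n)"
  let ?d = "\<lambda>z. pair (\<ominus>\<^bsub>Ob X (n + 1 + 1)\<^esub> Diff X (n + 1) (fst (unpair z)),
    Diff Y n (snd (unpair z)) \<ominus>\<^bsub>Ob Y (n + 1)\<^esub> f (n + 1) (fst (unpair z)))"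
  have "rlinear R ?S (Ob (cone X Y f) (n + 1)) ?d"
    unfolding cone_Ob
    by (intro rlinear_pair rlinear_uminus rlinear_diff M
        rlinear_comp[OF complex_Diff[OF XY(1) refl]] rlinear_comp[OF complex_Diff[OF XY(2) refl]]
        rlinear_comp[OF chain_map_rlinear[OF f]] rlinear_fst rlinear_snd)
  from restrict_rhom[OF direct_sum_right_module[OF M] this]
  show "Diff (cone X Y f) n \<in> rhom R (Ob (cone X Y f) n) (Ob (cone X Y f) (n + 1))"
    by (simp add: cone_def case_prod_beta cong: restrict_cong)
  fix z assume "z \<in> carrier (Ob (cone X Y f) n)"
  then obtain x y where "x \<in> carrier (Ob X (n + 1))" "y \<in> carrier (Ob Y n)" "z = pair (x, y)"
    by (auto elim: direct_sumE)
  then show "Diff (cone X Y f) (n + 1) (Diff (cone X Y f) n z) = \<zero>\<^bsub>Ob (cone X Y f) (n + 1 + 1)\<^esub>"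
    by (simp add: cone_Diff simps index_simps)
       (rule represents_eq, (rule represents | (rule represents_atom, simp add: simps, simp add: simps)
            | (simp add: simps; fail) | simp add: algebra_simps)+)
qed


lemma abelian_group_add_eq_zero:
  "abelian_group G \<Longrightarrow> a \<in> carrier G \<Longrightarrow> b \<in> carrier G \<Longrightarrow> \<zero>\<^bsub>G\<^esub> = a \<oplus>\<^bsub>G\<^esub> b \<Longrightarrow> b = \<ominus>\<^bsub>G\<^esub> a"
  by (metis abelian_group.minus_equality abelian_group.minus_minus abelian_group.a_inv_closed)

text \<open>\<open>cone_inj\<close> and \<open>cone_proj\<close> are restricted to carriers; these
  versions are not, in keeping with \<open>rlinear\<close> and \<open>chain_map\<close>.\<close>

definition cinj :: "('r, 'u) cochain_complex \<Rightarrow> int \<Rightarrow> 'u \<Rightarrow> 'u" where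
  "cinj X n y = pair (\<zero>\<^bsub>Ob X (n + 1)\<^esub>, y)"

definition cproj :: "int \<Rightarrow> 'u \<Rightarrow> 'u" where
  "cproj n z = fst (unpair z)"

lemma cproj_pair [simp]: "cproj n (pair (x, y)) = x"
  by (simp add: cproj_def)

section \<open>Homotopies and factorizations for the mapping cone of a chain map\<close>

context
  fixes X Y :: "('r, 'u) cochain_complex" and f
  assumes XY: "X \<in> complexes R" "Y \<in> complexes R" and f: "chain_map R X Y f"
begin

lemmas cone_simps = complex_simps[OF XY(1)] complex_simps[OF XY(2)] chain_map_simps[OF f XY]
  cone_Diff direct_sum_neg[OF complex_module(2)[OF XY(1)] complex_module(2)[OF XY(2)]]
  direct_sum_minus[OF complex_module(2)[OF XY(1)] complex_module(2)[OF XY(2)]] index_simps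

lemmas cone_cx = cone_complex[OF XY f]

lemma cone_coneE:
  assumes "z \<in> carrier (Ob (cone X Y f) n)"
  obtains x y where "x \<in> carrier (Ob X (n + 1))" "y \<in> carrier (Ob Y n)" "z = pair (x, y)"
  using assms by (auto elim: direct_sumE)

lemma rlinear_pair_zero:
  "rlinear R (Ob X (n + 1)) (Ob (cone X Y f) n) (\<lambda>x. pair (x, \<zero>\<^bsub>Ob Y n\<^esub>))"
  "rlinear R (Ob Y n) (Ob (cone X Y f) n) (\<lambda>y. pair (\<zero>\<^bsub>Ob X (n + 1)\<^esub>, y))"
  unfolding cone_Ob
  by (intro rlinear_pair rlinear_id rlinear_const_zero complex_module XY)+

lemma chain_map_cinj: "chain_map R Y (cone X Y f) (cinj X)"
  unfolding chain_map_def cinj_def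
  by (auto simp: cone_simps intro!: rlinear_pair rlinear_id rlinear_const_zero complex_module XY)

lemma chain_map_cproj: "chain_map R (cone X Y f) (shift (-1) X) cproj"
  unfolding chain_map_def cproj_def
  by (auto simp: cone_simps shift_Diff elim!: direct_sumE intro!: rlinear_fst)

lemma null_homotopic_cinj_comp: "null_homotopic R X (cone X Y f) (\<lambda>n x. cinj X n (f n x))"
\<comment> \<open>The differential of the cone sends (-x, 0) to (dx, f x), and the other term of the
  homotopy formula contributes (-dx, 0).\<close>
proof (rule null_homotopicI[where s = "\<lambda>n x. pair (\<ominus>\<^bsub>Ob X n\<^esub> x, \<zero>\<^bsub>Ob Y (n - 1)\<^esub>)"])
  show "rlinear R (Ob X n) (Ob (cone X Y f) (n - 1)) (\<lambda>x. pair (\<ominus>\<^bsub>Ob X n\<^esub> x, \<zero>\<^bsub>Ob Y (n - 1)\<^esub>))" for n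
    by (auto intro!: rlinear_pair rlinear_uminus rlinear_id rlinear_const_zero complex_module XY)
  note [simp] = cone_simps
  fix n x assume "x \<in> carrier (Ob X n)"
  then show "cinj X n (f n x) = Diff (cone X Y f) (n - 1) (pair (\<ominus>\<^bsub>Ob X n\<^esub> x, \<zero>\<^bsub>Ob Y (n - 1)\<^esub>))
     \<oplus>\<^bsub>Ob (cone X Y f) n\<^esub> pair (\<ominus>\<^bsub>Ob X (n + 1)\<^esub> Diff X n x, \<zero>\<^bsub>Ob Y (n + 1 - 1)\<^esub>)"
    by (simp add: cinj_def a_minus_def abelian_group.r_neg)
qed

lemma null_homotopic_comp_cproj:
  "null_homotopic R (cone X Y f) (shift (-1) Y) (\<lambda>n z. f (n + 1) (cproj n z))"
\<comment> \<open>Degree n - 1 of the shifted Y is degree n of Y. The first term of the formula is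
  dy and the second is -(dy - f x).\<close>
proof (rule null_homotopicI[where s = "\<lambda>n z. \<ominus>\<^bsub>Ob Y n\<^esub> snd (unpair z)"])
  show "rlinear R (Ob (cone X Y f) n) (Ob (shift (- 1) Y) (n - 1)) (\<lambda>z. \<ominus>\<^bsub>Ob Y n\<^esub> snd (unpair z))" for n
    by (auto intro!: rlinear_uminus rlinear_snd complex_module XY)
  note [simp] = cone_simps
  fix n z assume "z \<in> carrier (Ob (cone X Y f) n)"
  then obtain x y where z: "x \<in> carrier (Ob X (n + 1))" "y \<in> carrier (Ob Y n)" "z = pair (x, y)"
    by (rule cone_coneE)
  then show "f (n + 1) (cproj n z) = Diff (shift (- 1) Y) (n - 1) (\<ominus>\<^bsub>Ob Y n\<^esub> snd (unpair z))
     \<oplus>\<^bsub>Ob (shift (- 1) Y) n\<^esub> (\<ominus>\<^bsub>Ob Y (n + 1)\<^esub> snd (unpair (Diff (cone X Y f) n z)))"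
    by (simp add: shift_Diff) (rule represents_eq[where G = "Ob Y (n + 1)"],
      (rule represents | (rule represents_atom, simp, simp) | (simp; fail) | simp add: algebra_simps)+)
qed

text \<open>A null homotopy s of h f is what defines h on the summand X of the cone: (x, y) goes to
  h y - s x. The restriction to Y is h itself, without a homotopy.\<close>

lemma cone_extension:
  fixes Q :: "('r, 'u) cochain_complex"
  assumes Q: "Q \<in> complexes R" and h: "chain_map R Y Q h"
    and hf: "null_homotopic R X Q (\<lambda>n x. h n (f n x))"
  obtains k where "chain_map R (cone X Y f) Q k"
    "\<And>n y. y \<in> carrier (Ob Y n) \<Longrightarrow> k n (cinj X n y) = h n y"
proof -
  obtain s where s: "\<And>n. rlinear R (Ob X n) (Ob Q (n - 1)) (s n)"
    "\<And>n x. x \<in> carrier (Ob X n) \<Longrightarrow> h n (f n x) = Diff Q (n - 1) (s n x) \<oplus>\<^bsub>Ob Q n\<^esub> s (n + 1) (Diff X n x)"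
    using null_homotopicE[OF hf] by blast
  note [simp] = cone_simps complex_simps[OF Q] homotopy_simps[OF XY(1) Q s(1)] chain_map_simps[OF h XY(2) Q]
  let ?k = "\<lambda>n z. h n (snd (unpair z)) \<ominus>\<^bsub>Ob Q n\<^esub> s (n + 1) (fst (unpair z))"
  show thesis
  proof (rule that)
    show "?k n (cinj X n y) = h n y" if "y \<in> carrier (Ob Y n)" for n y
      using that by (simp add: cinj_def)
    show "chain_map R (cone X Y f) Q ?k"
      unfolding chain_map_def
    proof (intro conjI allI ballI)
      fix n
      have sl: "rlinear R (Ob X (n + 1)) (Ob Q n) (s (n + 1))" using s(1)[of "n + 1"] by simp
      show "rlinear R (Ob (cone X Y f) n) (Ob Q n) (?k n)"
        unfolding cone_Ob
        by (intro rlinear_diff complex_module Q rlinear_comp[OF chain_map_rlinear[OF h]]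
            rlinear_comp[OF sl] rlinear_fst rlinear_snd)
      fix z assume "z \<in> carrier (Ob (cone X Y f) n)"
      then obtain x y where z: "x \<in> carrier (Ob X (n + 1))" "y \<in> carrier (Ob Y n)" "z = pair (x, y)"
        by (rule cone_coneE)
      then show "?k (n + 1) (Diff (cone X Y f) n z) = Diff Q n (?k n z)"
        by (simp add: s(2)) (rule represents_eq,
          (rule represents | (rule represents_atom, simp, simp) | (simp; fail) | simp add: algebra_simps)+)
    qed
  qed
qed

text \<open>A null homotopy into the cone has two components. The one into X commutes with the
  differentials, the one into Y is a homotopy; up to sign the first is the required lift.\<close>

lemma cone_lift:
  fixes W :: "('r, 'u) cochain_complex"
  assumes W: "W \<in> complexes R" and h: "chain_map R W Y h"
    and n: "null_homotopic R W (cone X Y f) (\<lambda>n x. cinj X n (h n x))"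
  obtains h' where "chain_map R W X h'" "heq R W Y h (\<lambda>n x. f n (h' n x))"
proof -
  note C = cone_cx
  obtain s where s: "\<And>n. rlinear R (Ob W n) (Ob (cone X Y f) (n - 1)) (s n)"
    "\<And>n x. x \<in> carrier (Ob W n) \<Longrightarrow> cinj X n (h n x) =
       Diff (cone X Y f) (n - 1) (s n x) \<oplus>\<^bsub>Ob (cone X Y f) n\<^esub> s (n + 1) (Diff W n x)"
    using null_homotopicE[OF n] by blast
  \<comment> \<open>The homotopy lowers the degree by one and degree n - 1 of the cone is X^n +
    Y^(n-1), so \<open>a\<close> keeps the degree and \<open>b\<close> lowers it.\<close>
  define a b where "a n x = fst (unpair (s n x))" and "b n x = snd (unpair (s n x))" for n x
  have al: "rlinear R (Ob W n) (Ob X n) (a n)" for n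
    using rlinear_comp[OF rlinear_fst s(1)[unfolded cone_Ob], of n] by (simp add: a_def[abs_def])
  have bl: "rlinear R (Ob W n) (Ob Y (n - 1)) (b n)" for n
    using rlinear_comp[OF rlinear_snd s(1)[unfolded cone_Ob], of n] by (simp add: b_def[abs_def])
  note [simp] = cone_simps complex_simps[OF W] chain_map_simps[OF h W XY(2)]
    rlinear_simps[OF al complex_module(2)[OF W] complex_module(2)[OF XY(1)]]
    homotopy_simps[OF W XY(2) bl]
  have sx: "s n x = pair (a n x, b n x)" if "x \<in> carrier (Ob W n)" for n x
  proof -
    have "s n x \<in> carrier (Ob (cone X Y f) (n - 1))" using rlinear_closed[OF s(1) that] .
    then show ?thesis by (elim cone_coneE) (simp add: a_def b_def)
  qed
  have eq: "\<zero>\<^bsub>Ob X (n + 1)\<^esub> = \<ominus>\<^bsub>Ob X (n + 1)\<^esub> Diff X n (a n x) \<oplus>\<^bsub>Ob X (n + 1)\<^esub> a (n + 1) (Diff W n x)"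
     "h n x = (Diff Y (n - 1) (b n x) \<ominus>\<^bsub>Ob Y n\<^esub> f n (a n x)) \<oplus>\<^bsub>Ob Y n\<^esub> b (n + 1) (Diff W n x)"
    if "x \<in> carrier (Ob W n)" for n x
    using s(2)[OF that] that by (simp_all add: sx cinj_def)
  have acomm: "a (n + 1) (Diff W n x) = Diff X n (a n x)" if "x \<in> carrier (Ob W n)" for n x
    using abelian_group_add_eq_zero[OF _ _ _ eq(1)[OF that]] that by simp
  show thesis
  proof (rule that)
    have "chain_map R W X a" unfolding chain_map_def using al acomm by blast
    then show c: "chain_map R W X (\<lambda>n x. \<ominus>\<^bsub>Ob X n\<^esub> a n x)"
      by (rule chain_map_uminus[OF W XY(1)])
    show "heq R W Y h (\<lambda>n x. f n (\<ominus>\<^bsub>Ob X n\<^esub> a n x))"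
      unfolding heq_def
    proof (rule null_homotopicI[of R W Y b, OF bl])
      fix n x assume x: "x \<in> carrier (Ob W n)"
      then show "h n x \<ominus>\<^bsub>Ob Y n\<^esub> f n (\<ominus>\<^bsub>Ob X n\<^esub> a n x) =
          Diff Y (n - 1) (b n x) \<oplus>\<^bsub>Ob Y n\<^esub> b (n + 1) (Diff W n x)"
        by (simp add: eq(2)[OF x]) (rule represents_eq,
          (rule represents | (rule represents_atom, simp, simp) | (simp; fail) | simp add: algebra_simps)+)
    qed
  qed
qed

text \<open>The homotopy (x, y) |-> s y removes from k its part on Y. The term -f x in the
  differential of the cone then adds s f x to the part on X, which explains the map v = a + s
  f.\<close>

lemma cone_factor_cproj:
  fixes Q :: "('r, 'u) cochain_complex"
  assumes Q: "Q \<in> complexes R" and k: "chain_map R (cone X Y f) Q k"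
    and n: "null_homotopic R Y Q (\<lambda>n y. k n (cinj X n y))"
  obtains v where "chain_map R (shift (-1) X) Q v" "heq R (cone X Y f) Q k (\<lambda>n z. v n (cproj n z))"
proof -
  obtain s where s: "\<And>n. rlinear R (Ob Y n) (Ob Q (n - 1)) (s n)"
    "\<And>n y. y \<in> carrier (Ob Y n) \<Longrightarrow> k n (pair (\<zero>\<^bsub>Ob X (n + 1)\<^esub>, y)) =
       Diff Q (n - 1) (s n y) \<oplus>\<^bsub>Ob Q n\<^esub> s (n + 1) (Diff Y n y)"
    using null_homotopicE[OF n] unfolding cinj_def by blast
  note [simp] = cone_simps complex_simps[OF Q] homotopy_simps[OF XY(2) Q s(1)]
  define a where "a n x = k n (pair (x, \<zero>\<^bsub>Ob Y n\<^esub>))" for n x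
  have al: "rlinear R (Ob X (n + 1)) (Ob Q n) (a n)" for n
    unfolding a_def by (rule rlinear_comp[OF chain_map_rlinear[OF k] rlinear_pair_zero(1)])
  note asimp [simp] = graded_simps[OF XY(1) Q, of 1 0 a, simplified, OF al]
  have kx: "k n (pair (x, y)) = a n x \<oplus>\<^bsub>Ob Q n\<^esub> (Diff Q (n - 1) (s n y) \<oplus>\<^bsub>Ob Q n\<^esub> s (n + 1) (Diff Y n y))"
    if "x \<in> carrier (Ob X (n + 1))" "y \<in> carrier (Ob Y n)" for n x y
    using that chain_map_simps(2)[OF k cone_cx Q, of "pair (x, \<zero>\<^bsub>Ob Y n\<^esub>)" n "pair (\<zero>\<^bsub>Ob X (n + 1)\<^esub>, y)"]
    by (simp add: s(2) a_def)
  have ka: "\<ominus>\<^bsub>Ob Q (n + 1)\<^esub> a (n + 1) (Diff X (n + 1) x) \<ominus>\<^bsub>Ob Q (n + 1)\<^esub>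
      (Diff Q n (s (n + 1) (f (n + 1) x)) \<oplus>\<^bsub>Ob Q (n + 1)\<^esub> s (n + 2) (f (n + 2) (Diff X (n + 1) x)))
      = Diff Q n (a n x)"
    if x: "x \<in> carrier (Ob X (n + 1))" for n x
  proof -
    have "Diff Q n (a n x) = k (n + 1) (pair (\<ominus>\<^bsub>Ob X (n + 2)\<^esub> Diff X (n + 1) x, \<ominus>\<^bsub>Ob Y (n + 1)\<^esub> f (n + 1) x))"
      using chain_map_comm[OF k refl, of "pair (x, \<zero>\<^bsub>Ob Y n\<^esub>)" n] x by (simp add: a_def a_minus_def)
    also have "\<dots> = \<ominus>\<^bsub>Ob Q (n + 1)\<^esub> a (n + 1) (Diff X (n + 1) x) \<ominus>\<^bsub>Ob Q (n + 1)\<^esub>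
      (Diff Q n (s (n + 1) (f (n + 1) x)) \<oplus>\<^bsub>Ob Q (n + 1)\<^esub> s (n + 2) (f (n + 2) (Diff X (n + 1) x)))"
      using x by (simp add: kx) (rule represents_eq,
          (rule represents | (rule represents_atom, simp, simp) | (simp; fail) | simp add: algebra_simps)+)
    finally show ?thesis ..
  qed
  let ?v = "\<lambda>n x. a n x \<oplus>\<^bsub>Ob Q n\<^esub> s (n + 1) (f (n + 1) x)"
  show thesis
  proof (rule that)
    show "chain_map R (shift (- 1) X) Q ?v"
      unfolding chain_map_def
    proof (intro conjI allI ballI)
      fix n
      have sl: "rlinear R (Ob Y (n + 1)) (Ob Q n) (s (n + 1))" using s(1)[of "n + 1"] by simp
      show "rlinear R (Ob (shift (- 1) X) n) (Ob Q n) (?v n)"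
        using rlinear_add[OF complex_module(2)[OF Q] al rlinear_comp[OF sl chain_map_rlinear[OF f]]] by simp
      fix x assume "x \<in> carrier (Ob (shift (- 1) X) n)"
      then have x: "x \<in> carrier (Ob X (n + 1))" by simp
      then show "?v (n + 1) (Diff (shift (- 1) X) n x) = Diff Q n (?v n x)"
        by (simp add: shift_Diff ka[OF x, symmetric]) (rule represents_eq,
          (rule represents | (rule represents_atom, simp, simp) | (simp; fail) | simp add: algebra_simps)+)
    qed
    show "heq R (cone X Y f) Q k (\<lambda>n z. ?v n (cproj n z))"
      unfolding heq_def
    proof (rule null_homotopicI[where s = "\<lambda>n z. s n (snd (unpair z))"])
      show "rlinear R (Ob (cone X Y f) n) (Ob Q (n - 1)) (\<lambda>z. s n (snd (unpair z)))" for n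
        unfolding cone_Ob by (rule rlinear_comp[OF s(1) rlinear_snd])
      fix n z assume "z \<in> carrier (Ob (cone X Y f) n)"
      then obtain x y where z: "x \<in> carrier (Ob X (n + 1))" "y \<in> carrier (Ob Y n)" "z = pair (x, y)"
        by (rule cone_coneE)
      then show "k n z \<ominus>\<^bsub>Ob Q n\<^esub> ?v n (cproj n z) = Diff Q (n - 1) (s n (snd (unpair z)))
          \<oplus>\<^bsub>Ob Q n\<^esub> s (n + 1) (snd (unpair (Diff (cone X Y f) n z)))"
        by (simp add: kx) (rule represents_eq,
          (rule represents | (rule represents_atom, simp, simp) | (simp; fail) | simp add: algebra_simps)+)
    qed
  qed
qed

text \<open>The null homotopy is split into \<open>a\<close> on X and \<open>b\<close> on Y. On Y
  the equation says that \<open>b\<close> anticommutes with the differentials, so -b is a chain map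
  on the shifted Y; on X it says that \<open>a\<close> is a homotopy from h to -b f.\<close>

lemma shift_factor:
  fixes Q :: "('r, 'u) cochain_complex"
  assumes Q: "Q \<in> complexes R" and h: "chain_map R (shift (-1) X) Q h"
    and n: "null_homotopic R (cone X Y f) Q (\<lambda>n z. h n (cproj n z))"
  obtains k where "chain_map R (shift (-1) Y) Q k"
    "heq R (shift (-1) X) Q h (\<lambda>n x. k n (f (n + 1) x))"
proof -
  obtain s where s: "\<And>n. rlinear R (Ob (cone X Y f) n) (Ob Q (n - 1)) (s n)"
    "\<And>n z. z \<in> carrier (Ob (cone X Y f) n) \<Longrightarrow> h n (cproj n z) =
       Diff Q (n - 1) (s n z) \<oplus>\<^bsub>Ob Q n\<^esub> s (n + 1) (Diff (cone X Y f) n z)"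
    using null_homotopicE[OF n] by blast
  define a b where "a n x = s n (pair (x, \<zero>\<^bsub>Ob Y n\<^esub>))" and "b n y = s n (pair (\<zero>\<^bsub>Ob X (n + 1)\<^esub>, y))" for n x y
  have al: "rlinear R (Ob X (n + 1)) (Ob Q (n - 1)) (a n)" for n
    unfolding a_def by (rule rlinear_comp[OF s(1) rlinear_pair_zero(1)])
  have bl: "rlinear R (Ob Y n) (Ob Q (n - 1)) (b n)" for n
    unfolding b_def by (rule rlinear_comp[OF s(1) rlinear_pair_zero(2)])
  have h0: "h n \<zero>\<^bsub>Ob X (n + 1)\<^esub> = \<zero>\<^bsub>Ob Q n\<^esub>" for n
    using chain_map_simps(5)[OF h shift_complex[OF XY(1)] Q, of n] by simp
  note hc = chain_map_simps(1)[OF h shift_complex[OF XY(1)] Q, simplified]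
  note [simp] = cone_simps complex_simps[OF Q] homotopy_simps[OF XY(2) Q bl] h0 hc
    graded_simps[OF XY(1) Q, of 1 "-1" a, simplified, OF al]
  have sx: "s n (pair (x, y)) = a n x \<oplus>\<^bsub>Ob Q (n - 1)\<^esub> b n y"
    if "x \<in> carrier (Ob X (n + 1))" "y \<in> carrier (Ob Y n)" for n x y
    using that rlinear_simps(2)[OF s(1) complex_module(2)[OF cone_cx] complex_module(2)[OF Q],
        of "pair (x, \<zero>\<^bsub>Ob Y n\<^esub>)" n "pair (\<zero>\<^bsub>Ob X (n + 1)\<^esub>, y)"]
    by (simp add: a_def b_def)
  have eqx: "h n x = Diff Q (n - 1) (a n x) \<oplus>\<^bsub>Ob Q n\<^esub>
      (\<ominus>\<^bsub>Ob Q n\<^esub> a (n + 1) (Diff X (n + 1) x) \<ominus>\<^bsub>Ob Q n\<^esub> b (n + 1) (f (n + 1) x))"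
    if x: "x \<in> carrier (Ob X (n + 1))" for n x
    using s(2)[of "pair (x, \<zero>\<^bsub>Ob Y n\<^esub>)" n] x by (simp add: sx a_minus_def)
  have "\<zero>\<^bsub>Ob Q n\<^esub> = Diff Q (n - 1) (b n y) \<oplus>\<^bsub>Ob Q n\<^esub> b (n + 1) (Diff Y n y)"
    if y: "y \<in> carrier (Ob Y n)" for n y
    using s(2)[of "pair (\<zero>\<^bsub>Ob X (n + 1)\<^esub>, y)" n] y by (simp add: sx)
  from abelian_group_add_eq_zero[OF _ _ _ this]
  have bcomm: "b (n + 1) (Diff Y n y) = \<ominus>\<^bsub>Ob Q n\<^esub> Diff Q (n - 1) (b n y)"
    if y: "y \<in> carrier (Ob Y n)" for n y
    using y by simp
  let ?k = "\<lambda>n y. \<ominus>\<^bsub>Ob Q n\<^esub> b (n + 1) y"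
  show thesis
  proof (rule that)
    show "chain_map R (shift (-1) Y) Q ?k"
      unfolding chain_map_def
    proof (intro conjI allI ballI)
      fix n
      show "rlinear R (Ob (shift (- 1) Y) n) (Ob Q n) (?k n)"
        using rlinear_uminus[OF complex_module(2)[OF Q] bl[of "n + 1", simplified]] by simp
      fix y assume "y \<in> carrier (Ob (shift (- 1) Y) n)"
      then show "?k (n + 1) (Diff (shift (- 1) Y) n y) = Diff Q n (?k n y)"
        using bcomm[of y "n + 1"] by (simp add: shift_Diff)
    qed
    show "heq R (shift (-1) X) Q h (\<lambda>n x. ?k n (f (n + 1) x))"
      unfolding heq_def
    proof (rule null_homotopicI[where s = a])
      show "rlinear R (Ob (shift (- 1) X) n) (Ob Q (n - 1)) (a n)" for n using al by simp
      fix n x assume "x \<in> carrier (Ob (shift (- 1) X) n)"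
      then have x: "x \<in> carrier (Ob X (n + 1))" by simp
      then show "h n x \<ominus>\<^bsub>Ob Q n\<^esub> ?k n (f (n + 1) x) =
         Diff Q (n - 1) (a n x) \<oplus>\<^bsub>Ob Q n\<^esub> a (n + 1) (Diff (shift (- 1) X) n x)"
        by (simp add: shift_Diff eqx[OF x]) (rule represents_eq,
          (rule represents | (rule represents_atom, simp, simp) | (simp; fail) | simp add: algebra_simps)+)
    qed
  qed
qed

end

end


section \<open>The homotopy category in terms of chain maps\<close>

text \<open>The homotopy class named by a representative that may fail to be extensional; its
  members are extensional, as in \<open>K_Mod\<close>.\<close>

definition cls :: "('r, 'k) ring_scheme \<Rightarrow> ('r, 'u) cochain_complex \<Rightarrow>
    ('r, 'u) cochain_complex \<Rightarrow> (int \<Rightarrow> 'u \<Rightarrow> 'u) \<Rightarrow> (int \<Rightarrow> 'u \<Rightarrow> 'u) set" where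
  "cls R X Y f = {g \<in> cochain_maps R X Y. heq R X Y f g}"

definition restr :: "('r, 'u) cochain_complex \<Rightarrow> (int \<Rightarrow> 'u \<Rightarrow> 'u) \<Rightarrow> int \<Rightarrow> 'u \<Rightarrow> 'u" where
  "restr X f n = restrict (f n) (carrier (Ob X n))"

lemma restr_apply [simp]: "x \<in> carrier (Ob X n) \<Longrightarrow> restr X f n x = f n x"
  by (simp add: restr_def)

lemma cochain_maps_iff:
  "f \<in> cochain_maps R X Y \<longleftrightarrow> chain_map R X Y f \<and> (\<forall>n. f n \<in> extensional (carrier (Ob X n)))"
  by (auto simp: cochain_maps_def chain_map_def rhom_iff)

lemma chain_map_restr:
  assumes "X \<in> complexes R"
  shows "chain_map R X Y (restr X f) \<longleftrightarrow> chain_map R X Y f"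
  by (auto elim: chain_map_cong[OF assms])

lemma restr_cochain_maps:
  "X \<in> complexes R \<Longrightarrow> chain_map R X Y f \<Longrightarrow> restr X f \<in> cochain_maps R X Y"
  by (auto simp: cochain_maps_iff chain_map_restr) (simp add: restr_def)

lemma restr_eq: "f \<in> cochain_maps R X Y \<Longrightarrow> restr X f = f"
  by (auto simp: cochain_maps_iff restr_def fun_eq_iff extensional_def)

lemma heq_restr:
  "heq R X Y (restr X f) g \<longleftrightarrow> heq R X Y f g" "heq R X Y f (restr X g) \<longleftrightarrow> heq R X Y f g"
  by (auto elim: heq_cong)

lemma homotopic_iff:
  assumes "X \<in> complexes R" "Y \<in> complexes R"
  shows "(f, g) \<in> homotopic R X Y \<longleftrightarrow> f \<in> cochain_maps R X Y \<and> g \<in> cochain_maps R X Y \<and> heq R X Y f g"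
proof
  assume "(f, g) \<in> homotopic R X Y"
  then show "f \<in> cochain_maps R X Y \<and> g \<in> cochain_maps R X Y \<and> heq R X Y f g"
    unfolding homotopic_def heq_def null_homotopic_def by (auto simp: rhom_iff)
next
  assume h: "f \<in> cochain_maps R X Y \<and> g \<in> cochain_maps R X Y \<and> heq R X Y f g"
  then obtain s where s: "\<And>n. rlinear R (Ob X n) (Ob Y (n - 1)) (s n)"
    "\<And>n x. x \<in> carrier (Ob X n) \<Longrightarrow>
      f n x \<ominus>\<^bsub>Ob Y n\<^esub> g n x = Diff Y (n - 1) (s n x) \<oplus>\<^bsub>Ob Y n\<^esub> s (n + 1) (Diff X n x)"
    unfolding heq_def null_homotopic_def by blast
  have "restr X s n \<in> rhom R (Ob X n) (Ob Y (n - 1))" for n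
    unfolding restr_def by (rule restrict_rhom[OF complex_module(2)[OF assms(1)] s(1)])
  moreover have "f n x \<ominus>\<^bsub>Ob Y n\<^esub> g n x =
      Diff Y (n - 1) (restr X s n x) \<oplus>\<^bsub>Ob Y n\<^esub> restr X s (n + 1) (Diff X n x)"
    if "x \<in> carrier (Ob X n)" for n x
    using s(2)[OF that] that complex_simps[OF assms(1)] by simp
  ultimately show "(f, g) \<in> homotopic R X Y"
    unfolding homotopic_def using h by blast
qed

lemma homotopy_class_eq:
  assumes "X \<in> complexes R" "Y \<in> complexes R" "f \<in> cochain_maps R X Y"
  shows "homotopy_class R X Y f = cls R X Y f"
  using assms by (auto simp: homotopy_class_def cls_def homotopic_iff)

lemma cls_restr: "cls R X Y (restr X f) = cls R X Y f"
  by (simp add: cls_def heq_restr)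

lemma homotopy_class_restr:
  assumes "X \<in> complexes R" "Y \<in> complexes R" "chain_map R X Y f"
  shows "homotopy_class R X Y (restr X f) = cls R X Y f"
  using homotopy_class_eq[OF assms(1,2) restr_cochain_maps[OF assms(1,3)]] by (simp add: cls_restr)

lemma cls_eq_iff:
  assumes XY: "X \<in> complexes R" "Y \<in> complexes R" and f: "chain_map R X Y f" "chain_map R X Y g"
  shows "cls R X Y f = cls R X Y g \<longleftrightarrow> heq R X Y f g"
proof
  assume "cls R X Y f = cls R X Y g"
  moreover have "restr X g \<in> cls R X Y g"
    using heq_refl[OF XY f(2)] restr_cochain_maps[OF XY(1) f(2)] by (simp add: cls_def heq_restr)
  ultimately have "restr X g \<in> cls R X Y f" by simp
  then show "heq R X Y f g" by (simp add: cls_def heq_restr)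
next
  assume h: "heq R X Y f g"
  have "heq R X Y f k \<longleftrightarrow> heq R X Y g k" if "chain_map R X Y k" for k
    using heq_trans[OF XY f that h] heq_trans[OF XY f(2,1) that heq_sym[OF XY f h]] by blast
  then show "cls R X Y f = cls R X Y g"
    by (auto simp: cls_def cochain_maps_iff)
qed

lemma Hom_K_Mod:
  assumes "X \<in> complexes R" "Y \<in> complexes R"
  shows "F \<in> Hom (K_Mod R) X Y \<longleftrightarrow> (\<exists>f. chain_map R X Y f \<and> F = cls R X Y f)"
proof
  assume "F \<in> Hom (K_Mod R) X Y"
  then obtain f where f: "f \<in> cochain_maps R X Y" "F = homotopic R X Y `` {f}"
    by (auto simp: K_Mod_def elim: quotientE)
  then show "\<exists>f. chain_map R X Y f \<and> F = cls R X Y f"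
    using homotopy_class_eq[OF assms f(1)] by (auto simp: homotopy_class_def cochain_maps_iff)
next
  assume "\<exists>f. chain_map R X Y f \<and> F = cls R X Y f"
  then obtain f where f: "chain_map R X Y f" "F = cls R X Y f" by blast
  then have "F = homotopic R X Y `` {restr X f}"
    using homotopy_class_restr[OF assms f(1)] by (simp add: homotopy_class_def)
  then show "F \<in> Hom (K_Mod R) X Y"
    using restr_cochain_maps[OF assms(1) f(1)] by (auto simp: K_Mod_def intro: quotientI)
qed

lemma cls_in_Hom:
  "X \<in> complexes R \<Longrightarrow> Y \<in> complexes R \<Longrightarrow> chain_map R X Y f \<Longrightarrow> cls R X Y f \<in> Hom (K_Mod R) X Y"
  by (auto simp: Hom_K_Mod)

text \<open>All pairs of representatives give the same class and both classes are nonempty, so the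
  union over representatives in \<open>K_Mod\<close> collapses to this class.\<close>

lemma Comp_K_Mod:
  assumes XYZ: "X \<in> complexes R" "Y \<in> complexes R" "Z \<in> complexes R"
    and f: "chain_map R X Y f" and g: "chain_map R Y Z g"
  shows "Comp (K_Mod R) X Y Z (cls R Y Z g) (cls R X Y f) = cls R X Z (\<lambda>n x. g n (f n x))"
proof -
  note gf = chain_map_comp[OF g f]
  have c: "cochain_comp X g' f' = restr X (\<lambda>n x. g' n (f' n x))" for g' f'
    by (auto simp: cochain_comp_def compose_def restr_def fun_eq_iff)
  have eq: "homotopy_class R X Z (cochain_comp X g' f') = cls R X Z (\<lambda>n x. g n (f n x))"
    if "g' \<in> cls R Y Z g" "f' \<in> cls R X Y f" for g' f'
  proof -
    have g': "chain_map R Y Z g'" "heq R Y Z g g'" and f': "chain_map R X Y f'" "heq R X Y f f'"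
      using that by (auto simp: cls_def cochain_maps_iff)
    have "heq R X Z (\<lambda>n x. g n (f n x)) (\<lambda>n x. g' n (f' n x))"
      using heq_trans[OF XYZ(1,3) gf chain_map_comp[OF g f'(1)] chain_map_comp[OF g'(1) f'(1)]
          heq_comp_left[OF XYZ f f'(1) f'(2) g] heq_comp_right[OF XYZ f'(1) g'(2)]] .
    then show ?thesis
      using homotopy_class_restr[OF XYZ(1,3) chain_map_comp[OF g'(1) f'(1)]]
        cls_eq_iff[OF XYZ(1,3) gf chain_map_comp[OF g'(1) f'(1)]] by (simp add: c)
  qed
  have "restr Y g \<in> cls R Y Z g" "restr X f \<in> cls R X Y f"
    using heq_refl[OF XYZ(1,2) f] restr_cochain_maps[OF XYZ(1) f]
      heq_refl[OF XYZ(2,3) g] restr_cochain_maps[OF XYZ(2) g] by (simp_all add: cls_def heq_restr)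
  then have "(\<Union>g'\<in>cls R Y Z g. \<Union>f'\<in>cls R X Y f. homotopy_class R X Z (cochain_comp X g' f'))
      = cls R X Z (\<lambda>n x. g n (f n x))"
    using eq by blast
  then show ?thesis by (simp add: K_Mod_def)
qed

lemma Id_K_Mod:
  assumes "X \<in> complexes R"
  shows "Id (K_Mod R) X = cls R X X (\<lambda>n x. x)"
proof -
  have "cochain_id X = restr X (\<lambda>n x. x)" by (simp add: cochain_id_def restr_def fun_eq_iff)
  then show ?thesis using homotopy_class_restr[OF assms assms chain_map_id] by (simp add: K_Mod_def)
qed

lemma shift_map_cls:
  assumes XY: "X \<in> complexes R" "Y \<in> complexes R" and f: "chain_map R X Y f" and k: "odd k"
  shows "shift_map k ` cls R X Y f = cls R (shift k X) (shift k Y) (\<lambda>n. f (n - k))"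
proof (intro equalityI subsetI)
  fix g assume "g \<in> shift_map k ` cls R X Y f"
  then obtain g' where g': "g = shift_map k g'" "chain_map R X Y g'"
    "\<And>n. g' n \<in> extensional (carrier (Ob X n))" "heq R X Y f g'"
    by (auto simp: cls_def cochain_maps_iff)
  have "heq R (shift k X) (shift k Y) (\<lambda>n. f (n - k)) (\<lambda>n. g' (n - k))"
    using null_homotopic_shift[OF XY k g'(4)[unfolded heq_def]] by (simp add: heq_def)
  then show "g \<in> cls R (shift k X) (shift k Y) (\<lambda>n. f (n - k))"
    using chain_map_shift[OF XY k g'(2)] g'(1,3) by (simp add: cls_def cochain_maps_iff shift_map_def)
next
  fix g assume "g \<in> cls R (shift k X) (shift k Y) (\<lambda>n. f (n - k))"
  then have g: "chain_map R (shift k X) (shift k Y) g" "heq R (shift k X) (shift k Y) (\<lambda>n. f (n - k)) g"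
    "\<And>n. g n \<in> extensional (carrier (Ob X (n - k)))"
    by (auto simp: cls_def cochain_maps_iff)
  have "heq R X Y f (\<lambda>n. g (n + k))"
    using null_homotopic_unshift[OF XY k g(2)[unfolded heq_def]] by (simp add: heq_def)
  moreover have "g (n + k) \<in> extensional (carrier (Ob X n))" for n using g(3)[of "n + k"] by simp
  ultimately have "(\<lambda>n. g (n + k)) \<in> cls R X Y f"
    using chain_map_unshift[OF XY k g(1)] by (simp add: cls_def cochain_maps_iff)
  moreover have "g = shift_map k (\<lambda>n. g (n + k))" by (simp add: shift_map_def)
  ultimately show "g \<in> shift_map k ` cls R X Y f" by blast
qed

lemma K_Proj_simps [simp]:
  "Obj (K_Proj R) = {X \<in> complexes R. \<forall>n. projective R (Ob X n)}"
  "Hom (K_Proj R) = Hom (K_Mod R)" "Comp (K_Proj R) = Comp (K_Mod R)" "Id (K_Proj R) = Id (K_Mod R)"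
  by (auto simp: K_Proj_def full_subcategory_def K_Mod_def)

lemma is_iso_K_ModD:
  assumes "X \<in> complexes R" "Y \<in> complexes R" "is_iso (K_Mod R) X Y F"
  obtains a b where "chain_map R X Y a" "F = cls R X Y a" "chain_map R Y X b"
    "heq R X X (\<lambda>n x. b n (a n x)) (\<lambda>n x. x)" "heq R Y Y (\<lambda>n x. a n (b n x)) (\<lambda>n x. x)"
proof -
  obtain G where G: "F \<in> Hom (K_Mod R) X Y" "G \<in> Hom (K_Mod R) Y X"
    "Comp (K_Mod R) X Y X G F = Id (K_Mod R) X" "Comp (K_Mod R) Y X Y F G = Id (K_Mod R) Y"
    using assms(3) by (auto simp: is_iso_def)
  obtain a where a: "chain_map R X Y a" "F = cls R X Y a" using G(1) by (auto simp: Hom_K_Mod assms)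
  obtain b where b: "chain_map R Y X b" "G = cls R Y X b" using G(2) by (auto simp: Hom_K_Mod assms)
  have "heq R X X (\<lambda>n x. b n (a n x)) (\<lambda>n x. x)"
    using G(3) by (simp add: a b Comp_K_Mod assms(1,2) Id_K_Mod cls_eq_iff chain_map_id chain_map_comp[OF b(1) a(1)])
  moreover have "heq R Y Y (\<lambda>n x. a n (b n x)) (\<lambda>n x. x)"
    using G(4) by (simp add: a b Comp_K_Mod assms(1,2) Id_K_Mod cls_eq_iff chain_map_id chain_map_comp[OF a(1) b(1)])
  ultimately show thesis using that a b by blast
qed

lemma is_iso_Id:
  assumes "X \<in> complexes R"
  shows "is_iso (K_Mod R) X X (cls R X X (\<lambda>n x. x))"
  unfolding is_iso_def using assms
  by (auto intro!: bexI[of _ "cls R X X (\<lambda>n x. x)"] simp: cls_in_Hom chain_map_id Comp_K_Mod Id_K_Mod)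

context module_universe
begin

text \<open>The standard triangle on f is exact by definition, with identities as the isomorphisms;
  the work lies in matching the extensional representatives.\<close>

lemma Mor_coneI:
  fixes X Y :: "('r, 'u) cochain_complex"
  assumes XY: "X \<in> Obj (K_Proj R)" "Y \<in> Obj (K_Proj R)" and f: "chain_map R X Y f"
    and C: "cone X Y f \<in> \<K>"
  shows "(X, cls R X Y f, Y) \<in> Mor R \<K>"
proof -
  have XY': "X \<in> complexes R" "Y \<in> complexes R" using XY by auto
  let ?C = "cone X Y f" and ?S = "shift (-1) X"
  have cx: "?C \<in> complexes R" "?S \<in> complexes R"
    using cone_complex[OF XY' f] shift_complex[OF XY'(1)] by auto
  note ci = chain_map_cinj[OF XY' f] and cp = chain_map_cproj[OF XY' f]
  have i: "homotopy_class R Y ?C (cone_inj X Y) = cls R Y ?C (cinj X)"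
  proof -
    have "cone_inj X Y = restr Y (cinj X)" by (simp add: cone_inj_def restr_def cinj_def fun_eq_iff)
    then show ?thesis using homotopy_class_restr[OF XY'(2) cx(1) ci] by simp
  qed
  have p: "homotopy_class R ?C ?S (cone_proj X Y) = cls R ?C ?S cproj"
  proof -
    have "cone_proj X Y = restr ?C cproj" by (simp add: cone_proj_def restr_def cproj_def fun_eq_iff)
    then show ?thesis using homotopy_class_restr[OF cx cp] by simp
  qed
  have ff: "homotopy_class R X Y (restr X f) = cls R X Y f" by (rule homotopy_class_restr[OF XY' f])
  \<comment> \<open>The cone evaluates f on carriers only, so restricting f leaves it literally
    unchanged.\<close>
  have cr: "cone X Y (restr X f) = ?C"
    by (auto simp: cone_def fun_eq_iff direct_sum_def intro!: restrict_ext split: prod.splits)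
  have sh: "shift_map (-1) ` cls R X X (\<lambda>n x. x) = cls R ?S ?S (\<lambda>n x. x)"
    using shift_map_cls[OF XY'(1) XY'(1) chain_map_id, of "-1"] by simp
  have "exact_triangle R X (cls R X Y f) Y (cls R Y ?C (cinj X)) ?C (cls R ?C ?S cproj)"
    unfolding exact_triangle_def
  proof (intro conjI, goal_cases)
    case 7
    show ?case
    proof (rule bexI[of _ X], rule bexI[of _ Y], rule bexI[of _ "restr X f"],
        rule exI[of _ "cls R X X (\<lambda>n x. x)"], rule exI[of _ "cls R Y Y (\<lambda>n x. x)"],
        rule exI[of _ "cls R ?C ?C (\<lambda>n x. x)"], intro conjI)
    show "is_iso (K_Mod R) X X (cls R X X (\<lambda>n x. x))" "is_iso (K_Mod R) Y Y (cls R Y Y (\<lambda>n x. x))"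
      "is_iso (K_Mod R) ?C (cone X Y (restr X f)) (cls R ?C ?C (\<lambda>n x. x))"
      using is_iso_Id XY' cx cr by auto
    show "Comp (K_Mod R) ?C ?S ?S (shift_map (- 1) ` cls R X X (\<lambda>n x. x)) (cls R ?C ?S cproj) =
      Comp (K_Mod R) ?C (cone X Y (restr X f)) ?S
       (homotopy_class R (cone X Y (restr X f)) ?S (cone_proj X Y)) (cls R ?C ?C (\<lambda>n x. x))"
      unfolding cr p sh by (simp add: Comp_K_Mod cx cp chain_map_id)
    show "Comp (K_Mod R) Y ?C (cone X Y (restr X f)) (cls R ?C ?C (\<lambda>n x. x)) (cls R Y ?C (cinj X)) =
      Comp (K_Mod R) Y Y (cone X Y (restr X f))
       (homotopy_class R Y (cone X Y (restr X f)) (cone_inj X Y)) (cls R Y Y (\<lambda>n x. x))"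
      unfolding cr i by (simp add: Comp_K_Mod cx XY' ci chain_map_id)
    show "Comp (K_Mod R) X Y Y (cls R Y Y (\<lambda>n x. x)) (cls R X Y f) =
      Comp (K_Mod R) X X Y (homotopy_class R X Y (restr X f)) (cls R X X (\<lambda>n x. x))"
      unfolding ff by (simp add: Comp_K_Mod XY' f chain_map_id)
    qed (use XY' f in \<open>auto simp: restr_cochain_maps\<close>)
  qed (use XY' cx f ci cp in \<open>auto simp: cls_in_Hom\<close>)
  then show ?thesis using XY C XY' f unfolding Mor_def by (auto simp: cls_in_Hom)
qed

end


section \<open>Composition and zero morphisms in the homotopy category\<close>

lemma HomE:
  assumes "F \<in> Hom (K_Mod R) X Y" "X \<in> complexes R" "Y \<in> complexes R"
  obtains f where "chain_map R X Y f" "F = cls R X Y f"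
  using assms by (auto simp: Hom_K_Mod)

definition zero_hom :: "('r, 'k) ring_scheme \<Rightarrow> ('r, 'u) cochain_complex \<Rightarrow>
    ('r, 'u) cochain_complex \<Rightarrow> (int \<Rightarrow> 'u \<Rightarrow> 'u) set" where
  "zero_hom R X Y = cls R X Y (\<lambda>n x. \<zero>\<^bsub>Ob Y n\<^esub>)"

lemma zero_hom_in_Hom: "X \<in> complexes R \<Longrightarrow> Y \<in> complexes R \<Longrightarrow> zero_hom R X Y \<in> Hom (K_Mod R) X Y"
  by (simp add: zero_hom_def cls_in_Hom chain_map_zero)

lemma cls_eq_zero:
  "X \<in> complexes R \<Longrightarrow> Y \<in> complexes R \<Longrightarrow> chain_map R X Y f \<Longrightarrow>
     cls R X Y f = zero_hom R X Y \<longleftrightarrow> null_homotopic R X Y f"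
  by (simp add: zero_hom_def cls_eq_iff chain_map_zero heq_zero_iff)

lemma Comp_in_Hom:
  assumes "X \<in> complexes R" "Y \<in> complexes R" "Z \<in> complexes R"
    "F \<in> Hom (K_Mod R) X Y" "G \<in> Hom (K_Mod R) Y Z"
  shows "Comp (K_Mod R) X Y Z G F \<in> Hom (K_Mod R) X Z"
  using assms by (elim HomE) (simp_all add: Comp_K_Mod cls_in_Hom chain_map_comp)

lemma Comp_assoc:
  assumes "X \<in> complexes R" "Y \<in> complexes R" "Z \<in> complexes R" "W \<in> complexes R"
    "F \<in> Hom (K_Mod R) X Y" "G \<in> Hom (K_Mod R) Y Z" "H \<in> Hom (K_Mod R) Z W"
  shows "Comp (K_Mod R) X Y W (Comp (K_Mod R) Y Z W H G) F =
    Comp (K_Mod R) X Z W H (Comp (K_Mod R) X Y Z G F)"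
proof -
  obtain f where f: "chain_map R X Y f" "F = cls R X Y f" using HomE[OF assms(5,1,2)] .
  obtain g where g: "chain_map R Y Z g" "G = cls R Y Z g" using HomE[OF assms(6,2,3)] .
  obtain h where h: "chain_map R Z W h" "H = cls R Z W h" using HomE[OF assms(7,3,4)] .
  show ?thesis
    by (simp add: f g h Comp_K_Mod assms(1-4) chain_map_comp[OF h(1) g(1)] chain_map_comp[OF g(1) f(1)])
qed

lemma Id_in_Hom: "X \<in> complexes R \<Longrightarrow> Id (K_Mod R) X \<in> Hom (K_Mod R) X X"
  by (simp add: Id_K_Mod cls_in_Hom chain_map_id)

lemma Comp_Id:
  assumes "X \<in> complexes R" "Y \<in> complexes R" "F \<in> Hom (K_Mod R) X Y"
  shows "Comp (K_Mod R) X X Y F (Id (K_Mod R) X) = F" "Comp (K_Mod R) X Y Y (Id (K_Mod R) Y) F = F"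
  using assms by (auto elim!: HomE simp: Id_K_Mod Comp_K_Mod chain_map_id)

lemma Comp_zero:
  assumes "X \<in> complexes R" "Y \<in> complexes R" "Z \<in> complexes R"
  shows "F \<in> Hom (K_Mod R) X Y \<Longrightarrow> Comp (K_Mod R) X Y Z (zero_hom R Y Z) F = zero_hom R X Z"
    "G \<in> Hom (K_Mod R) Y Z \<Longrightarrow> Comp (K_Mod R) X Y Z G (zero_hom R X Y) = zero_hom R X Z"
proof -
  show "Comp (K_Mod R) X Y Z (zero_hom R Y Z) F = zero_hom R X Z" if "F \<in> Hom (K_Mod R) X Y"
    using that assms by (auto elim!: HomE simp: zero_hom_def Comp_K_Mod chain_map_zero)
  assume "G \<in> Hom (K_Mod R) Y Z"
  then obtain g where g: "chain_map R Y Z g" "G = cls R Y Z g" using HomE[OF _ assms(2,3)] by blast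
  show "Comp (K_Mod R) X Y Z G (zero_hom R X Y) = zero_hom R X Z"
    using chain_map_simps[OF g(1) assms(2,3)]
    by (simp add: zero_hom_def Comp_K_Mod chain_map_zero assms g)
qed

lemma orth_iff_Hom:
  assumes "X \<in> complexes R" "Y \<in> complexes R"
  shows "orth R X Y \<longleftrightarrow> Hom (K_Mod R) X Y = {zero_hom R X Y}"
proof
  assume o: "orth R X Y"
  have "F = zero_hom R X Y" if F: "F \<in> Hom (K_Mod R) X Y" for F
  proof -
    obtain f where f: "chain_map R X Y f" "F = cls R X Y f" using HomE[OF F assms] .
    show ?thesis unfolding f(2) cls_eq_zero[OF assms f(1)] by (rule orthD[OF o f(1)])
  qed
  then show "Hom (K_Mod R) X Y = {zero_hom R X Y}" using zero_hom_in_Hom[OF assms] by blast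
next
  assume h: "Hom (K_Mod R) X Y = {zero_hom R X Y}"
  show "orth R X Y" unfolding orth_def
  proof (intro allI impI)
    fix f assume f: "chain_map R X Y f"
    have "cls R X Y f = zero_hom R X Y" using cls_in_Hom[OF assms f] h by simp
    then show "null_homotopic R X Y f" by (simp only: cls_eq_zero[OF assms f])
  qed
qed

section \<open>The shift functor on homotopy classes\<close>

definition shift_hom :: "int \<Rightarrow> (int \<Rightarrow> 'u \<Rightarrow> 'u) set \<Rightarrow> (int \<Rightarrow> 'u \<Rightarrow> 'u) set" where
  "shift_hom k F = shift_map k ` F"

lemma shift_hom_inverse [simp]: "l = - k \<Longrightarrow> shift_hom l (shift_hom k F) = F"
  by (simp add: shift_hom_def shift_map_def image_image)

lemma shift_hom_in_Hom:
  assumes "X \<in> complexes R" "Y \<in> complexes R" "odd k" "F \<in> Hom (K_Mod R) X Y"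
  shows "shift_hom k F \<in> Hom (K_Mod R) (shift k X) (shift k Y)"
proof -
  obtain f where f: "chain_map R X Y f" "F = cls R X Y f" using HomE[OF assms(4,1,2)] .
  show ?thesis
    unfolding f shift_hom_def shift_map_cls[OF assms(1,2) f(1) assms(3)]
    by (intro cls_in_Hom shift_complex chain_map_shift assms f)
qed

lemma shift_hom_Comp:
  assumes XYZ: "X \<in> complexes R" "Y \<in> complexes R" "Z \<in> complexes R" and k: "odd k"
    and F: "F \<in> Hom (K_Mod R) X Y" and G: "G \<in> Hom (K_Mod R) Y Z"
  shows "shift_hom k (Comp (K_Mod R) X Y Z G F) =
    Comp (K_Mod R) (shift k X) (shift k Y) (shift k Z) (shift_hom k G) (shift_hom k F)"
proof -
  obtain f where f: "chain_map R X Y f" "F = cls R X Y f" using HomE[OF F XYZ(1,2)] .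
  obtain g where g: "chain_map R Y Z g" "G = cls R Y Z g" using HomE[OF G XYZ(2,3)] .
  show ?thesis
    using chain_map_shift[OF XYZ(1,2) k f(1)] chain_map_shift[OF XYZ(2,3) k g(1)]
    by (simp add: f g shift_hom_def Comp_K_Mod XYZ shift_map_cls k chain_map_comp[OF g(1) f(1)] shift_complex)
qed

lemma shift_hom_zero:
  assumes "X \<in> complexes R" "Y \<in> complexes R" "odd k"
  shows "shift_hom k (zero_hom R X Y) = zero_hom R (shift k X) (shift k Y)"
  unfolding shift_hom_def zero_hom_def by (simp add: shift_map_cls assms chain_map_zero)

section \<open>Exactness of the standard triangle in the homotopy category\<close>

context module_universe
begin

context
  fixes X Y C :: "('r, 'u) cochain_complex" and f I P F
    and S :: "('r, 'u) cochain_complex \<Rightarrow> ('r, 'u) cochain_complex"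
  assumes XY: "X \<in> complexes R" "Y \<in> complexes R" and f: "chain_map R X Y f"
  defines "C \<equiv> cone X Y f" and "S \<equiv> shift (-1)"
    and "I \<equiv> cls R Y (cone X Y f) (cinj X)" and "P \<equiv> cls R (cone X Y f) (shift (-1) X) cproj"
    and "F \<equiv> cls R X Y f"
begin

lemma cone_triangle_complexes: "C \<in> complexes R" "S X \<in> complexes R" "S Y \<in> complexes R"
  unfolding C_def S_def using cone_complex[OF XY f] shift_complex[OF XY(1), of "-1"]
    shift_complex[OF XY(2), of "-1"] by simp_all

lemma cone_triangle_homs:
  "F \<in> Hom (K_Mod R) X Y" "I \<in> Hom (K_Mod R) Y C" "P \<in> Hom (K_Mod R) C (S X)"
  "shift_hom (-1) F \<in> Hom (K_Mod R) (S X) (S Y)"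
  using cone_triangle_complexes chain_map_cinj[OF XY f] chain_map_cproj[OF XY f] XY f
  unfolding F_def I_def P_def C_def S_def by (auto simp: cls_in_Hom intro: shift_hom_in_Hom)

lemma cone_triangle_zero:
  "Comp (K_Mod R) X Y C I F = zero_hom R X C"
  "Comp (K_Mod R) C (S X) (S Y) (shift_hom (-1) F) P = zero_hom R C (S Y)"
proof -
  note cx = cone_triangle_complexes
  show "Comp (K_Mod R) X Y C I F = zero_hom R X C"
    using null_homotopic_cinj_comp[OF XY f] chain_map_cinj[OF XY f] cx unfolding C_def I_def F_def
    by (simp add: Comp_K_Mod XY f cls_eq_zero chain_map_comp[OF chain_map_cinj[OF XY f] f])
  have s: "shift_hom (-1) F = cls R (S X) (S Y) (\<lambda>n. f (n + 1))"
    unfolding F_def S_def shift_hom_def by (simp add: shift_map_cls XY f)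
  have m: "chain_map R (S X) (S Y) (\<lambda>n. f (n + 1))"
    using chain_map_shift[OF XY _ f, of "-1"] by (simp add: S_def)
  show "Comp (K_Mod R) C (S X) (S Y) (shift_hom (-1) F) P = zero_hom R C (S Y)"
    using null_homotopic_comp_cproj[OF XY f] m chain_map_cproj[OF XY f] cx unfolding s C_def P_def S_def
    by (simp add: Comp_K_Mod XY f cls_eq_zero chain_map_comp[OF m[unfolded S_def] chain_map_cproj[OF XY f]])
qed

lemma cone_triangle_extend:
  fixes Q :: "('r, 'u) cochain_complex"
  assumes Q: "Q \<in> complexes R" and H: "H \<in> Hom (K_Mod R) Y Q"
    and "Comp (K_Mod R) X Y Q H F = zero_hom R X Q"
  shows "\<exists>K\<in>Hom (K_Mod R) C Q. H = Comp (K_Mod R) Y C Q K I"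
proof -
  obtain h where h: "chain_map R Y Q h" "H = cls R Y Q h" using HomE[OF H XY(2) Q] .
  have "null_homotopic R X Q (\<lambda>n x. h n (f n x))"
    using assms(3) by (simp add: h F_def Comp_K_Mod XY Q f cls_eq_zero chain_map_comp[OF h(1) f])
  from cone_extension[OF XY f Q h(1) this] obtain k where k: "chain_map R C Q k"
    "\<And>n y. y \<in> carrier (Ob Y n) \<Longrightarrow> k n (cinj X n y) = h n y"
    unfolding C_def by blast
  note kc = k(1)[unfolded C_def] and ci = chain_map_cinj[OF XY f]
  have "heq R Y Q h (\<lambda>n x. k n (cinj X n x))"
    by (rule heq_cong[OF heq_refl[OF XY(2) Q h(1)]]) (simp_all add: k(2))
  then have "cls R Y Q h = cls R Y Q (\<lambda>n x. k n (cinj X n x))"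
    by (simp add: cls_eq_iff XY Q h(1) chain_map_comp[OF kc ci])
  then show ?thesis
    using cone_triangle_complexes kc ci unfolding C_def I_def h
    by (intro bexI[of _ "cls R (cone X Y f) Q k"]) (simp_all add: Comp_K_Mod XY Q cls_in_Hom)
qed

lemma cone_triangle_lift:
  fixes W :: "('r, 'u) cochain_complex"
  assumes W: "W \<in> complexes R" and H: "H \<in> Hom (K_Mod R) W Y"
    and "Comp (K_Mod R) W Y C I H = zero_hom R W C"
  shows "\<exists>H'\<in>Hom (K_Mod R) W X. H = Comp (K_Mod R) W X Y F H'"
proof -
  obtain h where h: "chain_map R W Y h" "H = cls R W Y h" using HomE[OF H W XY(2)] .
  note ci = chain_map_cinj[OF XY f]
  have "null_homotopic R W (cone X Y f) (\<lambda>n x. cinj X n (h n x))"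
    using assms(3) cone_triangle_complexes ci unfolding C_def
    by (simp add: h I_def Comp_K_Mod XY W cls_eq_zero chain_map_comp[OF ci h(1)])
  from cone_lift[OF XY f W h(1) this] obtain h' where h': "chain_map R W X h'"
    "heq R W Y h (\<lambda>n x. f n (h' n x))" by blast
  then show ?thesis
    by (intro bexI[of _ "cls R W X h'"])
      (simp_all add: h F_def Comp_K_Mod XY W f cls_in_Hom cls_eq_iff chain_map_comp[OF f h'(1)])
qed

lemma cone_triangle_factor:
  fixes Q :: "('r, 'u) cochain_complex"
  assumes Q: "Q \<in> complexes R" and K: "K \<in> Hom (K_Mod R) C Q"
    and "Comp (K_Mod R) Y C Q K I = zero_hom R Y Q"
  shows "\<exists>V\<in>Hom (K_Mod R) (S X) Q. K = Comp (K_Mod R) C (S X) Q V P"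
proof -
  note cx = cone_triangle_complexes
  obtain k where k: "chain_map R (cone X Y f) Q k" "K = cls R (cone X Y f) Q k"
    using HomE[OF K cx(1) Q] unfolding C_def by blast
  note ci = chain_map_cinj[OF XY f] and cp = chain_map_cproj[OF XY f]
  have "null_homotopic R Y Q (\<lambda>n x. k n (cinj X n x))"
    using assms(3) cx k ci unfolding C_def
    by (simp add: k I_def Comp_K_Mod XY Q cls_eq_zero chain_map_comp[OF k(1) ci])
  from cone_factor_cproj[OF XY f Q k(1) this] obtain v where v: "chain_map R (shift (-1) X) Q v"
    "heq R (cone X Y f) Q k (\<lambda>n z. v n (cproj n z))" by blast
  then show ?thesis
    using cx cp unfolding C_def S_def
    by (intro bexI[of _ "cls R (shift (-1) X) Q v"])
      (simp_all add: k P_def Comp_K_Mod XY Q cls_in_Hom cls_eq_iff chain_map_comp[OF v(1) cp])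
qed

lemma cone_triangle_shift:
  fixes Q :: "('r, 'u) cochain_complex"
  assumes Q: "Q \<in> complexes R" and H: "H \<in> Hom (K_Mod R) (S X) Q"
    and "Comp (K_Mod R) C (S X) Q H P = zero_hom R C Q"
  shows "\<exists>K\<in>Hom (K_Mod R) (S Y) Q. H = Comp (K_Mod R) (S X) (S Y) Q K (shift_hom (-1) F)"
proof -
  note cx = cone_triangle_complexes
  obtain h where h: "chain_map R (shift (-1) X) Q h" "H = cls R (shift (-1) X) Q h"
    using HomE[OF H cx(2) Q] unfolding S_def by blast
  note cp = chain_map_cproj[OF XY f]
  have "null_homotopic R (cone X Y f) Q (\<lambda>n x. h n (cproj n x))"
    using assms(3) cx h cp unfolding C_def S_def
    by (simp add: h P_def Comp_K_Mod XY Q cls_eq_zero chain_map_comp[OF h(1) cp])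
  from shift_factor[OF XY f Q h(1) this] obtain k where k: "chain_map R (shift (-1) Y) Q k"
    "heq R (shift (-1) X) Q h (\<lambda>n x. k n (f (n + 1) x))" by blast
  have m: "chain_map R (shift (-1) X) (shift (-1) Y) (\<lambda>n. f (n + 1))"
    using chain_map_shift[OF XY _ f, of "-1"] by simp
  have s: "shift_hom (-1) F = cls R (shift (-1) X) (shift (-1) Y) (\<lambda>n. f (n + 1))"
    unfolding F_def shift_hom_def by (simp add: shift_map_cls XY f)
  show ?thesis
    using cx k m unfolding C_def S_def s
    by (intro bexI[of _ "cls R (shift (-1) Y) Q k"])
      (simp_all add: h Comp_K_Mod XY Q cls_in_Hom cls_eq_iff chain_map_comp[OF k(1) m])
qed

text \<open>H vanishes on X, so it extends to the cone C, and every morphism from C to Q is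
  zero.\<close>

lemma cone_orth_injective:
  fixes Q :: "('r, 'u) cochain_complex"
  assumes Q: "Q \<in> complexes R" and o: "orth R C Q"
    and H: "H \<in> Hom (K_Mod R) Y Q" "Comp (K_Mod R) X Y Q H F = zero_hom R X Q"
  shows "H = zero_hom R Y Q"
proof -
  note cx = cone_triangle_complexes
  obtain K where K: "K \<in> Hom (K_Mod R) C Q" "H = Comp (K_Mod R) Y C Q K I"
    using cone_triangle_extend[OF Q H] by blast
  then have "K = zero_hom R C Q" using o orth_iff_Hom[OF cx(1) Q] by auto
  then show ?thesis using K(2) Comp_zero(1)[OF XY(2) cx(1) Q cone_triangle_homs(2)] by simp
qed

text \<open>The composite C -> X[-1] -> Q[-1] vanishes by orthogonality, so H[-1] factors through
  F[-1]; the shift is then undone.\<close>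

lemma cone_orth_surjective:
  fixes Q :: "('r, 'u) cochain_complex"
  assumes Q: "Q \<in> complexes R" and o: "orth R C (S Q)" and H: "H \<in> Hom (K_Mod R) X Q"
  shows "\<exists>K\<in>Hom (K_Mod R) Y Q. H = Comp (K_Mod R) X Y Q K F"
proof -
  note cx = cone_triangle_complexes and ho = cone_triangle_homs
  have SQ: "S Q \<in> complexes R" unfolding S_def by (rule shift_complex[OF Q]) simp
  have sH: "shift_hom (-1) H \<in> Hom (K_Mod R) (S X) (S Q)"
    unfolding S_def by (rule shift_hom_in_Hom[OF XY(1) Q _ H]) simp
  have "Comp (K_Mod R) C (S X) (S Q) (shift_hom (-1) H) P \<in> Hom (K_Mod R) C (S Q)"
    by (rule Comp_in_Hom[OF cx(1,2) SQ ho(3) sH])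
  then have "Comp (K_Mod R) C (S X) (S Q) (shift_hom (-1) H) P = zero_hom R C (S Q)"
    using o orth_iff_Hom[OF cx(1) SQ] by auto
  from cone_triangle_shift[OF SQ sH this] obtain K where K: "K \<in> Hom (K_Mod R) (S Y) (S Q)"
    "shift_hom (-1) H = Comp (K_Mod R) (S X) (S Y) (S Q) K (shift_hom (-1) F)" by blast
  have ss: "shift 1 (S Z) = Z" if "Z \<in> complexes R" for Z
    unfolding S_def by (rule shift_shift[OF that]) auto
  have "shift_hom 1 K \<in> Hom (K_Mod R) Y Q"
    using shift_hom_in_Hom[OF cx(3) SQ _ K(1), of 1] by (simp add: ss XY Q)
  moreover have "H = Comp (K_Mod R) X Y Q (shift_hom 1 K) F"
  proof -
    have "H = shift_hom 1 (shift_hom (-1) H)" by simp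
    also have "\<dots> = Comp (K_Mod R) (shift 1 (S X)) (shift 1 (S Y)) (shift 1 (S Q))
        (shift_hom 1 K) (shift_hom 1 (shift_hom (-1) F))"
      unfolding K(2) by (rule shift_hom_Comp[OF cx(2,3) SQ _ ho(4) K(1)]) simp
    finally show ?thesis by (simp add: ss XY Q)
  qed
  ultimately show ?thesis by blast
qed

end

text \<open>Conjugation by the isomorphisms onto a standard triangle reduces the claim to the two
  preceding lemmas; orthogonality passes from Z to the cone, which is a retract of Z up to homotopy.
  The second conclusion involves Q[-1] because the obstruction to extending H lies in Hom(Z,
  Q[-1]).\<close>

lemma Mor_cone:
  fixes X Y :: "('r, 'u) cochain_complex"
  assumes K: "\<K> \<subseteq> complexes R" and m: "(X, F, Y) \<in> Mor R \<K>"
  obtains Z where "Z \<in> \<K>"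
    "\<And>Q H. Q \<in> complexes R \<Longrightarrow> orth R Z Q \<Longrightarrow> H \<in> Hom (K_Mod R) Y Q \<Longrightarrow>
       Comp (K_Mod R) X Y Q H F = zero_hom R X Q \<Longrightarrow> H = zero_hom R Y Q"
    "\<And>Q H. Q \<in> complexes R \<Longrightarrow> orth R Z (shift (-1) Q) \<Longrightarrow> H \<in> Hom (K_Mod R) X Q \<Longrightarrow>
       \<exists>L\<in>Hom (K_Mod R) Y Q. H = Comp (K_Mod R) X Y Q L F"
proof -
  obtain Z G H where Z: "Z \<in> \<K>" and t: "exact_triangle R X F Y G Z H"
    using m by (auto simp: Mor_def)
  have cx: "X \<in> complexes R" "Y \<in> complexes R" "Z \<in> complexes R" and F: "F \<in> Hom (K_Mod R) X Y"
    using t by (auto simp: exact_triangle_def)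
  obtain X' Y' f \<alpha> \<beta> \<gamma> where cx': "X' \<in> complexes R" "Y' \<in> complexes R" and f: "f \<in> cochain_maps R X' Y'"
    and i: "is_iso (K_Mod R) X X' \<alpha>" "is_iso (K_Mod R) Y Y' \<beta>" "is_iso (K_Mod R) Z (cone X' Y' f) \<gamma>"
    and sq: "Comp (K_Mod R) X Y Y' \<beta> F = Comp (K_Mod R) X X' Y' (homotopy_class R X' Y' f) \<alpha>"
    using t unfolding exact_triangle_def by blast
  define F' where "F' = cls R X' Y' f"
  have fm: "chain_map R X' Y' f" using f by (simp add: cochain_maps_iff)
  have F': "F' \<in> Hom (K_Mod R) X' Y'" by (simp add: F'_def cls_in_Hom cx' fm)
  have sq': "Comp (K_Mod R) X Y Y' \<beta> F = Comp (K_Mod R) X X' Y' F' \<alpha>"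
    using sq homotopy_class_eq[OF cx' f] by (simp add: F'_def)
  have C: "cone X' Y' f \<in> complexes R" by (rule cone_complex[OF cx' fm])
  obtain c d where cd: "chain_map R Z (cone X' Y' f) c" "chain_map R (cone X' Y' f) Z d"
    "heq R (cone X' Y' f) (cone X' Y' f) (\<lambda>n x. c n (d n x)) (\<lambda>n x. x)"
    using is_iso_K_ModD[OF cx(3) C i(3)] by blast
  have oC: "orth R (cone X' Y' f) Q" if "orth R Z Q" "Q \<in> complexes R" for Q
    by (rule orth_retract[OF C cx(3) that(2) cd(2,1,3) that(1)])
  obtain \<alpha>' where \<alpha>: "\<alpha> \<in> Hom (K_Mod R) X X'" "\<alpha>' \<in> Hom (K_Mod R) X' X"
    "Comp (K_Mod R) X X' X \<alpha>' \<alpha> = Id (K_Mod R) X" "Comp (K_Mod R) X' X X' \<alpha> \<alpha>' = Id (K_Mod R) X'"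
    using i(1) by (auto simp: is_iso_def)
  obtain \<beta>' where \<beta>: "\<beta> \<in> Hom (K_Mod R) Y Y'" "\<beta>' \<in> Hom (K_Mod R) Y' Y"
    "Comp (K_Mod R) Y Y' Y \<beta>' \<beta> = Id (K_Mod R) Y" "Comp (K_Mod R) Y' Y Y' \<beta> \<beta>' = Id (K_Mod R) Y'"
    using i(2) by (auto simp: is_iso_def)
  note [simp] = cx cx' F F' \<alpha>(1,2) \<beta>(1,2) Comp_in_Hom Comp_Id
  show thesis
  proof (rule that[OF Z])
    fix Q H assume Q [simp]: "Q \<in> complexes R" and o: "orth R Z Q" and H [simp]: "H \<in> Hom (K_Mod R) Y Q"
      and z: "Comp (K_Mod R) X Y Q H F = zero_hom R X Q"
    let ?H = "Comp (K_Mod R) Y' Y Q H \<beta>'"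
    have F'eq: "F' = Comp (K_Mod R) X' X Y' (Comp (K_Mod R) X Y Y' \<beta> F) \<alpha>'"
      using \<alpha>(4) by (simp add: sq' Comp_assoc[of X' R X X' Y'])
    have "Comp (K_Mod R) X' Y' Q ?H F' =
      Comp (K_Mod R) X' X Q (Comp (K_Mod R) X Y' Q ?H (Comp (K_Mod R) X Y Y' \<beta> F)) \<alpha>'"
      by (simp add: F'eq Comp_assoc[of X' R X Y' Q])
    also have "Comp (K_Mod R) X Y' Q ?H (Comp (K_Mod R) X Y Y' \<beta> F) = Comp (K_Mod R) X Y Q (Comp (K_Mod R) Y Y' Q ?H \<beta>) F"
      by (simp add: Comp_assoc[of X R Y Y' Q])
    also have "Comp (K_Mod R) Y Y' Q ?H \<beta> = H"
      using \<beta>(3) by (simp add: Comp_assoc[of Y R Y' Y Q])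
    finally have "Comp (K_Mod R) X' Y' Q ?H F' = zero_hom R X' Q"
      by (simp add: z Comp_zero)
    from cone_orth_injective[OF cx' fm Q oC[OF o Q] _ this[unfolded F'_def]]
    have "?H = zero_hom R Y' Q" by simp
    moreover have "H = Comp (K_Mod R) Y Y' Q ?H \<beta>" using \<beta>(3) by (simp add: Comp_assoc[of Y R Y' Y Q])
    ultimately show "H = zero_hom R Y Q" by (simp add: Comp_zero)
  next
    fix Q H assume Q [simp]: "Q \<in> complexes R" and o: "orth R Z (shift (-1) Q)"
      and H [simp]: "H \<in> Hom (K_Mod R) X Q"
    have SQ: "shift (-1) Q \<in> complexes R" by (rule shift_complex) auto
    have "Comp (K_Mod R) X' X Q H \<alpha>' \<in> Hom (K_Mod R) X' Q" by simp
    from cone_orth_surjective[OF cx' fm Q oC[OF o SQ] this]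
    obtain L where L [simp]: "L \<in> Hom (K_Mod R) Y' Q" and
      eq: "Comp (K_Mod R) X' X Q H \<alpha>' = Comp (K_Mod R) X' Y' Q L F'" unfolding F'_def by blast
    have "H = Comp (K_Mod R) X X' Q (Comp (K_Mod R) X' X Q H \<alpha>') \<alpha>"
      using \<alpha>(3) by (simp add: Comp_assoc[of X R X' X Q])
    also have "\<dots> = Comp (K_Mod R) X Y' Q L (Comp (K_Mod R) X X' Y' F' \<alpha>)"
      by (simp add: eq Comp_assoc[of X R X' Y' Q])
    also have "\<dots> = Comp (K_Mod R) X Y Q (Comp (K_Mod R) Y Y' Q L \<beta>) F"
      by (simp add: sq'[symmetric] Comp_assoc[of X R Y Y' Q])
    finally show "\<exists>L\<in>Hom (K_Mod R) Y Q. H = Comp (K_Mod R) X Y Q L F" by (rule bexI) simp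
  qed
qed

end


section \<open>Totally acyclic complexes\<close>

text \<open>In degree k = -n-1 the differential of the Hom complex is composition with d^n, from
  Hom(X^(n+1), P) to Hom(X^n, P). Cocycles in the target are the maps on X^n that vanish on
  boundaries.\<close>

lemma Hom_complex_exact_iff:
  fixes X :: "('r, 'u) cochain_complex" and P :: "('r, 'u) module"
  assumes X: "X \<in> complexes R" and P: "right_module R P"
  shows "exact_complex (Hom_complex_Ob R X P) (Hom_complex_Diff X) \<longleftrightarrow>
    (\<forall>n \<phi>. rlinear R (Ob X n) P \<phi> \<longrightarrow> (\<forall>y\<in>carrier (Ob X (n - 1)). \<phi> (Diff X (n - 1) y) = \<zero>\<^bsub>P\<^esub>) \<longrightarrow>
      (\<exists>\<psi>. rlinear R (Ob X (n + 1)) P \<psi> \<and> (\<forall>x\<in>carrier (Ob X n). \<phi> x = \<psi> (Diff X n x))))"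
    (is "?L \<longleftrightarrow> ?R")
proof -
  note simps = complex_simps[OF X]
  have D: "Hom_complex_Diff X (- n - 1) \<phi> = restrict (\<lambda>x. \<phi> (Diff X n x)) (carrier (Ob X n))" for n \<phi>
    by (simp add: Hom_complex_Diff_def compose_def)
  have D': "Hom_complex_Diff X (- n) \<phi> = restrict (\<lambda>x. \<phi> (Diff X (n - 1) x)) (carrier (Ob X (n - 1)))" for n \<phi>
    by (simp add: Hom_complex_Diff_def compose_def)
  have c: "carrier (Hom_complex_Ob R X P k) = rhom R (Ob X (- k)) P" for k
    by (simp add: Hom_complex_Ob_def hom_group_def)
  have z: "\<zero>\<^bsub>Hom_complex_Ob R X P (1 - n)\<^esub> = restrict (\<lambda>x. \<zero>\<^bsub>P\<^esub>) (carrier (Ob X (n - 1)))" for n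
    by (simp add: Hom_complex_Ob_def hom_group_def)
  have "?L \<longleftrightarrow> (\<forall>n. Hom_complex_Diff X (- n - 1) ` rhom R (Ob X (n + 1)) P =
      {\<phi> \<in> rhom R (Ob X n) P. Hom_complex_Diff X (- n) \<phi> = \<zero>\<^bsub>Hom_complex_Ob R X P (1 - n)\<^esub>})"
    (is "_ \<longleftrightarrow> (\<forall>n. ?A n)")
  proof
    assume l: ?L
    show "\<forall>n. ?A n"
    proof
      \<comment> \<open>The substitution n |-> -n-1 is an involution, so all degrees are covered in
        both directions.\<close>
      fix n show "?A n" using l[unfolded exact_complex_def, rule_format, of "- n - 1"] by (simp add: c add.commute)
    qed
  next
    assume r: "\<forall>n. ?A n"
    show ?L unfolding exact_complex_def
    proof
      fix k :: int
      have idx: "k + 1 - 1 = k" "- (-k - 1) = k + 1" "1 - (- k - 1) = k + 1 + 1" "- k - 1 + 1 = - k" "- k - 1 = - (k + 1)"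
        by simp_all
      show "Hom_complex_Diff X k ` carrier (Hom_complex_Ob R X P k) =
        {x \<in> carrier (Hom_complex_Ob R X P (k + 1)). Hom_complex_Diff X (k + 1) x = \<zero>\<^bsub>Hom_complex_Ob R X P (k + 1 + 1)\<^esub>}"
        using r[rule_format, of "- k - 1"] unfolding c idx(1-4) unfolding idx(5) .
    qed
  qed
  also have "\<dots> \<longleftrightarrow> ?R"
  proof (intro all_cong1 iffI allI impI equalityI subsetI)
    fix n \<phi>
    assume A: "?A n" and \<phi>: "rlinear R (Ob X n) P \<phi>"
      and k: "\<forall>y\<in>carrier (Ob X (n - 1)). \<phi> (Diff X (n - 1) y) = \<zero>\<^bsub>P\<^esub>"
    have "restrict \<phi> (carrier (Ob X n)) \<in> rhom R (Ob X n) P"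
      by (rule restrict_rhom[OF complex_module(2)[OF X] \<phi>])
    then have "restrict \<phi> (carrier (Ob X n)) \<in> Hom_complex_Diff X (- n - 1) ` rhom R (Ob X (n + 1)) P"
      using k unfolding A by (auto simp: D' z simps intro!: restrict_ext)
    then obtain \<psi> where \<psi>: "\<psi> \<in> rhom R (Ob X (n + 1)) P"
      "restrict \<phi> (carrier (Ob X n)) = restrict (\<lambda>x. \<psi> (Diff X n x)) (carrier (Ob X n))"
      by (auto simp: D)
    have "\<phi> x = \<psi> (Diff X n x)" if "x \<in> carrier (Ob X n)" for x
      using fun_cong[OF \<psi>(2), of x] that by simp
    then show "\<exists>\<psi>. rlinear R (Ob X (n + 1)) P \<psi> \<and> (\<forall>x\<in>carrier (Ob X n). \<phi> x = \<psi> (Diff X n x))"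
      using \<psi>(1) by (auto simp: rhom_iff)
  next
    fix n \<phi>
    assume "\<phi> \<in> Hom_complex_Diff X (- n - 1) ` rhom R (Ob X (n + 1)) P"
    then obtain \<psi> where \<psi>: "rlinear R (Ob X (n + 1)) P \<psi>" "\<phi> = restrict (\<lambda>x. \<psi> (Diff X n x)) (carrier (Ob X n))"
      by (auto simp: D rhom_iff)
    have "\<phi> \<in> rhom R (Ob X n) P" unfolding \<psi>(2)
      by (rule restrict_rhom[OF complex_module(2)[OF X] rlinear_comp[OF \<psi>(1) complex_Diff[OF X refl]]])
    moreover have "\<phi> (Diff X (n - 1) x) = \<zero>\<^bsub>P\<^esub>" if "x \<in> carrier (Ob X (n - 1))" for x
      using that rlinear_simps(5)[OF \<psi>(1) complex_module(2)[OF X] P] by (simp add: \<psi>(2) simps)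
    ultimately show "\<phi> \<in> {\<phi> \<in> rhom R (Ob X n) P. Hom_complex_Diff X (- n) \<phi> = \<zero>\<^bsub>Hom_complex_Ob R X P (1 - n)\<^esub>}"
      by (auto simp: D' z intro!: restrict_ext)
  next
    fix n \<phi>
    assume R: "\<forall>\<phi>. rlinear R (Ob X n) P \<phi> \<longrightarrow> (\<forall>y\<in>carrier (Ob X (n - 1)). \<phi> (Diff X (n - 1) y) = \<zero>\<^bsub>P\<^esub>) \<longrightarrow>
      (\<exists>\<psi>. rlinear R (Ob X (n + 1)) P \<psi> \<and> (\<forall>x\<in>carrier (Ob X n). \<phi> x = \<psi> (Diff X n x)))"
      and "\<phi> \<in> {\<phi> \<in> rhom R (Ob X n) P. Hom_complex_Diff X (- n) \<phi> = \<zero>\<^bsub>Hom_complex_Ob R X P (1 - n)\<^esub>}"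
    then have \<phi>: "\<phi> \<in> rhom R (Ob X n) P" and k: "restrict (\<lambda>x. \<phi> (Diff X (n - 1) x)) (carrier (Ob X (n - 1)))
        = restrict (\<lambda>x. \<zero>\<^bsub>P\<^esub>) (carrier (Ob X (n - 1)))"
      by (simp_all add: D' z)
    have "\<phi> (Diff X (n - 1) y) = \<zero>\<^bsub>P\<^esub>" if "y \<in> carrier (Ob X (n - 1))" for y
      using fun_cong[OF k, of y] that by simp
    then obtain \<psi> where \<psi>: "rlinear R (Ob X (n + 1)) P \<psi>" "\<forall>x\<in>carrier (Ob X n). \<phi> x = \<psi> (Diff X n x)"
      using R \<phi> unfolding rhom_iff by blast
    let ?\<psi> = "restrict \<psi> (carrier (Ob X (n + 1)))"
    have r: "?\<psi> \<in> rhom R (Ob X (n + 1)) P" by (rule restrict_rhom[OF complex_module(2)[OF X] \<psi>(1)])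
    have "\<phi> = Hom_complex_Diff X (- n - 1) ?\<psi>"
      using \<phi> \<psi>(2) by (intro ext) (auto simp: D rhom_iff extensional_def simps)
    then show "\<phi> \<in> Hom_complex_Diff X (- n - 1) ` rhom R (Ob X (n + 1)) P" using r by blast
  qed
  finally show ?thesis .
qed

lemma totally_acyclic_iff:
  fixes X :: "('r, 'u) cochain_complex"
  shows "X \<in> totally_acyclic R \<longleftrightarrow> X \<in> complexes R \<and> (\<forall>n. projective R (Ob X n)) \<and>
    (\<forall>n. \<forall>x\<in>carrier (Ob X n). Diff X n x = \<zero>\<^bsub>Ob X (n + 1)\<^esub> \<longrightarrow> (\<exists>y\<in>carrier (Ob X (n - 1)). Diff X (n - 1) y = x)) \<and>
    (\<forall>(P :: ('r, 'u) module) n \<phi>. projective R P \<longrightarrow> rlinear R (Ob X n) P \<phi> \<longrightarrow>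
      (\<forall>y\<in>carrier (Ob X (n - 1)). \<phi> (Diff X (n - 1) y) = \<zero>\<^bsub>P\<^esub>) \<longrightarrow>
      (\<exists>\<psi>. rlinear R (Ob X (n + 1)) P \<psi> \<and> (\<forall>x\<in>carrier (Ob X n). \<phi> x = \<psi> (Diff X n x))))"
proof -
  have e: "exact_complex (Ob X) (Diff X) \<longleftrightarrow> (\<forall>n. \<forall>x\<in>carrier (Ob X n). Diff X n x = \<zero>\<^bsub>Ob X (n + 1)\<^esub> \<longrightarrow>
      (\<exists>y\<in>carrier (Ob X (n - 1)). Diff X (n - 1) y = x))" (is "?L \<longleftrightarrow> ?R") if X: "X \<in> complexes R"
  proof
    assume ?L
    show ?R
    proof (intro allI ballI impI)
      fix n x assume "x \<in> carrier (Ob X n)" "Diff X n x = \<zero>\<^bsub>Ob X (n + 1)\<^esub>"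
      then have "x \<in> Diff X (n - 1) ` carrier (Ob X (n - 1))"
        using \<open>?L\<close>[unfolded exact_complex_def, rule_format, of "n - 1"] by simp
      then show "\<exists>y\<in>carrier (Ob X (n - 1)). Diff X (n - 1) y = x" by blast
    qed
  next
    assume r: ?R
    show ?L unfolding exact_complex_def
    proof
      fix n
      show "Diff X n ` carrier (Ob X n) = {x \<in> carrier (Ob X (n + 1)). Diff X (n + 1) x = \<zero>\<^bsub>Ob X (n + 1 + 1)\<^esub>}"
        using r[rule_format, of _ "n + 1"] by (force simp: complex_simps[OF X])
    qed
  qed
  have pr: "right_module R P" if "projective R P" for P :: "('r, 'u) module"
    using that by (simp add: projective_def rmodulesD)
  show ?thesis
  proof (cases "X \<in> complexes R")
    case True
    then show ?thesis
      using pr by (simp add: totally_acyclic_def e Hom_complex_exact_iff)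
  qed (simp add: totally_acyclic_def)
qed

lemma totally_acyclic_complex: "X \<in> totally_acyclic R \<Longrightarrow> X \<in> complexes R"
  by (simp add: totally_acyclic_iff)

text \<open>The homotopy gives x = d s x + s d x + b a x (\<open>dec\<close>), which transfers both
  exactness conditions from T to C. Projectivity of the terms is assumed, since homotopy retracts do
  not inherit it.\<close>

lemma totally_acyclic_retract:
  fixes C :: "('r, 'u) cochain_complex"
  assumes C: "C \<in> complexes R" "\<And>n. projective R (Ob C n)" and T: "T \<in> totally_acyclic R"
    and a: "chain_map R C T a" and b: "chain_map R T C b" and h: "heq R C C (\<lambda>n x. x) (\<lambda>n x. b n (a n x))"
  shows "C \<in> totally_acyclic R"
proof -
  have Tc: "T \<in> complexes R" using T by (rule totally_acyclic_complex)
  obtain s where s: "\<And>n. rlinear R (Ob C n) (Ob C (n - 1)) (s n)"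
    "\<And>n x. x \<in> carrier (Ob C n) \<Longrightarrow> x \<ominus>\<^bsub>Ob C n\<^esub> b n (a n x) =
       Diff C (n - 1) (s n x) \<oplus>\<^bsub>Ob C n\<^esub> s (n + 1) (Diff C n x)"
    using h unfolding heq_def null_homotopic_def by blast
  note [simp] = complex_simps[OF C(1)] complex_simps[OF Tc] chain_map_simps[OF a C(1) Tc]
    chain_map_simps[OF b Tc C(1)] homotopy_simps[OF C(1) C(1) s(1)]
  have dec: "x = Diff C (n - 1) (s n x) \<oplus>\<^bsub>Ob C n\<^esub> s (n + 1) (Diff C n x) \<oplus>\<^bsub>Ob C n\<^esub> b n (a n x)"
    if x: "x \<in> carrier (Ob C n)" for n x
  proof -
    have "x = (x \<ominus>\<^bsub>Ob C n\<^esub> b n (a n x)) \<oplus>\<^bsub>Ob C n\<^esub> b n (a n x)"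
      by (rule represents_eq[where G = "Ob C n"],
          (rule represents | (rule represents_atom, simp, simp add: x) | (simp; fail) | simp add: algebra_simps)+)
    then show ?thesis by (simp only: s(2)[OF x])
  qed
  show ?thesis
    unfolding totally_acyclic_iff
  proof (intro conjI allI ballI impI C)
    fix n x assume x: "x \<in> carrier (Ob C n)" and dx: "Diff C n x = \<zero>\<^bsub>Ob C (n + 1)\<^esub>"
    have "Diff T n (a n x) = a (n + 1) (Diff C n x)" using x by simp
    also have "\<dots> = \<zero>\<^bsub>Ob T (n + 1)\<^esub>" by (simp add: dx)
    finally have "Diff T n (a n x) = \<zero>\<^bsub>Ob T (n + 1)\<^esub>" .
    moreover have "a n x \<in> carrier (Ob T n)" using x by simp
    ultimately obtain y where y: "y \<in> carrier (Ob T (n - 1))" "Diff T (n - 1) y = a n x"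
      using T unfolding totally_acyclic_iff by blast
    have "s (n + 1) (Diff C n x) = \<zero>\<^bsub>Ob C n\<^esub>"
      using homotopy_simps(5)[OF C(1) C(1) s(1), of "n + 1"] by (simp add: dx)
    then have "x = Diff C (n - 1) (s n x) \<oplus>\<^bsub>Ob C n\<^esub> b n (a n x)"
      using dec[OF x] x by simp
    also have "b n (a n x) = Diff C (n - 1) (b (n - 1) y)"
      using y chain_map_comm[OF b, of n "n - 1" y] by simp
    finally have "Diff C (n - 1) (s n x \<oplus>\<^bsub>Ob C (n - 1)\<^esub> b (n - 1) y) = x"
      using x y(1) by simp
    then show "\<exists>y\<in>carrier (Ob C (n - 1)). Diff C (n - 1) y = x"
      by (rule bexI) (use x y(1) in simp)
  next
    fix P :: "('r, 'u) module" and n \<phi>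
    assume P: "projective R P" and \<phi>: "rlinear R (Ob C n) P \<phi>"
      and k: "\<forall>y\<in>carrier (Ob C (n - 1)). \<phi> (Diff C (n - 1) y) = \<zero>\<^bsub>P\<^esub>"
    have Pm: "right_module R P" using P by (simp add: projective_def rmodulesD)
    note [simp] = rlinear_simps[OF \<phi> complex_module(2)[OF C(1)] Pm] right_module_simps[OF Pm]
    have "rlinear R (Ob T n) P (\<lambda>x. \<phi> (b n x))" by (rule rlinear_comp[OF \<phi> chain_map_rlinear[OF b]])
    moreover have "\<forall>y\<in>carrier (Ob T (n - 1)). \<phi> (b n (Diff T (n - 1) y)) = \<zero>\<^bsub>P\<^esub>" using k by simp
    ultimately obtain \<psi> where \<psi>: "rlinear R (Ob T (n + 1)) P \<psi>"
      "\<forall>x\<in>carrier (Ob T n). \<phi> (b n x) = \<psi> (Diff T n x)"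
      using T P unfolding totally_acyclic_iff by blast
    show "\<exists>\<psi>. rlinear R (Ob C (n + 1)) P \<psi> \<and> (\<forall>x\<in>carrier (Ob C n). \<phi> x = \<psi> (Diff C n x))"
    proof (intro exI conjI ballI)
      have sl: "rlinear R (Ob C (n + 1)) (Ob C n) (s (n + 1))" using s(1)[of "n + 1"] by simp
      \<comment> \<open>Apply \<phi> to \<open>dec\<close>: the boundary term vanishes, and on T the
        map \<phi> b equals \<psi> d.\<close>
      show "rlinear R (Ob C (n + 1)) P (\<lambda>x. \<phi> (s (n + 1) x) \<oplus>\<^bsub>P\<^esub> \<psi> (a (n + 1) x))"
        by (intro rlinear_add Pm rlinear_comp[OF \<phi> sl] rlinear_comp[OF \<psi>(1) chain_map_rlinear[OF a]])
      fix x assume x: "x \<in> carrier (Ob C n)"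
      have "\<phi> x = \<phi> (Diff C (n - 1) (s n x) \<oplus>\<^bsub>Ob C n\<^esub> s (n + 1) (Diff C n x) \<oplus>\<^bsub>Ob C n\<^esub> b n (a n x))"
        using dec[OF x] by simp
      also have "\<dots> = \<phi> (s (n + 1) (Diff C n x)) \<oplus>\<^bsub>P\<^esub> \<psi> (a (n + 1) (Diff C n x))"
        using x k \<psi>(2) by simp
      finally show "\<phi> x = \<phi> (s (n + 1) (Diff C n x)) \<oplus>\<^bsub>P\<^esub> \<psi> (a (n + 1) (Diff C n x))" .
    qed
  qed
qed

lemma totally_acyclic_shift:
  fixes T :: "('r, 'u) cochain_complex"
  assumes T: "T \<in> totally_acyclic R" and k: "odd k"
  shows "shift k T \<in> totally_acyclic R"
proof -
  have Tc: "T \<in> complexes R" using T by (rule totally_acyclic_complex)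
  note [simp] = complex_simps[OF Tc] k
  show ?thesis
    unfolding totally_acyclic_iff
  proof (intro conjI allI ballI impI shift_complex Tc k)
    fix n show "projective R (Ob (shift k T) n)" using T by (simp add: totally_acyclic_iff)
  next
    fix n x assume "x \<in> carrier (Ob (shift k T) n)" "Diff (shift k T) n x = \<zero>\<^bsub>Ob (shift k T) (n + 1)\<^esub>"
    moreover have idx: "n + 1 - k = n - k + 1" "n - 1 - k = n - k - 1" by simp_all
    ultimately have x: "x \<in> carrier (Ob T (n - k))" "\<ominus>\<^bsub>Ob T (n - k + 1)\<^esub> Diff T (n - k) x = \<zero>\<^bsub>Ob T (n - k + 1)\<^esub>"
      by (simp_all add: shift_Diff)
    have "Diff T (n - k) x = \<ominus>\<^bsub>Ob T (n - k + 1)\<^esub> (\<ominus>\<^bsub>Ob T (n - k + 1)\<^esub> Diff T (n - k) x)" using x(1) by simp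
    also have "\<dots> = \<zero>\<^bsub>Ob T (n - k + 1)\<^esub>" by (simp only: x(2)) simp
    finally obtain y where "y \<in> carrier (Ob T (n - k - 1))" "Diff T (n - k - 1) y = x"
      using x(1) T unfolding totally_acyclic_iff by blast
    then show "\<exists>y\<in>carrier (Ob (shift k T) (n - 1)). Diff (shift k T) (n - 1) y = x"
      by (intro bexI[of _ "\<ominus>\<^bsub>Ob T (n - k - 1)\<^esub> y"]) (auto simp: shift_Diff idx)
  next
    fix P :: "('r, 'u) module" and n \<phi>
    assume P: "projective R P" and \<phi>: "rlinear R (Ob (shift k T) n) P \<phi>"
      and z: "\<forall>y\<in>carrier (Ob (shift k T) (n - 1)). \<phi> (Diff (shift k T) (n - 1) y) = \<zero>\<^bsub>P\<^esub>"
    have idx: "n + 1 - k = n - k + 1" "n - 1 - k = n - k - 1" by simp_all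
    have Pm: "right_module R P" using P by (simp add: projective_def rmodulesD)
    have \<phi>': "rlinear R (Ob T (n - k)) P \<phi>" using \<phi> by simp
    have "\<phi> (Diff T (n - k - 1) y) = \<zero>\<^bsub>P\<^esub>" if y: "y \<in> carrier (Ob T (n - k - 1))" for y
      using z[rule_format, of "\<ominus>\<^bsub>Ob T (n - k - 1)\<^esub> y"] y by (simp add: shift_Diff idx)
    then obtain \<psi> where \<psi>: "rlinear R (Ob T (n - k + 1)) P \<psi>"
      "\<forall>x\<in>carrier (Ob T (n - k)). \<phi> x = \<psi> (Diff T (n - k) x)"
      using T P \<phi>' unfolding totally_acyclic_iff by blast
    note [simp] = rlinear_simps[OF \<psi>(1) complex_module(2)[OF Tc] Pm] right_module_simps[OF Pm]
    show "\<exists>\<psi>. rlinear R (Ob (shift k T) (n + 1)) P \<psi> \<and>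
        (\<forall>x\<in>carrier (Ob (shift k T) n). \<phi> x = \<psi> (Diff (shift k T) n x))"
      by (intro exI[of _ "\<lambda>x. \<ominus>\<^bsub>P\<^esub> \<psi> x"] conjI ballI)
        (use \<psi>(2) in \<open>auto simp: shift_Diff idx intro: rlinear_uminus[OF Pm \<psi>(1)]\<close>)
  qed
qed

section \<open>Submodules, and complexes concentrated in one degree\<close>

lemma submodule_right_module:
  assumes M: "right_module R M" and H: "H \<subseteq> carrier M" "\<zero>\<^bsub>M\<^esub> \<in> H"
    "\<And>x y. x \<in> H \<Longrightarrow> y \<in> H \<Longrightarrow> x \<oplus>\<^bsub>M\<^esub> y \<in> H"
    "\<And>a x. a \<in> carrier R \<Longrightarrow> x \<in> H \<Longrightarrow> a \<odot>\<^bsub>M\<^esub> x \<in> H"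
    "\<And>x. x \<in> H \<Longrightarrow> \<ominus>\<^bsub>M\<^esub> x \<in> H"
  shows "right_module R (M\<lparr>carrier := H\<rparr>)"
proof -
  interpret M: right_module R M by fact
  have "abelian_group (M\<lparr>carrier := H\<rparr>)"
  proof (rule abelian_groupI)
    fix x assume "x \<in> carrier (M\<lparr>carrier := H\<rparr>)"
    then have x: "x \<in> H" by simp
    then have "x \<in> carrier M" using H(1) by blast
    with x show "\<exists>y\<in>carrier (M\<lparr>carrier := H\<rparr>). y \<oplus>\<^bsub>M\<lparr>carrier := H\<rparr>\<^esub> x = \<zero>\<^bsub>M\<lparr>carrier := H\<rparr>\<^esub>"
      using H(1) by (intro bexI[of _ "\<ominus>\<^bsub>M\<^esub> x"]) (auto simp: H M.M.l_neg)
  qed (use H subsetD[OF H(1)] M.M.a_ac M.M.l_zero in auto)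
  then interpret S: abelian_group "M\<lparr>carrier := H\<rparr>" .
  show ?thesis
    by unfold_locales
      (use H subsetD[OF H(1)] M.smult_l_distr M.smult_r_distr M.smult_assoc M.smult_one in auto)
qed

text \<open>The zero modules are taken as the zero submodule of P, so that all degrees share the
  operations of P and one zero element.\<close>

definition sphere_complex :: "int \<Rightarrow> ('r, 'u) module \<Rightarrow> ('r, 'u) cochain_complex" where
  "sphere_complex n P = \<lparr>
     Ob = (\<lambda>k. if k = n then P else P\<lparr>carrier := {\<zero>\<^bsub>P\<^esub>}\<rparr>),
     Diff = (\<lambda>k. \<lambda>x\<in>(if k = n then carrier P else {\<zero>\<^bsub>P\<^esub>}). \<zero>\<^bsub>P\<^esub>)\<rparr>"

lemma sphere_complex_simps [simp]:
  "Ob (sphere_complex n P) n = P"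
  "k \<noteq> n \<Longrightarrow> Ob (sphere_complex n P) k = P\<lparr>carrier := {\<zero>\<^bsub>P\<^esub>}\<rparr>"
  "\<zero>\<^bsub>Ob (sphere_complex n P) k\<^esub> = \<zero>\<^bsub>P\<^esub>" "(\<oplus>\<^bsub>Ob (sphere_complex n P) k\<^esub>) = (\<oplus>\<^bsub>P\<^esub>)"
  "x \<in> carrier (Ob (sphere_complex n P) k) \<Longrightarrow> Diff (sphere_complex n P) k x = \<zero>\<^bsub>P\<^esub>"
  by (auto simp: sphere_complex_def split: if_splits)

lemma sphere_complex_complex:
  assumes "(P :: ('r, 'u) module) \<in> rmodules R"
  shows "sphere_complex n P \<in> complexes R"
proof -
  have P: "right_module R P" using assms by (rule rmodulesD)
  note s = right_module_simps[OF P]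
  have Z: "right_module R (P\<lparr>carrier := {\<zero>\<^bsub>P\<^esub>}\<rparr>)"
    by (rule submodule_right_module[OF P]) (use s in auto)
  have "small TYPE('u) {\<zero>\<^bsub>P\<^esub>}"
    by (rule small_subset[of _ "carrier P"]) (use assms s in \<open>auto simp: rmodules_def\<close>)
  then have O: "Ob (sphere_complex n P) k \<in> rmodules R" for k
    using assms Z by (cases "k = n") (auto simp: rmodules_def)
  have "Diff (sphere_complex n P) k \<in> rhom R (Ob (sphere_complex n P) k) (Ob (sphere_complex n P) (k + 1))" for k
  proof -
    have c: "\<zero>\<^bsub>P\<^esub> \<in> carrier (Ob (sphere_complex n P) k)" for k
      using s by (cases "k = n") auto
    have "rlinear R (Ob (sphere_complex n P) k) (Ob (sphere_complex n P) (k + 1)) (\<lambda>x. \<zero>\<^bsub>P\<^esub>)"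
      using rlinear_const_zero[OF rmodulesD[OF O[of "k + 1"]]] by simp
    from restrict_rhom[OF rmodulesD[OF O] this] show ?thesis
      by (auto simp: sphere_complex_def)
  qed
  moreover have "Diff (sphere_complex n P) (k + 1) (Diff (sphere_complex n P) k x) = \<zero>\<^bsub>Ob (sphere_complex n P) (k + 1 + 1)\<^esub>"
    if "x \<in> carrier (Ob (sphere_complex n P) k)" for k x
  proof -
    have "\<zero>\<^bsub>P\<^esub> \<in> carrier (Ob (sphere_complex n P) (k + 1))"
      using s by (cases "k + 1 = n") auto
    then show ?thesis using that by simp
  qed
  ultimately show ?thesis using O by (simp add: complexes_def)
qed

lemma chain_map_to_sphere_complex:
  assumes X: "X \<in> complexes R" and P: "P \<in> rmodules R"
    and \<phi>: "rlinear R (Ob X n) P \<phi>"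
    and z: "\<forall>y\<in>carrier (Ob X (n - 1)). \<phi> (Diff X (n - 1) y) = \<zero>\<^bsub>P\<^esub>"
  shows "chain_map R X (sphere_complex n P) (\<lambda>k. if k = n then \<phi> else (\<lambda>x. \<zero>\<^bsub>P\<^esub>))"
    (is "chain_map R X ?S ?f")
proof -
  have S: "?S \<in> complexes R" by (rule sphere_complex_complex[OF P])
  have l: "rlinear R (Ob X k) (Ob ?S k) (?f k)" for k
    using \<phi> rlinear_const_zero[OF complex_module(2)[OF S, of k], of "Ob X k"] by (cases "k = n") simp_all
  show ?thesis
    unfolding chain_map_def
  proof (intro conjI allI ballI l)
    fix k x assume x: "x \<in> carrier (Ob X k)"
    have "?f k x \<in> carrier (Ob ?S k)" by (rule rlinear_closed[OF l x])
    moreover have "\<phi> (Diff X k x) = \<zero>\<^bsub>P\<^esub>" if "k + 1 = n"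
    proof -
      have "n - 1 = k" using that by simp
      then show ?thesis using z x by simp
    qed
    ultimately show "?f (k + 1) (Diff X k x) = Diff ?S k (?f k x)" by (subst sphere_complex_simps(5)) auto
  qed
qed

text \<open>A chain map from X to P in degree n is a map on X^n vanishing on boundaries, and a null
  homotopy is a map on X^(n+1). Acyclicity of Hom(X, P) thus becomes an instance of orthogonality,
  accessible to the arguments about cells.\<close>

lemma orth_sphere_complex_iff:
  assumes X: "X \<in> complexes R" and P: "P \<in> rmodules R"
  shows "orth R X (sphere_complex n P) \<longleftrightarrow>
    (\<forall>\<phi>. rlinear R (Ob X n) P \<phi> \<longrightarrow> (\<forall>y\<in>carrier (Ob X (n - 1)). \<phi> (Diff X (n - 1) y) = \<zero>\<^bsub>P\<^esub>) \<longrightarrow>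
      (\<exists>\<psi>. rlinear R (Ob X (n + 1)) P \<psi> \<and> (\<forall>x\<in>carrier (Ob X n). \<phi> x = \<psi> (Diff X n x))))"
proof (intro iffI allI impI)
  let ?S = "sphere_complex n P"
  have S: "?S \<in> complexes R" by (rule sphere_complex_complex[OF P])
  have Pm: "right_module R P" using P by (rule rmodulesD)
  note [simp] = complex_simps[OF X] right_module_simps[OF Pm]
  {
    fix \<phi> assume o: "orth R X ?S" and \<phi>: "rlinear R (Ob X n) P \<phi>"
      and z: "\<forall>y\<in>carrier (Ob X (n - 1)). \<phi> (Diff X (n - 1) y) = \<zero>\<^bsub>P\<^esub>"
    let ?f = "\<lambda>k. if k = n then \<phi> else (\<lambda>x. \<zero>\<^bsub>P\<^esub>)"
    note chain_map_to_sphere_complex[OF X P \<phi> z]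
    from orthD[OF o this] obtain s where s: "\<And>k. rlinear R (Ob X k) (Ob ?S (k - 1)) (s k)"
      "\<And>k x. x \<in> carrier (Ob X k) \<Longrightarrow> ?f k x = Diff ?S (k - 1) (s k x) \<oplus>\<^bsub>Ob ?S k\<^esub> s (k + 1) (Diff X k x)"
      using null_homotopicE by blast
    have sl: "rlinear R (Ob X (n + 1)) P (s (n + 1))" using s(1)[of "n + 1"] by simp
    have "\<phi> x = s (n + 1) (Diff X n x)" if x: "x \<in> carrier (Ob X n)" for x
      using s(2)[OF x] x rlinear_closed[OF s(1) x] rlinear_closed[OF sl] by simp
    then show "\<exists>\<psi>. rlinear R (Ob X (n + 1)) P \<psi> \<and> (\<forall>x\<in>carrier (Ob X n). \<phi> x = \<psi> (Diff X n x))"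
      using sl by blast
  }
  assume h: "\<forall>\<phi>. rlinear R (Ob X n) P \<phi> \<longrightarrow> (\<forall>y\<in>carrier (Ob X (n - 1)). \<phi> (Diff X (n - 1) y) = \<zero>\<^bsub>P\<^esub>) \<longrightarrow>
      (\<exists>\<psi>. rlinear R (Ob X (n + 1)) P \<psi> \<and> (\<forall>x\<in>carrier (Ob X n). \<phi> x = \<psi> (Diff X n x)))"
  show "orth R X ?S"
    unfolding orth_def
  proof (intro allI impI)
    fix f assume f: "chain_map R X ?S f"
    have fl: "rlinear R (Ob X k) (Ob ?S k) (f k)" for k by (rule chain_map_rlinear[OF f])
    have fn: "rlinear R (Ob X n) P (f n)" using fl[of n] by simp
    have "f n (Diff X (n - 1) y) = \<zero>\<^bsub>P\<^esub>" if y: "y \<in> carrier (Ob X (n - 1))" for y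
      using chain_map_comm[OF f, of n "n - 1" y] y rlinear_closed[OF fl y] by simp
    with h fn obtain \<psi> where \<psi>: "rlinear R (Ob X (n + 1)) P \<psi>" "\<forall>x\<in>carrier (Ob X n). f n x = \<psi> (Diff X n x)"
      by blast
    let ?s = "\<lambda>k. if k = n + 1 then \<psi> else (\<lambda>x. \<zero>\<^bsub>P\<^esub>)"
    have l: "rlinear R (Ob X k) (Ob ?S (k - 1)) (?s k)" for k
      using \<psi>(1) rlinear_const_zero[OF complex_module(2)[OF S, of "k - 1"], of "Ob X k"]
      by (cases "k = n + 1") simp_all
    show "null_homotopic R X ?S f"
    proof (rule null_homotopicI[of R X ?S ?s, OF l])
      fix k x assume x: "x \<in> carrier (Ob X k)"
      have "Diff ?S (k - 1) (?s k x) = \<zero>\<^bsub>P\<^esub>" by (rule sphere_complex_simps(5)[OF rlinear_closed[OF l x]])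
      moreover have "f k x = \<zero>\<^bsub>P\<^esub>" if "k \<noteq> n" using rlinear_closed[OF fl x] that by simp
      moreover have "\<psi> (Diff X n x) \<in> carrier P" if "k = n" using rlinear_closed[OF \<psi>(1)] x that by simp
      ultimately show "f k x = Diff ?S (k - 1) (?s k x) \<oplus>\<^bsub>Ob ?S k\<^esub> ?s (k + 1) (Diff X k x)"
        using \<psi>(2) x by (cases "k = n") simp_all
    qed
  qed
qed


section \<open>Consequences of the existence of cellular approximations\<close>

definition perp :: "('r, 'k) ring_scheme \<Rightarrow> ('r, 'u) cochain_complex set" where
  "perp R = {Q \<in> complexes R. \<forall>T\<in>totally_acyclic R. orth R T Q}"

lemma perp_complex: "Q \<in> perp R \<Longrightarrow> Q \<in> complexes R"
  by (simp add: perp_def)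

lemma perp_orth: "Q \<in> perp R \<Longrightarrow> T \<in> totally_acyclic R \<Longrightarrow> orth R T Q"
  by (simp add: perp_def)

lemma perp_shift:
  assumes Q: "Q \<in> perp R" and k: "odd k"
  shows "shift k Q \<in> perp R"
proof -
  have "orth R T (shift k Q)" if T: "T \<in> totally_acyclic R" for T
  proof -
    have T': "shift (- k) T \<in> totally_acyclic R" using totally_acyclic_shift[OF T, of "- k"] k by simp
    have "shift k (shift (- k) T) = T"
      using shift_shift[OF totally_acyclic_complex[OF T], of "- k" k] k by simp
    moreover have "orth R (shift k (shift (- k) T)) (shift k Q)"
      using orth_shift_iff[OF totally_acyclic_complex[OF T'] perp_complex[OF Q] k] perp_orth[OF Q T'] by blast
    ultimately show ?thesis by simp
  qed
  then show ?thesis using shift_complex[OF perp_complex[OF Q] k] by (simp add: perp_def)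
qed

lemma perp_Hom: "Q \<in> perp R \<Longrightarrow> T \<in> totally_acyclic R \<Longrightarrow> F \<in> Hom (K_Mod R) T Q \<Longrightarrow> F = zero_hom R T Q"
  using orth_iff_Hom[of T R Q] perp_orth[of Q R T] perp_complex[of Q R] totally_acyclic_complex[of T R] by auto

text \<open>Hom(F, Q) is bijective for every Q in \<open>perp\<close>; injectivity is stated at
  zero. Between complexes of projectives this will describe the morphisms with totally acyclic cone,
  and closure under composition is immediate in this form.\<close>

definition perp_iso :: "('r, 'k) ring_scheme \<Rightarrow> ('r, 'u) cochain_complex \<Rightarrow>
    ('r, 'u) cochain_complex \<Rightarrow> (int \<Rightarrow> 'u \<Rightarrow> 'u) set \<Rightarrow> bool" where
  "perp_iso R X Y F \<longleftrightarrow> F \<in> Hom (K_Mod R) X Y \<and> (\<forall>Q\<in>perp R.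
     (\<forall>H\<in>Hom (K_Mod R) Y Q. Comp (K_Mod R) X Y Q H F = zero_hom R X Q \<longrightarrow> H = zero_hom R Y Q) \<and>
     (\<forall>H\<in>Hom (K_Mod R) X Q. \<exists>L\<in>Hom (K_Mod R) Y Q. H = Comp (K_Mod R) X Y Q L F))"

lemma perp_iso_comp:
  assumes XYZ: "X \<in> complexes R" "Y \<in> complexes R" "Z \<in> complexes R"
    and F: "perp_iso R X Y F" and G: "perp_iso R Y Z G"
  shows "perp_iso R X Z (Comp (K_Mod R) X Y Z G F)"
proof -
  have FG: "F \<in> Hom (K_Mod R) X Y" "G \<in> Hom (K_Mod R) Y Z" using F G by (auto simp: perp_iso_def)
  show ?thesis
    unfolding perp_iso_def
  proof (intro conjI ballI impI Comp_in_Hom XYZ FG)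
    fix Q H assume Q: "Q \<in> perp R" and H: "H \<in> Hom (K_Mod R) Z Q"
      and z: "Comp (K_Mod R) X Z Q H (Comp (K_Mod R) X Y Z G F) = zero_hom R X Q"
    have "Comp (K_Mod R) X Y Q (Comp (K_Mod R) Y Z Q H G) F = zero_hom R X Q"
      using z by (simp add: Comp_assoc[OF XYZ perp_complex[OF Q] FG H])
    then have "Comp (K_Mod R) Y Z Q H G = zero_hom R Y Q"
      using F Q Comp_in_Hom[OF XYZ(2,3) perp_complex[OF Q] FG(2) H] unfolding perp_iso_def by blast
    then show "H = zero_hom R Z Q" using G Q H unfolding perp_iso_def by blast
  next
    fix Q H assume Q: "Q \<in> perp R" and H: "H \<in> Hom (K_Mod R) X Q"
    then obtain L where L: "L \<in> Hom (K_Mod R) Y Q" "H = Comp (K_Mod R) X Y Q L F"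
      using F unfolding perp_iso_def by blast
    then obtain M where M: "M \<in> Hom (K_Mod R) Z Q" "L = Comp (K_Mod R) Y Z Q M G"
      using G Q unfolding perp_iso_def by blast
    have "H = Comp (K_Mod R) X Z Q M (Comp (K_Mod R) X Y Z G F)"
      using L M by (simp add: Comp_assoc[OF XYZ perp_complex[OF Q] FG M(1)])
    then show "\<exists>L\<in>Hom (K_Mod R) Z Q. H = Comp (K_Mod R) X Z Q L (Comp (K_Mod R) X Y Z G F)"
      using M by blast
  qed
qed

text \<open>This stands in for the additive structure of the Hom-sets: the difference D of H and H'
  becomes zero under composition on either side exactly when the two composites agree.\<close>

lemma Hom_difference:
  assumes YQ: "Y \<in> complexes R" "Q \<in> complexes R"
    and H: "H \<in> Hom (K_Mod R) Y Q" "H' \<in> Hom (K_Mod R) Y Q"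
  obtains D where "D \<in> Hom (K_Mod R) Y Q" "D = zero_hom R Y Q \<longleftrightarrow> H = H'"
    "\<And>X F. X \<in> complexes R \<Longrightarrow> F \<in> Hom (K_Mod R) X Y \<Longrightarrow>
      Comp (K_Mod R) X Y Q D F = zero_hom R X Q \<longleftrightarrow> Comp (K_Mod R) X Y Q H F = Comp (K_Mod R) X Y Q H' F"
    "\<And>W G. W \<in> complexes R \<Longrightarrow> G \<in> Hom (K_Mod R) Q W \<Longrightarrow>
      Comp (K_Mod R) Y Q W G D = zero_hom R Y W \<longleftrightarrow> Comp (K_Mod R) Y Q W G H = Comp (K_Mod R) Y Q W G H'"
proof -
  obtain h where h: "chain_map R Y Q h" "H = cls R Y Q h" using HomE[OF H(1) YQ] .
  obtain h' where h': "chain_map R Y Q h'" "H' = cls R Y Q h'" using HomE[OF H(2) YQ] .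
  let ?d = "\<lambda>n x. h n x \<ominus>\<^bsub>Ob Q n\<^esub> h' n x"
  have d: "chain_map R Y Q ?d" by (rule chain_map_diff[OF YQ h(1) h'(1)])
  show thesis
  proof (rule that[of "cls R Y Q ?d"])
    show "cls R Y Q ?d \<in> Hom (K_Mod R) Y Q" by (rule cls_in_Hom[OF YQ d])
    show "cls R Y Q ?d = zero_hom R Y Q \<longleftrightarrow> H = H'"
      by (simp add: cls_eq_zero[OF YQ d] h(2) h'(2) cls_eq_iff[OF YQ h(1) h'(1)] heq_def)
  next
    fix X F assume X: "X \<in> complexes R" and F: "F \<in> Hom (K_Mod R) X Y"
    obtain f where f: "chain_map R X Y f" "F = cls R X Y f" using HomE[OF F X YQ(1)] .
    show "Comp (K_Mod R) X Y Q (cls R Y Q ?d) F = zero_hom R X Q \<longleftrightarrow>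
        Comp (K_Mod R) X Y Q H F = Comp (K_Mod R) X Y Q H' F"
      unfolding f(2) h(2) h'(2) Comp_K_Mod[OF X YQ f(1) d] Comp_K_Mod[OF X YQ f(1) h(1)]
        Comp_K_Mod[OF X YQ f(1) h'(1)] cls_eq_zero[OF X YQ(2) chain_map_comp[OF d f(1)]]
        cls_eq_iff[OF X YQ(2) chain_map_comp[OF h(1) f(1)] chain_map_comp[OF h'(1) f(1)]] heq_def ..
  next
    fix W G assume W: "W \<in> complexes R" and G: "G \<in> Hom (K_Mod R) Q W"
    obtain g where g: "chain_map R Q W g" "G = cls R Q W g" using HomE[OF G YQ(2) W] .
    have "null_homotopic R Y W (\<lambda>n x. g n (?d n x)) \<longleftrightarrow>
      null_homotopic R Y W (\<lambda>n x. g n (h n x) \<ominus>\<^bsub>Ob W n\<^esub> g n (h' n x))"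
      using chain_map_simps[OF g(1) YQ(2) W] chain_map_simps(1)[OF h(1) YQ] chain_map_simps(1)[OF h'(1) YQ]
      by (intro iffI; elim null_homotopic_cong) simp_all
    then show "Comp (K_Mod R) Y Q W G (cls R Y Q ?d) = zero_hom R Y W \<longleftrightarrow>
        Comp (K_Mod R) Y Q W G H = Comp (K_Mod R) Y Q W G H'"
      unfolding g(2) h(2) h'(2) Comp_K_Mod[OF YQ W d g(1)] Comp_K_Mod[OF YQ W h(1) g(1)]
        Comp_K_Mod[OF YQ W h'(1) g(1)] cls_eq_zero[OF YQ(1) W chain_map_comp[OF g(1) d]]
        cls_eq_iff[OF YQ(1) W chain_map_comp[OF g(1) h(1)] chain_map_comp[OF g(1) h'(1)]] heq_def .
  qed
qed

lemma perp_iso_cancel: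
  assumes XY: "X \<in> complexes R" "Y \<in> complexes R" and F: "perp_iso R X Y F" and Q: "Q \<in> perp R"
    and H: "H \<in> Hom (K_Mod R) Y Q" "H' \<in> Hom (K_Mod R) Y Q"
    and eq: "Comp (K_Mod R) X Y Q H F = Comp (K_Mod R) X Y Q H' F"
  shows "H = H'"
proof -
  have F': "F \<in> Hom (K_Mod R) X Y" using F by (simp add: perp_iso_def)
  obtain D where D: "D \<in> Hom (K_Mod R) Y Q" "D = zero_hom R Y Q \<longleftrightarrow> H = H'"
    "Comp (K_Mod R) X Y Q D F = zero_hom R X Q \<longleftrightarrow> Comp (K_Mod R) X Y Q H F = Comp (K_Mod R) X Y Q H' F"
    using Hom_difference[OF XY(2) perp_complex[OF Q] H] XY(1) F' by metis
  then show ?thesis using eq F Q unfolding perp_iso_def by blast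
qed

context module_universe
begin

lemma Mor_perp_iso:
  fixes X Y :: "('r, 'u) cochain_complex"
  assumes m: "(X, F, Y) \<in> Mor R (totally_acyclic R)"
  shows "perp_iso R X Y F"
proof -
  have F: "F \<in> Hom (K_Mod R) X Y" using m by (simp add: Mor_def)
  have "totally_acyclic R \<subseteq> complexes R" using totally_acyclic_complex by blast
  from Mor_cone[OF this m] obtain Z where Z: "Z \<in> totally_acyclic R"
    "\<And>Q H. Q \<in> complexes R \<Longrightarrow> orth R Z Q \<Longrightarrow> H \<in> Hom (K_Mod R) Y Q \<Longrightarrow>
       Comp (K_Mod R) X Y Q H F = zero_hom R X Q \<Longrightarrow> H = zero_hom R Y Q"
    "\<And>Q H. Q \<in> complexes R \<Longrightarrow> orth R Z (shift (-1) Q) \<Longrightarrow> H \<in> Hom (K_Mod R) X Q \<Longrightarrow>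
       \<exists>L\<in>Hom (K_Mod R) Y Q. H = Comp (K_Mod R) X Y Q L F" by blast
  have "orth R Z Q" "orth R Z (shift (-1) Q)" if "Q \<in> perp R" for Q
    using perp_orth[OF that Z(1)] perp_orth[OF perp_shift[OF that, of "-1"] Z(1)] by simp_all
  then show ?thesis using F Z(2,3) perp_complex unfolding perp_iso_def by blast
qed

text \<open>W is the cone of Z -> C shifted back, a homotopy kernel of J. All maps from C and C[-1]
  to \<open>perp\<close> are zero, so W -> Z is bijective on Hom into \<open>perp\<close>. Hence J
  can be killed by passing to another denominator.\<close>

lemma fibre:
  fixes Z C :: "('r, 'u) cochain_complex"
  assumes Z: "Z \<in> complexes R" and C: "C \<in> totally_acyclic R" and J: "J \<in> Hom (K_Mod R) Z C"
  obtains W p where "W \<in> complexes R" "p \<in> Hom (K_Mod R) W Z" "Comp (K_Mod R) W Z C J p = zero_hom R W C"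
    "perp_iso R W Z p" "(\<forall>n. projective R (Ob Z n)) \<Longrightarrow> (\<forall>n. projective R (Ob W n))"
proof -
  have Cc: "C \<in> complexes R" by (rule totally_acyclic_complex[OF C])
  obtain j where j: "chain_map R Z C j" "J = cls R Z C j" using HomE[OF J Z Cc] .
  note ZC = Z Cc
  define S where "S X = shift (-1) X" for X :: "('r, 'u) cochain_complex"
  define E where "E = cone Z C j"
  define P where "P = cls R E (S Z) cproj"
  define I where "I = cls R C E (cinj Z)"
  note t = cone_triangle_complexes[OF ZC j(1), folded E_def S_def]
  note h = cone_triangle_homs[OF ZC j(1), folded E_def S_def, folded P_def I_def j(2)]
  have odd1: "odd (1 :: int)" "odd (-1 :: int)" by auto
  have sS: "S X \<in> complexes R" "shift 1 X \<in> complexes R" "shift 1 (S X) = X" "S (shift 1 X) = X"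
    if "X \<in> complexes R" for X :: "('r, 'u) cochain_complex"
    using that by (simp_all add: S_def shift_complex shift_shift)
  let ?W = "shift 1 E" and ?p = "shift_hom 1 P"
  have p: "?p \<in> Hom (K_Mod R) ?W Z"
    using shift_hom_in_Hom[OF t(1,2) odd1(1) h(3)] by (simp add: sS Z)
  have sp: "shift_hom (-1) ?p = P" by simp
  have z: "Comp (K_Mod R) ?W Z C J ?p = zero_hom R ?W C"
  proof -
    have "shift_hom 1 (Comp (K_Mod R) E (S Z) (S C) (shift_hom (-1) J) P) = zero_hom R ?W C"
      using cone_triangle_zero(2)[OF ZC j(1), folded E_def S_def, folded P_def j(2)]
      by (simp add: shift_hom_zero t sS Cc)
    then show ?thesis
      using shift_hom_Comp[OF t odd1(1) h(3,4)] by (simp add: sS ZC)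
  qed
  have i: "perp_iso R ?W Z ?p"
    unfolding perp_iso_def
  proof (intro conjI ballI impI p)
    fix Q H assume Q: "Q \<in> perp R" and H: "H \<in> Hom (K_Mod R) Z Q"
      and zH: "Comp (K_Mod R) ?W Z Q H ?p = zero_hom R ?W Q"
    note Qc = perp_complex[OF Q]
    have SQ: "S Q \<in> perp R" unfolding S_def by (rule perp_shift[OF Q odd1(2)])
    have SH: "shift_hom (-1) H \<in> Hom (K_Mod R) (S Z) (S Q)"
      unfolding S_def by (rule shift_hom_in_Hom[OF Z Qc odd1(2) H])
    have "Comp (K_Mod R) E (S Z) (S Q) (shift_hom (-1) H) P = shift_hom (-1) (Comp (K_Mod R) ?W Z Q H ?p)"
      using shift_hom_Comp[OF sS(2)[OF t(1)] Z Qc odd1(2) p H] sS(4)[OF t(1)] by (simp add: S_def)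
    also have "\<dots> = zero_hom R E (S Q)"
      unfolding zH shift_hom_zero[OF sS(2)[OF t(1)] Qc odd1(2)] using sS(4)[OF t(1)] by (simp add: S_def)
    finally have "Comp (K_Mod R) E (S Z) (S Q) (shift_hom (-1) H) P = zero_hom R E (S Q)" .
    from cone_triangle_shift[OF ZC j(1) perp_complex[OF SQ], folded E_def S_def, folded P_def j(2), OF SH this]
    obtain K where K: "K \<in> Hom (K_Mod R) (S C) (S Q)"
      "shift_hom (-1) H = Comp (K_Mod R) (S Z) (S C) (S Q) K (shift_hom (-1) J)" by blast
    have "K = zero_hom R (S C) (S Q)"
      using perp_Hom[OF SQ _ K(1)] totally_acyclic_shift[OF C odd1(2)] by (simp add: S_def)
    then have "shift_hom (-1) H = zero_hom R (S Z) (S Q)"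
      using K(2) Comp_zero(1)[OF t(2,3) perp_complex[OF SQ] h(4)] by simp
    then have "shift_hom 1 (shift_hom (-1) H) = zero_hom R Z Q"
      using shift_hom_zero[OF t(2) perp_complex[OF SQ] odd1(1)] by (simp add: sS Z Qc)
    then show "H = zero_hom R Z Q" by simp
  next
    fix Q B assume Q: "Q \<in> perp R" and B: "B \<in> Hom (K_Mod R) ?W Q"
    note Qc = perp_complex[OF Q]
    have SQ: "S Q \<in> perp R" unfolding S_def by (rule perp_shift[OF Q odd1(2)])
    have SB: "shift_hom (-1) B \<in> Hom (K_Mod R) E (S Q)"
      using shift_hom_in_Hom[OF sS(2)[OF t(1)] Qc odd1(2) B] sS(4)[OF t(1)] by (simp add: S_def)
    have "Comp (K_Mod R) C E (S Q) (shift_hom (-1) B) I = zero_hom R C (S Q)"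
      by (rule perp_Hom[OF SQ C Comp_in_Hom[OF Cc t(1) perp_complex[OF SQ] h(2) SB]])
    from cone_triangle_factor[OF ZC j(1) perp_complex[OF SQ], folded E_def S_def, folded P_def I_def, OF SB this]
    obtain V where V: "V \<in> Hom (K_Mod R) (S Z) (S Q)"
      "shift_hom (-1) B = Comp (K_Mod R) E (S Z) (S Q) V P" by blast
    have "B = shift_hom 1 (Comp (K_Mod R) E (S Z) (S Q) V P)" by (simp add: V(2)[symmetric])
    also have "\<dots> = Comp (K_Mod R) ?W Z Q (shift_hom 1 V) ?p"
      using shift_hom_Comp[OF t(1,2) perp_complex[OF SQ] odd1(1) h(3) V(1)] by (simp add: sS Z Qc)
    finally show "\<exists>L\<in>Hom (K_Mod R) Z Q. B = Comp (K_Mod R) ?W Z Q L ?p"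
      using shift_hom_in_Hom[OF t(2) perp_complex[OF SQ] odd1(1) V(1)] by (auto simp: sS Z Qc)
  qed
  have "\<forall>n. projective R (Ob ?W n)" if "\<forall>n. projective R (Ob Z n)"
    using that C by (auto simp: E_def totally_acyclic_iff intro: projective_direct_sum)
  then show thesis using that[OF sS(2)[OF t(1)] p z i] by blast
qed

end

text \<open>What the cellular construction has to supply. The cone in \<open>perp\<close> governs
  the homotopy category; the factorization holds on the nose, as precovers in the category of
  complexes require.\<close>

locale approximation_universe = module_universe R U
  for R :: "('r, 'k) ring_scheme" and U :: "'u itself" +
  assumes approximation: "\<And>M. M \<in> complexes R \<Longrightarrow>
    \<exists>T\<in>totally_acyclic R. \<exists>g. chain_map R T M g \<and> cone T (M :: ('r, 'u) cochain_complex) g \<in> perp R \<and>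
      (\<forall>T'\<in>totally_acyclic R. \<forall>\<phi>. chain_map R T' M \<phi> \<longrightarrow>
        (\<exists>\<psi>. chain_map R T' T \<psi> \<and> (\<forall>n. \<forall>x\<in>carrier (Ob T' n). \<phi> n x = g n (\<psi> n x))))"
begin

text \<open>Approximate C by T -> C with cone E. Since C -> E is zero, the identity of C lifts to T
  up to homotopy, so C is a homotopy retract of T.\<close>

lemma totally_acyclicI_orth:
  fixes C :: "('r, 'u) cochain_complex"
  assumes C: "C \<in> complexes R" "\<And>n. projective R (Ob C n)" and o: "\<And>Q. Q \<in> perp R \<Longrightarrow> orth R C Q"
  shows "C \<in> totally_acyclic R"
proof -
  obtain T g where T: "T \<in> totally_acyclic R" and g: "chain_map R T C g" and E: "cone T C g \<in> perp R"
    using approximation[OF C(1)] by blast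
  have Tc: "T \<in> complexes R" by (rule totally_acyclic_complex[OF T])
  note i = cone_triangle_homs(2)[OF Tc C(1) g]
  have "Comp (K_Mod R) C C (cone T C g) (cls R C (cone T C g) (cinj T)) (Id (K_Mod R) C) = zero_hom R C (cone T C g)"
    using o[OF E] i orth_iff_Hom[OF C(1) perp_complex[OF E]] by (simp add: Comp_Id C perp_complex[OF E])
  from cone_triangle_lift[OF Tc C(1) g C(1) Id_in_Hom[OF C(1)] this]
  obtain H where H: "H \<in> Hom (K_Mod R) C T" "Id (K_Mod R) C = Comp (K_Mod R) C T C (cls R T C g) H" by blast
  obtain h where h: "chain_map R C T h" "H = cls R C T h" using HomE[OF H(1) C(1) Tc] .
  have "heq R C C (\<lambda>n x. x) (\<lambda>n x. g n (h n x))"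
    using H(2) unfolding h(2) Id_K_Mod[OF C(1)] Comp_K_Mod[OF C(1) Tc C(1) h(1) g]
      cls_eq_iff[OF C(1) C(1) chain_map_id chain_map_comp[OF g h(1)]] .
  then show ?thesis by (rule totally_acyclic_retract[OF C T h(1) g])
qed

text \<open>A morphism K from the cone to Q vanishes on Y by injectivity of Hom(F, Q), so it factors
  as V P through X[-1]. Surjectivity of Hom(F, Q[1]) writes V as a composite with F[-1], and F[-1] P
  = 0.\<close>

lemma cone_totally_acyclic:
  fixes X Y :: "('r, 'u) cochain_complex"
  assumes X: "X \<in> complexes R" "\<And>n. projective R (Ob X n)" and Y: "Y \<in> complexes R" "\<And>n. projective R (Ob Y n)"
    and f: "chain_map R X Y f" and F: "perp_iso R X Y (cls R X Y f)"
  shows "cone X Y f \<in> totally_acyclic R"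
proof (rule totally_acyclicI_orth)
  note XY = X(1) Y(1)
  define S where "S X = shift (-1) X" for X :: "('r, 'u) cochain_complex"
  define E where "E = cone X Y f"
  define P where "P = cls R E (S X) cproj"
  define I where "I = cls R Y E (cinj X)"
  define F' where "F' = cls R X Y f"
  note t = cone_triangle_complexes[OF XY f, folded E_def S_def]
  note h = cone_triangle_homs[OF XY f, folded E_def S_def, folded P_def I_def F'_def]
  note z = cone_triangle_zero[OF XY f, folded E_def S_def, folded P_def I_def F'_def]
  have odd1: "odd (1 :: int)" "odd (-1 :: int)" by auto
  have sS: "shift 1 (S Z) = Z" "S (shift 1 Z) = Z" if "Z \<in> complexes R" for Z :: "('r, 'u) cochain_complex"
    using that by (simp_all add: S_def shift_shift)
  show "cone X Y f \<in> complexes R" using t(1) by (simp add: E_def)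
  show "projective R (Ob (cone X Y f) n)" for n using X(2) Y(2) by (auto intro: projective_direct_sum)
  fix Q :: "('r, 'u) cochain_complex" assume Q: "Q \<in> perp R"
  note Qc = perp_complex[OF Q]
  have "K = zero_hom R E Q" if K: "K \<in> Hom (K_Mod R) E Q" for K
  proof -
    have KI: "Comp (K_Mod R) Y E Q K I \<in> Hom (K_Mod R) Y Q"
      by (rule Comp_in_Hom[OF XY(2) t(1) Qc h(2) K])
    have "Comp (K_Mod R) X Y Q (Comp (K_Mod R) Y E Q K I) F' = zero_hom R X Q"
      by (simp add: Comp_assoc[OF XY t(1) Qc h(1,2) K] z(1) Comp_zero(2)[OF X(1) t(1) Qc K])
    then have "Comp (K_Mod R) Y E Q K I = zero_hom R Y Q"
      using F[folded F'_def] Q KI unfolding perp_iso_def by blast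
    from cone_triangle_factor[OF XY f Qc, folded E_def S_def, folded P_def I_def, OF K this]
    obtain V where V: "V \<in> Hom (K_Mod R) (S X) Q" "K = Comp (K_Mod R) E (S X) Q V P" by blast
    have "shift_hom 1 V \<in> Hom (K_Mod R) X (shift 1 Q)"
      using shift_hom_in_Hom[OF t(2) Qc odd1(1) V(1)] by (simp add: sS X(1))
    moreover have Q1: "shift 1 Q \<in> perp R" by (rule perp_shift[OF Q odd1(1)])
    ultimately obtain L where L: "L \<in> Hom (K_Mod R) Y (shift 1 Q)"
      "shift_hom 1 V = Comp (K_Mod R) X Y (shift 1 Q) L F'"
      using F[folded F'_def] unfolding perp_iso_def by blast
    have sQ: "S (shift 1 Q) = Q" by (rule sS(2)[OF Qc])
    have SL: "shift_hom (-1) L \<in> Hom (K_Mod R) (S Y) Q"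
      using shift_hom_in_Hom[OF XY(2) perp_complex[OF Q1] odd1(2) L(1)] sQ by (simp add: S_def)
    have "V = shift_hom (-1) (Comp (K_Mod R) X Y (shift 1 Q) L F')" by (simp add: L(2)[symmetric])
    also have "\<dots> = Comp (K_Mod R) (S X) (S Y) Q (shift_hom (-1) L) (shift_hom (-1) F')"
      using shift_hom_Comp[OF XY perp_complex[OF Q1] odd1(2) h(1) L(1)] sQ by (simp add: S_def)
    finally show ?thesis
      by (simp add: V(2) Comp_assoc[OF t Qc h(3,4) SL] z(2) Comp_zero(2)[OF t(1,3) Qc SL])
  qed
  then show "orth R (cone X Y f) Q"
    using zero_hom_in_Hom[OF t(1) Qc] orth_iff_Hom[OF t(1) Qc] unfolding E_def by blast
qed

text \<open>Through this equivalence composites of denominators are denominators, without recourse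
  to the octahedral axiom.\<close>

lemma Mor_iff_perp_iso:
  fixes X Y :: "('r, 'u) cochain_complex"
  assumes "X \<in> Obj (K_Proj R)" "Y \<in> Obj (K_Proj R)"
  shows "(X, F, Y) \<in> Mor R (totally_acyclic R) \<longleftrightarrow> perp_iso R X Y F"
proof
  assume p: "perp_iso R X Y F"
  have XY: "X \<in> complexes R" "Y \<in> complexes R" using assms by auto
  have F: "F \<in> Hom (K_Mod R) X Y" using p by (simp add: perp_iso_def)
  obtain f where f: "chain_map R X Y f" "F = cls R X Y f" using HomE[OF F XY] .
  have "cone X Y f \<in> totally_acyclic R"
    using assms p[unfolded f(2)] f(1) by (intro cone_totally_acyclic) auto
  then show "(X, F, Y) \<in> Mor R (totally_acyclic R)"
    unfolding f(2) by (rule Mor_coneI[OF assms f(1)])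
qed (rule Mor_perp_iso)

text \<open>Both T and T[-1] have only zero morphisms into \<open>perp\<close>. In the triangle T ->
  Y -> E the former makes Hom(E, Q) -> Hom(Y, Q) surjective and the latter makes it
  injective.\<close>

lemma perp_approximation:
  fixes Y :: "('r, 'u) cochain_complex"
  assumes Y: "Y \<in> Obj (K_Proj R)"
  obtains T t where "T \<in> totally_acyclic R" "chain_map R T Y t" "cone T Y t \<in> perp R"
    "cone T Y t \<in> Obj (K_Proj R)"
    "(Y, cls R Y (cone T Y t) (cinj T), cone T Y t) \<in> Mor R (totally_acyclic R)"
proof -
  have Yc: "Y \<in> complexes R" using Y by simp
  obtain T t where T: "T \<in> totally_acyclic R" and tm: "chain_map R T Y t" and Ep: "cone T Y t \<in> perp R"
    using approximation[OF Yc] by blast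
  have Tc: "T \<in> complexes R" by (rule totally_acyclic_complex[OF T])
  define S where "S X = shift (-1) X" for X :: "('r, 'u) cochain_complex"
  define E where "E = cone T Y t"
  define P where "P = cls R E (S T) cproj"
  define I where "I = cls R Y E (cinj T)"
  define F where "F = cls R T Y t"
  note tc = cone_triangle_complexes[OF Tc Yc tm, folded E_def S_def]
  note h = cone_triangle_homs[OF Tc Yc tm, folded E_def S_def, folded P_def I_def F_def]
  have E: "E \<in> Obj (K_Proj R)"
    using tc(1) T Y by (auto simp: E_def totally_acyclic_iff intro: projective_direct_sum)
  have "perp_iso R Y E I"
    unfolding perp_iso_def
  proof (intro conjI ballI impI h(2))
    fix Q K assume Q: "Q \<in> perp R" and K: "K \<in> Hom (K_Mod R) E Q"
      and z: "Comp (K_Mod R) Y E Q K I = zero_hom R Y Q"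
    note Qc = perp_complex[OF Q]
    from cone_triangle_factor[OF Tc Yc tm Qc, folded E_def S_def, folded P_def I_def, OF K z]
    obtain V where V: "V \<in> Hom (K_Mod R) (S T) Q" "K = Comp (K_Mod R) E (S T) Q V P" by blast
    have "V = zero_hom R (S T) Q"
      using perp_Hom[OF Q _ V(1)] totally_acyclic_shift[OF T, of "-1"] by (simp add: S_def)
    then show "K = zero_hom R E Q" using V(2) Comp_zero(1)[OF tc(1,2) Qc h(3)] by simp
  next
    fix Q H assume Q: "Q \<in> perp R" and H: "H \<in> Hom (K_Mod R) Y Q"
    note Qc = perp_complex[OF Q]
    have "Comp (K_Mod R) T Y Q H F = zero_hom R T Q"
      by (rule perp_Hom[OF Q T Comp_in_Hom[OF Tc Yc Qc h(1) H]])
    from cone_triangle_extend[OF Tc Yc tm Qc H, folded E_def S_def, folded I_def F_def, OF this]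
    show "\<exists>L\<in>Hom (K_Mod R) E Q. H = Comp (K_Mod R) Y E Q L I" .
  qed
  then have "(Y, I, E) \<in> Mor R (totally_acyclic R)" using Mor_iff_perp_iso[OF Y E] by simp
  then show thesis using that[OF T tm Ep] E by (simp add: I_def E_def)
qed

text \<open>This is the surjective half of \<open>perp_iso\<close>, applied to the morphisms in
  \<open>Mor\<close>.\<close>

lemma perp_injective:
  fixes E :: "('r, 'u) cochain_complex"
  assumes E: "E \<in> perp R" "E \<in> Obj (K_Proj R)"
  shows "injective_wrt (K_Proj R) (Mor R (totally_acyclic R)) E"
  unfolding injective_wrt_def
proof (intro conjI E(2), safe)
  fix X Y :: "('r, 'u) cochain_complex" and F
  assume m: "(X, F, Y) \<in> Mor R (totally_acyclic R)"
  then have XY: "X \<in> complexes R" "Y \<in> complexes R" and F: "F \<in> Hom (K_Mod R) X Y" by (auto simp: Mor_def)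
  note Ec = perp_complex[OF E(1)]
  {
    fix H assume "H \<in> Hom (K_Proj R) Y E"
    then show "Comp (K_Proj R) X Y E H F \<in> Hom (K_Proj R) X E"
      using Comp_in_Hom[OF XY Ec F] by simp
  }
  fix H assume "H \<in> Hom (K_Proj R) X E"
  then obtain L where "L \<in> Hom (K_Mod R) Y E" "H = Comp (K_Mod R) X Y E L F"
    using Mor_perp_iso[OF m] E(1) unfolding perp_iso_def K_Proj_simps by blast
  then show "H \<in> (\<lambda>h. Comp (K_Proj R) X Y E h F) ` Hom (K_Proj R) Y E"
    by (simp add: image_iff) blast
qed

lemma enough_injectives_K_Proj:
  "enough_injectives (K_Proj R :: (('r, 'u) cochain_complex, _) category) (Mor R (totally_acyclic R))"
  unfolding enough_injectives_def
proof
  fix A :: "('r, 'u) cochain_complex" assume "A \<in> Obj (K_Proj R)"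
  from perp_approximation[OF this] obtain T t where E: "cone T A t \<in> perp R"
    "cone T A t \<in> Obj (K_Proj R)" "(A, cls R A (cone T A t) (cinj T), cone T A t) \<in> Mor R (totally_acyclic R)"
    by blast
  show "\<exists>E i. (A, i, E) \<in> Mor R (totally_acyclic R) \<and>
      injective_wrt (K_Proj R) (Mor R (totally_acyclic R)) E"
    by (intro exI conjI) (rule E(3), rule perp_injective[OF E(1,2)])
qed

end


section \<open>Smallness of the Hom-sets of the Verdier quotient\<close>

lemma small_Hom:
  fixes X E :: "('r, 'u) cochain_complex"
  assumes u: "universe TYPE('u)" and XE: "X \<in> complexes R" "E \<in> complexes R"
  shows "small TYPE('u) (Hom (K_Mod R) X E)"
proof -
  let ?H = "\<Union>n\<in>(UNIV :: int set). carrier (Ob X n) \<rightarrow>\<^sub>E carrier (Ob E n)"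
  have sm: "small TYPE('u) (carrier (Ob X n))" "small TYPE('u) (carrier (Ob E n))" for n
    using complex_module(1)[OF XE(1), of n] complex_module(1)[OF XE(2), of n] by (auto simp: rmodules_def)
  have "small TYPE('u) ((UNIV :: int set) \<rightarrow>\<^sub>E ?H)"
    by (intro small_PiE small_UN small_countable u sm)
  moreover have "cochain_maps R X E \<subseteq> UNIV \<rightarrow>\<^sub>E ?H"
  proof
    fix f assume "f \<in> cochain_maps R X E"
    then have "f n \<in> carrier (Ob X n) \<rightarrow>\<^sub>E carrier (Ob E n)" for n
      by (simp add: cochain_maps_def rhom_def)
    then show "f \<in> UNIV \<rightarrow>\<^sub>E ?H" by blast
  qed
  ultimately have "small TYPE('u) (cochain_maps R X E)" by (rule small_subset)
  then have "small TYPE('u) ((\<lambda>f. homotopic R X E `` {f}) ` cochain_maps R X E)" by (rule small_image)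
  moreover have "Hom (K_Mod R) X E = (\<lambda>f. homotopic R X E `` {f}) ` cochain_maps R X E"
    by (auto simp: K_Mod_def quotient_def)
  ultimately show ?thesis by simp
qed

context approximation_universe
begin

lemma fraction_Hom_small:
  fixes X Y :: "('r, 'u) cochain_complex"
  assumes X: "X \<in> Obj (K_Proj R)" and Y: "Y \<in> Obj (K_Proj R)"
  shows "small TYPE('u) (fraction_Hom (K_Proj R) (Mor R (totally_acyclic R)) X Y)"
proof -
  let ?M = "Mor R (totally_acyclic R) :: (('r, 'u) cochain_complex \<times> _ \<times> _) set"
  let ?fr = "fractions (K_Proj R) ?M X Y" and ?rel = "fraction_rel (K_Proj R) ?M X Y"
  let ?C = "Comp (K_Mod R)"
  have XY: "X \<in> complexes R" "Y \<in> complexes R" using X Y by auto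
  obtain T t where T: "T \<in> totally_acyclic R" and tm: "chain_map R T Y t" and
    Ep: "cone T Y t \<in> perp R" and EO: "cone T Y t \<in> Obj (K_Proj R)"
    and M: "(Y, cls R Y (cone T Y t) (cinj T), cone T Y t) \<in> ?M"
    using perp_approximation[OF Y] .
  note Tc = totally_acyclic_complex[OF T]
  \<comment> \<open>E is the replacement of Y in \<open>perp\<close>: Hom(X, E) in the homotopy
    category will bound the morphisms from X to Y in the quotient.\<close>
  define E where "E = cone T Y t"
  define I where "I = cls R Y E (cinj T)"
  define t' where "t' = cls R T Y t"
  have E: "E \<in> perp R" "E \<in> complexes R" using Ep perp_complex[OF Ep] by (simp_all add: E_def)
  have I: "I \<in> Hom (K_Mod R) Y E" using cone_triangle_homs(2)[OF Tc XY(2) tm] by (simp add: I_def E_def)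
  have t': "t' \<in> Hom (K_Mod R) T Y" using cone_triangle_homs(1)[OF Tc XY(2) tm] by (simp add: t'_def)
  have frD: "Z \<in> complexes R" "Z \<in> Obj (K_Proj R)" "f \<in> Hom (K_Mod R) Z X" "g \<in> Hom (K_Mod R) Z Y"
    "perp_iso R Z X f" "(Z, f, X) \<in> ?M" if "(Z, f, g) \<in> ?fr" for Z f g
    using that Mor_perp_iso[of Z f X] by (auto simp: fractions_def Mor_def)
  have ex: "\<exists>H\<in>Hom (K_Mod R) X E. ?C Z X E H f = ?C Z Y E I g" if z: "(Z, f, g) \<in> ?fr" for Z f g
  proof -
    note d = frD[OF z]
    have "?C Z Y E I g \<in> Hom (K_Mod R) Z E" by (rule Comp_in_Hom[OF d(1) XY(2) E(2) d(4) I])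
    then show ?thesis using d(5) E(1) unfolding perp_iso_def by metis
  qed
  \<comment> \<open>The class of a fraction is the full fibre over H of the assignment of extensions
    X -> E. One inclusion cancels the common denominator f''; the other has to build a common
    refinement.\<close>
  have cls_eq: "?rel `` {(Z, f, g)} = {(Z', f', g') \<in> ?fr. ?C Z' X E H f' = ?C Z' Y E I g'}"
    if z: "(Z, f, g) \<in> ?fr" and H: "H \<in> Hom (K_Mod R) X E" "?C Z X E H f = ?C Z Y E I g" for Z f g H
  proof (intro equalityI subsetI)
    note d = frD[OF z]
    fix q assume "q \<in> ?rel `` {(Z, f, g)}"
    then obtain Z' f' g' Z'' f'' g'' u v where q: "q = (Z', f', g')" and z': "(Z', f', g') \<in> ?fr"
      and z'': "(Z'', f'', g'') \<in> ?fr" and uv: "u \<in> Hom (K_Mod R) Z'' Z" "v \<in> Hom (K_Mod R) Z'' Z'"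
      "?C Z'' Z X f u = f''" "?C Z'' Z' X f' v = f''" "?C Z'' Z Y g u = g''" "?C Z'' Z' Y g' v = g''"
      unfolding fraction_rel_def by auto
    note d' = frD[OF z'] and d'' = frD[OF z'']
    obtain H' where H': "H' \<in> Hom (K_Mod R) X E" "?C Z' X E H' f' = ?C Z' Y E I g'" using ex[OF z'] by blast
    have "?C Z'' X E H f'' = ?C Z'' Z E (?C Z X E H f) u"
      by (simp add: Comp_assoc[OF d''(1) d(1) XY(1) E(2) uv(1) d(3) H(1)] uv(3))
    also have "\<dots> = ?C Z'' Y E I g''"
      by (simp add: H(2) Comp_assoc[OF d''(1) d(1) XY(2) E(2) uv(1) d(4) I] uv(5))
    also have "\<dots> = ?C Z'' Z' E (?C Z' X E H' f') v"
      by (simp add: H'(2) Comp_assoc[OF d''(1) d'(1) XY(2) E(2) uv(2) d'(4) I] uv(6))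
    also have "\<dots> = ?C Z'' X E H' f''"
      by (simp add: Comp_assoc[OF d''(1) d'(1) XY(1) E(2) uv(2) d'(3) H'(1)] uv(4))
    finally have "H = H'" by (rule perp_iso_cancel[OF d''(1) XY(1) d''(5) E(1) H(1) H'(1)])
    then show "q \<in> {(Z', f', g') \<in> ?fr. ?C Z' X E H f' = ?C Z' Y E I g'}" using q z' H'(2) by simp
  next
    note d = frD[OF z]
    fix q assume "q \<in> {(Z', f', g') \<in> ?fr. ?C Z' X E H f' = ?C Z' Y E I g'}"
    then obtain Z' f' g' where q: "q = (Z', f', g')" and z': "(Z', f', g') \<in> ?fr"
      and e: "?C Z' X E H f' = ?C Z' Y E I g'" by blast
    note d' = frD[OF z']
    obtain fc where fc: "chain_map R Z' X fc" "f' = cls R Z' X fc" using HomE[OF d'(3,1) XY(1)] .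
    \<comment> \<open>Ore condition: the cone of f' is totally acyclic. On the fibre W of Z -> X ->
      cone the composite vanishes, so there f p factors through f', and W remains a
      denominator.\<close>
    let ?K = "cone Z' X fc" and ?J = "cls R X (cone Z' X fc) (cinj Z')"
    have K: "?K \<in> totally_acyclic R"
      by (rule cone_totally_acyclic) (use d'(1,2,5) X fc in auto)
    note Kc = totally_acyclic_complex[OF K]
    note J = cone_triangle_homs(2)[OF d'(1) XY(1) fc(1)]
    have Jf: "?C Z X ?K ?J f \<in> Hom (K_Mod R) Z ?K" by (rule Comp_in_Hom[OF d(1) XY(1) Kc d(3) J])
    obtain W p where W: "W \<in> complexes R" and p: "p \<in> Hom (K_Mod R) W Z" and
      Jfp: "?C W Z ?K (?C Z X ?K ?J f) p = zero_hom R W ?K" and pi: "perp_iso R W Z p"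
      and Wp: "(\<forall>n. projective R (Ob Z n)) \<Longrightarrow> (\<forall>n. projective R (Ob W n))"
      using fibre[OF d(1) K Jf] by blast
    have fp: "?C W Z X f p \<in> Hom (K_Mod R) W X" by (rule Comp_in_Hom[OF W d(1) XY(1) p d(3)])
    have "?C W X ?K ?J (?C W Z X f p) = zero_hom R W ?K"
      using Jfp by (simp add: Comp_assoc[OF W d(1) XY(1) Kc p d(3) J])
    from cone_triangle_lift[OF d'(1) XY(1) fc(1) W fp this]
    obtain p' where p': "p' \<in> Hom (K_Mod R) W Z'" "?C W Z X f p = ?C W Z' X f' p'" unfolding fc(2) by blast
    have gp: "?C W Z Y g p \<in> Hom (K_Mod R) W Y" "?C W Z' Y g' p' \<in> Hom (K_Mod R) W Y"
      by (rule Comp_in_Hom[OF W d(1) XY(2) p d(4)], rule Comp_in_Hom[OF W d'(1) XY(2) p'(1) d'(4)])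
    have "?C W Y E I (?C W Z Y g p) = ?C W Z E (?C Z X E H f) p"
      by (simp add: H(2) Comp_assoc[OF W d(1) XY(2) E(2) p d(4) I])
    also have "\<dots> = ?C W Z' E (?C Z' X E H f') p'"
      by (simp add: Comp_assoc[OF W d(1) XY(1) E(2) p d(3) H(1)]
          Comp_assoc[OF W d'(1) XY(1) E(2) p'(1) d'(3) H(1)] p'(2))
    also have "\<dots> = ?C W Y E I (?C W Z' Y g' p')"
      by (simp add: e Comp_assoc[OF W d'(1) XY(2) E(2) p'(1) d'(4) I])
    finally have Ieq: "?C W Y E I (?C W Z Y g p) = ?C W Y E I (?C W Z' Y g' p')" .
    \<comment> \<open>On W the two numerators are so far known to agree only after composition with
      I.\<close>
    obtain D where D: "D \<in> Hom (K_Mod R) W Y"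
      "\<And>V r. V \<in> complexes R \<Longrightarrow> r \<in> Hom (K_Mod R) V W \<Longrightarrow>
        ?C V W Y D r = zero_hom R V Y \<longleftrightarrow> ?C V W Y (?C W Z Y g p) r = ?C V W Y (?C W Z' Y g' p') r"
      "\<And>V G. V \<in> complexes R \<Longrightarrow> G \<in> Hom (K_Mod R) Y V \<Longrightarrow>
        ?C W Y V G D = zero_hom R W V \<longleftrightarrow> ?C W Y V G (?C W Z Y g p) = ?C W Y V G (?C W Z' Y g' p')"
      by (rule Hom_difference[OF W XY(2) gp]) blast
    \<comment> \<open>Their difference dies in E, hence factors through the totally acyclic T; it
      vanishes on the fibre V of that factor.\<close>
    have "?C W Y E I D = zero_hom R W E" using D(3)[OF E(2) I] Ieq by simp
    from cone_triangle_lift[OF Tc XY(2) tm W D(1), folded E_def, folded I_def t'_def, OF this]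
    obtain s where s: "s \<in> Hom (K_Mod R) W T" "D = ?C W T Y t' s" by blast
    obtain V r where V: "V \<in> complexes R" and r: "r \<in> Hom (K_Mod R) V W" and
      sr: "?C V W T s r = zero_hom R V T" and ri: "perp_iso R V W r"
      and Vp: "(\<forall>n. projective R (Ob W n)) \<Longrightarrow> (\<forall>n. projective R (Ob V n))"
      using fibre[OF W T s(1)] by blast
    have VO: "V \<in> Obj (K_Proj R)" using V Vp Wp d(2) by auto
    have "?C V W Y D r = zero_hom R V Y"
      by (simp add: s(2) Comp_assoc[OF V W Tc XY(2) r s(1) t'] sr Comp_zero(2)[OF V Tc XY(2) t'])
    then have geq: "?C V W Y (?C W Z Y g p) r = ?C V W Y (?C W Z' Y g' p') r" using D(2)[OF V r] by simp
    let ?u = "?C V W Z p r" and ?v = "?C V W Z' p' r"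
    have u: "?u \<in> Hom (K_Mod R) V Z" and v: "?v \<in> Hom (K_Mod R) V Z'"
      by (rule Comp_in_Hom[OF V W d(1) r p], rule Comp_in_Hom[OF V W d'(1) r p'(1)])
    have fu: "?C V Z' X f' ?v = ?C V Z X f ?u"
      by (simp add: Comp_assoc[OF V W d(1) XY(1) r p d(3), symmetric]
          Comp_assoc[OF V W d'(1) XY(1) r p'(1) d'(3), symmetric] p'(2))
    have gu: "?C V Z' Y g' ?v = ?C V Z Y g ?u"
      using geq by (simp add: Comp_assoc[OF V W d(1) XY(2) r p d(4)]
          Comp_assoc[OF V W d'(1) XY(2) r p'(1) d'(4)])
    have "perp_iso R V X (?C V Z X f ?u)"
      by (rule perp_iso_comp[OF V d(1) XY(1) perp_iso_comp[OF V W d(1) ri pi] d(5)])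
    then have "(V, ?C V Z X f ?u, X) \<in> ?M" using Mor_iff_perp_iso[OF VO X] by simp
    moreover have "?C V Z Y g ?u \<in> Hom (K_Mod R) V Y" by (rule Comp_in_Hom[OF V d(1) XY(2) u d(4)])
    ultimately have "(V, ?C V Z X f ?u, ?C V Z Y g ?u) \<in> ?fr" using VO by (simp add: fractions_def)
    then have "((Z, f, g), (Z', f', g')) \<in> ?rel"
      unfolding fraction_rel_def mem_Collect_eq prod.case K_Proj_simps
      using z z' u v fu gu by metis
    then show "q \<in> ?rel `` {(Z, f, g)}" using q by simp
  qed
  have "fraction_Hom (K_Proj R) ?M X Y \<subseteq>
    (\<lambda>H. {(Z', f', g') \<in> ?fr. ?C Z' X E H f' = ?C Z' Y E I g'}) ` Hom (K_Mod R) X E"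
  proof
    fix c assume "c \<in> fraction_Hom (K_Proj R) ?M X Y"
    then obtain Z f g where z: "(Z, f, g) \<in> ?fr" "c = ?rel `` {(Z, f, g)}"
      unfolding fraction_Hom_def by (elim quotientE) auto
    obtain H where H: "H \<in> Hom (K_Mod R) X E" "?C Z X E H f = ?C Z Y E I g" using ex[OF z(1)] by blast
    show "c \<in> (\<lambda>H. {(Z', f', g') \<in> ?fr. ?C Z' X E H f' = ?C Z' Y E I g'}) ` Hom (K_Mod R) X E"
      unfolding z(2) cls_eq[OF z(1) H] using H(1) by (rule imageI)
  qed
  then show ?thesis
    using small_subset[OF small_image[OF small_Hom[OF univ' XY(1) E(2)]]] by blast
qed

section \<open>Precovers by totally acyclic complexes\<close>

lemma precovering_totally_acyclic:
  "precovering (C_Mod R) (totally_acyclic R :: ('r, 'u) cochain_complex set)"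
  unfolding precovering_def
proof (intro conjI ballI)
  show "totally_acyclic R \<subseteq> Obj (C_Mod R)" by (auto simp: C_Mod_def totally_acyclic_complex)
  fix M :: "('r, 'u) cochain_complex" assume "M \<in> Obj (C_Mod R)"
  then have M: "M \<in> complexes R" by (simp add: C_Mod_def)
  obtain T g where T: "T \<in> totally_acyclic R" and g: "chain_map R T M g" and
    fac: "\<forall>T'\<in>totally_acyclic R. \<forall>\<phi>. chain_map R T' M \<phi> \<longrightarrow>
        (\<exists>\<psi>. chain_map R T' T \<psi> \<and> (\<forall>n. \<forall>x\<in>carrier (Ob T' n). \<phi> n x = g n (\<psi> n x)))"
    using approximation[OF M] by blast
  note Tc = totally_acyclic_complex[OF T]
  note gm = restr_cochain_maps[OF Tc g]
  have "(\<lambda>h. cochain_comp T' (restr T g) h) ` cochain_maps R T' T = cochain_maps R T' M"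
    if T': "T' \<in> totally_acyclic R" for T'
  proof (intro equalityI subsetI)
    note Tc' = totally_acyclic_complex[OF T']
    fix \<phi> assume "\<phi> \<in> (\<lambda>h. cochain_comp T' (restr T g) h) ` cochain_maps R T' T"
    then obtain h where h: "h \<in> cochain_maps R T' T" "\<phi> = cochain_comp T' (restr T g) h" by blast
    have "\<phi> = restr T' (\<lambda>n x. restr T g n (h n x))"
      by (simp add: h(2) cochain_comp_def compose_def restr_def fun_eq_iff)
    moreover have "chain_map R T' M (\<lambda>n x. restr T g n (h n x))"
      using h(1) gm unfolding cochain_maps_iff by (blast intro: chain_map_comp)
    ultimately show "\<phi> \<in> cochain_maps R T' M" using restr_cochain_maps[OF Tc'] by simp
  next
    note Tc' = totally_acyclic_complex[OF T']
    fix \<phi> assume \<phi>: "\<phi> \<in> cochain_maps R T' M"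
    then have "chain_map R T' M \<phi>" by (simp add: cochain_maps_iff)
    then obtain \<psi> where \<psi>: "chain_map R T' T \<psi>" "\<forall>n. \<forall>x\<in>carrier (Ob T' n). \<phi> n x = g n (\<psi> n x)"
      using fac T' by blast
    have "cochain_comp T' (restr T g) (restr T' \<psi>) = restr T' \<phi>"
      using \<psi>(2) chain_map_simps(1)[OF \<psi>(1) Tc' Tc]
      by (auto simp: cochain_comp_def compose_def restr_def fun_eq_iff)
    then show "\<phi> \<in> (\<lambda>h. cochain_comp T' (restr T g) h) ` cochain_maps R T' T"
      using restr_cochain_maps[OF Tc' \<psi>(1)] restr_eq[OF \<phi>] by (intro image_eqI[of _ _ "restr T' \<psi>"]) simp_all
  qed
  then have "is_precover (C_Mod R) (totally_acyclic R) M T (restr T g)"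
    unfolding is_precover_def using T gm by (simp add: C_Mod_def)
  then show "\<exists>B f. is_precover (C_Mod R) (totally_acyclic R) M B f" by blast
qed

end

section \<open>Precovers by Gorenstein-projective modules\<close>

lemma rlinear_factor:
  assumes B: "right_module R B" and A: "right_module R A" and C: "right_module R C"
    and d: "rlinear R A B d" "carrier B \<subseteq> d ` carrier A" and g: "rlinear R A C g"
    and k: "\<And>y. y \<in> carrier A \<Longrightarrow> d y = \<zero>\<^bsub>B\<^esub> \<Longrightarrow> g y = \<zero>\<^bsub>C\<^esub>"
  obtains t where "rlinear R B C t" "\<And>y. y \<in> carrier A \<Longrightarrow> t (d y) = g y"
proof -
  note [simp] = right_module_simps[OF A] right_module_simps[OF B] right_module_simps[OF C]
    rlinear_simps[OF d(1) A B] rlinear_simps[OF g A C]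
  define t where "t z = g (SOME y. y \<in> carrier A \<and> d y = z)" for z
  have t: "t (d y) = g y" if y: "y \<in> carrier A" for y
  proof -
    define y' where "y' = (SOME y'. y' \<in> carrier A \<and> d y' = d y)"
    have y': "y' \<in> carrier A" "d y' = d y"
      unfolding y'_def using someI[of "\<lambda>y'. y' \<in> carrier A \<and> d y' = d y" y] y by auto
    have "g (y' \<ominus>\<^bsub>A\<^esub> y) = \<zero>\<^bsub>C\<^esub>" by (rule k) (use y y' in simp_all)
    then have "g y' \<ominus>\<^bsub>C\<^esub> g y = \<zero>\<^bsub>C\<^esub>" using y y' by simp
    then have "g y' = g y" using abelian_group_cancel[of C "g y'" "g y"] y y' by simp
    then show ?thesis by (simp add: t_def y'_def)
  qed
  have "rlinear R B C t"
  proof (rule rlinearI)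
    fix z assume "z \<in> carrier B"
    then obtain y where y: "y \<in> carrier A" "z = d y" using d(2) by blast
    then show "t z \<in> carrier C" by (simp add: t)
    fix w assume "w \<in> carrier B"
    then obtain x where x: "x \<in> carrier A" "w = d x" using d(2) by blast
    show "t (z \<oplus>\<^bsub>B\<^esub> w) = t z \<oplus>\<^bsub>C\<^esub> t w"
      using t[of "y \<oplus>\<^bsub>A\<^esub> x"] x y by (simp add: t)
  next
    fix a z assume a: "a \<in> carrier R" and "z \<in> carrier B"
    then obtain y where y: "y \<in> carrier A" "z = d y" using d(2) by blast
    show "t (a \<odot>\<^bsub>B\<^esub> z) = a \<odot>\<^bsub>C\<^esub> t z" using t[of "a \<odot>\<^bsub>A\<^esub> y"] a y by (simp add: t)
  qed
  then show thesis using t that by blast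
qed

lemma rlinear_inverse:
  assumes A: "right_module R A" and e: "rlinear R A B e" "bij_betw e (carrier A) (carrier B)"
  shows "rlinear R B A (inv_into (carrier A) e)"
proof -
  note s = right_module_simps[OF A]
  have i: "inv_into (carrier A) e (e x) = x" if "x \<in> carrier A" for x
    using bij_betw_inv_into_left[OF e(2) that] .
  have im: "\<exists>x\<in>carrier A. z = e x" if "z \<in> carrier B" for z
    using that e(2) by (auto simp: bij_betw_def)
  show ?thesis
  proof (rule rlinearI)
    fix z assume "z \<in> carrier B"
    then obtain y where y: "y \<in> carrier A" "z = e y" using im by blast
    then show "inv_into (carrier A) e z \<in> carrier A" by (simp add: i)
    fix w assume "w \<in> carrier B"
    then obtain x where x: "x \<in> carrier A" "w = e x" using im by blast
    have "z \<oplus>\<^bsub>B\<^esub> w = e (y \<oplus>\<^bsub>A\<^esub> x)" using e(1) x y by (simp add: rlinear_def)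
    then show "inv_into (carrier A) e (z \<oplus>\<^bsub>B\<^esub> w) = inv_into (carrier A) e z \<oplus>\<^bsub>A\<^esub> inv_into (carrier A) e w"
      using x y by (simp add: i s)
  next
    fix a z assume a: "a \<in> carrier R" and "z \<in> carrier B"
    then obtain y where y: "y \<in> carrier A" "z = e y" using im by blast
    have "a \<odot>\<^bsub>B\<^esub> z = e (a \<odot>\<^bsub>A\<^esub> y)" using e(1) a y by (simp add: rlinear_def)
    then show "inv_into (carrier A) e (a \<odot>\<^bsub>B\<^esub> z) = a \<odot>\<^bsub>A\<^esub> inv_into (carrier A) e z"
      using a y by (simp add: i s)
  qed
qed

lemma ker_Diff_rmodules:
  fixes X :: "('r, 'u) cochain_complex"
  assumes X: "X \<in> complexes R"
  shows "ker_Diff X n \<in> rmodules R"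
proof -
  note [simp] = complex_simps[OF X] right_module_simps[OF complex_module(2)[OF X]]
    rlinear_simps(6)[OF complex_Diff[OF X refl] complex_module(2)[OF X] complex_module(2)[OF X]]
  let ?H = "{x \<in> carrier (Ob X n). Diff X n x = \<zero>\<^bsub>Ob X (n + 1)\<^esub>}"
  have "right_module R (ker_Diff X n)"
    unfolding ker_Diff_def by (rule submodule_right_module[OF complex_module(2)[OF X]]) auto
  moreover have "small TYPE('u) ?H"
    by (rule small_subset[of _ "carrier (Ob X n)"]) (use complex_module(1)[OF X, of n] in \<open>auto simp: rmodules_def\<close>)
  ultimately show ?thesis by (simp add: rmodules_def ker_Diff_def)
qed

context approximation_universe
begin

text \<open>For exact T the differential maps T^(-1) onto Ker d^0 with the boundaries as kernel.
  Chain maps from T to M in degree -1 are therefore the same as linear maps Ker d^0 -> M, and a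
  precover of that complex yields a precover of M.\<close>

lemma precovering_Gorenstein_projective:
  "precovering (Mod R) (Gorenstein_projective R :: ('r, 'u) module set)"
  unfolding precovering_def
proof (intro conjI ballI)
  show "(Gorenstein_projective R :: ('r, 'u) module set) \<subseteq> Obj (Mod R)"
    by (auto simp: Gorenstein_projective_def Mod_def)
  fix M :: "('r, 'u) module" assume "M \<in> Obj (Mod R)"
  then have M: "M \<in> rmodules R" by (simp add: Mod_def)
  note Mm = rmodulesD[OF M]
  \<comment> \<open>Degree -1 is the source of the differential onto Ker d^0.\<close>
  let ?S = "sphere_complex (-1) M"
  have S: "?S \<in> complexes R" by (rule sphere_complex_complex[OF M])
  obtain T g where T: "T \<in> totally_acyclic R" and g: "chain_map R T ?S g" and
    fac: "\<forall>T'\<in>totally_acyclic R. \<forall>\<phi>. chain_map R T' ?S \<phi> \<longrightarrow>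
        (\<exists>\<psi>. chain_map R T' T \<psi> \<and> (\<forall>n. \<forall>x\<in>carrier (Ob T' n). \<phi> n x = g n (\<psi> n x)))"
    using approximation[OF S] by blast
  note Tc = totally_acyclic_complex[OF T]
  let ?N = "ker_Diff T 0"
  have N: "?N \<in> rmodules R" by (rule ker_Diff_rmodules[OF Tc])
  note Nm = rmodulesD[OF N]
  have Nsimps: "carrier ?N = {x \<in> carrier (Ob T 0). Diff T 0 x = \<zero>\<^bsub>Ob T 1\<^esub>}" "\<zero>\<^bsub>?N\<^esub> = \<zero>\<^bsub>Ob T 0\<^esub>"
    "(\<oplus>\<^bsub>?N\<^esub>) = (\<oplus>\<^bsub>Ob T 0\<^esub>)" "(\<odot>\<^bsub>?N\<^esub>) = (\<odot>\<^bsub>Ob T 0\<^esub>)"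
    by (auto simp: ker_Diff_def)
  have d: "rlinear R (Ob T (-1)) ?N (Diff T (-1))"
    using complex_Diff[OF Tc, of 0 "-1"] complex_simps(17)[OF Tc, of 0 "-1"]
    by (simp add: rlinear_def Nsimps)
  have surj: "carrier ?N \<subseteq> Diff T (-1) ` carrier (Ob T (-1))"
  proof
    fix z assume "z \<in> carrier ?N"
    then have "z \<in> carrier (Ob T 0)" "Diff T 0 z = \<zero>\<^bsub>Ob T (0 + 1)\<^esub>" by (simp_all add: Nsimps)
    then obtain y where "y \<in> carrier (Ob T (0 - 1))" "Diff T (0 - 1) y = z"
      using T unfolding totally_acyclic_iff by blast
    then show "z \<in> Diff T (-1) ` carrier (Ob T (-1))" by force
  qed
  have gl: "rlinear R (Ob T (-1)) M (g (-1))" using chain_map_rlinear[OF g, of "-1"] by simp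
  have "g (-1) y = \<zero>\<^bsub>M\<^esub>" if y: "y \<in> carrier (Ob T (-1))" "Diff T (-1) y = \<zero>\<^bsub>?N\<^esub>" for y
  proof -
    have "Diff T (-1) y = \<zero>\<^bsub>Ob T (-1 + 1)\<^esub>" using y(2) by (simp add: Nsimps)
    then obtain w where w: "w \<in> carrier (Ob T (-1 - 1))" "Diff T (-1 - 1) w = y"
      using T y(1) unfolding totally_acyclic_iff by blast
    have "g (-1) y = Diff ?S (-1 - 1) (g (-1 - 1) w)"
      using chain_map_comm[OF g, of "-1" "-1 - 1" w] w by simp
    also have "\<dots> = \<zero>\<^bsub>M\<^esub>"
      by (rule sphere_complex_simps(5)[OF rlinear_closed[OF chain_map_rlinear[OF g] w(1)]])
    finally show ?thesis .
  qed
  from rlinear_factor[OF Nm complex_module(2)[OF Tc] Mm d surj gl this]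
  obtain t where t: "rlinear R ?N M t" "\<And>y. y \<in> carrier (Ob T (-1)) \<Longrightarrow> t (Diff T (-1) y) = g (-1) y"
    by blast
  have NG: "?N \<in> Gorenstein_projective R"
  proof -
    have "restrict (\<lambda>x. x) (carrier ?N) \<in> rhom R ?N ?N" by (rule restrict_rhom[OF Nm rlinear_id])
    moreover have "bij_betw (restrict (\<lambda>x. x) (carrier ?N)) (carrier ?N) (carrier ?N)"
      by (auto simp: bij_betw_def inj_on_def)
    ultimately show ?thesis using N T unfolding Gorenstein_projective_def module_isomorphic_def by blast
  qed
  let ?t = "restrict t (carrier ?N)"
  have tm: "?t \<in> rhom R ?N M" by (rule restrict_rhom[OF Nm t(1)])
  have "(\<lambda>h. compose (carrier B) ?t h) ` rhom R B ?N = rhom R B M"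
    if B: "B \<in> Gorenstein_projective R" for B :: "('r, 'u) module"
  proof (intro equalityI subsetI)
    have "right_module R B" using B by (simp add: Gorenstein_projective_def rmodulesD)
    note Bm = this
    {
      fix \<phi> assume "\<phi> \<in> (\<lambda>h. compose (carrier B) ?t h) ` rhom R B ?N"
      then obtain h where h: "h \<in> rhom R B ?N" "\<phi> = compose (carrier B) ?t h" by blast
      have "rlinear R ?N M ?t" "rlinear R B ?N h" using tm h(1) by (simp_all only: rhom_iff)
      from rlinear_comp[OF this] have "rlinear R B M (\<lambda>x. ?t (h x))" .
      from restrict_rhom[OF Bm this] show "\<phi> \<in> rhom R B M" by (simp add: h(2) compose_def)
    }
    fix h assume h: "h \<in> rhom R B M"
    obtain X :: "('r, 'u) cochain_complex" where X: "X \<in> totally_acyclic R" "module_isomorphic R B (ker_Diff X 0)"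
      using B by (auto simp: Gorenstein_projective_def)
    note Xc = totally_acyclic_complex[OF X(1)]
    obtain e where e: "e \<in> rhom R B (ker_Diff X 0)" "bij_betw e (carrier B) (carrier (ker_Diff X 0))"
      using X(2) by (auto simp: module_isomorphic_def)
    have el: "rlinear R B (ker_Diff X 0) e" using e(1) by (simp add: rhom_iff)
    let ?e' = "inv_into (carrier B) e"
    note el' = rlinear_inverse[OF Bm el e(2)]
    have dX: "rlinear R (Ob X (-1)) (ker_Diff X 0) (Diff X (-1))"
      using complex_Diff[OF Xc, of 0 "-1"] complex_simps(17)[OF Xc, of 0 "-1"]
      by (simp add: rlinear_def ker_Diff_def)
    have hl: "rlinear R B M h" using h by (simp add: rhom_iff)
    \<comment> \<open>The given map h, viewed on Ker d^0 of X through the isomorphism e, becomes a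
      chain map to M in degree -1.\<close>
    let ?\<phi> = "\<lambda>x. h (?e' (Diff X (-1) x))"
    have \<phi>l: "rlinear R (Ob X (-1)) M ?\<phi>" by (rule rlinear_comp[OF hl rlinear_comp[OF el' dX]])
    have "\<forall>y\<in>carrier (Ob X (-1 - 1)). ?\<phi> (Diff X (-1 - 1) y) = \<zero>\<^bsub>M\<^esub>"
    proof
      fix y assume "y \<in> carrier (Ob X (-1 - 1))"
      then have "Diff X (-1) (Diff X (-1 - 1) y) = \<zero>\<^bsub>ker_Diff X 0\<^esub>"
        using complex_simps(17)[OF Xc, of "-1" "-1 - 1" y] by (simp add: ker_Diff_def)
      then show "?\<phi> (Diff X (-1 - 1) y) = \<zero>\<^bsub>M\<^esub>"
        using rlinear_zero[OF el' rmodulesD[OF ker_Diff_rmodules[OF Xc]] Bm] rlinear_zero[OF hl Bm Mm] by simp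
    qed
    from chain_map_to_sphere_complex[OF Xc M \<phi>l this] fac X(1)
    obtain \<psi> where \<psi>: "chain_map R X T \<psi>" "\<forall>n. \<forall>x\<in>carrier (Ob X n).
        (if n = -1 then ?\<phi> else (\<lambda>x. \<zero>\<^bsub>M\<^esub>)) x = g n (\<psi> n x)"
      by blast
    note \<psi>s = chain_map_simps[OF \<psi>(1) Xc Tc]
    have eB: "e b \<in> carrier (Ob X 0) \<and> Diff X 0 (e b) = \<zero>\<^bsub>Ob X 1\<^esub>" if "b \<in> carrier B" for b
      using rlinear_closed[OF el that] by (simp add: ker_Diff_def)
    let ?k = "\<lambda>b. \<psi> 0 (e b)"
    have kl: "rlinear R B ?N ?k"
    proof (rule rlinearI)
      fix b assume b: "b \<in> carrier B"
      show "?k b \<in> carrier ?N"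
        using eB[OF b] \<psi>s(6)[of 1 0 "e b"] \<psi>s(1)[of "e b" 0] \<psi>s(5)[of 1] by (simp add: Nsimps)
      fix c assume c: "c \<in> carrier B"
      have "e (b \<oplus>\<^bsub>B\<^esub> c) = e b \<oplus>\<^bsub>Ob X 0\<^esub> e c" using el b c by (simp add: rlinear_def ker_Diff_def)
      then show "?k (b \<oplus>\<^bsub>B\<^esub> c) = ?k b \<oplus>\<^bsub>?N\<^esub> ?k c"
        using eB[OF b] eB[OF c] \<psi>s(2)[of "e b" 0 "e c"] by (simp add: Nsimps)
    next
      fix a b assume a: "a \<in> carrier R" and b: "b \<in> carrier B"
      have "e (a \<odot>\<^bsub>B\<^esub> b) = a \<odot>\<^bsub>Ob X 0\<^esub> e b" using el a b by (simp add: rlinear_def ker_Diff_def)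
      then show "?k (a \<odot>\<^bsub>B\<^esub> b) = a \<odot>\<^bsub>?N\<^esub> ?k b"
        using eB[OF b] a chain_map_rlinear[OF \<psi>(1), of 0] by (simp add: Nsimps rlinear_def)
    qed
    have "t (?k b) = h b" if b: "b \<in> carrier B" for b
    proof -
      have "e b \<in> carrier (Ob X 0)" "Diff X 0 (e b) = \<zero>\<^bsub>Ob X (0 + 1)\<^esub>" using eB[OF b] by simp_all
      \<comment> \<open>Exactness writes e b as a boundary, and t is known on boundaries: there it
        is given by g in degree -1.\<close>
      then obtain x where "x \<in> carrier (Ob X (0 - 1))" "Diff X (0 - 1) x = e b"
        using X(1) unfolding totally_acyclic_iff by blast
      then have x: "x \<in> carrier (Ob X (-1))" "e b = Diff X (-1) x" by simp_all
      have "?k b = Diff T (-1) (\<psi> (-1) x)" using x \<psi>s(6)[of 0 "-1" x] by simp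
      then have "t (?k b) = g (-1) (\<psi> (-1) x)" using t(2) \<psi>s(1)[OF x(1)] by simp
      also have "\<dots> = ?\<phi> x" using \<psi>(2)[rule_format, of x "-1"] x(1) by simp
      also have "\<dots> = h b" using bij_betw_inv_into_left[OF e(2) b] by (simp add: x(2)[symmetric])
      finally show ?thesis .
    qed
    then have "compose (carrier B) ?t (restrict ?k (carrier B)) = h"
      using h rlinear_closed[OF kl] by (intro ext) (simp add: compose_def rhom_iff extensional_def)
    then show "h \<in> (\<lambda>h. compose (carrier B) ?t h) ` rhom R B ?N"
      using restrict_rhom[OF Bm kl] by blast
  qed
  then have "is_precover (Mod R) (Gorenstein_projective R) M ?N ?t"
    unfolding is_precover_def using NG tm by (simp add: Mod_def)
  then show "\<exists>B f. is_precover (Mod R) (Gorenstein_projective R) M B f" by blast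
qed

end


section \<open>Direct sums\<close>

lemma card_leI: "inj_on f A \<Longrightarrow> f ` A \<subseteq> B \<Longrightarrow> |A| \<le>o |B|"
  by (auto simp: card_of_ordLeq[symmetric])

lemma card_leE:
  assumes "|A| \<le>o |B|"
  obtains f where "inj_on f A" "f ` A \<subseteq> B"
  using assms by (auto simp: card_of_ordLeq[symmetric])

lemma card_Pow_Times:
  assumes "infinite B" "|A| \<le>o |Pow B|" "|C| \<le>o |Pow B|"
  shows "|A \<times> C| \<le>o |Pow B|"
  by (rule card_of_Sigma_ordLeq_infinite) (use assms in auto)

text \<open>A function f into subsets of B is coded by the set of pairs (a, b) with b in f a. After
  A is embedded into B this is a subset of B x B, hence corresponds to a subset of B.\<close>

lemma card_Pow_PiE:
  assumes B: "infinite B" and A: "|A| \<le>o |B|" and C: "|C| \<le>o |Pow B|"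
  shows "|A \<rightarrow>\<^sub>E C| \<le>o |Pow B|"
proof -
  obtain i where i: "inj_on i A" "i ` A \<subseteq> B" using card_leE[OF A] .
  obtain j where j: "inj_on j C" "j ` C \<subseteq> Pow B" using card_leE[OF C] .
  have "|B \<times> B| \<le>o |B|" by (rule card_of_Sigma_ordLeq_infinite[OF B]) (simp_all add: card_of_mono1)
  then obtain p where p: "inj_on p (B \<times> B)" "p ` (B \<times> B) \<subseteq> B" using card_leE by blast
  let ?g = "\<lambda>f. {(i a, b) |a b. a \<in> A \<and> b \<in> j (f a)}"
  have g: "?g f \<subseteq> B \<times> B" if f: "f \<in> A \<rightarrow>\<^sub>E C" for f
  proof
    fix y assume "y \<in> ?g f"
    then obtain a b where y: "y = (i a, b)" "a \<in> A" "b \<in> j (f a)" by blast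
    have "j (f a) \<subseteq> B" using j(2) PiE_mem[OF f y(2)] by blast
    then show "y \<in> B \<times> B" using y i(2) by blast
  qed
  show ?thesis
  proof (rule card_leI[of "\<lambda>f. p ` ?g f"])
    show "inj_on (\<lambda>f. p ` ?g f) (A \<rightarrow>\<^sub>E C)"
    proof (rule inj_onI)
      fix f h assume f: "f \<in> A \<rightarrow>\<^sub>E C" and h: "h \<in> A \<rightarrow>\<^sub>E C" and "p ` ?g f = p ` ?g h"
      then have eq: "?g f = ?g h" using inj_on_image_eq_iff[OF p(1) g[OF f] g[OF h]] by blast
      show "f = h"
      proof (rule PiE_ext[OF f h])
        fix a assume a: "a \<in> A"
        have "b \<in> j (f a) \<longleftrightarrow> (i a, b) \<in> ?g f" "b \<in> j (h a) \<longleftrightarrow> (i a, b) \<in> ?g h" for b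
          using a i(1) by (auto simp: inj_on_eq_iff)
        then have "j (f a) = j (h a)" using eq by blast
        then show "f a = h a" using j(1) f h a by (auto simp: inj_on_eq_iff PiE_iff)
      qed
    qed
    show "(\<lambda>f. p ` ?g f) ` (A \<rightarrow>\<^sub>E C) \<subseteq> Pow B"
    proof (intro subsetI PowI)
      fix x y assume "x \<in> (\<lambda>f. p ` ?g f) ` (A \<rightarrow>\<^sub>E C)" "y \<in> x"
      then obtain f where "f \<in> A \<rightarrow>\<^sub>E C" "y \<in> p ` ?g f" by blast
      then have "y \<in> p ` (B \<times> B)" using g by blast
      then show "y \<in> B" using p(2) by blast
    qed
  qed
qed

lemma card_Pow_insert:
  assumes "infinite B" "|A| \<le>o |Pow B|"
  shows "|insert x A| \<le>o |Pow B|"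
proof -
  have "|UNIV :: bool set| \<le>o |Pow B|"
    by (rule card_leI[of "\<lambda>b. if b then {} else B"]) (use assms(1) in \<open>auto simp: inj_on_def\<close>)
  moreover have "|{x}| \<le>o |Pow B|" by (rule card_leI[of "\<lambda>_. {}"]) auto
  ultimately have "|\<Union>b\<in>UNIV. if b then {x} else A| \<le>o |Pow B|"
    using assms by (intro card_of_UNION_ordLeq_infinite) (auto split: if_splits)
  moreover have "insert x A = (\<Union>b\<in>UNIV. if b then {x} else A)" by (auto split: if_splits)
  ultimately show ?thesis by simp
qed

lemma card_Pow_lists:
  assumes B: "infinite B" and C: "|C| \<le>o |Pow B|"
  shows "|lists C| \<le>o |Pow B|"
proof -
  let ?N = "UNIV :: nat set"
  have "|Some ` C| \<le>o |Pow B|" using ordLeq_transitive[OF card_of_image C] .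
  \<comment> \<open>A list is a sequence padded by \<open>None\<close>, and the set of indices is no
    larger than B.\<close>
  then have "|?N \<rightarrow>\<^sub>E insert None (Some ` C)| \<le>o |Pow B|"
    using B by (intro card_Pow_PiE card_Pow_insert) (simp_all add: infinite_iff_card_of_nat)
  moreover have "|lists C| \<le>o |?N \<rightarrow>\<^sub>E insert None (Some ` C)|"
  proof (rule card_leI[of "\<lambda>l k. if k < length l then Some (l ! k) else None"])
    show "inj_on (\<lambda>l k. if k < length l then Some (l ! k) else None) (lists C)"
    proof (rule inj_onI)
      fix l m :: "'b list"
      assume eq: "(\<lambda>k. if k < length l then Some (l ! k) else None) =
        (\<lambda>k. if k < length m then Some (m ! k) else None)"
      have e: "k < length l \<longleftrightarrow> k < length m" "k < length l \<Longrightarrow> l ! k = m ! k" for k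
        using fun_cong[OF eq, of k] by (auto split: if_splits)
      have "length l = length m" using e(1)[of "length l"] e(1)[of "length m"] by simp
      then show "l = m" using e(2) by (intro nth_equalityI) auto
    qed
  qed (auto split: if_splits)
  ultimately show ?thesis using ordLeq_transitive by blast
qed

section \<open>Transport of structure and arbitrary direct sums\<close>

definition transport_module :: "('v \<Rightarrow> 'u) \<Rightarrow> ('r, 'v) module \<Rightarrow> ('r, 'u) module" where
  "transport_module e M = \<lparr>carrier = e ` carrier M, mult = undefined, one = undefined, zero = e \<zero>\<^bsub>M\<^esub>,
     add = (\<lambda>z w. e (inv_into (carrier M) e z \<oplus>\<^bsub>M\<^esub> inv_into (carrier M) e w)),
     smult = (\<lambda>a z. e (a \<odot>\<^bsub>M\<^esub> inv_into (carrier M) e z))\<rparr>"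

text \<open>Needed because direct sums first arise on functions, and the free module on the type of
  scalars, while \<open>rmodules\<close> here are to have carriers in \<open>'u\<close>.\<close>

lemma transport_module:
  assumes M: "right_module R M" and e: "inj_on e (carrier M)"
  shows "right_module R (transport_module e M)" "rlinear R M (transport_module e M) e"
    "rlinear R (transport_module e M) M (inv_into (carrier M) e)"
proof -
  interpret M: right_module R M by fact
  let ?P = "transport_module e M" and ?d = "inv_into (carrier M) e"
  have d [simp]: "?d (e x) = x" if "x \<in> carrier M" for x using e that by (rule inv_into_f_f)
  have P: "carrier ?P = e ` carrier M" "\<zero>\<^bsub>?P\<^esub> = e \<zero>\<^bsub>M\<^esub>"
    "\<And>x y. x \<in> carrier M \<Longrightarrow> y \<in> carrier M \<Longrightarrow> e x \<oplus>\<^bsub>?P\<^esub> e y = e (x \<oplus>\<^bsub>M\<^esub> y)"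
    "\<And>a x. x \<in> carrier M \<Longrightarrow> a \<odot>\<^bsub>?P\<^esub> e x = e (a \<odot>\<^bsub>M\<^esub> x)"
    by (simp_all add: transport_module_def)
  have "abelian_group ?P"
  proof (rule abelian_groupI)
    fix z assume "z \<in> carrier ?P"
    then obtain x where x: "x \<in> carrier M" "z = e x" by (auto simp: P)
    then show "\<exists>w\<in>carrier ?P. w \<oplus>\<^bsub>?P\<^esub> z = \<zero>\<^bsub>?P\<^esub>"
      by (intro bexI[of _ "e (\<ominus>\<^bsub>M\<^esub> x)"]) (simp_all add: P M.M.l_neg)
  qed (auto simp: P M.M.a_ac)
  then interpret P: abelian_group ?P .
  show "right_module R ?P"
    by unfold_locales (auto simp: P M.smult_l_distr M.smult_r_distr M.smult_assoc)
  show "rlinear R M ?P e" "rlinear R ?P M ?d" by (auto simp: rlinear_def P)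
qed

text \<open>A direct sum is described through its elements, by finite supports and jointly injective
  projections. Counting elements and passing to subsums then become direct; the universal property
  is derived.\<close>

definition is_dsum :: "('r, 'k) ring_scheme \<Rightarrow> 'c set \<Rightarrow> ('c \<Rightarrow> ('r, 'u) module) \<Rightarrow> ('r, 'u) module \<Rightarrow>
    ('c \<Rightarrow> 'u \<Rightarrow> 'u) \<Rightarrow> ('c \<Rightarrow> 'u \<Rightarrow> 'u) \<Rightarrow> bool" where
  "is_dsum R V A P \<iota> \<pi> \<longleftrightarrow> P \<in> rmodules R \<and>
     (\<forall>c\<in>V. A c \<in> rmodules R \<and> rlinear R (A c) P (\<iota> c) \<and> rlinear R P (A c) (\<pi> c)) \<and>
     (\<forall>c\<in>V. \<forall>x\<in>carrier (A c). \<pi> c (\<iota> c x) = x) \<and>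
     (\<forall>c\<in>V. \<forall>c'\<in>V. c \<noteq> c' \<longrightarrow> (\<forall>x\<in>carrier (A c). \<pi> c' (\<iota> c x) = \<zero>\<^bsub>A c'\<^esub>)) \<and>
     (\<forall>z\<in>carrier P. finite {c \<in> V. \<pi> c z \<noteq> \<zero>\<^bsub>A c\<^esub>}) \<and>
     (\<forall>z\<in>carrier P. (\<forall>c\<in>V. \<pi> c z = \<zero>\<^bsub>A c\<^esub>) \<longrightarrow> z = \<zero>\<^bsub>P\<^esub>)"

lemma is_dsumD:
  assumes "is_dsum R V A P \<iota> \<pi>"
  shows "P \<in> rmodules R" "right_module R P"
    "\<And>c. c \<in> V \<Longrightarrow> A c \<in> rmodules R" "\<And>c. c \<in> V \<Longrightarrow> right_module R (A c)"
    "\<And>c. c \<in> V \<Longrightarrow> rlinear R (A c) P (\<iota> c)" "\<And>c. c \<in> V \<Longrightarrow> rlinear R P (A c) (\<pi> c)"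
    "\<And>c x. c \<in> V \<Longrightarrow> x \<in> carrier (A c) \<Longrightarrow> \<pi> c (\<iota> c x) = x"
    "\<And>c c' x. c \<in> V \<Longrightarrow> c' \<in> V \<Longrightarrow> c \<noteq> c' \<Longrightarrow> x \<in> carrier (A c) \<Longrightarrow> \<pi> c' (\<iota> c x) = \<zero>\<^bsub>A c'\<^esub>"
    "\<And>z. z \<in> carrier P \<Longrightarrow> finite {c \<in> V. \<pi> c z \<noteq> \<zero>\<^bsub>A c\<^esub>}"
    "\<And>z. z \<in> carrier P \<Longrightarrow> (\<And>c. c \<in> V \<Longrightarrow> \<pi> c z = \<zero>\<^bsub>A c\<^esub>) \<Longrightarrow> z = \<zero>\<^bsub>P\<^esub>"
  using assms unfolding is_dsum_def by (auto simp: rmodulesD)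

lemma is_dsum_split:
  assumes D: "is_dsum R V A P \<iota> \<pi>" and z: "z \<in> carrier P" and c: "c \<in> V"
  obtains w where "w \<in> carrier P" "z = \<iota> c (\<pi> c z) \<oplus>\<^bsub>P\<^esub> w" "\<pi> c w = \<zero>\<^bsub>A c\<^esub>"
    "\<And>c'. c' \<in> V \<Longrightarrow> c' \<noteq> c \<Longrightarrow> \<pi> c' w = \<pi> c' z"
proof -
  note d = is_dsumD[OF D]
  note s = right_module_simps[OF d(2)]
  have p: "\<pi> c z \<in> carrier (A c)" by (rule rlinear_closed[OF d(6)[OF c] z])
  have i: "\<iota> c (\<pi> c z) \<in> carrier P" by (rule rlinear_closed[OF d(5)[OF c] p])
  let ?w = "z \<ominus>\<^bsub>P\<^esub> \<iota> c (\<pi> c z)"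
  have pw: "\<pi> c' ?w = \<pi> c' z \<ominus>\<^bsub>A c'\<^esub> \<pi> c' (\<iota> c (\<pi> c z))" if "c' \<in> V" for c'
    using rlinear_simps(3)[OF d(6) d(2) d(4), OF that that z i] .
  show thesis
  proof (rule that[of ?w])
    show "?w \<in> carrier P" using s z i by simp
    show "z = \<iota> c (\<pi> c z) \<oplus>\<^bsub>P\<^esub> ?w"
      by (rule represents_eq[where G = P],
          (rule represents | (rule represents_atom, simp add: s(1), simp add: z i) | (simp add: s(1); fail) | simp add: algebra_simps)+)
    show "\<pi> c ?w = \<zero>\<^bsub>A c\<^esub>"
      using pw[OF c] d(7)[OF c p] right_module_simps[OF d(4)[OF c]] p by simp
    show "\<pi> c' ?w = \<pi> c' z" if "c' \<in> V" "c' \<noteq> c" for c'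
      using pw[OF that(1)] d(8)[OF c that(1) _ p] that(2) right_module_simps[OF d(4)[OF that(1)]]
        rlinear_closed[OF d(6)[OF that(1)] z] by simp
  qed
qed

text \<open>Induction over a finite set that contains the support, splitting off one component at a
  time.\<close>

lemma is_dsum_induct [consumes 2, case_names zero add]:
  assumes D: "is_dsum R V A P \<iota> \<pi>" and z: "z \<in> carrier P"
    and zero: "Q \<zero>\<^bsub>P\<^esub>"
    and add: "\<And>c x w. c \<in> V \<Longrightarrow> x \<in> carrier (A c) \<Longrightarrow> w \<in> carrier P \<Longrightarrow> Q w \<Longrightarrow> Q (\<iota> c x \<oplus>\<^bsub>P\<^esub> w)"
  shows "Q z"
proof -
  note d = is_dsumD[OF D]
  have "Q z" if "finite F" "z \<in> carrier P" "{c \<in> V. \<pi> c z \<noteq> \<zero>\<^bsub>A c\<^esub>} \<subseteq> F" for F z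
    using that
  proof (induction F arbitrary: z rule: finite_induct)
    case empty
    then have "z = \<zero>\<^bsub>P\<^esub>" by (intro d(10)) auto
    then show ?case using zero by simp
  next
    case (insert c F)
    show ?case
    proof (cases "c \<in> V")
      case True
      obtain w where w: "w \<in> carrier P" "z = \<iota> c (\<pi> c z) \<oplus>\<^bsub>P\<^esub> w" "\<pi> c w = \<zero>\<^bsub>A c\<^esub>"
        "\<And>c'. c' \<in> V \<Longrightarrow> c' \<noteq> c \<Longrightarrow> \<pi> c' w = \<pi> c' z"
        by (rule is_dsum_split[OF D insert.prems(1) True]) blast
      have "{c \<in> V. \<pi> c w \<noteq> \<zero>\<^bsub>A c\<^esub>} \<subseteq> F"
      proof
        fix c' assume "c' \<in> {c \<in> V. \<pi> c w \<noteq> \<zero>\<^bsub>A c\<^esub>}"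
        then have c': "c' \<in> V" "\<pi> c' w \<noteq> \<zero>\<^bsub>A c'\<^esub>" by auto
        then have "c' \<noteq> c" using w(3) by metis
        then have "c' \<in> V" "c' \<noteq> c" "\<pi> c' z \<noteq> \<zero>\<^bsub>A c'\<^esub>" using w(4)[OF c'(1)] c' by simp_all
        then show "c' \<in> F" using insert.prems(2) by auto
      qed
      then have "Q w" by (rule insert.IH[OF w(1)])
      then have "Q (\<iota> c (\<pi> c z) \<oplus>\<^bsub>P\<^esub> w)"
        by (rule add[OF True rlinear_closed[OF d(6)[OF True] insert.prems(1)] w(1)])
      then show ?thesis using w(2) by simp
    next
      case False
      then show ?thesis using insert by (intro insert.IH) auto
    qed
  qed
  then show ?thesis using d(9)[OF z] z by blast
qed

lemma additive_finsum:
  assumes M: "abelian_group M" and N: "abelian_group N"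
    and h: "\<And>x. x \<in> carrier M \<Longrightarrow> h x \<in> carrier N"
    "\<And>x y. x \<in> carrier M \<Longrightarrow> y \<in> carrier M \<Longrightarrow> h (x \<oplus>\<^bsub>M\<^esub> y) = h x \<oplus>\<^bsub>N\<^esub> h y" "h \<zero>\<^bsub>M\<^esub> = \<zero>\<^bsub>N\<^esub>"
    and F: "finite F" "\<And>c. c \<in> F \<Longrightarrow> g c \<in> carrier M"
  shows "h (finsum M g F) = finsum N (\<lambda>c. h (g c)) F"
proof -
  interpret M: abelian_group M by fact
  interpret N: abelian_group N by fact
  show ?thesis using F
  proof (induction F rule: finite_induct)
    case (insert c F)
    then have "finsum M g (insert c F) = g c \<oplus>\<^bsub>M\<^esub> finsum M g F"
      by (intro M.finsum_insert) auto
    moreover have "finsum M g F \<in> carrier M" using insert by (intro M.finsum_closed) auto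
    moreover have "finsum N (\<lambda>c. h (g c)) (insert c F) = h (g c) \<oplus>\<^bsub>N\<^esub> finsum N (\<lambda>c. h (g c)) F"
      using insert h by (intro N.finsum_insert) auto
    ultimately show ?case using insert h by simp
  qed (simp add: h)
qed

lemma is_dsum_universal:
  assumes D: "is_dsum R V A P \<iota> \<pi>" and N: "right_module R N"
    and \<phi>: "\<And>c. c \<in> V \<Longrightarrow> rlinear R (A c) N (\<phi> c)"
  obtains \<Phi> where "rlinear R P N \<Phi>" "\<And>c x. c \<in> V \<Longrightarrow> x \<in> carrier (A c) \<Longrightarrow> \<Phi> (\<iota> c x) = \<phi> c x"
proof -
  note d = is_dsumD[OF D]
  interpret N: right_module R N by fact
  define supp where "supp z = {c \<in> V. \<pi> c z \<noteq> \<zero>\<^bsub>A c\<^esub>}" for z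
  define \<Phi> where "\<Phi> z = finsum N (\<lambda>c. \<phi> c (\<pi> c z)) (supp z)" for z
  have cl: "\<phi> c (\<pi> c z) \<in> carrier N" if "z \<in> carrier P" "c \<in> V" for c z
    using \<phi>[OF that(2)] d(6)[OF that(2)] that(1) by (simp add: rlinear_def)
  \<comment> \<open>Supports vary with z, so additivity is checked after enlarging them to a common
    finite set of indices.\<close>
  have sup: "\<Phi> z = finsum N (\<lambda>c. \<phi> c (\<pi> c z)) F"
    if "z \<in> carrier P" "finite F" "supp z \<subseteq> F" "F \<subseteq> V" for z F
    unfolding \<Phi>_def
  proof (rule N.M.add.finprod_mono_neutral_cong_left)
    show "\<phi> c (\<pi> c z) = \<zero>\<^bsub>N\<^esub>" if "c \<in> F - supp z" for c
      using that \<open>F \<subseteq> V\<close> rlinear_zero[OF \<phi> d(4) N] by (auto simp: supp_def)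
    show "(\<lambda>c. \<phi> c (\<pi> c z)) \<in> F \<rightarrow> carrier N"
      using cl[OF \<open>z \<in> carrier P\<close>] \<open>F \<subseteq> V\<close> by auto
  qed (use that in auto)
  have fin: "finite (supp z)" "supp z \<subseteq> V" if "z \<in> carrier P" for z
    using d(9)[OF that] by (auto simp: supp_def)
  note sP = right_module_simps[OF d(2)] and sN = right_module_simps[OF N]
  have "rlinear R P N \<Phi>"
  proof (rule rlinearI)
    fix z assume z: "z \<in> carrier P"
    show "\<Phi> z \<in> carrier N" unfolding \<Phi>_def
      by (rule N.M.finsum_closed) (use cl[OF z] fin[OF z] in auto)
    fix w assume w: "w \<in> carrier P"
    have zw: "z \<oplus>\<^bsub>P\<^esub> w \<in> carrier P" using z w sP by simp
    let ?F = "supp z \<union> supp w \<union> supp (z \<oplus>\<^bsub>P\<^esub> w)"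
    have F: "finite ?F" "?F \<subseteq> V" using fin[OF z] fin[OF w] fin[OF zw] by auto
    have "\<Phi> (z \<oplus>\<^bsub>P\<^esub> w) = finsum N (\<lambda>c. \<phi> c (\<pi> c (z \<oplus>\<^bsub>P\<^esub> w))) ?F" by (rule sup) (use zw F in auto)
    also have "\<dots> = finsum N (\<lambda>c. \<phi> c (\<pi> c z) \<oplus>\<^bsub>N\<^esub> \<phi> c (\<pi> c w)) ?F"
    proof (rule N.M.finsum_cong')
      show "\<phi> c (\<pi> c (z \<oplus>\<^bsub>P\<^esub> w)) = \<phi> c (\<pi> c z) \<oplus>\<^bsub>N\<^esub> \<phi> c (\<pi> c w)" if "c \<in> ?F" for c
      proof -
        have "c \<in> V" using that F by blast
        then show ?thesis using \<phi>[of c] d(6)[of c] z w by (simp add: rlinear_def)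
      qed
    qed (use cl[OF z] cl[OF w] F in auto)
    also have "\<dots> = finsum N (\<lambda>c. \<phi> c (\<pi> c z)) ?F \<oplus>\<^bsub>N\<^esub> finsum N (\<lambda>c. \<phi> c (\<pi> c w)) ?F"
      by (rule N.M.finsum_addf) (use cl[OF z] cl[OF w] F in auto)
    also have "finsum N (\<lambda>c. \<phi> c (\<pi> c z)) ?F = \<Phi> z" by (rule sup[symmetric]) (use z F in auto)
    also have "finsum N (\<lambda>c. \<phi> c (\<pi> c w)) ?F = \<Phi> w" by (rule sup[symmetric]) (use w F in auto)
    finally show "\<Phi> (z \<oplus>\<^bsub>P\<^esub> w) = \<Phi> z \<oplus>\<^bsub>N\<^esub> \<Phi> w" .
  next
    fix a z assume a: "a \<in> carrier R" and z: "z \<in> carrier P"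
    have az: "a \<odot>\<^bsub>P\<^esub> z \<in> carrier P" using z a sP by simp
    let ?F = "supp z \<union> supp (a \<odot>\<^bsub>P\<^esub> z)"
    have F: "finite ?F" "?F \<subseteq> V" using fin[OF z] fin[OF az] by auto
    have "\<Phi> (a \<odot>\<^bsub>P\<^esub> z) = finsum N (\<lambda>c. \<phi> c (\<pi> c (a \<odot>\<^bsub>P\<^esub> z))) ?F" by (rule sup) (use az F in auto)
    also have "\<dots> = finsum N (\<lambda>c. a \<odot>\<^bsub>N\<^esub> \<phi> c (\<pi> c z)) ?F"
    proof (rule N.M.finsum_cong')
      show "\<phi> c (\<pi> c (a \<odot>\<^bsub>P\<^esub> z)) = a \<odot>\<^bsub>N\<^esub> \<phi> c (\<pi> c z)" if "c \<in> ?F" for c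
      proof -
        have "c \<in> V" using that F by blast
        then show ?thesis using \<phi>[of c] d(6)[of c] z a by (simp add: rlinear_def)
      qed
    qed (use cl[OF z] F sN a in auto)
    also have "\<dots> = a \<odot>\<^bsub>N\<^esub> finsum N (\<lambda>c. \<phi> c (\<pi> c z)) ?F"
      by (rule additive_finsum[symmetric, OF sN(1) sN(1)]) (use cl[OF z] F a sN in auto)
    also have "finsum N (\<lambda>c. \<phi> c (\<pi> c z)) ?F = \<Phi> z" by (rule sup[symmetric]) (use z F in auto)
    finally show "\<Phi> (a \<odot>\<^bsub>P\<^esub> z) = a \<odot>\<^bsub>N\<^esub> \<Phi> z" .
  qed
  moreover have "\<Phi> (\<iota> c x) = \<phi> c x" if c: "c \<in> V" and x: "x \<in> carrier (A c)" for c x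
  proof -
    have i: "\<iota> c x \<in> carrier P" by (rule rlinear_closed[OF d(5)[OF c] x])
    have "\<Phi> (\<iota> c x) = finsum N (\<lambda>c'. \<phi> c' (\<pi> c' (\<iota> c x))) {c}"
      by (rule sup[OF i]) (use d(8)[OF c _ _ x] c in \<open>auto simp: supp_def\<close>)
    also have "\<dots> = \<phi> c x"
      using cl[OF i c] d(7)[OF c x] by (simp add: N.M.finsum_insert)
    finally show ?thesis .
  qed
  ultimately show thesis using that by blast
qed

text \<open>The injections and projections stay the same, so the sums over different sets of cells
  all lie inside one module and no comparison maps are needed.\<close>

lemma is_dsum_subset:
  assumes D: "is_dsum R V A P \<iota> \<pi>" and J: "J \<subseteq> V"
  shows "is_dsum R J A (P\<lparr>carrier := {z \<in> carrier P. \<forall>c\<in>V - J. \<pi> c z = \<zero>\<^bsub>A c\<^esub>}\<rparr>) \<iota> \<pi>"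
    (is "is_dsum R J A ?P \<iota> \<pi>")
proof -
  note d = is_dsumD[OF D]
  note sP = right_module_simps[OF d(2)]
  let ?H = "{z \<in> carrier P. \<forall>c\<in>V - J. \<pi> c z = \<zero>\<^bsub>A c\<^esub>}"
  have "right_module R ?P"
  proof (rule submodule_right_module[OF d(2)])
    note s = rlinear_simps[OF d(6) d(2) d(4)] right_module_simps[OF d(4)]
    show "?H \<subseteq> carrier P" by blast
    show "\<zero>\<^bsub>P\<^esub> \<in> ?H" using s sP by auto
    show "x \<oplus>\<^bsub>P\<^esub> y \<in> ?H" if "x \<in> ?H" "y \<in> ?H" for x y using that s sP by auto
    show "\<ominus>\<^bsub>P\<^esub> x \<in> ?H" if "x \<in> ?H" for x using that s sP by auto
    show "a \<odot>\<^bsub>P\<^esub> x \<in> ?H" if "a \<in> carrier R" "x \<in> ?H" for a x using that s sP by auto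
  qed
  moreover have "|?H| \<le>o |carrier P|" by (rule card_of_mono1) blast
  ultimately have "?P \<in> rmodules R"
    using d(1) by (auto simp: rmodules_def intro: small_mono)
  moreover have "finite {c \<in> J. \<pi> c z \<noteq> \<zero>\<^bsub>A c\<^esub>}" if "z \<in> carrier P" for z
    by (rule finite_subset[OF _ d(9)[OF that]]) (use J in auto)
  moreover have "z = \<zero>\<^bsub>P\<^esub>" if "z \<in> ?H" "\<forall>c\<in>J. \<pi> c z = \<zero>\<^bsub>A c\<^esub>" for z
    by (rule d(10)) (use that in auto)
  moreover have "rlinear R (A c) ?P (\<iota> c)" "rlinear R ?P (A c) (\<pi> c)" if "c \<in> J" for c
  proof -
    have c: "c \<in> V" using that J by blast
    have "\<pi> c' (\<iota> c x) = \<zero>\<^bsub>A c'\<^esub>" if "c' \<in> V - J" "x \<in> carrier (A c)" for c' x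
      by (rule d(8)[OF c _ _ that(2)]) (use that(1) \<open>c \<in> J\<close> in auto)
    then show "rlinear R (A c) ?P (\<iota> c)" "rlinear R ?P (A c) (\<pi> c)"
      using d(5,6)[OF c] by (auto simp: rlinear_def)
  qed
  ultimately show ?thesis
    using d(3,7,8) J unfolding is_dsum_def by (auto simp: subset_iff)
qed

text \<open>Every element is a finite sum of images of components, hence the value of a list over V
  x W.\<close>

lemma is_dsum_card:
  assumes D: "is_dsum R V A P \<iota> \<pi>" and B: "infinite B" and V: "|V| \<le>o |Pow B|"
    and U: "|W| \<le>o |Pow B|" "\<And>c. c \<in> V \<Longrightarrow> carrier (A c) \<subseteq> W"
  shows "|carrier P| \<le>o |Pow B|"
proof -
  let ?f = "\<lambda>l. foldr (\<lambda>p w. \<iota> (fst p) (snd p) \<oplus>\<^bsub>P\<^esub> w) l \<zero>\<^bsub>P\<^esub>"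
  have "z \<in> ?f ` lists (V \<times> W)" if "z \<in> carrier P" for z
    using D that
  proof (induction rule: is_dsum_induct)
    case zero
    show ?case by (rule image_eqI[of _ _ "[]"]) auto
  next
    case (add c x w)
    then obtain l where "w = ?f l" "l \<in> lists (V \<times> W)" by blast
    then show ?case using add(1,2) U(2)[OF add(1)] by (intro image_eqI[of _ _ "(c, x) # l"]) auto
  qed
  then have "|carrier P| \<le>o |?f ` lists (V \<times> W)|" by (intro card_of_mono1 subsetI)
  also have "|?f ` lists (V \<times> W)| \<le>o |lists (V \<times> W)|" by (rule card_of_image)
  also have "|lists (V \<times> W)| \<le>o |Pow B|" by (rule card_Pow_lists[OF B card_Pow_Times[OF B V U(1)]])
  finally show ?thesis .
qed

lemma is_dsum_exists:
  fixes A :: "'c \<Rightarrow> ('r, 'u) module"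
  assumes u: "universe TYPE('u)" and V: "small TYPE('u) V" and A: "\<And>c. c \<in> V \<Longrightarrow> A c \<in> rmodules R"
    and R: "ring R"
  shows "\<exists>P \<iota> \<pi>. is_dsum R V A P \<iota> \<pi>"
proof -
  note Am = A[THEN rmodulesD]
  note s = right_module_simps[OF Am]
  define F where "F = {z \<in> (\<Pi>\<^sub>E c\<in>V. carrier (A c)). finite {c \<in> V. z c \<noteq> \<zero>\<^bsub>A c\<^esub>}}"
  define M :: "('r, 'c \<Rightarrow> 'u) module" where
    "M = \<lparr>carrier = F, mult = undefined, one = undefined, zero = (\<lambda>c\<in>V. \<zero>\<^bsub>A c\<^esub>),
      add = (\<lambda>z w. \<lambda>c\<in>V. z c \<oplus>\<^bsub>A c\<^esub> w c), smult = (\<lambda>a z. \<lambda>c\<in>V. a \<odot>\<^bsub>A c\<^esub> z c)\<rparr>"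
  have Fc: "z c \<in> carrier (A c)" if "z \<in> F" "c \<in> V" for z c using that by (auto simp: F_def)
  have Fext: "z = w" if "z \<in> F" "w \<in> F" "\<And>c. c \<in> V \<Longrightarrow> z c = w c" for z w
    using that unfolding F_def by (auto intro: PiE_ext)
  have FI: "(\<lambda>c\<in>V. g c) \<in> F" if "\<And>c. c \<in> V \<Longrightarrow> g c \<in> carrier (A c)" "finite S"
    "\<And>c. c \<in> V \<Longrightarrow> c \<notin> S \<Longrightarrow> g c = \<zero>\<^bsub>A c\<^esub>" for g S
    unfolding F_def
  proof (intro CollectI conjI)
    show "finite {c \<in> V. (\<lambda>c\<in>V. g c) c \<noteq> \<zero>\<^bsub>A c\<^esub>}"
      by (rule finite_subset[OF _ that(2)]) (use that(3) in auto)
  qed (use that(1) in auto)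
  have Ffin: "finite {c \<in> V. z c \<noteq> \<zero>\<^bsub>A c\<^esub>}" if "z \<in> F" for z using that by (simp add: F_def)
  have F0: "(\<lambda>c\<in>V. \<zero>\<^bsub>A c\<^esub>) \<in> F" by (rule FI[of _ "{}"]) (use s in auto)
  have Fadd: "(\<lambda>c\<in>V. z c \<oplus>\<^bsub>A c\<^esub> w c) \<in> F" if "z \<in> F" "w \<in> F" for z w
    by (rule FI[of _ "{c \<in> V. z c \<noteq> \<zero>\<^bsub>A c\<^esub>} \<union> {c \<in> V. w c \<noteq> \<zero>\<^bsub>A c\<^esub>}"])
      (use s Fc that Ffin in auto)
  have Fneg: "(\<lambda>c\<in>V. \<ominus>\<^bsub>A c\<^esub> z c) \<in> F" if "z \<in> F" for z
    by (rule FI[of _ "{c \<in> V. z c \<noteq> \<zero>\<^bsub>A c\<^esub>}"]) (use s Fc that Ffin in auto)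
  have Fsm: "(\<lambda>c\<in>V. a \<odot>\<^bsub>A c\<^esub> z c) \<in> F" if "z \<in> F" "a \<in> carrier R" for a z
    by (rule FI[of _ "{c \<in> V. z c \<noteq> \<zero>\<^bsub>A c\<^esub>}"]) (use s Fc that Ffin in auto)
  have gp: "abelian_group (A c)" if "c \<in> V" for c by (rule s(1)[OF that])
  have "abelian_group M"
  proof (rule abelian_groupI)
    fix z w v assume "z \<in> carrier M" "w \<in> carrier M" "v \<in> carrier M"
    then have F: "z \<in> F" "w \<in> F" "v \<in> F" by (simp_all add: M_def)
    then show "z \<oplus>\<^bsub>M\<^esub> w \<in> carrier M" by (simp add: M_def Fadd)
    show "z \<oplus>\<^bsub>M\<^esub> w \<oplus>\<^bsub>M\<^esub> v = z \<oplus>\<^bsub>M\<^esub> (w \<oplus>\<^bsub>M\<^esub> v)"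
      using F Fc gp by (auto simp: M_def abelian_monoid.a_assoc abelian_group.axioms intro!: restrict_ext)
    show "z \<oplus>\<^bsub>M\<^esub> w = w \<oplus>\<^bsub>M\<^esub> z"
      using F Fc gp by (auto simp: M_def abelian_monoid.a_comm abelian_group.axioms intro!: restrict_ext)
  next
    fix z assume "z \<in> carrier M"
    then have F: "z \<in> F" by (simp add: M_def)
    show "\<zero>\<^bsub>M\<^esub> \<oplus>\<^bsub>M\<^esub> z = z"
      by (rule Fext) (use F F0 Fc s Fadd[OF F0 F] in \<open>auto simp: M_def\<close>)
    show "\<exists>w\<in>carrier M. w \<oplus>\<^bsub>M\<^esub> z = \<zero>\<^bsub>M\<^esub>"
      using Fneg[OF F] F Fc abelian_group.l_neg[OF gp]
      by (intro bexI[of _ "\<lambda>c\<in>V. \<ominus>\<^bsub>A c\<^esub> z c"]) (auto simp: M_def intro!: restrict_ext)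
  qed (simp add: M_def F0)
  then interpret M: abelian_group M .
  interpret R: ring R by fact
  have M: "right_module R M"
  proof unfold_locales
    fix a x assume a: "a \<in> carrier R" and "x \<in> carrier M"
    then have x: "x \<in> F" by (simp add: M_def)
    show "a \<odot>\<^bsub>M\<^esub> x \<in> carrier M" using Fsm[OF x a] by (simp add: M_def)
    fix b assume b: "b \<in> carrier R"
    show "(a \<oplus>\<^bsub>R\<^esub> b) \<odot>\<^bsub>M\<^esub> x = a \<odot>\<^bsub>M\<^esub> x \<oplus>\<^bsub>M\<^esub> b \<odot>\<^bsub>M\<^esub> x" "(a \<otimes>\<^bsub>R\<^esub> b) \<odot>\<^bsub>M\<^esub> x = b \<odot>\<^bsub>M\<^esub> (a \<odot>\<^bsub>M\<^esub> x)"
      using a b x Fc right_module.smult_l_distr[OF Am] right_module.smult_assoc[OF Am]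
      by (auto simp: M_def intro!: restrict_ext)
  next
    fix a x y assume a: "a \<in> carrier R" and "x \<in> carrier M" "y \<in> carrier M"
    then have x: "x \<in> F" "y \<in> F" by (simp_all add: M_def)
    show "a \<odot>\<^bsub>M\<^esub> (x \<oplus>\<^bsub>M\<^esub> y) = a \<odot>\<^bsub>M\<^esub> x \<oplus>\<^bsub>M\<^esub> a \<odot>\<^bsub>M\<^esub> y"
      using a x Fc s by (auto simp: M_def intro!: restrict_ext)
  next
    fix x assume "x \<in> carrier M"
    then have x: "x \<in> F" by (simp add: M_def)
    show "\<one>\<^bsub>R\<^esub> \<odot>\<^bsub>M\<^esub> x = x"
      by (rule Fext) (use x Fc Fsm[OF x R.one_closed] right_module.smult_one[OF Am] in \<open>auto simp: M_def\<close>)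
  qed
  have "small TYPE('u) F"
  proof -
    have "small TYPE('u) (V \<rightarrow>\<^sub>E (\<Union>c\<in>V. carrier (A c)))"
      by (intro small_PiE small_UN u V) (use A in \<open>auto simp: rmodules_def\<close>)
    then show ?thesis by (rule small_subset) (auto simp: F_def)
  qed
  then obtain e :: "('c \<Rightarrow> 'u) \<Rightarrow> 'u" where e: "inj_on e F" using small_embeds by blast
  have ec: "inj_on e (carrier M)" using e by (simp add: M_def)
  let ?P = "transport_module e M" and ?d = "inv_into (carrier M) e"
  note P = transport_module[OF M ec]
  have Pc: "carrier ?P = e ` F" by (simp add: transport_module_def M_def)
  have de: "?d (e z) = z" if "z \<in> F" for z using inv_into_f_f[OF ec, of z] that by (simp add: M_def)
  let ?i = "\<lambda>c x. \<lambda>c'\<in>V. if c' = c then x else \<zero>\<^bsub>A c'\<^esub>"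
  have iF: "?i c x \<in> F" if "c \<in> V" "x \<in> carrier (A c)" for c x
    by (rule FI[of _ "{c}"]) (use s that in auto)
  have il: "rlinear R (A c) M (?i c)" if "c \<in> V" for c
    by (rule rlinearI) (use that iF s in \<open>auto simp: M_def intro!: restrict_ext\<close>)
  have pl: "rlinear R M (A c) (\<lambda>z. z c)" if "c \<in> V" for c
    by (rule rlinearI) (use that Fc in \<open>auto simp: M_def\<close>)
  have "is_dsum R V A ?P (\<lambda>c x. e (?i c x)) (\<lambda>c z. ?d z c)"
    unfolding is_dsum_def
  proof (intro conjI ballI impI)
    show "?P \<in> rmodules R" using P(1) small_image[OF \<open>small TYPE('u) F\<close>, of e] by (simp add: rmodules_def Pc)
  next
    fix c assume c: "c \<in> V"
    show "A c \<in> rmodules R" by (rule A[OF c])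
    show "rlinear R (A c) ?P (\<lambda>x. e (?i c x))" by (rule rlinear_comp[OF P(2) il[OF c]])
    show "rlinear R ?P (A c) (\<lambda>z. ?d z c)" by (rule rlinear_comp[OF pl[OF c] P(3)])
    fix x assume x: "x \<in> carrier (A c)"
    show "?d (e (?i c x)) c = x" using de[OF iF[OF c x]] c by simp
  next
    fix c c' x assume "c \<in> V" "c' \<in> V" "c \<noteq> c'" "x \<in> carrier (A c)"
    then show "?d (e (?i c x)) c' = \<zero>\<^bsub>A c'\<^esub>" using de[OF iF] by simp
  next
    fix z assume "z \<in> carrier ?P"
    then obtain w where w: "w \<in> F" "z = e w" by (auto simp: Pc)
    show "finite {c \<in> V. ?d z c \<noteq> \<zero>\<^bsub>A c\<^esub>}" using Ffin[OF w(1)] by (simp add: w(2) de[OF w(1)])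
    assume "\<forall>c\<in>V. ?d z c = \<zero>\<^bsub>A c\<^esub>"
    then have "w = (\<lambda>c\<in>V. \<zero>\<^bsub>A c\<^esub>)" by (intro Fext w F0) (simp add: w(2) de[OF w(1)])
    then show "z = \<zero>\<^bsub>?P\<^esub>" by (simp add: w(2) transport_module_def M_def)
  qed
  then show ?thesis by blast
qed

lemma (in module_universe) is_dsum_projective:
  fixes P :: "('r, 'u) module"
  assumes D: "is_dsum R V A P \<iota> \<pi>" and A: "\<And>c. c \<in> V \<Longrightarrow> projective R (A c)"
  shows "projective R P"
proof (rule projectiveI)
  note d = is_dsumD[OF D]
  show "P \<in> rmodules R" by (rule d(1))
  fix M N :: "('r, 'u) module" and p f
  assume h: "M \<in> rmodules R" "N \<in> rmodules R" "rlinear R M N p" "p ` carrier M = carrier N" "rlinear R P N f"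
  note MN = h(1,2)[THEN rmodulesD]
  have "\<exists>g. rlinear R (A c) M g \<and> (\<forall>x\<in>carrier (A c). p (g x) = f (\<iota> c x))" if c: "c \<in> V" for c
    by (rule projective_lift[OF A[OF c] h(1-4) rlinear_comp[OF h(5) d(5)[OF c]]]) blast
  then obtain g where g: "\<And>c. c \<in> V \<Longrightarrow> rlinear R (A c) M (g c)"
    "\<And>c x. c \<in> V \<Longrightarrow> x \<in> carrier (A c) \<Longrightarrow> p (g c x) = f (\<iota> c x)" by metis
  obtain G where G: "rlinear R P M G" "\<And>c x. c \<in> V \<Longrightarrow> x \<in> carrier (A c) \<Longrightarrow> G (\<iota> c x) = g c x"
    by (rule is_dsum_universal[OF D MN(1) g(1)]) auto
  have "p (G z) = f z" if z: "z \<in> carrier P" for z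
    using D z
  proof (induction rule: is_dsum_induct)
    case zero
    show ?case using rlinear_simps[OF h(3) MN] rlinear_simps[OF G(1) d(2) MN(1)] rlinear_simps[OF h(5) d(2) MN(2)]
      by simp
  next
    case (add c x w)
    have i: "\<iota> c x \<in> carrier P" by (rule rlinear_closed[OF d(5)[OF add(1)] add(2)])
    have "p (G (\<iota> c x)) = f (\<iota> c x)" using G(2) g(2) add(1,2) by simp
    then show ?case using i add(3,4) rlinear_simps[OF h(3) MN] rlinear_simps[OF G(1) d(2) MN(1)]
        rlinear_simps[OF h(5) d(2) MN(2)] by simp
  qed
  then show "\<exists>g. rlinear R P M g \<and> (\<forall>x\<in>carrier P. p (g x) = f x)" using G(1) by blast
qed

text \<open>L is a copy of R as a right module over itself; with the scalar written on the left,
  \<open>smult a r\<close> is r a. Maps out of L are determined by the image of the unit, which can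
  be prescribed.\<close>

lemma (in module_universe) free_module:
  assumes "small TYPE('u) (carrier R)"
  obtains L :: "('r, 'u) module" where "projective R L"
    "\<And>M m. (M :: ('r, 'u) module) \<in> rmodules R \<Longrightarrow> m \<in> carrier M \<Longrightarrow>
      \<exists>f. rlinear R L M f \<and> m \<in> f ` carrier L"
proof -
  interpret R: ring R by (rule ring)
  obtain e :: "'r \<Rightarrow> 'u" where e: "inj_on e (carrier R)" using small_embeds[OF assms] .
  define F :: "('r, 'r) module" where "F = \<lparr>carrier = carrier R, mult = undefined, one = undefined,
    zero = \<zero>\<^bsub>R\<^esub>, add = (\<oplus>\<^bsub>R\<^esub>), smult = (\<lambda>a r. r \<otimes>\<^bsub>R\<^esub> a)\<rparr>"
  have "abelian_group F"
  proof (rule abelian_groupI)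
    fix x assume "x \<in> carrier F"
    then show "\<exists>y\<in>carrier F. y \<oplus>\<^bsub>F\<^esub> x = \<zero>\<^bsub>F\<^esub>"
      by (intro bexI[of _ "\<ominus>\<^bsub>R\<^esub> x"]) (simp_all add: F_def R.l_neg)
  qed (auto simp: F_def R.a_ac)
  then interpret F: abelian_group F .
  have F: "right_module R F"
    by unfold_locales (auto simp: F_def R.r_distr R.l_distr R.m_assoc)
  have e': "inj_on e (carrier F)" using e by (simp add: F_def)
  let ?L = "transport_module e F" and ?d = "inv_into (carrier F) e"
  note L = transport_module[OF F e']
  have Lc: "carrier ?L = e ` carrier R" by (simp add: transport_module_def F_def)
  have de: "?d (e r) = r" if "r \<in> carrier R" for r using inv_into_f_f[OF e', of r] that by (simp add: F_def)
  have Lr: "?L \<in> rmodules R" using L(1) small_image[OF assms, of e] by (simp add: rmodules_def Lc)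
  have ex: "\<exists>f. rlinear R ?L M f \<and> f (e \<one>\<^bsub>R\<^esub>) = m"
    if M: "M \<in> rmodules R" and m: "m \<in> carrier M" for M :: "('r, 'u) module" and m
  proof -
    interpret M: right_module R M by (rule rmodulesD[OF M])
    have "rlinear R F M (\<lambda>r. r \<odot>\<^bsub>M\<^esub> m)"
      by (rule rlinearI) (use m in \<open>auto simp: F_def M.smult_l_distr M.smult_assoc\<close>)
    from rlinear_comp[OF this L(3)] show ?thesis
      using de[OF R.one_closed] m by (intro exI[of _ "\<lambda>z. ?d z \<odot>\<^bsub>M\<^esub> m"]) simp
  qed
  have one: "e \<one>\<^bsub>R\<^esub> \<in> carrier ?L" by (simp add: Lc)
  show thesis
  proof (rule that[of ?L])
    show "\<exists>f. rlinear R ?L M f \<and> m \<in> f ` carrier ?L" if "M \<in> rmodules R" "m \<in> carrier M"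
      for M :: "('r, 'u) module" and m
      using ex[OF that] one by blast
    show "projective R ?L"
    proof (rule projectiveI[OF Lr])
      fix M N :: "('r, 'u) module" and p f
      assume h: "M \<in> rmodules R" "N \<in> rmodules R" "rlinear R M N p" "p ` carrier M = carrier N" "rlinear R ?L N f"
      have "f (e \<one>\<^bsub>R\<^esub>) \<in> carrier N" by (rule rlinear_closed[OF h(5) one])
      then obtain m where m: "m \<in> carrier M" "p m = f (e \<one>\<^bsub>R\<^esub>)" using h(4) by (metis imageE)
      obtain g where g: "rlinear R ?L M g" "g (e \<one>\<^bsub>R\<^esub>) = m" using ex[OF h(1) m(1)] by blast
      have "p (g z) = f z" if "z \<in> carrier ?L" for z
      proof -
        obtain r where r: "r \<in> carrier R" "z = e r" using \<open>z \<in> carrier ?L\<close> by (auto simp: Lc)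
        have "r \<odot>\<^bsub>?L\<^esub> e \<one>\<^bsub>R\<^esub> = z" using r de[OF R.one_closed] by (simp add: transport_module_def F_def)
        then have z: "z = r \<odot>\<^bsub>?L\<^esub> e \<one>\<^bsub>R\<^esub>" by simp
        show ?thesis unfolding z using g h(3,5) m one r(1) by (simp add: rlinear_def)
      qed
      then show "\<exists>g. rlinear R ?L M g \<and> (\<forall>x\<in>carrier ?L. p (g x) = f x)" using g(1) by blast
    qed
  qed
qed


section \<open>Cellular complexes\<close>

text \<open>If S sits in T as a cell attached along \<open>a\<close>, the embedding with a sign, x
  |-> (-i x, 0), contracts the map (a, g i) into the cone: attaching a cell kills the map that it is
  attached by.\<close>

lemma (in module_universe) cone_null_homotopicI:
  fixes S T M :: "('r, 'u) cochain_complex"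
  assumes cx: "S \<in> complexes R" "T \<in> complexes R" "M \<in> complexes R" and g: "chain_map R T M g"
    and i: "\<And>n. rlinear R (Ob S n) (Ob T n) (i n)"
    and a: "\<And>n x. x \<in> carrier (Ob S n) \<Longrightarrow> a n x \<in> carrier (Ob T (n + 1))"
    and d: "\<And>n x. x \<in> carrier (Ob S n) \<Longrightarrow> Diff T n (i n x) = i (n + 1) (Diff S n x) \<oplus>\<^bsub>Ob T (n + 1)\<^esub> a n x"
  shows "null_homotopic R S (cone T M g) (\<lambda>n x. pair (a n x, g n (i n x)))"
proof -
  note [simp] = cone_simps[OF cx(2,3) g] complex_simps[OF cx(1)] a
    rlinear_simps[OF i complex_module(2)[OF cx(1)] complex_module(2)[OF cx(2)]]
  show ?thesis
  proof (rule null_homotopicI[where s = "\<lambda>n x. pair (\<ominus>\<^bsub>Ob T n\<^esub> i n x, \<zero>\<^bsub>Ob M (n - 1)\<^esub>)"])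
    show "rlinear R (Ob S n) (Ob (cone T M g) (n - 1)) (\<lambda>x. pair (\<ominus>\<^bsub>Ob T n\<^esub> i n x, \<zero>\<^bsub>Ob M (n - 1)\<^esub>))" for n
      by (auto intro!: rlinear_pair rlinear_uminus i rlinear_const_zero complex_module cx)
    fix n x assume x: "x \<in> carrier (Ob S n)"
    have 1: "i (n + 1) (Diff S n x) \<oplus>\<^bsub>Ob T (n + 1)\<^esub> a n x \<oplus>\<^bsub>Ob T (n + 1)\<^esub> \<ominus>\<^bsub>Ob T (n + 1)\<^esub> i (n + 1) (Diff S n x) = a n x"
      by (rule represents_eq[where G = "Ob T (n + 1)"],
          (rule represents | (rule represents_atom, simp, simp add: x) | (simp; fail) | simp add: algebra_simps)+)
    show "pair (a n x, g n (i n x)) = Diff (cone T M g) (n - 1) (pair (\<ominus>\<^bsub>Ob T n\<^esub> i n x, \<zero>\<^bsub>Ob M (n - 1)\<^esub>))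
       \<oplus>\<^bsub>Ob (cone T M g) n\<^esub> pair (\<ominus>\<^bsub>Ob T (n + 1)\<^esub> i (n + 1) (Diff S n x), \<zero>\<^bsub>Ob M (n + 1 - 1)\<^esub>)"
      using x 1 by (simp add: d a_minus_def)
  qed
qed

text \<open>
  A cell \<open>c\<close> consists of a complex \<open>S c\<close> and of attaching maps \<open>\<alpha> c : S c \<rightarrow> P\<close> of degree 1 and
  \<open>\<beta> c : S c \<rightarrow> M\<close> of degree 0, where \<open>P\<close> is the direct sum over all cells; \<open>\<delta>\<close> and \<open>\<gamma>\<close> are the
  resulting would-be differential of \<open>P\<close> and would-be chain map \<open>P \<rightarrow> M\<close>. Cells that violate the
  required identities precede themselves in the relation \<open>below\<close>, hence are excluded from its
  accessible part, and \<open>P\<close> restricted to the accessible cells is a complex over \<open>M\<close>.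
\<close>

locale cells = module_universe R U
  for R :: "('r, 'k) ring_scheme" and U :: "'u itself" +
  fixes S :: "'c \<Rightarrow> ('r, 'u) cochain_complex" and V :: "'c set" and P :: "int \<Rightarrow> ('r, 'u) module"
    and \<iota> \<pi> :: "int \<Rightarrow> 'c \<Rightarrow> 'u \<Rightarrow> 'u" and \<alpha> \<beta> :: "'c \<Rightarrow> int \<Rightarrow> 'u \<Rightarrow> 'u"
    and \<delta> \<gamma> :: "int \<Rightarrow> 'u \<Rightarrow> 'u" and M :: "('r, 'u) cochain_complex"
  assumes S: "\<And>c. c \<in> V \<Longrightarrow> S c \<in> complexes R" and M: "M \<in> complexes R"
    and dsum: "\<And>n. is_dsum R V (\<lambda>c. Ob (S c) n) (P n) (\<iota> n) (\<pi> n)"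
    and \<alpha>: "\<And>c n. c \<in> V \<Longrightarrow> rlinear R (Ob (S c) n) (P (n + 1)) (\<alpha> c n)"
    and \<beta>: "\<And>c n. c \<in> V \<Longrightarrow> rlinear R (Ob (S c) n) (Ob M n) (\<beta> c n)"
    and \<delta>: "\<And>n. rlinear R (P n) (P (n + 1)) (\<delta> n)"
    and \<delta>_cell: "\<And>n c x. c \<in> V \<Longrightarrow> x \<in> carrier (Ob (S c) n) \<Longrightarrow>
      \<delta> n (\<iota> n c x) = \<iota> (n + 1) c (Diff (S c) n x) \<oplus>\<^bsub>P (n + 1)\<^esub> \<alpha> c n x"
    and \<gamma>: "\<And>n. rlinear R (P n) (Ob M n) (\<gamma> n)"
    and \<gamma>_cell: "\<And>n c x. c \<in> V \<Longrightarrow> x \<in> carrier (Ob (S c) n) \<Longrightarrow> \<gamma> n (\<iota> n c x) = \<beta> c n x"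
begin

text \<open>Given that \<open>\<delta>\<close> and \<open>\<gamma>\<close> are determined by their
  values on cells, the two identities say that \<open>\<delta>\<close> squares to zero and that
  \<open>\<gamma>\<close> commutes with the differentials on the summand of c. They are also the
  formulas for (\<alpha>, \<beta>) to be a chain map into the cone of \<gamma>.\<close>

definition valid :: "'c \<Rightarrow> bool" where
  "valid c \<longleftrightarrow> (\<forall>n. \<forall>x\<in>carrier (Ob (S c) n).
     \<alpha> c (n + 1) (Diff (S c) n x) = \<ominus>\<^bsub>P (n + 2)\<^esub> \<delta> (n + 1) (\<alpha> c n x) \<and>
     \<beta> c (n + 1) (Diff (S c) n x) = Diff M n (\<beta> c n x) \<ominus>\<^bsub>Ob M (n + 1)\<^esub> \<gamma> (n + 1) (\<alpha> c n x))"

definition below :: "'c rel" where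
  "below = {(c', c). c \<in> V \<and> c' \<in> V \<and>
     ((\<exists>n. \<exists>x\<in>carrier (Ob (S c) n). \<pi> (n + 1) c' (\<alpha> c n x) \<noteq> \<zero>\<^bsub>Ob (S c') (n + 1)\<^esub>) \<or>
      c' = c \<and> \<not> valid c)}"

definition J :: "'c set" where
  "J = V \<inter> Wellfounded.acc below"

text \<open>Only the accessible part of \<open>below\<close> is well founded; inductions and
  recursions over cells use this restriction.\<close>

definition below' :: "'c rel" where
  "below' = {(c', c) \<in> below. c \<in> J}"

definition sub :: "'c set \<Rightarrow> int \<Rightarrow> ('r, 'u) module" where
  "sub K n = (P n)\<lparr>carrier := {z \<in> carrier (P n). \<forall>c\<in>V - K. \<pi> n c z = \<zero>\<^bsub>Ob (S c) n\<^esub>}\<rparr>"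

definition closed :: "'c set \<Rightarrow> bool" where
  "closed K \<longleftrightarrow> K \<subseteq> J \<and> (\<forall>c c'. c \<in> K \<longrightarrow> (c', c) \<in> below \<longrightarrow> c' \<in> K)"

definition T :: "('r, 'u) cochain_complex" where
  "T = \<lparr>Ob = sub J, Diff = (\<lambda>n. restrict (\<delta> n) (carrier (sub J n)))\<rparr>"

lemma JV: "c \<in> J \<Longrightarrow> c \<in> V"
  by (simp add: J_def)

lemma wf_below': "wf below'"
proof (rule wfUNIVI)
  fix Q x assume h: "\<forall>x. (\<forall>y. (y, x) \<in> below' \<longrightarrow> Q y) \<longrightarrow> Q x"
  have "Q x" if "x \<in> Wellfounded.acc below" for x
    using that
  proof (rule acc_induct)
    fix x assume "\<forall>y. (y, x) \<in> below \<longrightarrow> Q y"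
    then show "Q x" using h unfolding below'_def by blast
  qed
  then show "Q x" using h unfolding below'_def J_def by blast
qed

lemma below_irrefl: "c \<in> J \<Longrightarrow> (c, c) \<notin> below"
  using wf_not_refl[OF wf_below', of c] by (simp add: below'_def)

lemma J_valid: "c \<in> J \<Longrightarrow> valid c"
  using below_irrefl JV by (auto simp: below_def)

lemma closed_J: "closed J"
  unfolding closed_def
proof (intro conjI allI impI order_refl)
  fix c c' assume c: "c \<in> J" "(c', c) \<in> below"
  then have "c' \<in> Wellfounded.acc below" using acc_downward[of c below c'] by (simp add: J_def)
  moreover have "c' \<in> V" using c(2) by (simp add: below_def)
  ultimately show "c' \<in> J" by (simp add: J_def)
qed

lemma closed_down: "closed {c'. (c', c) \<in> below'\<^sup>+}"
proof -
  have 1: "c' \<in> J" if "(c', c) \<in> below'\<^sup>+" for c'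
    using that by (induction rule: converse_trancl_induct)
      (use closed_J in \<open>auto simp: closed_def below'_def\<close>)
  have 2: "(d, c) \<in> below'\<^sup>+" if "(c', c) \<in> below'\<^sup>+" "(d, c') \<in> below" for d c'
  proof -
    have "(d, c') \<in> below'" using 1[OF that(1)] that(2) by (simp add: below'_def)
    then show ?thesis using that(1) by (rule trancl_into_trancl2)
  qed
  show ?thesis unfolding closed_def using 1 2 by blast
qed

lemma sub_ops [simp]: "\<zero>\<^bsub>sub K n\<^esub> = \<zero>\<^bsub>P n\<^esub>" "(\<oplus>\<^bsub>sub K n\<^esub>) = (\<oplus>\<^bsub>P n\<^esub>)" "(\<odot>\<^bsub>sub K n\<^esub>) = (\<odot>\<^bsub>P n\<^esub>)"
  by (simp_all add: sub_def)

lemma sub_carrier: "z \<in> carrier (sub K n) \<longleftrightarrow> z \<in> carrier (P n) \<and> (\<forall>c\<in>V - K. \<pi> n c z = \<zero>\<^bsub>Ob (S c) n\<^esub>)"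
  by (simp add: sub_def)

lemma sub_mono: "K \<subseteq> K' \<Longrightarrow> z \<in> carrier (sub K n) \<Longrightarrow> z \<in> carrier (sub K' n)"
  by (auto simp: sub_carrier)

lemma sub_dsum: "K \<subseteq> V \<Longrightarrow> is_dsum R K (\<lambda>c. Ob (S c) n) (sub K n) (\<iota> n) (\<pi> n)"
  unfolding sub_def by (rule is_dsum_subset[OF dsum])

lemma sub_module: "K \<subseteq> V \<Longrightarrow> right_module R (sub K n)"
  by (rule is_dsumD(2)[OF sub_dsum])

lemma sub_uminus:
  assumes "K \<subseteq> V" "x \<in> carrier (sub K n)"
  shows "\<ominus>\<^bsub>sub K n\<^esub> x = \<ominus>\<^bsub>P n\<^esub> x"
proof -
  interpret P: right_module R "P n" by (rule is_dsumD(2)[OF dsum])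
  interpret K: right_module R "sub K n" by (rule sub_module[OF assms(1)])
  have "\<ominus>\<^bsub>sub K n\<^esub> x \<oplus>\<^bsub>P n\<^esub> x = \<zero>\<^bsub>P n\<^esub>" using K.M.l_neg[OF assms(2)] by simp
  moreover have "\<ominus>\<^bsub>sub K n\<^esub> x \<in> carrier (P n)" using K.M.a_inv_closed[OF assms(2)] by (simp add: sub_carrier)
  ultimately show ?thesis using P.M.minus_equality assms(2) by (simp add: sub_carrier)
qed

lemma cell_in_sub: "K \<subseteq> V \<Longrightarrow> c \<in> K \<Longrightarrow> x \<in> carrier (Ob (S c) n) \<Longrightarrow> \<iota> n c x \<in> carrier (sub K n)"
  using rlinear_closed[OF is_dsumD(5)[OF sub_dsum]] .

lemma closedV: "closed K \<Longrightarrow> K \<subseteq> V"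
  using JV by (auto simp: closed_def)

lemma \<alpha>_sub:
  assumes "c \<in> V" "\<And>c'. (c', c) \<in> below \<Longrightarrow> c' \<in> K" "x \<in> carrier (Ob (S c) n)"
  shows "\<alpha> c n x \<in> carrier (sub K (n + 1))"
  using rlinear_closed[OF \<alpha>[OF assms(1)] assms(3)] assms by (auto simp: sub_carrier below_def)

lemma \<alpha>_sub_rlinear:
  assumes "c \<in> V" "\<And>c'. (c', c) \<in> below \<Longrightarrow> c' \<in> K"
  shows "rlinear R (Ob (S c) n) (sub K (n + 1)) (\<alpha> c n)"
  using \<alpha>_sub[OF assms] \<alpha>[OF assms(1), of n] by (simp add: rlinear_def)

lemma \<delta>_sub:
  assumes K: "closed K" and z: "z \<in> carrier (sub K n)"
  shows "\<delta> n z \<in> carrier (sub K (n + 1))"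
  using sub_dsum[OF closedV[OF K]] z
proof (induction rule: is_dsum_induct)
  note s = right_module_simps[OF sub_module[OF closedV[OF K]]]
  note Pm = is_dsumD(2)[OF dsum]
  case zero
  then show ?case using rlinear_zero[OF \<delta> Pm Pm] s(2)[of "n + 1"] by simp
next
  note s = right_module_simps[OF sub_module[OF closedV[OF K]]]
  case (add c x w)
  have c: "c \<in> V" using add(1) closedV[OF K] by blast
  have "\<iota> n c x \<in> carrier (P n)" "w \<in> carrier (P n)"
    using cell_in_sub[OF closedV[OF K] add(1,2)] add(3) by (simp_all add: sub_carrier)
  then have "\<delta> n (\<iota> n c x \<oplus>\<^bsub>P n\<^esub> w) = \<delta> n (\<iota> n c x) \<oplus>\<^bsub>P (n + 1)\<^esub> \<delta> n w"
    using \<delta>[of n] by (simp add: rlinear_def)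
  moreover have "\<alpha> c n x \<in> carrier (sub K (n + 1))"
    by (rule \<alpha>_sub[OF c _ add(2)]) (use K add(1) in \<open>auto simp: closed_def\<close>)
  moreover have "\<iota> (n + 1) c (Diff (S c) n x) \<in> carrier (sub K (n + 1))"
    using add(1,2) complex_simps[OF S[OF c]] by (intro cell_in_sub closedV[OF K]) auto
  ultimately show ?case using \<delta>_cell[OF c add(2)] s(3)[of _ "n + 1"] add(4) by simp
qed

lemma \<delta>_sub_rlinear: "closed K \<Longrightarrow> rlinear R (sub K n) (sub K (n + 1)) (\<delta> n)"
  using \<delta>_sub \<delta>[of n] by (simp add: rlinear_def sub_carrier)

lemma Pm: "right_module R (P n)"
  by (rule is_dsumD(2)[OF dsum])

lemma \<delta>\<delta>:
  assumes z: "z \<in> carrier (sub J n)"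
  shows "\<delta> (n + 1) (\<delta> n z) = \<zero>\<^bsub>P (n + 2)\<^esub>"
  using sub_dsum[OF closedV[OF closed_J]] z
proof (induction rule: is_dsum_induct)
  case zero
  then show ?case using rlinear_zero[OF \<delta> Pm Pm, of n] rlinear_zero[OF \<delta> Pm Pm, of "n + 1"]
    by (simp add: index_simps)
next
  note s = right_module_simps[OF Pm] rlinear_simps[OF \<delta> Pm Pm]
  case (add c x w)
  note c = JV[OF add(1)]
  note cs = complex_simps[OF S[OF c]]
  have i: "\<iota> n c x \<in> carrier (P n)" "w \<in> carrier (P n)"
    using cell_in_sub[OF closedV[OF closed_J] add(1,2)] add(3) by (simp_all add: sub_carrier)
  have dx: "Diff (S c) n x \<in> carrier (Ob (S c) (n + 1))" using cs add(2) by simp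
  have ax: "\<alpha> c n x \<in> carrier (P (n + 1))" by (rule rlinear_closed[OF \<alpha>[OF c] add(2)])
  have idx: "\<iota> (n + 1) c (Diff (S c) n x) \<in> carrier (P (n + 1))"
    by (rule rlinear_closed[OF is_dsumD(5)[OF dsum c] dx])
  have v: "\<alpha> c (n + 1) (Diff (S c) n x) = \<ominus>\<^bsub>P (n + 2)\<^esub> \<delta> (n + 1) (\<alpha> c n x)"
    using J_valid[OF add(1)] add(2) by (simp add: valid_def)
  have dax: "\<delta> (n + 1) (\<alpha> c n x) \<in> carrier (P (n + 2))"
    using rlinear_closed[OF \<delta> ax] by (simp add: index_simps)
  have "Diff (S c) (n + 1) (Diff (S c) n x) = \<zero>\<^bsub>Ob (S c) (n + 2)\<^esub>" 
    using cs(17)[OF refl add(2)] by (simp add: index_simps)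
  then have "\<delta> (n + 1) (\<iota> (n + 1) c (Diff (S c) n x)) = \<ominus>\<^bsub>P (n + 2)\<^esub> \<delta> (n + 1) (\<alpha> c n x)"
    using \<delta>_cell[OF c dx] v rlinear_zero[OF is_dsumD(5)[OF dsum c] complex_module(2)[OF S[OF c]] Pm, of "n + 2"]
      s(7)[of _ "n + 2"] s(5)[OF dax] by (simp add: index_simps)
  then have "\<delta> (n + 1) (\<delta> n (\<iota> n c x)) = \<zero>\<^bsub>P (n + 2)\<^esub>"
    using \<delta>_cell[OF c add(2)] rlinear_simps(2)[OF \<delta> Pm Pm idx ax] abelian_group.l_neg[OF s(1) dax]
    by (simp add: index_simps)
  then show ?case
    using i add(4) rlinear_simps(2)[OF \<delta> Pm Pm i] rlinear_simps(2)[OF \<delta> Pm Pm rlinear_closed[OF \<delta> i(1)] rlinear_closed[OF \<delta> i(2)]]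
      s(7)[OF s(2)[of "n + 2"]] by (simp add: index_simps)
qed

lemma T_Ob [simp]: "Ob T n = sub J n"
  by (simp add: T_def)

lemma T_Diff [simp]: "x \<in> carrier (sub J n) \<Longrightarrow> Diff T n x = \<delta> n x"
  by (simp add: T_def)

lemma T_complex: "T \<in> complexes R"
  unfolding complexes_def
proof (intro CollectI allI conjI ballI)
  note JV' = closedV[OF closed_J]
  fix n
  show "Ob T n \<in> rmodules R" using is_dsumD(1)[OF sub_dsum[OF JV']] by simp
  show "Diff T n \<in> rhom R (Ob T n) (Ob T (n + 1))"
    using restrict_rhom[OF sub_module[OF JV'] \<delta>_sub_rlinear[OF closed_J]] by (simp add: T_def)
  fix x assume "x \<in> carrier (Ob T n)"
  then show "Diff T (n + 1) (Diff T n x) = \<zero>\<^bsub>Ob T (n + 1 + 1)\<^esub>"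
    using \<delta>_sub[OF closed_J] \<delta>\<delta> by (simp add: index_simps)
qed

lemma chain_map_\<gamma>: "chain_map R T M \<gamma>"
  unfolding chain_map_def
proof (intro conjI allI ballI)
  fix n show "rlinear R (Ob T n) (Ob M n) (\<gamma> n)"
    using \<gamma>[of n] by (simp add: rlinear_def sub_carrier)
  fix z assume "z \<in> carrier (Ob T n)"
  then have z: "z \<in> carrier (sub J n)" by simp
  note Mm = complex_module(2)[OF M]
  have "\<gamma> (n + 1) (\<delta> n z) = Diff M n (\<gamma> n z)"
    using sub_dsum[OF closedV[OF closed_J]] z
  proof (induction rule: is_dsum_induct)
    case zero
    show ?case using rlinear_zero[OF \<delta> Pm Pm] rlinear_zero[OF \<gamma> Pm Mm] complex_simps[OF M] by simp
  next
    case (add c x w)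
    note c = JV[OF add(1)]
    note cs = complex_simps[OF S[OF c]]
    have i: "\<iota> n c x \<in> carrier (P n)" "w \<in> carrier (P n)"
      using cell_in_sub[OF closedV[OF closed_J] add(1,2)] add(3) by (simp_all add: sub_carrier)
    have dx: "Diff (S c) n x \<in> carrier (Ob (S c) (n + 1))" using cs add(2) by simp
    have ax: "\<alpha> c n x \<in> carrier (P (n + 1))" by (rule rlinear_closed[OF \<alpha>[OF c] add(2)])
    have idx: "\<iota> (n + 1) c (Diff (S c) n x) \<in> carrier (P (n + 1))"
      by (rule rlinear_closed[OF is_dsumD(5)[OF dsum c] dx])
    note [simp] = complex_simps[OF M] rlinear_closed[OF \<gamma> ax] rlinear_closed[OF \<beta>[OF c] add(2)]
    have "\<beta> c (n + 1) (Diff (S c) n x) = Diff M n (\<beta> c n x) \<ominus>\<^bsub>Ob M (n + 1)\<^esub> \<gamma> (n + 1) (\<alpha> c n x)"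
      using J_valid[OF add(1)] add(2) by (simp add: valid_def)
    then have "\<gamma> (n + 1) (\<delta> n (\<iota> n c x)) =
        (Diff M n (\<beta> c n x) \<ominus>\<^bsub>Ob M (n + 1)\<^esub> \<gamma> (n + 1) (\<alpha> c n x)) \<oplus>\<^bsub>Ob M (n + 1)\<^esub> \<gamma> (n + 1) (\<alpha> c n x)"
      using \<delta>_cell[OF c add(2)] rlinear_simps(2)[OF \<gamma> Pm Mm idx ax] \<gamma>_cell[OF c dx] by simp
    also have "\<dots> = Diff M n (\<beta> c n x)"
      by (rule represents_eq[where G = "Ob M (n + 1)"],
          (rule represents | (rule represents_atom, simp, simp) | (simp; fail) | simp add: algebra_simps)+)
    finally have "\<gamma> (n + 1) (\<delta> n (\<iota> n c x)) = Diff M n (\<gamma> n (\<iota> n c x))" using \<gamma>_cell[OF c add(2)] by simp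
    then show ?case
      using add(4) rlinear_simps(2)[OF \<delta> Pm Pm i]
        rlinear_simps(2)[OF \<gamma> Pm Mm rlinear_closed[OF \<delta> i(1)] rlinear_closed[OF \<delta> i(2)]]
        rlinear_simps(2)[OF \<gamma> Pm Mm i] rlinear_closed[OF \<gamma> i(1)] rlinear_closed[OF \<gamma> i(2)] by simp
  qed
  then show "\<gamma> (n + 1) (Diff T n z) = Diff M n (\<gamma> n z)" using z by simp
qed

text \<open>Accessibility is closed upwards: once everything below c is accessible, so is c. This
  takes the place of a limit stage of a transfinite construction.\<close>

lemma cell_in_J:
  assumes "c \<in> V" "valid c" "\<And>n x. x \<in> carrier (Ob (S c) n) \<Longrightarrow> \<alpha> c n x \<in> carrier (sub J (n + 1))"
  shows "c \<in> J"
proof -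
  have "c \<in> Wellfounded.acc below"
  proof (rule accI)
    fix c' assume "(c', c) \<in> below"
    then have "c' \<in> J" using assms by (auto simp: below_def sub_carrier)
    then show "c' \<in> Wellfounded.acc below" by (simp add: J_def)
  qed
  then show ?thesis using assms(1) by (simp add: J_def)
qed

text \<open>Being a chain map into the cone of \<gamma> makes c valid and lets its attaching map
  land in T. Hence c already belongs to T, and its embedding contracts \<phi>.\<close>

lemma cell_kills:
  assumes c: "c \<in> V" and \<phi>: "chain_map R (S c) (cone T M \<gamma>) \<phi>"
    and eq: "\<And>n x. x \<in> carrier (Ob (S c) n) \<Longrightarrow> \<phi> n x = pair (\<alpha> c n x, \<beta> c n x)"
  shows "null_homotopic R (S c) (cone T M \<gamma>) \<phi>"
proof -
  note Sc = S[OF c]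
  note JV' = closedV[OF closed_J]
  note csimps = complex_simps[OF Sc]
  have ab: "\<alpha> c n x \<in> carrier (sub J (n + 1))" "\<beta> c n x \<in> carrier (Ob M n)"
    if x: "x \<in> carrier (Ob (S c) n)" for n x
    using rlinear_closed[OF chain_map_rlinear[OF \<phi>] x] eq[OF x] by simp_all
  have "valid c"
    unfolding valid_def
  proof (intro allI ballI)
    fix n x assume x: "x \<in> carrier (Ob (S c) n)"
    have dx: "Diff (S c) n x \<in> carrier (Ob (S c) (n + 1))" by (rule csimps(12)[OF refl x])
    have "pair (\<alpha> c (n + 1) (Diff (S c) n x), \<beta> c (n + 1) (Diff (S c) n x)) =
        Diff (cone T M \<gamma>) n (pair (\<alpha> c n x, \<beta> c n x))"
      using chain_map_comm[OF \<phi> refl x] eq[OF x] eq[OF dx] by simp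
    also have "\<dots> = pair (\<ominus>\<^bsub>P (n + 2)\<^esub> \<delta> (n + 1) (\<alpha> c n x), Diff M n (\<beta> c n x) \<ominus>\<^bsub>Ob M (n + 1)\<^esub> \<gamma> (n + 1) (\<alpha> c n x))"
      using ab[OF x] \<delta>_sub[OF closed_J ab(1)[OF x]] by (simp add: cone_Diff sub_uminus[OF JV'] index_simps)
    finally show "\<alpha> c (n + 1) (Diff (S c) n x) = \<ominus>\<^bsub>P (n + 2)\<^esub> \<delta> (n + 1) (\<alpha> c n x) \<and>
      \<beta> c (n + 1) (Diff (S c) n x) = Diff M n (\<beta> c n x) \<ominus>\<^bsub>Ob M (n + 1)\<^esub> \<gamma> (n + 1) (\<alpha> c n x)"
      by simp
  qed
  then have cJ: "c \<in> J" using ab(1) by (intro cell_in_J c)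
  have il: "rlinear R (Ob (S c) n) (sub J n) (\<iota> n c)" for n by (rule is_dsumD(5)[OF sub_dsum[OF JV'] cJ])
  have "null_homotopic R (S c) (cone T M \<gamma>) (\<lambda>n x. pair (\<alpha> c n x, \<gamma> n (\<iota> n c x)))"
  proof (rule cone_null_homotopicI[OF Sc T_complex M chain_map_\<gamma>])
    show "rlinear R (Ob (S c) n) (Ob T n) (\<iota> n c)" for n using il by simp
    show "\<alpha> c n x \<in> carrier (Ob T (n + 1))" if "x \<in> carrier (Ob (S c) n)" for n x using ab that by simp
    show "Diff T n (\<iota> n c x) = \<iota> (n + 1) c (Diff (S c) n x) \<oplus>\<^bsub>Ob T (n + 1)\<^esub> \<alpha> c n x"
      if "x \<in> carrier (Ob (S c) n)" for n x
      using rlinear_closed[OF il that] \<delta>_cell[OF c that] by simp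
  qed
  then show ?thesis
    by (rule null_homotopic_cong) (simp add: eq \<gamma>_cell[OF c])
qed

text \<open>With zero attaching map into P, the cell is a copy of S c inside T as a subcomplex, and
  \<gamma> restricts to \<phi> on it. This is why the factorization is strict.\<close>

lemma cell_factor:
  assumes c: "c \<in> V" and \<phi>: "chain_map R (S c) M \<phi>"
    and eq: "\<And>n x. x \<in> carrier (Ob (S c) n) \<Longrightarrow> \<alpha> c n x = \<zero>\<^bsub>P (n + 1)\<^esub>"
    "\<And>n x. x \<in> carrier (Ob (S c) n) \<Longrightarrow> \<beta> c n x = \<phi> n x"
  shows "chain_map R (S c) T (\<lambda>n. \<iota> n c)"
    "\<And>n x. x \<in> carrier (Ob (S c) n) \<Longrightarrow> \<phi> n x = \<gamma> n (\<iota> n c x)"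
proof -
  note Sc = S[OF c]
  note [simp] = complex_simps[OF Sc] complex_simps[OF M] chain_map_simps[OF \<phi> Sc M]
  note JV' = closedV[OF closed_J]
  note z = rlinear_zero[OF \<delta> Pm Pm] rlinear_zero[OF \<gamma> Pm complex_module(2)[OF M]] right_module_simps[OF Pm]
  have "valid c"
    unfolding valid_def by (auto simp: eq z index_simps)
  moreover have "\<alpha> c n x \<in> carrier (sub J (n + 1))" if "x \<in> carrier (Ob (S c) n)" for n x
    using right_module_simps(2)[OF sub_module[OF JV'], of "n + 1"] eq(1)[OF that] by simp
  ultimately have cJ: "c \<in> J" by (intro cell_in_J c)
  have il: "rlinear R (Ob (S c) n) (sub J n) (\<iota> n c)" for n by (rule is_dsumD(5)[OF sub_dsum[OF JV'] cJ])
  show "chain_map R (S c) T (\<lambda>n. \<iota> n c)"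
    unfolding chain_map_def
  proof (intro conjI allI ballI)
    show "rlinear R (Ob (S c) n) (Ob T n) (\<iota> n c)" for n using il by simp
    fix n x assume x: "x \<in> carrier (Ob (S c) n)"
    have "\<iota> (n + 1) c (Diff (S c) n x) \<in> carrier (P (n + 1))"
      using rlinear_closed[OF il, of "Diff (S c) n x" "n + 1"] x by (simp add: sub_carrier)
    then show "\<iota> (n + 1) c (Diff (S c) n x) = Diff T n (\<iota> n c x)"
      using rlinear_closed[OF il x] \<delta>_cell[OF c x] eq(1)[OF x] z by simp
  qed
  show "\<phi> n x = \<gamma> n (\<iota> n c x)" if "x \<in> carrier (Ob (S c) n)" for n x
    using \<gamma>_cell[OF c that] eq(2)[OF that] by simp
qed

end


section \<open>Null homotopies by recursion over the cells\<close>

context cells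
begin

text \<open>A chosen map from the universal property. It depends on f only through the values on K
  (\<open>extend_cong\<close>), as the recursion over cells requires.\<close>

definition extend :: "('r, 'u) cochain_complex \<Rightarrow> 'c set \<Rightarrow> ('c \<Rightarrow> int \<Rightarrow> 'u \<Rightarrow> 'u) \<Rightarrow> int \<Rightarrow> 'u \<Rightarrow> 'u" where
  "extend Q K f n = (SOME \<Phi>. rlinear R (sub K n) (Ob Q (n - 1)) \<Phi> \<and>
     (\<forall>c\<in>K. \<forall>x\<in>carrier (Ob (S c) n). \<Phi> (\<iota> n c x) = f c n x))"

lemma extend_cong: "(\<And>c. c \<in> K \<Longrightarrow> f c = g c) \<Longrightarrow> extend Q K f = extend Q K g"
  by (simp add: extend_def fun_eq_iff)

lemma extend:
  assumes Q: "Q \<in> complexes R" and K: "K \<subseteq> V"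
    and f: "\<forall>c\<in>K. \<forall>n. rlinear R (Ob (S c) n) (Ob Q (n - 1)) (f c n)"
  shows "rlinear R (sub K n) (Ob Q (n - 1)) (extend Q K f n)"
    "\<And>c x. c \<in> K \<Longrightarrow> x \<in> carrier (Ob (S c) n) \<Longrightarrow> extend Q K f n (\<iota> n c x) = f c n x"
proof -
  obtain \<Phi> where "rlinear R (sub K n) (Ob Q (n - 1)) \<Phi>"
    "\<And>c x. c \<in> K \<Longrightarrow> x \<in> carrier (Ob (S c) n) \<Longrightarrow> \<Phi> (\<iota> n c x) = f c n x"
    by (rule is_dsum_universal[OF sub_dsum[OF K] complex_module(2)[OF Q] f[rule_format]]) auto
  then have "\<exists>\<Phi>. rlinear R (sub K n) (Ob Q (n - 1)) \<Phi> \<and>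
     (\<forall>c\<in>K. \<forall>x\<in>carrier (Ob (S c) n). \<Phi> (\<iota> n c x) = f c n x)" by blast
  from someI_ex[OF this] show "rlinear R (sub K n) (Ob Q (n - 1)) (extend Q K f n)"
    "\<And>c x. c \<in> K \<Longrightarrow> x \<in> carrier (Ob (S c) n) \<Longrightarrow> extend Q K f n (\<iota> n c x) = f c n x"
    unfolding extend_def by blast+
qed

lemma extend_mono:
  assumes Q: "Q \<in> complexes R" and K: "K \<subseteq> V" and L: "L \<subseteq> K"
    and f: "\<forall>c\<in>K. \<forall>n. rlinear R (Ob (S c) n) (Ob Q (n - 1)) (f c n)"
    and z: "z \<in> carrier (sub L n)"
  shows "extend Q K f n z = extend Q L f n z"
proof -
  have LV: "L \<subseteq> V" using K L by blast
  have fL: "\<forall>c\<in>L. \<forall>n. rlinear R (Ob (S c) n) (Ob Q (n - 1)) (f c n)" using f L by blast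
  note eK = extend[OF Q K f] and eL = extend[OF Q LV fL]
  note sK = rlinear_simps[OF eK(1) sub_module[OF K] complex_module(2)[OF Q]]
    and sL = rlinear_simps[OF eL(1) sub_module[OF LV] complex_module(2)[OF Q]]
  show ?thesis
    using sub_dsum[OF LV] z
  proof (induction rule: is_dsum_induct)
    case zero
    show ?case using sK(5)[of n] sL(5)[of n] by simp
  next
    case (add c x w)
    have i: "\<iota> n c x \<in> carrier (sub L n)" by (rule cell_in_sub[OF LV add(1,2)])
    have "extend Q K f n (\<iota> n c x \<oplus>\<^bsub>sub L n\<^esub> w) = extend Q K f n (\<iota> n c x) \<oplus>\<^bsub>Ob Q (n - 1)\<^esub> extend Q K f n w"
      using sK(2)[OF sub_mono[OF L i] sub_mono[OF L add(3)]] by simp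
    also have "\<dots> = extend Q L f n (\<iota> n c x) \<oplus>\<^bsub>Ob Q (n - 1)\<^esub> extend Q L f n w"
      using add(4) eK(2)[of c x n] eL(2)[of c x n] add(1,2) L by auto
    also have "\<dots> = extend Q L f n (\<iota> n c x \<oplus>\<^bsub>sub L n\<^esub> w)" by (rule sL(2)[OF i add(3), symmetric])
    finally show ?case .
  qed
qed

definition down :: "'c \<Rightarrow> 'c set" where
  "down c = {c'. (c', c) \<in> below'\<^sup>+}"

text \<open>The homotopy formula on the cell c: s is the new homotopy on S c, and the last summand
  is the homotopy already built below c, evaluated on the attaching map. Cells outside J satisfy it
  vacuously, so that the recursion can run over the whole type.\<close>

definition contracts :: "('r, 'u) cochain_complex \<Rightarrow> (int \<Rightarrow> 'u \<Rightarrow> 'u) \<Rightarrow>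
    ('c \<Rightarrow> int \<Rightarrow> 'u \<Rightarrow> 'u) \<Rightarrow> 'c \<Rightarrow> (int \<Rightarrow> 'u \<Rightarrow> 'u) \<Rightarrow> bool" where
  "contracts Q \<phi> f c s \<longleftrightarrow> (c \<in> J \<longrightarrow> (\<forall>n. rlinear R (Ob (S c) n) (Ob Q (n - 1)) (s n)) \<and>
     (\<forall>n. \<forall>x\<in>carrier (Ob (S c) n). \<phi> n (\<iota> n c x) =
       (Diff Q (n - 1) (s n x) \<oplus>\<^bsub>Ob Q n\<^esub> s (n + 1) (Diff (S c) n x))
         \<oplus>\<^bsub>Ob Q n\<^esub> extend Q (down c) f (n + 1) (\<alpha> c n x)))"

lemma down_V: "down c \<subseteq> V"
  using closedV[OF closed_down] by (simp add: down_def)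

lemma \<alpha>_down:
  assumes "c \<in> J" "x \<in> carrier (Ob (S c) n)"
  shows "\<alpha> c n x \<in> carrier (sub (down c) (n + 1))"
  by (rule \<alpha>_sub[OF JV[OF assms(1)] _ assms(2)]) (use assms(1) in \<open>auto simp: down_def below'_def\<close>)

text \<open>On one cell the formula is \<open>contracts\<close>, since the homotopies on
  \<open>down c\<close> and on K agree where both are defined; the sum induction extends it
  additively.\<close>

lemma contraction:
  assumes Q: "Q \<in> complexes R" and \<phi>: "chain_map R T Q \<phi>"
    and K: "closed K" "\<forall>c\<in>K. down c \<subseteq> K"
    and f: "\<forall>c\<in>K. contracts Q \<phi> f c (f c)" and z: "z \<in> carrier (sub K n)"
  shows "\<phi> n z = Diff Q (n - 1) (extend Q K f n z) \<oplus>\<^bsub>Ob Q n\<^esub> extend Q K f (n + 1) (\<delta> n z)"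
proof -
  note KV = closedV[OF K(1)]
  have KJ: "K \<subseteq> J" using K(1) by (simp add: closed_def)
  have fl: "\<forall>c\<in>K. \<forall>n. rlinear R (Ob (S c) n) (Ob Q (n - 1)) (f c n)"
    using f KJ unfolding contracts_def by blast
  note e = extend[OF Q KV fl]
  note Qm = complex_module(2)[OF Q]
  note es = rlinear_simps[OF e(1) sub_module[OF KV] Qm]
  note qs = complex_simps[OF Q]
  note \<phi>s = chain_map_simps[OF \<phi> T_complex Q]
  have e1: "extend Q K f (n + 1) w \<in> carrier (Ob Q n)" if "w \<in> carrier (sub K (n + 1))" for w
    using es(1)[OF that] by simp
  show ?thesis
    using sub_dsum[OF KV] z
  proof (induction rule: is_dsum_induct)
    case zero
    show ?case using \<phi>s(5)[of n] es(5)[of n] es(5)[of "n + 1"] qs rlinear_zero[OF \<delta> Pm Pm, of n] qs(16)[of "n - 1"]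
      by simp
  next
    case (add c x w)
    note c = KV[THEN subsetD, OF add(1)]
    have i: "\<iota> n c x \<in> carrier (sub K n)" by (rule cell_in_sub[OF KV add(1,2)])
    have dx: "Diff (S c) n x \<in> carrier (Ob (S c) (n + 1))" using complex_simps[OF S[OF c]] add(2) by simp
    have idx: "\<iota> (n + 1) c (Diff (S c) n x) \<in> carrier (sub K (n + 1))" by (rule cell_in_sub[OF KV add(1) dx])
    have cJ: "c \<in> J" using KJ add(1) by blast
    have ax': "\<alpha> c n x \<in> carrier (sub (down c) (n + 1))" by (rule \<alpha>_down[OF cJ add(2)])
    have ax: "\<alpha> c n x \<in> carrier (sub K (n + 1))" by (rule sub_mono[OF K(2)[rule_format, OF add(1)] ax'])
    have fc: "f c n x \<in> carrier (Ob Q (n - 1))" by (rule rlinear_closed[OF fl[rule_format, OF add(1)] add(2)])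
    have fc': "f c (n + 1) (Diff (S c) n x) \<in> carrier (Ob Q n)"
      using rlinear_closed[OF fl[rule_format, OF add(1)] dx] by simp
    have "\<phi> n (\<iota> n c x) = (Diff Q (n - 1) (f c n x) \<oplus>\<^bsub>Ob Q n\<^esub> f c (n + 1) (Diff (S c) n x))
         \<oplus>\<^bsub>Ob Q n\<^esub> extend Q (down c) f (n + 1) (\<alpha> c n x)"
      using f[rule_format, OF add(1)] cJ add(2) unfolding contracts_def by blast
    also have "extend Q (down c) f (n + 1) (\<alpha> c n x) = extend Q K f (n + 1) (\<alpha> c n x)"
      by (rule extend_mono[OF Q KV K(2)[rule_format, OF add(1)] fl ax', symmetric])
    also have "(Diff Q (n - 1) (f c n x) \<oplus>\<^bsub>Ob Q n\<^esub> f c (n + 1) (Diff (S c) n x)) \<oplus>\<^bsub>Ob Q n\<^esub>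
        extend Q K f (n + 1) (\<alpha> c n x) =
        Diff Q (n - 1) (f c n x) \<oplus>\<^bsub>Ob Q n\<^esub> (f c (n + 1) (Diff (S c) n x) \<oplus>\<^bsub>Ob Q n\<^esub> extend Q K f (n + 1) (\<alpha> c n x))"
      using abelian_monoid.a_assoc[of "Ob Q n"] qs(1) fc fc' e1[OF ax] qs(12)[of n "n - 1"]
      by (simp add: abelian_group.axioms)
    also have "f c (n + 1) (Diff (S c) n x) \<oplus>\<^bsub>Ob Q n\<^esub> extend Q K f (n + 1) (\<alpha> c n x) =
        extend Q K f (n + 1) (\<delta> n (\<iota> n c x))"
      using \<delta>_cell[OF c add(2)] es(2)[OF idx ax] e(2)[OF add(1) dx] by simp
    also have "f c n x = extend Q K f n (\<iota> n c x)" by (rule e(2)[OF add(1,2), symmetric])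
    finally have g: "\<phi> n (\<iota> n c x) = Diff Q (n - 1) (extend Q K f n (\<iota> n c x)) \<oplus>\<^bsub>Ob Q n\<^esub>
        extend Q K f (n + 1) (\<delta> n (\<iota> n c x))" .
    have cl: "extend Q K f n (\<iota> n c x) \<in> carrier (Ob Q (n - 1))" "extend Q K f n w \<in> carrier (Ob Q (n - 1))"
      "extend Q K f (n + 1) (\<delta> n (\<iota> n c x)) \<in> carrier (Ob Q n)" "extend Q K f (n + 1) (\<delta> n w) \<in> carrier (Ob Q n)"
      using es(1)[OF i] es(1)[OF add(3)] e1[OF \<delta>_sub[OF K(1) i]] e1[OF \<delta>_sub[OF K(1) add(3)]] by auto
    have P': "\<iota> n c x \<in> carrier (P n)" "w \<in> carrier (P n)" using i add(3) by (simp_all add: sub_carrier)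
    have "\<phi> n (\<iota> n c x \<oplus>\<^bsub>sub K n\<^esub> w) = \<phi> n (\<iota> n c x) \<oplus>\<^bsub>Ob Q n\<^esub> \<phi> n w"
      using \<phi>s(2)[of "\<iota> n c x" n w] sub_mono[OF KJ i] sub_mono[OF KJ add(3)] by simp
    also have "\<dots> = Diff Q (n - 1) (extend Q K f n (\<iota> n c x) \<oplus>\<^bsub>Ob Q (n - 1)\<^esub> extend Q K f n w) \<oplus>\<^bsub>Ob Q n\<^esub>
       (extend Q K f (n + 1) (\<delta> n (\<iota> n c x)) \<oplus>\<^bsub>Ob Q n\<^esub> extend Q K f (n + 1) (\<delta> n w))"
      unfolding g add(4) using cl qs(13)[OF cl(1,2)]
      by simp (rule represents_eq[where G = "Ob Q n"],
        (rule represents | (rule represents_atom, simp only: qs(1), simp add: qs) | (simp only: qs(1); fail)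
          | simp add: algebra_simps)+)
    also have "\<dots> = Diff Q (n - 1) (extend Q K f n (\<iota> n c x \<oplus>\<^bsub>sub K n\<^esub> w)) \<oplus>\<^bsub>Ob Q n\<^esub>
        extend Q K f (n + 1) (\<delta> n (\<iota> n c x \<oplus>\<^bsub>sub K n\<^esub> w))"
      using es(2)[OF i add(3)] es(2)[OF \<delta>_sub[OF K(1) i] \<delta>_sub[OF K(1) add(3)]] rlinear_simps(2)[OF \<delta> Pm Pm P']
      by simp
    finally show ?case .
  qed
qed

lemma T_orth:
  assumes Q: "Q \<in> complexes R" and o: "\<And>c. c \<in> V \<Longrightarrow> orth R (S c) Q"
  shows "orth R T Q"
  unfolding orth_def
proof (intro allI impI)
  fix \<phi> assume \<phi>: "chain_map R T Q \<phi>"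
  note qs = complex_simps[OF Q] and \<phi>s = chain_map_simps[OF \<phi> T_complex Q]
  note Qm = complex_module(2)[OF Q]
  have down_trans: "\<forall>c'\<in>down c. down c' \<subseteq> down c" for c
    by (auto simp: down_def intro: trancl_trans)
  have downJ: "down c \<subseteq> J" "closed (down c)" for c
    using closed_down[of c] by (auto simp: down_def closed_def)
  have "\<exists>f. \<forall>c. contracts Q \<phi> f c (f c)"
  \<comment> \<open>The choice at c uses the homotopy on all of \<open>down c\<close>, not only on
    immediate predecessors, hence the transitive closure.\<close>
  proof (rule dependent_wf_choice[OF wf_trancl[OF wf_below']])
    fix f g :: "'c \<Rightarrow> int \<Rightarrow> 'u \<Rightarrow> 'u" and c s
    assume "\<And>z. (z, c) \<in> below'\<^sup>+ \<Longrightarrow> f z = g z"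
    then have "extend Q (down c) f = extend Q (down c) g" by (intro extend_cong) (simp add: down_def)
    then show "contracts Q \<phi> f c s = contracts Q \<phi> g c s" by (simp add: contracts_def)
  next
    fix c f assume IH: "\<And>y. (y, c) \<in> below'\<^sup>+ \<Longrightarrow> contracts Q \<phi> f y (f y)"
    show "\<exists>s. contracts Q \<phi> f c s"
    proof (cases "c \<in> J")
      case False
      then show ?thesis by (simp add: contracts_def)
    next
      case True
      note c = JV[OF True]
      note cs = complex_simps[OF S[OF c]]
      have f: "\<forall>c'\<in>down c. contracts Q \<phi> f c' (f c')" using IH by (simp add: down_def)
      have fl: "\<forall>c'\<in>down c. \<forall>n. rlinear R (Ob (S c') n) (Ob Q (n - 1)) (f c' n)"
        using f downJ(1) unfolding contracts_def by blast
      let ?E = "extend Q (down c) f"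
      note e = extend[OF Q down_V fl]
      note es = rlinear_simps[OF e(1) sub_module[OF down_V] Qm]
      have con: "\<phi> n z = Diff Q (n - 1) (?E n z) \<oplus>\<^bsub>Ob Q n\<^esub> ?E (n + 1) (\<delta> n z)"
        if "z \<in> carrier (sub (down c) n)" for n z
        by (rule contraction[OF Q \<phi> downJ(2) down_trans f that])
      \<comment> \<open>The map \<phi> \<iota> fails to commute with the differentials by \<phi>
        \<alpha>. On the cells below, \<phi> is already contracted by E, so subtracting E \<alpha>
        gives a chain map on S c, to which orthogonality applies.\<close>
      let ?\<chi> = "\<lambda>n x. \<phi> n (\<iota> n c x) \<ominus>\<^bsub>Ob Q n\<^esub> ?E (n + 1) (\<alpha> c n x)"
      have il: "rlinear R (Ob (S c) n) (sub J n) (\<iota> n c)" for n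
        by (rule is_dsumD(5)[OF sub_dsum[OF closedV[OF closed_J]] True])
      have al: "rlinear R (Ob (S c) n) (sub (down c) (n + 1)) (\<alpha> c n)" for n
        using \<alpha>_down[OF True] \<alpha>[OF c, of n] by (simp add: rlinear_def)
      have el: "rlinear R (sub (down c) (n + 1)) (Ob Q n) (?E (n + 1))" for n using e(1)[of "n + 1"] by simp
      have \<phi>l: "rlinear R (sub J n) (Ob Q n) (\<phi> n)" for n using chain_map_rlinear[OF \<phi>, of n] by simp
      have "chain_map R (S c) Q ?\<chi>"
        unfolding chain_map_def
      proof (intro conjI allI ballI)
        show "rlinear R (Ob (S c) n) (Ob Q n) (?\<chi> n)" for n
          by (rule rlinear_diff[OF Qm rlinear_comp[OF \<phi>l il] rlinear_comp[OF el al]])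
        fix n x assume x: "x \<in> carrier (Ob (S c) n)"
        have dx: "Diff (S c) n x \<in> carrier (Ob (S c) (n + 1))" using cs x by simp
        have i: "\<iota> n c x \<in> carrier (sub J n)" "\<iota> (n + 1) c (Diff (S c) n x) \<in> carrier (sub J (n + 1))"
          by (rule rlinear_closed[OF il x], rule rlinear_closed[OF il dx])
        have ax: "\<alpha> c n x \<in> carrier (sub (down c) (n + 1))" by (rule rlinear_closed[OF al x])
        have axJ: "\<alpha> c n x \<in> carrier (sub J (n + 1))" by (rule sub_mono[OF downJ(1) ax])
        have dax: "\<delta> (n + 1) (\<alpha> c n x) \<in> carrier (sub (down c) (n + 1 + 1))" by (rule \<delta>_sub[OF downJ(2) ax])
        define p where "p = \<phi> (n + 1) (\<iota> (n + 1) c (Diff (S c) n x))"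
        define a where "a = Diff Q n (?E (n + 1) (\<alpha> c n x))"
        define b where "b = ?E (n + 1 + 1) (\<delta> (n + 1) (\<alpha> c n x))"
        have pa: "p \<in> carrier (Ob Q (n + 1))" "a \<in> carrier (Ob Q (n + 1))" "b \<in> carrier (Ob Q (n + 1))"
          unfolding p_def a_def b_def
          using rlinear_closed[OF \<phi>l i(2)] rlinear_closed[OF el dax] rlinear_closed[OF el ax] qs by simp_all
        have "\<phi> (n + 1) (\<alpha> c n x) = a \<oplus>\<^bsub>Ob Q (n + 1)\<^esub> b" using con[OF ax] by (simp add: a_def b_def)
        then have "Diff Q n (\<phi> n (\<iota> n c x)) = p \<oplus>\<^bsub>Ob Q (n + 1)\<^esub> (a \<oplus>\<^bsub>Ob Q (n + 1)\<^esub> b)"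
          using \<phi>s(6)[of "n + 1" n "\<iota> n c x"] i axJ \<delta>_cell[OF c x] rlinear_simps(2)[OF \<phi>l sub_module[OF closedV[OF closed_J]] Qm i(2) axJ]
          by (simp add: p_def)
        moreover have "?E (n + 1 + 1) (\<alpha> c (n + 1) (Diff (S c) n x)) = \<ominus>\<^bsub>Ob Q (n + 1)\<^esub> b"
        proof -
          have "\<alpha> c (n + 1) (Diff (S c) n x) = \<ominus>\<^bsub>sub (down c) (n + 1 + 1)\<^esub> \<delta> (n + 1) (\<alpha> c n x)"
            using J_valid[OF True] x sub_uminus[OF down_V dax] by (simp add: valid_def index_simps)
          then show ?thesis using es(4)[OF dax] by (simp add: b_def index_simps)
        qed
        ultimately show "?\<chi> (n + 1) (Diff (S c) n x) = Diff Q n (?\<chi> n x)"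
          using qs(14)[of "\<phi> n (\<iota> n c x)" n "?E (n + 1) (\<alpha> c n x)"] rlinear_closed[OF \<phi>l i(1)] rlinear_closed[OF el ax] pa
          unfolding p_def[symmetric] a_def[symmetric]
          by simp (rule represents_eq[where G = "Ob Q (n + 1)"],
            (rule represents | (rule represents_atom, simp only: qs(1), simp) | (simp only: qs(1); fail)
              | simp add: algebra_simps)+)
      qed
      from orthD[OF o[OF c] this] obtain s where s: "\<And>n. rlinear R (Ob (S c) n) (Ob Q (n - 1)) (s n)"
        "\<And>n x. x \<in> carrier (Ob (S c) n) \<Longrightarrow> ?\<chi> n x = Diff Q (n - 1) (s n x) \<oplus>\<^bsub>Ob Q n\<^esub> s (n + 1) (Diff (S c) n x)"
        using null_homotopicE by blast
      have "contracts Q \<phi> f c s"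
        unfolding contracts_def
      proof (intro impI conjI allI ballI s(1))
        fix n x assume x: "x \<in> carrier (Ob (S c) n)"
        have "\<phi> n (\<iota> n c x) \<in> carrier (Ob Q n)" "?E (n + 1) (\<alpha> c n x) \<in> carrier (Ob Q n)"
          by (rule rlinear_closed[OF \<phi>l rlinear_closed[OF il x]], rule rlinear_closed[OF el rlinear_closed[OF al x]])
        then have "\<phi> n (\<iota> n c x) = ?\<chi> n x \<oplus>\<^bsub>Ob Q n\<^esub> ?E (n + 1) (\<alpha> c n x)"
          by - (rule represents_eq[where G = "Ob Q n"],
            (rule represents | (rule represents_atom, simp only: qs(1), simp) | (simp only: qs(1); fail)
              | simp add: algebra_simps)+)
        then show "\<phi> n (\<iota> n c x) = (Diff Q (n - 1) (s n x) \<oplus>\<^bsub>Ob Q n\<^esub> s (n + 1) (Diff (S c) n x)) \<oplus>\<^bsub>Ob Q n\<^esub>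
            ?E (n + 1) (\<alpha> c n x)"
          unfolding s(2)[OF x] .
      qed
      then show ?thesis by blast
    qed
  qed
  then obtain f where f: "\<forall>c\<in>J. contracts Q \<phi> f c (f c)" by blast
  have fl: "\<forall>c\<in>J. \<forall>n. rlinear R (Ob (S c) n) (Ob Q (n - 1)) (f c n)"
    using f unfolding contracts_def by blast
  note e = extend[OF Q closedV[OF closed_J] fl]
  show "null_homotopic R T Q \<phi>"
  proof (rule null_homotopicI[where s = "extend Q J f"])
    show "rlinear R (Ob T n) (Ob Q (n - 1)) (extend Q J f n)" for n using e(1) by simp
    fix n x assume "x \<in> carrier (Ob T n)"
    then show "\<phi> n x = Diff Q (n - 1) (extend Q J f n x) \<oplus>\<^bsub>Ob Q n\<^esub> extend Q J f (n + 1) (Diff T n x)"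
      using contraction[OF Q \<phi> closed_J _ f] downJ(1) by simp
  qed
qed

section \<open>Exactness of the complex of accessible cells\<close>

lemma \<delta>_component:
  assumes F: "F \<subseteq> J" "\<And>c'. c' \<in> F \<Longrightarrow> (c, c') \<notin> below" and c: "c \<in> V" and z: "z \<in> carrier (sub F n)"
  shows "\<pi> (n + 1) c (\<delta> n z) = Diff (S c) n (\<pi> n c z)"
proof -
  have FV: "F \<subseteq> V" using F(1) JV by blast
  note D = is_dsumD[OF dsum]
  note cs = complex_simps[OF S[OF c]] and cm = complex_module(2)[OF S[OF c]]
  note pl = D(6)[OF c]
  show ?thesis
    using sub_dsum[OF FV] z
  proof (induction rule: is_dsum_induct)
    case zero
    show ?case using rlinear_zero[OF \<delta> Pm Pm] rlinear_zero[OF pl Pm cm] cs by simp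
  next
    case (add c' x w)
    have c': "c' \<in> V" using add(1) FV by blast
    note cs' = complex_simps[OF S[OF c']]
    have i: "\<iota> n c' x \<in> carrier (P n)" "w \<in> carrier (P n)"
      using cell_in_sub[OF FV add(1,2)] add(3) by (simp_all add: sub_carrier)
    have dx: "Diff (S c') n x \<in> carrier (Ob (S c') (n + 1))" using cs' add(2) by simp
    have idx: "\<iota> (n + 1) c' (Diff (S c') n x) \<in> carrier (P (n + 1))" by (rule rlinear_closed[OF D(5)[OF c'] dx])
    have ax: "\<alpha> c' n x \<in> carrier (P (n + 1))" by (rule rlinear_closed[OF \<alpha>[OF c'] add(2)])
    \<comment> \<open>No cell of F is attached to c, so the component at c receives only the
      internal differential of S c.\<close>
    have a0: "\<pi> (n + 1) c (\<alpha> c' n x) = \<zero>\<^bsub>Ob (S c) (n + 1)\<^esub>"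
      using F(2)[OF add(1)] c c' add(2) unfolding below_def by blast
    have "\<pi> (n + 1) c (\<iota> (n + 1) c' (Diff (S c') n x)) = Diff (S c) n (\<pi> n c (\<iota> n c' x))"
    proof (cases "c' = c")
      case True
      then show ?thesis using D(7)[OF c] dx add(2) by simp
    next
      case False
      then show ?thesis using D(8)[OF c' c False dx] D(8)[OF c' c False add(2)] cs by simp
    qed
    then have "\<pi> (n + 1) c (\<delta> n (\<iota> n c' x)) = Diff (S c) n (\<pi> n c (\<iota> n c' x))"
      using \<delta>_cell[OF c' add(2)] rlinear_simps(2)[OF pl Pm cm idx ax] a0 rlinear_closed[OF pl i(1)] cs by simp
    then show ?case
      using add(4) rlinear_simps(2)[OF \<delta> Pm Pm i] rlinear_simps(2)[OF pl Pm cm i] rlinear_closed[OF pl i(1)]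
        rlinear_closed[OF pl i(2)] rlinear_simps(2)[OF pl Pm cm rlinear_closed[OF \<delta> i(1)] rlinear_closed[OF \<delta> i(2)]] cs
      by simp
  qed
qed

text \<open>A cocycle is supported on finitely many cells. At a top cell its component is a cocycle
  of S c, hence a boundary there; subtracting a boundary of T replaces that cell by finitely many
  cells below it. This process ends by well-foundedness of the multiset order.\<close>

lemma T_exact:
  assumes ex: "\<And>c n x. c \<in> V \<Longrightarrow> x \<in> carrier (Ob (S c) n) \<Longrightarrow> Diff (S c) n x = \<zero>\<^bsub>Ob (S c) (n + 1)\<^esub> \<Longrightarrow>
      \<exists>y\<in>carrier (Ob (S c) (n - 1)). Diff (S c) (n - 1) y = x"
    and z: "z \<in> carrier (sub J n)" "\<delta> n z = \<zero>\<^bsub>P (n + 1)\<^esub>"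
  shows "\<exists>y\<in>carrier (sub J (n - 1)). \<delta> (n - 1) y = z"
proof -
  note JV' = closedV[OF closed_J]
  note D = is_dsumD[OF dsum]
  note sJ = right_module_simps[OF sub_module[OF JV']]
  note sP = right_module_simps[OF Pm]
  have dl: "rlinear R (sub J (n - 1)) (sub J n) (\<delta> (n - 1))" using \<delta>_sub_rlinear[OF closed_J, of "n - 1"] by simp
  have "\<exists>y\<in>carrier (sub J (n - 1)). \<delta> (n - 1) y = z"
    if "set_mset N \<subseteq> J" "z \<in> carrier (sub (set_mset N) n)" "\<delta> n z = \<zero>\<^bsub>P (n + 1)\<^esub>" for N z
    using wf_mult1[OF wf_below'] that
  proof (induction N arbitrary: z rule: wf_induct_rule)
    case (less N)
    note NJ = less.prems(1) and z = less.prems(2) and dz = less.prems(3)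
    have zP: "z \<in> carrier (P n)" using z by (simp add: sub_carrier)
    show ?case
    proof (cases "N = {#}")
      case True
      then have "z = \<zero>\<^bsub>P n\<^esub>" using z by (intro D(10)) (auto simp: sub_carrier)
      then show ?thesis using sJ(2)[of "n - 1"] rlinear_zero[OF \<delta> Pm Pm, of "n - 1"]
        by (intro bexI[of _ "\<zero>\<^bsub>P (n - 1)\<^esub>"]) simp_all
    next
      case False
      \<comment> \<open>On a finite set the converse of an acyclic relation is well founded, which
        supplies a cell that is maximal in the support.\<close>
      have "finite (below' \<inter> set_mset N \<times> set_mset N)" by auto
      moreover have "acyclic (below' \<inter> set_mset N \<times> set_mset N)"
        using wf_acyclic[OF wf_below'] by (rule acyclic_subset) auto
      ultimately have "wf ((below' \<inter> set_mset N \<times> set_mset N)\<inverse>)" by (rule finite_acyclic_wf_converse)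
      moreover obtain c0 where "c0 \<in> set_mset N" using False by blast
      ultimately obtain c where c: "c \<in> set_mset N"
        "\<And>c'. (c', c) \<in> (below' \<inter> set_mset N \<times> set_mset N)\<inverse> \<Longrightarrow> c' \<notin> set_mset N"
        by (rule wfE_min) blast
      have cJ: "c \<in> J" using c(1) NJ by blast
      note cV = JV[OF cJ]
      have top: "(c, c') \<notin> below" if "c' \<in> set_mset N" for c'
      proof
        assume b: "(c, c') \<in> below"
        have "c' \<in> J" using that NJ by (rule rev_subsetD)
        then have "(c', c) \<in> (below' \<inter> set_mset N \<times> set_mset N)\<inverse>"
          using b c(1) that by (simp add: below'_def)
        from c(2)[OF this] that show False by blast
      qed
      have pz: "\<pi> n c z \<in> carrier (Ob (S c) n)" by (rule rlinear_closed[OF D(6)[OF cV] zP])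
      have "Diff (S c) n (\<pi> n c z) = \<pi> (n + 1) c (\<delta> n z)" by (rule \<delta>_component[OF NJ top cV z, symmetric])
      also have "\<dots> = \<zero>\<^bsub>Ob (S c) (n + 1)\<^esub>" unfolding dz
        by (rule rlinear_zero[OF D(6)[OF cV] Pm complex_module(2)[OF S[OF cV]]])
      finally obtain y where y: "y \<in> carrier (Ob (S c) (n - 1))" "Diff (S c) (n - 1) y = \<pi> n c z"
        using ex[OF cV pz] by blast
      have iy: "\<iota> (n - 1) c y \<in> carrier (sub J (n - 1))" by (rule cell_in_sub[OF JV' cJ y(1)])
      have ay: "\<alpha> c (n - 1) y \<in> carrier (P n)" using rlinear_closed[OF \<alpha>[OF cV] y(1)] by simp
      have iz: "\<iota> n c (\<pi> n c z) \<in> carrier (P n)" by (rule rlinear_closed[OF D(5)[OF cV] pz])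
      have diy: "\<delta> (n - 1) (\<iota> (n - 1) c y) = \<iota> n c (\<pi> n c z) \<oplus>\<^bsub>P n\<^esub> \<alpha> c (n - 1) y"
        using \<delta>_cell[OF cV y(1)] y(2) by simp
      have diyJ: "\<delta> (n - 1) (\<iota> (n - 1) c y) \<in> carrier (sub J n)" by (rule rlinear_closed[OF dl iy])
      let ?d = "\<delta> (n - 1) (\<iota> (n - 1) c y)"
      \<comment> \<open>The component at c cancels; new components come only from the attaching map
        \<alpha>, so from cells below c.\<close>
      let ?z = "z \<ominus>\<^bsub>P n\<^esub> ?d"
      have dP: "?d \<in> carrier (P n)" using diyJ by (simp add: sub_carrier)
      have z'P: "?z \<in> carrier (P n)" using sP zP dP by simp
      have pz': "\<pi> n c' ?z = \<pi> n c' z \<ominus>\<^bsub>Ob (S c') n\<^esub> (\<pi> n c' (\<iota> n c (\<pi> n c z)) \<oplus>\<^bsub>Ob (S c') n\<^esub> \<pi> n c' (\<alpha> c (n - 1) y))"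
        if "c' \<in> V" for c'
        using rlinear_simps[OF D(6)[OF that] Pm complex_module(2)[OF S[OF that]]] zP dP iz ay by (simp add: diy)
      \<comment> \<open>In the multiset order, one copy of c is exchanged for the finite set K of
        cells below it.\<close>
      obtain N0 where N0: "N = add_mset c N0" using c(1) by (metis insert_DiffM)
      define K where "K = {c' \<in> V. \<pi> n c' (\<alpha> c (n - 1) y) \<noteq> \<zero>\<^bsub>Ob (S c') n\<^esub>}"
      have Kfin: "finite K" unfolding K_def by (rule D(9)[OF ay])
      have Kb: "(c', c) \<in> below'" if "c' \<in> K" for c'
      proof -
        have "\<exists>m. \<exists>x\<in>carrier (Ob (S c) m). \<pi> (m + 1) c' (\<alpha> c m x) \<noteq> \<zero>\<^bsub>Ob (S c') (m + 1)\<^esub>"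
          using that y(1) by (intro exI[of _ "n - 1"] bexI[of _ y]) (auto simp: K_def)
        then show ?thesis using that cV cJ by (simp add: below'_def below_def K_def)
      qed
      have lt: "(N0 + mset_set K, N) \<in> mult1 below'"
      proof -
        have "\<forall>b. b \<in># mset_set K \<longrightarrow> (b, c) \<in> below'" using Kb Kfin by simp
        then show ?thesis unfolding mult1_def N0 by blast
      qed
      have KJ: "K \<subseteq> J"
      proof
        fix c' assume "c' \<in> K"
        then have "(c', c) \<in> below" using Kb by (simp add: below'_def)
        then show "c' \<in> J" using closed_J cJ unfolding closed_def by blast
      qed
      have N0J: "set_mset (N0 + mset_set K) \<subseteq> J" using NJ KJ Kfin by (auto simp: N0)
      have z'N: "?z \<in> carrier (sub (set_mset (N0 + mset_set K)) n)"
        unfolding sub_carrier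
      proof (intro conjI z'P ballI)
        fix c' assume c': "c' \<in> V - set_mset (N0 + mset_set K)"
        then have c'V: "c' \<in> V" by blast
        note cs = complex_simps[OF S[OF c'V]]
        have ka: "\<pi> n c' (\<alpha> c (n - 1) y) = \<zero>\<^bsub>Ob (S c') n\<^esub>" using c' Kfin by (auto simp: K_def)
        show "\<pi> n c' ?z = \<zero>\<^bsub>Ob (S c') n\<^esub>"
        proof (cases "c' = c")
          case True
          then show ?thesis using pz'[OF c'V] ka D(7)[OF cV pz] pz cs by simp
        next
          case False
          then have "\<pi> n c' z = \<zero>\<^bsub>Ob (S c') n\<^esub>" using z c' by (auto simp: sub_carrier N0)
          then show ?thesis using pz'[OF c'V] ka D(8)[OF cV c'V _ pz] False cs by simp
        qed
      qed
      have "\<delta> n ?d = \<zero>\<^bsub>P (n + 1)\<^esub>" using \<delta>\<delta>[OF iy] by (simp add: index_simps)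
      then have "\<delta> n ?z = \<zero>\<^bsub>P (n + 1)\<^esub>" using rlinear_simps(3)[OF \<delta> Pm Pm zP dP] dz sP by simp
      from less.IH[OF lt N0J z'N this] obtain y' where y': "y' \<in> carrier (sub J (n - 1))" "\<delta> (n - 1) y' = ?z"
        by blast
      have yP: "y' \<in> carrier (P (n - 1))" "\<iota> (n - 1) c y \<in> carrier (P (n - 1))"
        using y'(1) iy by (simp_all add: sub_carrier)
      have "\<delta> (n - 1) (y' \<oplus>\<^bsub>P (n - 1)\<^esub> \<iota> (n - 1) c y) = ?z \<oplus>\<^bsub>P n\<^esub> ?d"
        using rlinear_simps(2)[OF \<delta> Pm Pm yP] y'(2) by simp
      also have "\<dots> = z"
        using zP dP by - (rule represents_eq[where G = "P n"],
            (rule represents | (rule represents_atom, simp only: sP(1), simp) | (simp only: sP(1); fail)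
              | simp add: algebra_simps)+)
      finally show ?thesis using sJ(3)[OF y'(1) iy] by (intro bexI[of _ "y' \<oplus>\<^bsub>P (n - 1)\<^esub> \<iota> (n - 1) c y"]) simp_all
    qed
  qed
  note claim = this
  define F where "F = {c \<in> V. \<pi> n c z \<noteq> \<zero>\<^bsub>Ob (S c) n\<^esub>}"
  have zP: "z \<in> carrier (P n)" using z by (simp add: sub_carrier)
  have "finite F" unfolding F_def by (rule D(9)[OF zP])
  moreover have "F \<subseteq> J" "z \<in> carrier (sub F n)" using z zP by (auto simp: F_def sub_carrier)
  ultimately show ?thesis using claim[of "mset_set F" z] z(2) by simp
qed

lemma T_totally_acyclic:
  assumes TA: "\<And>c. c \<in> V \<Longrightarrow> S c \<in> totally_acyclic R"
  shows "T \<in> totally_acyclic R"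
  unfolding totally_acyclic_iff
proof (intro conjI allI ballI impI T_complex)
  note JV' = closedV[OF closed_J]
  show "projective R (Ob T n)" for n
    using is_dsum_projective[OF sub_dsum[OF JV'], of n] TA JV by (simp add: totally_acyclic_iff)
  show "\<exists>y\<in>carrier (Ob T (n - 1)). Diff T (n - 1) y = x"
    if x: "x \<in> carrier (Ob T n)" "Diff T n x = \<zero>\<^bsub>Ob T (n + 1)\<^esub>" for n x
  proof -
    have "\<exists>y\<in>carrier (sub J (n - 1)). \<delta> (n - 1) y = x"
    proof (rule T_exact)
      show "\<exists>y\<in>carrier (Ob (S c) (m - 1)). Diff (S c) (m - 1) y = w"
        if "c \<in> V" "w \<in> carrier (Ob (S c) m)" "Diff (S c) m w = \<zero>\<^bsub>Ob (S c) (m + 1)\<^esub>" for c m w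
        using TA[OF that(1)] that(2,3) unfolding totally_acyclic_iff by blast
    qed (use x in simp_all)
    then show ?thesis by auto
  qed
  fix Q :: "('r, 'u) module" and n \<phi>
  assume Q: "projective R Q" and \<phi>: "rlinear R (Ob T n) Q \<phi>"
    "\<forall>y\<in>carrier (Ob T (n - 1)). \<phi> (Diff T (n - 1) y) = \<zero>\<^bsub>Q\<^esub>"
  have Qr: "Q \<in> rmodules R" using Q by (rule projective_rmodules)
  \<comment> \<open>Acyclicity of Hom into a projective is passed from the cells to T as
    orthogonality to a complex in a single degree.\<close>
  have "orth R (S c) (sphere_complex n Q)" if "c \<in> V" for c
    using TA[OF that] Q unfolding orth_sphere_complex_iff[OF S[OF that] Qr] totally_acyclic_iff by blast
  then have "orth R T (sphere_complex n Q)" by (intro T_orth sphere_complex_complex[OF Qr])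
  then show "\<exists>\<psi>. rlinear R (Ob T (n + 1)) Q \<psi> \<and> (\<forall>x\<in>carrier (Ob T n). \<phi> x = \<psi> (Diff T n x))"
    using \<phi> unfolding orth_sphere_complex_iff[OF T_complex Qr] by blast
qed

end


section \<open>Approximation by complexes built from a set of complexes\<close>

lemma (in module_universe) cellular_approximation:
  fixes SS :: "('r, 'u) cochain_complex set"
  assumes SS: "SS \<subseteq> complexes R" "small TYPE('u) SS" and M: "M \<in> complexes R"
  obtains T g where "T \<in> complexes R" "chain_map R T M g"
    "\<forall>S\<in>SS. orth R S (cone T M g)"
    "\<forall>S\<in>SS. \<forall>\<phi>. chain_map R S M \<phi> \<longrightarrow>
       (\<exists>\<psi>. chain_map R S T \<psi> \<and> (\<forall>n. \<forall>x\<in>carrier (Ob S n). \<phi> n x = g n (\<psi> n x)))"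
    "\<forall>Q\<in>complexes R. (\<forall>S\<in>SS. orth R S Q) \<longrightarrow> orth R T Q"
    "SS \<subseteq> totally_acyclic R \<longrightarrow> T \<in> totally_acyclic R"
proof -
  note u = univ'
  have small_Ob: "small TYPE('u) (carrier (Ob X n))" if "X \<in> complexes R" for X :: "('r, 'u) cochain_complex" and n
    using complex_module(1)[OF that, of n] by (simp add: rmodules_def)
  \<comment> \<open>W bounds all carriers of the given complexes and of M at once, so that one index
    set serves every degree and every complex.\<close>
  define W where "W = (\<Union>S\<in>SS. \<Union>n. carrier (Ob S n)) \<union> (\<Union>n. carrier (Ob M n))"
  have W: "small TYPE('u) W"
    unfolding W_def using SS by (intro small_Un small_UN u small_countable[OF u] small_Ob M) auto
  obtain i :: "nat \<Rightarrow> 'u" where i: "inj i"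
    using small_embeds[OF small_countable[OF u, of "UNIV :: nat set"]] .
  obtain e :: "('r, 'u) cochain_complex \<Rightarrow> 'u" where e: "inj_on e SS" using small_embeds[OF SS(2)] .
  \<comment> \<open>The three parts bound the modules, make B infinite, and bound the number of
    complexes.\<close>
  define B where "B = W \<union> range i \<union> e ` SS"
  have B: "infinite B" using i by (simp add: B_def finite_image_iff)
  have Bs: "small TYPE('u) B"
    unfolding B_def by (intro small_Un u W small_image SS small_countable)
  have WB: "|W| \<le>o |B|" by (rule card_of_mono1) (auto simp: B_def)
  have SB: "|SS| \<le>o |B|" by (rule card_leI[OF e]) (simp add: B_def)
  have PB: "|A| \<le>o |Pow B|" if "|A| \<le>o |B|" for A :: "'z set"
    using ordLeq_transitive[OF that ordLess_imp_ordLeq[OF card_of_Pow]] .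
  have NB: "|UNIV :: nat set| \<le>o |B|" using B by (simp add: infinite_iff_card_of_nat)
  have IB: "|UNIV :: int set| \<le>o |B|"
    using ordLeq_transitive[OF card_leI[of to_nat UNIV "UNIV :: nat set"] NB] by simp
  \<comment> \<open>The labels are chosen before P and the attaching maps exist; their meaning is
    assigned below by \<open>dec\<close>.\<close>
  define V where "V = SS \<times> Pow B"
  have Vs: "small TYPE('u) V" unfolding V_def by (intro small_Times u SS small_Pow Bs)
  have V: "|V| \<le>o |Pow B|"
    unfolding V_def by (rule card_Pow_Times[OF B PB[OF SB]]) (rule card_of_mono1, rule order_refl)
  have VS: "fst c \<in> complexes R" "fst c \<in> SS" if "c \<in> V" for c using that SS(1) by (auto simp: V_def)
  have "\<exists>P \<iota> \<pi>. is_dsum R V (\<lambda>c. Ob (fst c) n) P \<iota> \<pi>" for n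
    using VS complex_module(1) by (intro is_dsum_exists u Vs ring) blast
  then obtain P \<iota> \<pi> where D: "\<And>n. is_dsum R V (\<lambda>c. Ob (fst c) n) (P n) (\<iota> n) (\<pi> n)" by metis
  have VW: "carrier (Ob (fst c) n) \<subseteq> W" if "c \<in> V" for c n using VS[OF that] by (auto simp: W_def)
  have Pc: "|carrier (P n)| \<le>o |Pow B|" for n by (rule is_dsum_card[OF D B V PB[OF WB] VW])
  note Pm = is_dsumD(2)[OF D]
  define \<Theta> where "\<Theta> S = {(\<alpha>, \<beta>). (\<forall>n. \<alpha> n \<in> rhom R (Ob S n) (P (n + 1))) \<and> (\<forall>n. \<beta> n \<in> rhom R (Ob S n) (Ob M n))}"
    for S :: "('r, 'u) cochain_complex"
  have "|\<Theta> S| \<le>o |Pow B|" if S: "S \<in> SS" for S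
  proof -
    let ?A = "(UNIV :: int set) \<times> W"
    \<comment> \<open>Extensional maps are \<open>undefined\<close> off their carriers, and they are
      coded here as functions on the larger common domain int x W.\<close>
    let ?C = "insert undefined (\<Union>n. carrier (P n)) \<times> insert undefined W"
    have "|?A| \<le>o |B|" by (rule card_of_Sigma_ordLeq_infinite[OF B IB]) (simp add: WB)
    moreover have "|\<Union>n. carrier (P n)| \<le>o |Pow B|"
      using B PB[OF IB] Pc by (intro card_of_UNION_ordLeq_infinite) simp_all
    then have "|?C| \<le>o |Pow B|" by (intro card_Pow_Times card_Pow_insert B PB[OF WB])
    ultimately have "|?A \<rightarrow>\<^sub>E ?C| \<le>o |Pow B|" by (rule card_Pow_PiE[OF B])
    moreover have "|\<Theta> S| \<le>o |?A \<rightarrow>\<^sub>E ?C|"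
    proof (rule card_leI[of "\<lambda>(\<alpha>, \<beta>). \<lambda>(n, x)\<in>?A. (\<alpha> n x, \<beta> n x)"])
      show "inj_on (\<lambda>(\<alpha>, \<beta>). \<lambda>(n, x)\<in>?A. (\<alpha> n x, \<beta> n x)) (\<Theta> S)"
      proof (rule inj_onI, clarsimp simp only: prod.case prod.inject)
        fix \<alpha> \<beta> \<alpha>' \<beta>' assume t: "(\<alpha>, \<beta>) \<in> \<Theta> S" "(\<alpha>', \<beta>') \<in> \<Theta> S"
          and eq: "(\<lambda>(n, x)\<in>?A. (\<alpha> n x, \<beta> n x)) = (\<lambda>(n, x)\<in>?A. (\<alpha>' n x, \<beta>' n x))"
        have "\<alpha> n x = \<alpha>' n x \<and> \<beta> n x = \<beta>' n x" for n x
        proof (cases "x \<in> carrier (Ob S n)")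
          case True
          then have "x \<in> W" using S by (auto simp: W_def)
          then show ?thesis using fun_cong[OF eq, of "(n, x)"] by simp
        next
          case False
          then show ?thesis using t by (simp add: \<Theta>_def rhom_iff extensional_def)
        qed
        then show "\<alpha> = \<alpha>' \<and> \<beta> = \<beta>'" by (simp add: fun_eq_iff)
      qed
      show "(\<lambda>(\<alpha>, \<beta>). \<lambda>(n, x)\<in>?A. (\<alpha> n x, \<beta> n x)) ` \<Theta> S \<subseteq> ?A \<rightarrow>\<^sub>E ?C"
      proof
        fix f assume "f \<in> (\<lambda>(\<alpha>, \<beta>). \<lambda>(n, x)\<in>?A. (\<alpha> n x, \<beta> n x)) ` \<Theta> S"
        then obtain \<alpha> \<beta> where t: "(\<alpha>, \<beta>) \<in> \<Theta> S" and f: "f = (\<lambda>(n, x)\<in>?A. (\<alpha> n x, \<beta> n x))" by auto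
        have "\<alpha> n x \<in> insert undefined (\<Union>n. carrier (P n)) \<and> \<beta> n x \<in> insert undefined W" for n x
        proof (cases "x \<in> carrier (Ob S n)")
          case True
          then have "\<alpha> n x \<in> carrier (P (n + 1))" "\<beta> n x \<in> carrier (Ob M n)"
            using t by (auto simp: \<Theta>_def rhom_iff rlinear_def)
          then show ?thesis by (auto simp: W_def)
        next
          case False
          then show ?thesis using t by (simp add: \<Theta>_def rhom_iff extensional_def)
        qed
        then show "f \<in> ?A \<rightarrow>\<^sub>E ?C" unfolding f by (intro restrict_PiE_iff[THEN iffD2]) auto
      qed
    qed
    ultimately show ?thesis using ordLeq_transitive by blast
  qed
  \<comment> \<open>A nonempty set with at most |Pow B| elements is an image of Pow B; the zero maps
    show nonemptiness.\<close>
  moreover have "\<Theta> S \<noteq> {}" if S: "S \<in> SS" for S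
  proof -
    have Sm: "right_module R (Ob S n)" for n using SS(1) S complex_module(2) by blast
    have "(\<lambda>n. restrict (\<lambda>x. \<zero>\<^bsub>P (n + 1)\<^esub>) (carrier (Ob S n)), \<lambda>n. restrict (\<lambda>x. \<zero>\<^bsub>Ob M n\<^esub>) (carrier (Ob S n))) \<in> \<Theta> S"
      unfolding \<Theta>_def using restrict_rhom[OF Sm rlinear_const_zero[OF Pm]]
        restrict_rhom[OF Sm rlinear_const_zero[OF complex_module(2)[OF M]]] by simp
    then show ?thesis by blast
  qed
  ultimately have "\<forall>S\<in>SS. \<exists>g. g ` Pow B = \<Theta> S" using card_of_ordLeq2 by metis
  then obtain dec where dec: "\<And>S. S \<in> SS \<Longrightarrow> dec S ` Pow B = \<Theta> S" by metis
  define \<alpha> \<beta> where "\<alpha> c = fst (dec (fst c) (snd c))" and "\<beta> c = snd (dec (fst c) (snd c))" for c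
  have \<alpha>\<beta>: "rlinear R (Ob (fst c) n) (P (n + 1)) (\<alpha> c n)" "rlinear R (Ob (fst c) n) (Ob M n) (\<beta> c n)"
    if c: "c \<in> V" for c n
  proof -
    have "dec (fst c) (snd c) \<in> \<Theta> (fst c)" using dec[OF VS(2)[OF c]] c by (auto simp: V_def)
    then show "rlinear R (Ob (fst c) n) (P (n + 1)) (\<alpha> c n)" "rlinear R (Ob (fst c) n) (Ob M n) (\<beta> c n)"
      by (auto simp: \<Theta>_def \<alpha>_def \<beta>_def rhom_iff)
  qed
  have surj: "\<exists>c\<in>V. fst c = S \<and> \<alpha> c = a \<and> \<beta> c = b" if S: "S \<in> SS" and ab: "(a, b) \<in> \<Theta> S" for S a b
  proof -
    obtain p where "p \<in> Pow B" "dec S p = (a, b)" using dec[OF S] ab by (metis imageE)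
    then show ?thesis using S by (intro bexI[of _ "(S, p)"]) (auto simp: \<alpha>_def \<beta>_def V_def)
  qed
  have "\<exists>\<Phi>. rlinear R (P n) (P (n + 1)) \<Phi> \<and> (\<forall>c\<in>V. \<forall>x\<in>carrier (Ob (fst c) n).
      \<Phi> (\<iota> n c x) = \<iota> (n + 1) c (Diff (fst c) n x) \<oplus>\<^bsub>P (n + 1)\<^esub> \<alpha> c n x)" for n
  proof -
    have l: "rlinear R (Ob (fst c) n) (P (n + 1)) (\<lambda>x. \<iota> (n + 1) c (Diff (fst c) n x) \<oplus>\<^bsub>P (n + 1)\<^esub> \<alpha> c n x)"
      if c: "c \<in> V" for c
      by (rule rlinear_add[OF Pm rlinear_comp[OF is_dsumD(5)[OF D c] complex_Diff[OF VS(1)[OF c] refl]] \<alpha>\<beta>(1)[OF c]])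
    obtain \<Phi> where "rlinear R (P n) (P (n + 1)) \<Phi>" "\<And>c x. c \<in> V \<Longrightarrow> x \<in> carrier (Ob (fst c) n) \<Longrightarrow>
      \<Phi> (\<iota> n c x) = \<iota> (n + 1) c (Diff (fst c) n x) \<oplus>\<^bsub>P (n + 1)\<^esub> \<alpha> c n x"
      by (rule is_dsum_universal[OF D Pm l]) auto
    then show ?thesis by blast
  qed
  then obtain \<delta> where \<delta>: "\<And>n. rlinear R (P n) (P (n + 1)) (\<delta> n)" "\<And>n. \<forall>c\<in>V. \<forall>x\<in>carrier (Ob (fst c) n).
      \<delta> n (\<iota> n c x) = \<iota> (n + 1) c (Diff (fst c) n x) \<oplus>\<^bsub>P (n + 1)\<^esub> \<alpha> c n x" by metis
  have "\<exists>\<Phi>. rlinear R (P n) (Ob M n) \<Phi> \<and> (\<forall>c\<in>V. \<forall>x\<in>carrier (Ob (fst c) n). \<Phi> (\<iota> n c x) = \<beta> c n x)" for n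
  proof -
    obtain \<Phi> where "rlinear R (P n) (Ob M n) \<Phi>"
      "\<And>c x. c \<in> V \<Longrightarrow> x \<in> carrier (Ob (fst c) n) \<Longrightarrow> \<Phi> (\<iota> n c x) = \<beta> c n x"
      by (rule is_dsum_universal[OF D complex_module(2)[OF M] \<alpha>\<beta>(2)]) auto
    then show ?thesis by blast
  qed
  then obtain \<gamma> where \<gamma>: "\<And>n. rlinear R (P n) (Ob M n) (\<gamma> n)"
    "\<And>n. \<forall>c\<in>V. \<forall>x\<in>carrier (Ob (fst c) n). \<gamma> n (\<iota> n c x) = \<beta> c n x" by metis
  interpret cells R U fst V P \<iota> \<pi> \<alpha> \<beta> \<delta> \<gamma> M
    by unfold_locales (use VS M D \<alpha>\<beta> \<delta> \<gamma> in auto)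
  have Sm: "right_module R (Ob S n)" if "S \<in> SS" for S n using SS(1) that complex_module(2) by blast
  show thesis
  proof (rule that[OF T_complex chain_map_\<gamma>])
    show "\<forall>S\<in>SS. orth R S (cone T M \<gamma>)"
      unfolding orth_def
    proof (intro ballI allI impI)
      fix S \<phi> assume S: "S \<in> SS" and \<phi>: "chain_map R S (cone T M \<gamma>) \<phi>"
      define a b where "a n = restrict (\<lambda>x. fst (unpair (\<phi> n x))) (carrier (Ob S n))"
        and "b n = restrict (\<lambda>x. snd (unpair (\<phi> n x))) (carrier (Ob S n))" for n
      have \<phi>l: "rlinear R (Ob S n) (direct_sum (sub J (n + 1)) (Ob M n)) (\<phi> n)" for n
        using chain_map_rlinear[OF \<phi>, of n] by simp
      have "rlinear R (Ob S n) (sub J (n + 1)) (\<lambda>x. fst (unpair (\<phi> n x)))" for n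
        by (rule rlinear_comp[OF rlinear_fst \<phi>l])
      then have "rlinear R (Ob S n) (P (n + 1)) (\<lambda>x. fst (unpair (\<phi> n x)))" for n
        by (simp add: rlinear_def sub_carrier)
      moreover have "rlinear R (Ob S n) (Ob M n) (\<lambda>x. snd (unpair (\<phi> n x)))" for n
        by (rule rlinear_comp[OF rlinear_snd \<phi>l])
      \<comment> \<open>The first component lands in the accessible part of P, so the pair is among
        the attaching data and some cell carries it.\<close>
      ultimately have "(a, b) \<in> \<Theta> S"
        unfolding \<Theta>_def a_def b_def using restrict_rhom[OF Sm[OF S]] by blast
      from surj[OF S this] obtain c where c: "c \<in> V" "fst c = S" "\<alpha> c = a" "\<beta> c = b" by blast
      have "null_homotopic R (fst c) (cone T M \<gamma>) \<phi>"
      proof (rule cell_kills[OF c(1)])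
        show "chain_map R (fst c) (cone T M \<gamma>) \<phi>" using \<phi> c(2) by simp
        fix n x assume "x \<in> carrier (Ob (fst c) n)"
        then have x: "x \<in> carrier (Ob S n)" using c(2) by simp
        obtain y z where "\<phi> n x = pair (y, z)" using rlinear_closed[OF \<phi>l x] by (rule direct_sumE) blast
        then show "\<phi> n x = pair (\<alpha> c n x, \<beta> c n x)" using x by (simp add: c a_def b_def)
      qed
      then show "null_homotopic R S (cone T M \<gamma>) \<phi>" using c(2) by simp
    qed
    show "\<forall>S\<in>SS. \<forall>\<phi>. chain_map R S M \<phi> \<longrightarrow>
       (\<exists>\<psi>. chain_map R S T \<psi> \<and> (\<forall>n. \<forall>x\<in>carrier (Ob S n). \<phi> n x = \<gamma> n (\<psi> n x)))"
    proof (intro ballI allI impI)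
      fix S \<phi> assume S: "S \<in> SS" and \<phi>: "chain_map R S M \<phi>"
      \<comment> \<open>The cell with zero attaching map into P and \<phi> as its map to M provides
        the factorization.\<close>
      have "(\<lambda>n. restrict (\<lambda>x. \<zero>\<^bsub>P (n + 1)\<^esub>) (carrier (Ob S n)), restr S \<phi>) \<in> \<Theta> S"
        unfolding \<Theta>_def restr_def using restrict_rhom[OF Sm[OF S] rlinear_const_zero[OF Pm]]
          restrict_rhom[OF Sm[OF S] chain_map_rlinear[OF \<phi>]] by simp
      from surj[OF S this] obtain c where c: "c \<in> V" "fst c = S"
        "\<alpha> c = (\<lambda>n. restrict (\<lambda>x. \<zero>\<^bsub>P (n + 1)\<^esub>) (carrier (Ob S n)))" "\<beta> c = restr S \<phi>" by blast
      have \<phi>c: "chain_map R (fst c) M \<phi>" using \<phi> c(2) by simp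
      have "\<alpha> c n x = \<zero>\<^bsub>P (n + 1)\<^esub>" "\<beta> c n x = \<phi> n x" if "x \<in> carrier (Ob (fst c) n)" for n x
        using that c by simp_all
      from cell_factor[OF c(1) \<phi>c this]
      show "\<exists>\<psi>. chain_map R S T \<psi> \<and> (\<forall>n. \<forall>x\<in>carrier (Ob S n). \<phi> n x = \<gamma> n (\<psi> n x))"
        unfolding c(2) by blast
    qed
    show "\<forall>Q\<in>complexes R. (\<forall>S\<in>SS. orth R S Q) \<longrightarrow> orth R T Q" using T_orth VS(2) by blast
    show "SS \<subseteq> totally_acyclic R \<longrightarrow> T \<in> totally_acyclic R" using T_totally_acyclic VS(2) by blast
  qed
qed


section \<open>Contractible complexes\<close>

context module_universe
begin

text \<open>The identity of C is homotopic to zero, so C is a homotopy retract of any totally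
  acyclic complex, through zero maps. One such complex comes from the cellular construction with no
  cells.\<close>

lemma totally_acyclic_contractible:
  fixes C :: "('r, 'u) cochain_complex"
  assumes C: "C \<in> complexes R" "\<And>n. projective R (Ob C n)" and n: "null_homotopic R C C (\<lambda>n x. x)"
  shows "C \<in> totally_acyclic R"
proof -
  have e: "{} \<subseteq> complexes R" "small TYPE('u) ({} :: ('r, 'u) cochain_complex set)"
    using small_image[OF small_countable[OF univ', of "{} :: nat set"], of undefined] by simp_all
  obtain T :: "('r, 'u) cochain_complex" where "({} :: ('r, 'u) cochain_complex set) \<subseteq> totally_acyclic R \<longrightarrow> T \<in> totally_acyclic R"
    by (rule cellular_approximation[OF e C(1)]) (rule that, assumption)
  then have T: "T \<in> totally_acyclic R" by simp
  note Tc = totally_acyclic_complex[OF T]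
  have "heq R C C (\<lambda>n x. x) (\<lambda>n x. \<zero>\<^bsub>Ob C n\<^esub>)"
    using n heq_zero_iff[OF C(1) C(1) chain_map_id] by simp
  then show ?thesis
    by (intro totally_acyclic_retract[OF C T chain_map_zero[OF Tc] chain_map_zero[OF C(1)]])
qed

text \<open>The homotopy (x, y) |-> (-y, 0) works: its two terms are (dy, y) and (x - dy,
  0).\<close>

lemma cone_id_contractible:
  fixes X :: "('r, 'u) cochain_complex"
  assumes X: "X \<in> complexes R"
  shows "null_homotopic R (cone X X (\<lambda>n x. x)) (cone X X (\<lambda>n x. x)) (\<lambda>n z. z)"
proof (rule null_homotopicI[where s = "\<lambda>n z. pair (\<ominus>\<^bsub>Ob X n\<^esub> snd (unpair z), \<zero>\<^bsub>Ob X (n - 1)\<^esub>)"])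
  let ?C = "cone X X (\<lambda>n x. x)"
  show "rlinear R (Ob ?C n) (Ob ?C (n - 1)) (\<lambda>z. pair (\<ominus>\<^bsub>Ob X n\<^esub> snd (unpair z), \<zero>\<^bsub>Ob X (n - 1)\<^esub>))" for n
    by (auto intro!: rlinear_pair rlinear_uminus rlinear_snd rlinear_const_zero complex_module X)
  note [simp] = complex_simps[OF X] cone_Diff index_simps
  fix n z assume "z \<in> carrier (Ob ?C n)"
  then obtain x y where z: "x \<in> carrier (Ob X (n + 1))" "y \<in> carrier (Ob X n)" "z = pair (x, y)"
    by (auto elim: direct_sumE)
  have "Diff X n y \<ominus>\<^bsub>Ob X (n + 1)\<^esub> (Diff X n y \<ominus>\<^bsub>Ob X (n + 1)\<^esub> x) = x"
    by (rule abelian_group_diff_diff[OF complex_simps(1,12)[OF X]]) (use z in simp_all)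
  then have 1: "Diff X n y \<oplus>\<^bsub>Ob X (n + 1)\<^esub> \<ominus>\<^bsub>Ob X (n + 1)\<^esub> (Diff X n y \<ominus>\<^bsub>Ob X (n + 1)\<^esub> x) = x"
    unfolding a_minus_def .
  have 2: "\<zero>\<^bsub>Ob X n\<^esub> \<ominus>\<^bsub>Ob X n\<^esub> \<ominus>\<^bsub>Ob X n\<^esub> y = y" using z by (simp add: a_minus_def)
  show "z = Diff ?C (n - 1) (pair (\<ominus>\<^bsub>Ob X n\<^esub> snd (unpair z), \<zero>\<^bsub>Ob X (n - 1)\<^esub>)) \<oplus>\<^bsub>Ob ?C n\<^esub>
      pair (\<ominus>\<^bsub>Ob X (n + 1)\<^esub> snd (unpair (Diff ?C n z)), \<zero>\<^bsub>Ob X (n + 1 - 1)\<^esub>)"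
    using z by (simp add: 1 2)
qed

text \<open>D is the cone of the identity on L in all degrees with zero differential, so its
  differential is (x, y) |-> (0, -x). A chain map out of D can be built from an arbitrary family of
  linear maps L -> M^k, and one with a prescribed element of M in its image exists because L
  generates.\<close>

lemma small_generator:
  assumes "small TYPE('u) (carrier R)"
  obtains D :: "('r, 'u) cochain_complex" where "D \<in> totally_acyclic R"
    "\<And>M n m. (M :: ('r, 'u) cochain_complex) \<in> complexes R \<Longrightarrow> m \<in> carrier (Ob M n) \<Longrightarrow>
      \<exists>u. chain_map R D M u \<and> m \<in> u n ` carrier (Ob D n)"
proof -
  obtain L :: "('r, 'u) module" where L: "projective R L"
    "\<And>M m. (M :: ('r, 'u) module) \<in> rmodules R \<Longrightarrow> m \<in> carrier M \<Longrightarrow>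
      \<exists>f. rlinear R L M f \<and> m \<in> f ` carrier L" by (rule free_module[OF assms]) (rule that, assumption, assumption)
  have Lr: "L \<in> rmodules R" by (rule projective_rmodules[OF L(1)])
  note Lm = rmodulesD[OF Lr] and ls = right_module_simps[OF rmodulesD[OF Lr]]
  define X :: "('r, 'u) cochain_complex" where
    "X = \<lparr>Ob = (\<lambda>n. L), Diff = (\<lambda>n. restrict (\<lambda>x. \<zero>\<^bsub>L\<^esub>) (carrier L))\<rparr>"
  have XO [simp]: "Ob X n = L" for n by (simp add: X_def)
  have XD [simp]: "x \<in> carrier L \<Longrightarrow> Diff X n x = \<zero>\<^bsub>L\<^esub>" for n x by (simp add: X_def)
  have X: "X \<in> complexes R"
    using Lr ls restrict_rhom[OF Lm rlinear_const_zero[OF Lm]] by (simp add: complexes_def X_def)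
  let ?D = "cone X X (\<lambda>n x. x)"
  have Dc: "?D \<in> complexes R" by (rule cone_complex[OF X X chain_map_id])
  show thesis
  proof (rule that[of ?D])
    show "?D \<in> totally_acyclic R"
      by (rule totally_acyclic_contractible[OF Dc _ cone_id_contractible[OF X]])
        (simp add: projective_direct_sum L(1))
    fix M :: "('r, 'u) cochain_complex" and n m
    assume M: "M \<in> complexes R" and m: "m \<in> carrier (Ob M n)"
    obtain f where f: "rlinear R L (Ob M n) f" "m \<in> f ` carrier L"
      using L(2)[OF complex_module(1)[OF M] m] by blast
    define F where "F k = (if k = n then f else (\<lambda>x. \<zero>\<^bsub>Ob M k\<^esub>))" for k
    have Fl: "rlinear R L (Ob M k) (F k)" for k
      using f(1) rlinear_const_zero[OF complex_module(2)[OF M]] by (cases "k = n") (simp_all add: F_def)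
    have dF: "rlinear R L (Ob M k) (\<lambda>x. Diff M (k - 1) (F (k - 1) x))" for k
      by (rule rlinear_comp[OF complex_Diff[OF M] Fl]) simp
    note [simp] = complex_simps[OF X] complex_simps[OF M] cone_Diff index_simps
      rlinear_simps[OF Fl Lm complex_module(2)[OF M]]
    \<comment> \<open>The value on (0, y) is forced: up to sign, (0, y) is the differential of (y,
      0) in the preceding degree.\<close>
    let ?u = "\<lambda>k z. F k (fst (unpair z)) \<ominus>\<^bsub>Ob M k\<^esub> Diff M (k - 1) (F (k - 1) (snd (unpair z)))"
    have cm: "chain_map R ?D M ?u"
      unfolding chain_map_def
    proof (intro conjI allI ballI)
      fix k
      have "rlinear R (direct_sum L L) (Ob M k) (?u k)"
        by (rule rlinear_diff[OF complex_module(2)[OF M] rlinear_comp[OF Fl rlinear_fst] rlinear_comp[OF dF rlinear_snd]])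
      then show "rlinear R (Ob ?D k) (Ob M k) (?u k)" by simp
      fix z assume "z \<in> carrier (Ob ?D k)"
      then obtain x y where z: "x \<in> carrier L" "y \<in> carrier L" "z = pair (x, y)" by (auto elim: direct_sumE)
      then show "?u (k + 1) (Diff ?D k z) = Diff M k (?u k z)"
        using ls rlinear_simps(4)[OF Fl Lm complex_module(2)[OF M]] by (simp add: cone_Diff a_minus_def)
    qed
    obtain l where l: "l \<in> carrier L" "m = f l" using f(2) by blast
    have v: "?u n (pair (l, \<zero>\<^bsub>L\<^esub>)) = m"
      using l m ls rlinear_simps(5)[OF Fl Lm complex_module(2)[OF M], of "n - 1"] complex_simps(16)[OF M, of "n - 1"]
      by (simp add: F_def)
    have "m \<in> ?u n ` carrier (Ob ?D n)" by (rule image_eqI[where f = "?u n", OF v[symmetric]]) (use l ls(2) in simp)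
    with cm show "\<exists>u. chain_map R ?D M u \<and> m \<in> u n ` carrier (Ob ?D n)" by blast
  qed
qed

text \<open>The morphism T -> 0 lies in \<open>Mor\<close> because its cone is T[-1]. Injectivity of
  E with respect to it says that every morphism T -> E is zero. The zero complex is built from the
  zero submodule of T^0.\<close>

lemma totally_acyclic_to_zero:
  fixes T :: "('r, 'u) cochain_complex"
  assumes T: "T \<in> totally_acyclic R"
  obtains Z F where "(T, F, Z) \<in> Mor R (totally_acyclic R)" "F = zero_hom R T Z"
proof -
  note Tc = totally_acyclic_complex[OF T]
  define L where "L = (Ob T 0)\<lparr>carrier := {\<zero>\<^bsub>Ob T 0\<^esub>}\<rparr>"
  note ts = right_module_simps[OF complex_module(2)[OF Tc]]
  have Lm: "right_module R L" unfolding L_def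
    by (rule submodule_right_module[OF complex_module(2)[OF Tc]]) (use ts in auto)
  have L: "L \<in> rmodules R"
    using Lm small_subset[of "TYPE('u)" "carrier (Ob T 0)" "{\<zero>\<^bsub>Ob T 0\<^esub>}"] complex_module(1)[OF Tc, of 0] ts
    by (simp add: rmodules_def L_def)
  have Lp: "projective R L"
  proof (rule projectiveI[OF L])
    fix M N :: "('r, 'u) module" and p f
    assume h: "M \<in> rmodules R" "N \<in> rmodules R" "rlinear R M N p" "rlinear R L N f"
    note MN = h(1,2)[THEN rmodulesD]
    show "\<exists>g. rlinear R L M g \<and> (\<forall>x\<in>carrier L. p (g x) = f x)"
      using rlinear_const_zero[OF MN(1)] rlinear_zero[OF h(3) MN] rlinear_zero[OF h(4) Lm MN(2)]
      by (intro exI[of _ "\<lambda>x. \<zero>\<^bsub>M\<^esub>"]) (simp add: L_def)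
  qed
  let ?Z = "sphere_complex 0 L"
  have Z: "?Z \<in> complexes R" by (rule sphere_complex_complex[OF L])
  have ZO [simp]: "Ob ?Z n = L" for n by (cases "n = 0") (simp_all add: L_def)
  have L0: "carrier L = {\<zero>\<^bsub>L\<^esub>}" by (simp add: L_def)
  let ?z = "\<lambda>n x. \<zero>\<^bsub>Ob ?Z n\<^esub>"
  note z = chain_map_zero[OF Z, of T]
  let ?C = "cone T ?Z ?z"
  have C: "?C \<in> complexes R" by (rule cone_complex[OF Tc Z z])
  have "?C \<in> totally_acyclic R"
  proof (rule totally_acyclic_retract[OF C])
    show "projective R (Ob ?C n)" for n using T Lp by (simp add: totally_acyclic_iff projective_direct_sum)
    show "shift (-1) T \<in> totally_acyclic R" by (rule totally_acyclic_shift[OF T]) simp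
    show "chain_map R ?C (shift (-1) T) cproj" by (rule chain_map_cproj[OF Tc Z z])
    note [simp] = complex_simps[OF Tc]
    show "chain_map R (shift (-1) T) ?C (\<lambda>n x. pair (x, \<zero>\<^bsub>Ob ?Z n\<^esub>))"
      unfolding chain_map_def
    proof (intro conjI allI ballI)
      fix n
      show "rlinear R (Ob (shift (-1) T) n) (Ob ?C n) (\<lambda>x. pair (x, \<zero>\<^bsub>Ob ?Z n\<^esub>))"
        by (auto intro!: rlinear_pair rlinear_id rlinear_const_zero Lm)
      fix x assume "x \<in> carrier (Ob (shift (-1) T) n)"
      then show "pair (Diff (shift (-1) T) n x, \<zero>\<^bsub>Ob ?Z (n + 1)\<^esub>) = Diff ?C n (pair (x, \<zero>\<^bsub>Ob ?Z n\<^esub>))"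
        using right_module_simps[OF Lm] sphere_complex_simps(5)[of "\<zero>\<^bsub>L\<^esub>" 0 L n]
        by (simp add: shift_Diff cone_Diff index_simps)
    qed
    show "heq R ?C ?C (\<lambda>n x. x) (\<lambda>n x. pair (cproj n x, \<zero>\<^bsub>Ob ?Z n\<^esub>))"
      by (rule heq_cong[OF heq_refl[OF C C chain_map_id]]) (auto simp: L0 elim!: direct_sumE)
  qed
  then have "(T, cls R T ?Z ?z, ?Z) \<in> Mor R (totally_acyclic R)"
    using T Tc Z Lp by (intro Mor_coneI z) (simp_all add: totally_acyclic_iff)
  then show thesis by (rule that[OF _]) (simp only: zero_hom_def)
qed


section \<open>The generalized Baer Lemma\<close>

text \<open>Orthogonality to the shifted cones of the test morphisms gives injectivity for the test
  set, hence for all of \<open>Mor\<close>; the morphisms T -> 0 then force E into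
  \<open>perp\<close>.\<close>

lemma Baer_generators:
  assumes Baer: "generalized_Baer TYPE('u) (K_Proj R :: (('r, 'u) cochain_complex, _) category)
    (Mor R (totally_acyclic R))"
  obtains SS :: "('r, 'u) cochain_complex set" where "SS \<subseteq> totally_acyclic R" "small TYPE('u) SS"
    "\<And>E. E \<in> Obj (K_Proj R) \<Longrightarrow> \<forall>S\<in>SS. orth R S E \<Longrightarrow> E \<in> perp R"
proof -
  let ?M = "Mor R (totally_acyclic R) :: (('r, 'u) cochain_complex \<times> _ \<times> _) set"
  obtain \<N> where \<N>: "\<N> \<subseteq> ?M" "small TYPE('u) \<N>"
    "\<And>E. injective_wrt (K_Proj R) \<N> E \<Longrightarrow> injective_wrt (K_Proj R) ?M E"
    using Baer unfolding generalized_Baer_def by blast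
  \<comment> \<open>Packages the cone of a test morphism with its extension property, so that one
    complex can be chosen for each test morphism.\<close>
  define ok where "ok N Z \<longleftrightarrow> Z \<in> totally_acyclic R \<and> (\<forall>Q\<in>complexes R. orth R Z (shift (-1) Q) \<longrightarrow>
      (\<forall>H\<in>Hom (K_Mod R) (fst N) Q. \<exists>L\<in>Hom (K_Mod R) (snd (snd N)) Q.
        H = Comp (K_Mod R) (fst N) (snd (snd N)) Q L (fst (snd N))))"
    for N :: "('r, 'u) cochain_complex \<times> (int \<Rightarrow> 'u \<Rightarrow> 'u) set \<times> ('r, 'u) cochain_complex" and Z
  define Z where "Z N = (SOME Z. ok N Z)" for N
  have "ok N (Z N)" if NN: "N \<in> \<N>" for N
    unfolding Z_def
  proof (rule someI_ex)
    obtain X F Y where N: "N = (X, F, Y)" by (cases N) auto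
    have K: "(totally_acyclic R :: ('r, 'u) cochain_complex set) \<subseteq> complexes R"
      by (rule subsetI) (rule totally_acyclic_complex)
    have m: "(X, F, Y) \<in> ?M" using \<N>(1) NN unfolding N by (rule subsetD)
    obtain Z where "Z \<in> totally_acyclic R"
      "\<And>Q H. Q \<in> complexes R \<Longrightarrow> orth R Z (shift (-1) Q) \<Longrightarrow> H \<in> Hom (K_Mod R) X Q \<Longrightarrow>
         \<exists>L\<in>Hom (K_Mod R) Y Q. H = Comp (K_Mod R) X Y Q L F"
      by (rule Mor_cone[OF K m]) (rule that, assumption, assumption)
    then have "ok N Z" unfolding ok_def N fst_conv snd_conv by (intro conjI ballI impI)
    then show "\<exists>Z. ok N Z" by (rule exI)
  qed
  then have Z: "\<And>N. N \<in> \<N> \<Longrightarrow> Z N \<in> totally_acyclic R"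
    "\<And>N Q H. N \<in> \<N> \<Longrightarrow> Q \<in> complexes R \<Longrightarrow> orth R (Z N) (shift (-1) Q) \<Longrightarrow> H \<in> Hom (K_Mod R) (fst N) Q \<Longrightarrow>
      \<exists>L\<in>Hom (K_Mod R) (snd (snd N)) Q. H = Comp (K_Mod R) (fst N) (snd (snd N)) Q L (fst (snd N))"
    by (auto simp: ok_def)
  \<comment> \<open>The obstruction to extending a map into E lies in Hom(Z, E[-1]), which is
    Hom(Z[1], E).\<close>
  let ?SS = "(\<lambda>N. shift 1 (Z N)) ` \<N>"
  show thesis
  proof (rule that[of ?SS])
    show "?SS \<subseteq> totally_acyclic R" 
    proof (rule image_subsetI)
      fix N assume "N \<in> \<N>"
      from Z(1)[OF this] show "shift 1 (Z N) \<in> totally_acyclic R" by (rule totally_acyclic_shift) simp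
    qed
    show "small TYPE('u) ?SS" by (rule small_image[OF \<N>(2)])
    fix E :: "('r, 'u) cochain_complex" assume E: "E \<in> Obj (K_Proj R)" and o: "\<forall>S\<in>?SS. orth R S E"
    have Ec: "E \<in> complexes R" using E by simp
    have "injective_wrt (K_Proj R) \<N> E"
      unfolding injective_wrt_def
    proof (intro conjI E ballI, clarify)
      fix X F Y assume N: "(X, F, Y) \<in> \<N>"
      then have XY: "X \<in> complexes R" "Y \<in> complexes R" "F \<in> Hom (K_Mod R) X Y"
        using \<N>(1) by (auto simp: Mor_def)
      let ?Z = "Z (X, F, Y)"
      have Zc: "?Z \<in> complexes R" by (rule totally_acyclic_complex[OF Z(1)[OF N]])
      have "orth R (shift 1 ?Z) E" using o N by blast
      then have "orth R (shift (-1) (shift 1 ?Z)) (shift (-1) E)"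
        using orth_shift_iff[OF shift_complex[OF Zc, of 1] Ec, of "-1"] by simp
      then have "orth R ?Z (shift (-1) E)" using shift_shift[OF Zc, of 1 "-1"] by simp
      from Z(2)[OF N Ec this] show "(\<lambda>h. Comp (K_Proj R) X Y E h F) ` Hom (K_Proj R) Y E = Hom (K_Proj R) X E"
        using Comp_in_Hom[OF XY(1,2) Ec XY(3)] by auto
    qed
    then have i: "injective_wrt (K_Proj R) ?M E" by (rule \<N>(3))
    have "orth R T E" if T: "T \<in> totally_acyclic R" for T
    proof -
      note Tc = totally_acyclic_complex[OF T]
      obtain Y F where m: "(T, F, Y) \<in> ?M" "F = zero_hom R T Y" using totally_acyclic_to_zero[OF T] .
      have Y: "Y \<in> complexes R" using m(1) by (simp add: Mor_def)
      have "(\<lambda>h. Comp (K_Mod R) T Y E h F) ` Hom (K_Mod R) Y E = Hom (K_Mod R) T E"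
        using bspec[OF conjunct2[OF i[unfolded injective_wrt_def]] m(1)] by simp
      moreover have "Comp (K_Mod R) T Y E H F = zero_hom R T E" if "H \<in> Hom (K_Mod R) Y E" for H
        unfolding m(2) by (rule Comp_zero(2)[OF Tc Y Ec that])
      ultimately have "Hom (K_Mod R) T E = {zero_hom R T E}"
        using zero_hom_in_Hom[OF Tc Ec] by auto
      then show ?thesis using orth_iff_Hom[OF Tc Ec] by simp
    qed
    then show "E \<in> perp R" using Ec by (simp add: perp_def)
  qed
qed

section \<open>Approximation of arbitrary complexes\<close>

lemma Baer_approximation:
  assumes R: "small TYPE('u) (carrier R)"
    and Baer: "generalized_Baer TYPE('u) (K_Proj R :: (('r, 'u) cochain_complex, _) category)
      (Mor R (totally_acyclic R))"
  shows "approximation_universe R U"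
proof unfold_locales
  obtain S0 :: "('r, 'u) cochain_complex set" where S0: "S0 \<subseteq> totally_acyclic R" "small TYPE('u) S0"
    "\<And>E. E \<in> Obj (K_Proj R) \<Longrightarrow> \<forall>S\<in>S0. orth R S E \<Longrightarrow> E \<in> perp R"
    by (rule Baer_generators[OF Baer]) (rule that, assumption, assumption, assumption)
  obtain D :: "('r, 'u) cochain_complex" where D: "D \<in> totally_acyclic R"
    "\<And>M n m. (M :: ('r, 'u) cochain_complex) \<in> complexes R \<Longrightarrow> m \<in> carrier (Ob M n) \<Longrightarrow>
      \<exists>u. chain_map R D M u \<and> m \<in> u n ` carrier (Ob D n)"
    by (rule small_generator[OF R]) (rule that, assumption, assumption)
  define SS where "SS = insert D S0"
  have SS: "SS \<subseteq> totally_acyclic R" "small TYPE('u) SS" "SS \<subseteq> complexes R"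
    using S0(1) D(1) small_insert[OF univ' S0(2)] totally_acyclic_complex by (auto simp: SS_def)
  \<comment> \<open>S0 decides membership in \<open>perp\<close> only among complexes of
    projectives; here Q is arbitrary, so the argument resolves the source T instead of Q.\<close>
  have perpI: "Q \<in> perp R" if Q: "Q \<in> complexes R" "\<forall>S\<in>SS. orth R S Q" for Q
  proof -
    have "orth R T Q" if T: "T \<in> totally_acyclic R" for T
      unfolding orth_def
    proof (intro allI impI)
      fix \<phi> assume \<phi>: "chain_map R T Q \<phi>"
      note Tc = totally_acyclic_complex[OF T]
      obtain T0 g where g: "T0 \<in> complexes R" "chain_map R T0 T g" "\<forall>S\<in>SS. orth R S (cone T0 T g)"
        "\<forall>Q\<in>complexes R. (\<forall>S\<in>SS. orth R S Q) \<longrightarrow> orth R T0 Q" "SS \<subseteq> totally_acyclic R \<longrightarrow> T0 \<in> totally_acyclic R"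
        by (rule cellular_approximation[OF SS(3,2) Tc]) (rule that, assumption+)
      have T0: "T0 \<in> totally_acyclic R" using g(5) SS(1) by simp
      have Ec: "cone T0 T g \<in> complexes R" by (rule cone_complex[OF g(1) Tc g(2)])
      have "cone T0 T g \<in> Obj (K_Proj R)"
        using Ec T T0 by (simp add: totally_acyclic_iff projective_direct_sum)
      then have E: "cone T0 T g \<in> perp R" by (rule S0(3)) (use g(3) in \<open>simp add: SS_def\<close>)
      have "orth R T0 Q" using g(4) Q by blast
      then have "null_homotopic R T0 Q (\<lambda>n x. \<phi> n (g n x))" by (rule orthD[OF _ chain_map_comp[OF \<phi> g(2)]])
      from cone_extension[OF g(1) Tc g(2) Q(1) \<phi> this] obtain k where k: "chain_map R (cone T0 T g) Q k"
        "\<And>n y. y \<in> carrier (Ob T n) \<Longrightarrow> k n (cinj T0 n y) = \<phi> n y" by blast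
      \<comment> \<open>A map from a totally acyclic complex into \<open>perp\<close>; since \<phi>
        factors through it, \<phi> is null homotopic.\<close>
      have "null_homotopic R T (cone T0 T g) (cinj T0)"
        by (rule orthD[OF perp_orth[OF E T] chain_map_cinj[OF g(1) Tc g(2)]])
      from null_homotopic_comp_left[OF Tc Ec Q(1) this k(1)] show "null_homotopic R T Q \<phi>"
        by (rule null_homotopic_cong) (rule k(2))
    qed
    then show ?thesis using Q(1) by (simp add: perp_def)
  qed
  fix M :: "('r, 'u) cochain_complex" assume M: "M \<in> complexes R"
  obtain T g where g: "T \<in> complexes R" "chain_map R T M g" "\<forall>S\<in>SS. orth R S (cone T M g)"
    "\<forall>S\<in>SS. \<forall>\<phi>. chain_map R S M \<phi> \<longrightarrow>
       (\<exists>\<psi>. chain_map R S T \<psi> \<and> (\<forall>n. \<forall>x\<in>carrier (Ob S n). \<phi> n x = g n (\<psi> n x)))"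
    "SS \<subseteq> totally_acyclic R \<longrightarrow> T \<in> totally_acyclic R"
    using cellular_approximation[OF SS(3,2) M] .
  have T: "T \<in> totally_acyclic R" using g(5) SS(1) by simp
  have E: "cone T M g \<in> perp R" by (rule perpI[OF cone_complex[OF g(1) M g(2)] g(3)])
  have surj: "g n ` carrier (Ob T n) = carrier (Ob M n)" for n
  proof (intro equalityI subsetI)
    fix m assume "m \<in> g n ` carrier (Ob T n)"
    then show "m \<in> carrier (Ob M n)" using rlinear_closed[OF chain_map_rlinear[OF g(2)]] by blast
  next
    fix m assume "m \<in> carrier (Ob M n)"
    \<comment> \<open>The element m is hit by a chain map from D, and that map factors strictly
      through g because D belongs to SS.\<close>
    then obtain u where u: "chain_map R D M u" "m \<in> u n ` carrier (Ob D n)" using D(2)[OF M] by blast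
    then obtain \<psi> where "chain_map R D T \<psi>" "\<forall>n. \<forall>x\<in>carrier (Ob D n). u n x = g n (\<psi> n x)"
      using g(4) by (auto simp: SS_def)
    then show "m \<in> g n ` carrier (Ob T n)" using u(2) rlinear_closed[OF chain_map_rlinear] by fastforce
  qed
  have "\<exists>\<psi>. chain_map R T' T \<psi> \<and> (\<forall>n. \<forall>x\<in>carrier (Ob T' n). \<phi> n x = g n (\<psi> n x))"
    if T': "T' \<in> totally_acyclic R" and \<phi>: "chain_map R T' M \<phi>" for T' \<phi>
  proof -
    note Tc' = totally_acyclic_complex[OF T']
    have "null_homotopic R T' (cone T M g) (\<lambda>n x. cinj T n (\<phi> n x))"
      by (rule orthD[OF perp_orth[OF E T'] chain_map_comp[OF chain_map_cinj[OF g(1) M g(2)] \<phi>]])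
    from cone_lift[OF g(1) M g(2) Tc' \<phi> this] obtain h where h: "chain_map R T' T h"
      "heq R T' M \<phi> (\<lambda>n x. g n (h n x))" by blast
    obtain s where s: "\<And>n. rlinear R (Ob T' n) (Ob M (n - 1)) (s n)"
      "\<And>n x. x \<in> carrier (Ob T' n) \<Longrightarrow> \<phi> n x \<ominus>\<^bsub>Ob M n\<^esub> g n (h n x) =
         Diff M (n - 1) (s n x) \<oplus>\<^bsub>Ob M n\<^esub> s (n + 1) (Diff T' n x)"
      using h(2) unfolding heq_def null_homotopic_def by blast
    \<comment> \<open>In each degree the homotopy lifts along the surjection g, as the terms of T'
      are projective; no compatibility between degrees is required of a homotopy.\<close>
    have "\<exists>t. rlinear R (Ob T' n) (Ob T (n - 1)) t \<and> (\<forall>x\<in>carrier (Ob T' n). g (n - 1) (t x) = s n x)" for n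
    proof -
      have "projective R (Ob T' n)" using T' by (simp add: totally_acyclic_iff)
      from projective_lift[OF this complex_module(1)[OF g(1)] complex_module(1)[OF M] chain_map_rlinear[OF g(2)] surj s(1)]
      show ?thesis by blast
    qed
    then obtain t where t: "\<And>n. rlinear R (Ob T' n) (Ob T (n - 1)) (t n)"
      "\<And>n. \<forall>x\<in>carrier (Ob T' n). g (n - 1) (t n x) = s n x" by metis
    note [simp] = complex_simps[OF Tc'] complex_simps[OF g(1)] complex_simps[OF M] chain_map_simps[OF h(1) Tc' g(1)]
      chain_map_simps[OF g(2) g(1) M] homotopy_simps[OF Tc' g(1) t(1)] chain_map_simps(1)[OF \<phi> Tc' M]
    have tl: "rlinear R (Ob T' (n + 1)) (Ob T n) (t (n + 1))" for n using t(1)[of "n + 1"] by simp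
    \<comment> \<open>The chain map with null homotopy t; g carries it to the null homotopic map
      given by s, which is \<phi> - g h.\<close>
    let ?k = "\<lambda>n x. Diff T (n - 1) (t n x) \<oplus>\<^bsub>Ob T n\<^esub> t (n + 1) (Diff T' n x)"
    have kl: "rlinear R (Ob T' n) (Ob T n) (?k n)" for n
    proof (rule rlinear_add[OF complex_module(2)[OF g(1)]])
      show "rlinear R (Ob T' n) (Ob T n) (\<lambda>x. Diff T (n - 1) (t n x))"
        by (rule rlinear_comp[OF complex_Diff[OF g(1)] t(1)]) simp
      show "rlinear R (Ob T' n) (Ob T n) (\<lambda>x. t (n + 1) (Diff T' n x))"
        by (rule rlinear_comp[OF tl complex_Diff[OF Tc' refl]])
    qed
    have "chain_map R T' T ?k"
      unfolding chain_map_def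
    proof (intro conjI allI ballI kl)
      fix n x assume "x \<in> carrier (Ob T' n)"
      then show "?k (n + 1) (Diff T' n x) = Diff T n (?k n x)"
        using homotopy_simps(5)[OF Tc' g(1) t(1), of "n + 2"] by (simp add: index_simps)
    qed
    from chain_map_add[OF Tc' g(1) h(1) this]
    have "chain_map R T' T (\<lambda>n x. h n x \<oplus>\<^bsub>Ob T n\<^esub> ?k n x)" .
    moreover have "\<phi> n x = g n (h n x \<oplus>\<^bsub>Ob T n\<^esub> ?k n x)" if x: "x \<in> carrier (Ob T' n)" for n x
    proof -
      have "g n (?k n x) = Diff M (n - 1) (g (n - 1) (t n x)) \<oplus>\<^bsub>Ob M n\<^esub> g n (t (n + 1) (Diff T' n x))"
        using x by simp
      also have "\<dots> = Diff M (n - 1) (s n x) \<oplus>\<^bsub>Ob M n\<^esub> s (n + 1) (Diff T' n x)"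
        using t(2)[of n] t(2)[of "n + 1"] x by simp
      also have "\<dots> = \<phi> n x \<ominus>\<^bsub>Ob M n\<^esub> g n (h n x)" by (rule s(2)[OF x, symmetric])
      finally have gk: "g n (?k n x) = \<phi> n x \<ominus>\<^bsub>Ob M n\<^esub> g n (h n x)" .
      have "g n (h n x \<oplus>\<^bsub>Ob T n\<^esub> ?k n x) = g n (h n x) \<oplus>\<^bsub>Ob M n\<^esub> g n (?k n x)"
        by (rule chain_map_simps(2)[OF g(2) g(1) M]) (use x in simp_all)
      also have "\<dots> = \<phi> n x" unfolding gk
        using x by - (rule represents_eq[where G = "Ob M n"],
          (rule represents | (rule represents_atom, simp, simp) | (simp; fail) | simp add: algebra_simps)+)
      finally show ?thesis ..
    qed
    ultimately show ?thesis by blast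
  qed
  then show "\<exists>T\<in>totally_acyclic R. \<exists>g. chain_map R T M g \<and> cone T M g \<in> perp R \<and>
      (\<forall>T'\<in>totally_acyclic R. \<forall>\<phi>. chain_map R T' M \<phi> \<longrightarrow>
        (\<exists>\<psi>. chain_map R T' T \<psi> \<and> (\<forall>n. \<forall>x\<in>carrier (Ob T' n). \<phi> n x = g n (\<psi> n x))))"
    using T g(2) E by blast
qed

end

theorem theorem4p6:
  fixes R :: "('r, 'k) ring_scheme"
    and \<K> :: "('r, 'u) cochain_complex set"
  assumes "universe TYPE('u)"
    and "ring R"
    and "small TYPE('u) (carrier R)"
    and "\<K> = totally_acyclic R"
    and "generalized_Baer TYPE('u) (K_Proj R) (Mor R \<K>)"
  shows "enough_injectives (K_Proj R) (Mor R \<K>) \<and>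
    (\<forall>X\<in>Obj (K_Proj R). \<forall>Y\<in>Obj (K_Proj R).
       small TYPE('u) (fraction_Hom (K_Proj R) (Mor R \<K>) X Y)) \<and>
    precovering (Mod R) (Gorenstein_projective R :: ('r, 'u) module set) \<and>
    precovering (C_Mod R) \<K>"
proof -
  interpret module_universe R "TYPE('u)" by (rule module_universe.intro) (fact assms(1), fact assms(2))
  interpret approximation_universe R "TYPE('u)"
    using assms(5) unfolding assms(4) by (rule Baer_approximation[OF assms(3)])
  show ?thesis
    unfolding assms(4)
    using enough_injectives_K_Proj fraction_Hom_small precovering_Gorenstein_projective
      precovering_totally_acyclic by blast
qed




end
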